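(* Let $n\in\{2,3\}$, let $\Omega$ be a convex polytope in $\mathbb{R}^n$ (bounded, with nonempty interior, regarded as a domain), and let $k=1$. Let $\mathcal{B}$ be the Dirichlet, Neumann or Robin boundary operator; in the Neumann case assume $\int_\Omega f=0$, and in the Robin case assume $\kappa\in C^{1}(\Omega)$. Let $s\in(0,1)$, $a\in(0,2]$, $c>0$ and $h_0\in(0,1)$ be fixed, let $0<h\le h_0$ and $\Delta t=c\,h^a$, and assume that, if the parameter $\theta\in[0,1]$ of the time discretization satisfies $0\le\theta<\frac12$, then the stability condition $\Delta t\le C_{\rm st}h^2$ holds, with $C_{\rm st}>0$ the stability constant depending on $\theta$ and $a(\cdot,\cdot)$. Assume moreover: (Regularity) $f\in\mathbb{H}_{\mathcal{B}}^r(\Omega)$ for some $r\in[0,4-2s]$. (Finite elements) $w_{1,\tau}$ is the finite element solution, of order of accuracy $2$ in space and $\tau$ in time, of the heat equation with boundary condition $\mathcal{B}(w)=0$ and initial datum $f$, where $\tau\in\{1,2\}$ is arbitrary if $r\in[0,2-2s)$, and $\tau=2$ if $r\in[2-2s,4-2s]$. (Quadrature) $Q^s_r$ is the quadrature rule with step $\Delta t$ on $[0,T]$, with $T=N_T\Delta t>\frac{1}{\lambda_{\min}}\log\left(\frac{1}{\Delta t^{\frac r2+s}}\right)$, where $\lambda_{\min}$ is the first positive eigenvalue of $-\Delta_{\mathcal{B}}$ on $\Omega$. Then there exists a constant $C>0$, independent of $h$, $\Delta t$, $T$ and $f$, such that $$\|Q^s_r[w_{1,\tau}]-(-\Delta_{\mathcal{B}})^{-s}f\|_{L^2(\Omega)}\le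 C_{r,h}\,h^{\min\{2,\,a(\frac r2+s)\}}\,\|f\|_{\mathbb{H}_{\mathcal{B}}^r(\Omega)},$$ where $C_{r,h}=C$ if $r\notin\{2-2s,\,4-2s\}$ and $C_{r,h}=C\log(h^{-a})$ if $r\in\{2-2s,\,4-2s\}$.
   Context: Boundary operators on $\partial\Omega$: $\mathcal{B}(u)=u$ (Dirichlet), $\mathcal{B}(u)=\partial u/\partial\nu$ (Neumann), $\mathcal{B}(u)=\kappa u+\partial u/\partial\nu$ with $\kappa>0$ on $\partial\Omega$ (Robin). $\{\varphi_m,\lambda_m\}_{m\ge1}$ are the eigenpairs of $-\Delta_{\mathcal{B}}$: $-\Delta\varphi_m=\lambda_m\varphi_m$ in $\Omega$, $\mathcal{B}(\varphi_m)=0$ on $\partial\Omega$, with $(\varphi_m)$ an orthonormal basis of $L^2(\Omega)$. For $\psi\in L^2(\Omega)$, $\hat\psi_m=\int_\Omega\psi\varphi_m\,dx$. In the Neumann case $\lambda_1=0$ and, since data have zero mean, all sums over $m$ omit the zero eigenvalue. For $r\ge0$, $\mathbb{H}_{\mathcal{B}}^r(\Omega)=\{\psi\in L^2(\Omega):\|\psi\|_{\mathbb{H}_{\mathcal{B}}^r(\Omega)}:=(\sum_m\lambda_m^r|\hat\psi_m|^2)^{1/2}<\infty\}$. Further, $(-\Delta_{\mathcal{B}})^{-s}f=\sum_m\lambda_m^{-s}\hat f_m\varphi_m$. The heat equation is $w_t-\Delta w=0$ in $\Omega\times(0,\infty)$, $\mathcal{B}(w)=0$ on $\partial\Omega\times(0,\infty)$,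 $w(\cdot,0)=f$. Quadrature. Let $t_j=j\Delta t$, $0\le j\le N_T$, $T=N_T\Delta t$ (with $N_T\ge2$). For a function $\rho$ on $\{t_0,\dots,t_{N_T}\}$, $Q^s_r[\rho]=\frac{1}{\Gamma(s)}\sum_{j=0}^{N_T}\rho(t_j)\beta_j$, with weights: - if $r\in[0,2-2s]$: $\beta_j=\frac{\Delta t^s}{s}\left((j+1)^s-j^s\right)$ for $0\le j\le N_T-1$, $\beta_{N_T}=0$; - if $r\in(2-2s,2)$: $\beta_j=\frac{\Delta t^s}{s(1+s)}b_j$ with $b_0=0$, $b_1=2^{1+s}-1$, $b_j=(j+1)^{1+s}-2j^{1+s}+(j-1)^{1+s}$ for $2\le j\le N_T-1$, and $b_{N_T}=(N_T-1)^{1+s}+(1+s)N_T^s-N_T^{1+s}$; - if $r\in[2,4-2s]$: $\beta_j=\frac{\Delta t^s}{s(1+s)}b_j$ with $b_0=1$, $b_j=(j+1)^{1+s}-2j^{1+s}+(j-1)^{1+s}$ for $1\le j\le N_T-1$, and $b_{N_T}=(N_T-1)^{1+s}+(1+s)N_T^s-N_T^{1+s}$. Applied to $w_{1,\tau}$: $Q^s_r[w_{1,\tau}](x)=\frac1{\Gamma(s)}\sum_{j=0}^{N_T}w_{1,\tau}(x,t_j)\beta_j$. Finite elements (with $k=1$). $\langle\cdot,\cdot\rangle$ is the $L^2(\Omega)$ inner product. The bilinear form is $a(w,v)=\int_\Omega\nabla w\cdot\nabla v$ on $V=H^1_0(\Omega)$ (Dirichlet) or $V=H^1(\Omega)$ (Neumann),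 and $a(w,v)=\int_\Omega\nabla w\cdot\nabla v+\int_{\partial\Omega}\kappa wv$ on $V=H^1(\Omega)$ (Robin). $\{\mathcal{T}_h\}$ is a quasi-uniform family of triangulations of $\Omega$ with mesh parameter $h$, $\{V_h\}$ is an associated family of finite-dimensional subspaces of $L^2(\Omega)$ with bases $\{\phi_i\}_{i=1}^{N_h}$ (for example continuous functions that are piecewise polynomial of degree at most $1$ on each element of $\mathcal{T}_h$). $E$ is the exact solution operator of $-\Delta\psi=g$, $\mathcal{B}(\psi)=0$ ($Eg=\psi$), and $E_h:L^2(\Omega)\to V_h$ is the finite element solution operator approximating $E$, i.e. $a(E_hg,\chi)=\langle g,\chi\rangle$ for all $\chi\in V_h$ (in the Neumann case on zero-mean functions). It is assumed that (i) $E_h$ is selfadjoint, positive semi-definite on $L^2$ and positive definite on $V_h$; (ii) $\|(E_h-E)g\|_{L^2}\le Ch^2\|g\|_{L^2}$ for $g\in L^2(\Omega)$, with $C$ independent of $h$ and $g$ (order of accuracy $2$ in space). With $M_{ij}=\langle\phi_i,\phi_j\rangle$, $A_{ij}=a(\phi_i,\phi_j)$ and a parameter $\theta\in[0,1]$, set $w_{1,\tau}(x,t_j)=\sum_{i=1}^{N_h}W_i^{(j)}\phi_i(x)$, where $(M+\theta\Delta tA)\mathbf{W}^{(j)}=(M+(\theta-1)\Delta tA)\mathbf{W}^{(j-1)}$ for $j\ge1$ and $\mathbf{W}^{(0)}$ is the coefficient vector of the $L^2$-orthogonal projection of $f$ onto $V_h$. The order in time is $\tau=2$ if $\theta=\frac12$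 (Crank–Nicolson) and $\tau=1$ if $\theta\ne\frac12$. The stability constant $C_{\rm st}$ (for $\theta<\frac12$) is a constant, depending on $\theta$ and $a(\cdot,\cdot)$, such that $\Delta t\le C_{\rm st}h^2$ guarantees $L^2$-stability of this scheme. *)

theory Defs
  imports "HOL-Analysis.Analysis"
begin

subsection \<open>Square-integrable functions\<close>

definition square_integrable :: "'a measure \<Rightarrow> ('a \<Rightarrow> 'b::euclidean_space) \<Rightarrow> bool" where
  "square_integrable M u \<longleftrightarrow> u \<in> borel_measurable M \<and> integrable M (\<lambda>x. (norm (u x))\<^sup>2)"

definition L2_inner :: "'a measure \<Rightarrow> ('a \<Rightarrow> 'b::euclidean_space) \<Rightarrow> ('a \<Rightarrow> 'b) \<Rightarrow> real" where
  "L2_inner M u v = (LINT x|M. u x \<bullet> v x)"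

definition L2_norm :: "'a measure \<Rightarrow> ('a \<Rightarrow> 'b::euclidean_space) \<Rightarrow> real" where
  "L2_norm M u = sqrt (L2_inner M u u)"

subsection \<open>Sobolev spaces\<close>

text \<open>As in Brezis' textbook, test functions are \<open>C\<^sup>1\<close> with compact support; they yield the same weak
  gradients and the same space \<open>H\<^sup>1\<^sub>0\<close> as smooth ones.\<close>

definition C1_on :: "'a::euclidean_space set \<Rightarrow> ('a \<Rightarrow> real) \<Rightarrow> bool" where
  "C1_on S u \<longleftrightarrow> (\<exists>u'. continuous_on S u' \<and> (\<forall>x\<in>S. GDERIV u x :> u' x))"

definition grad :: "('a::euclidean_space \<Rightarrow> real) \<Rightarrow> 'a \<Rightarrow> 'a" where
  "grad u x = (THE D. GDERIV u x :> D)"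

definition test_functions :: "'a::euclidean_space set \<Rightarrow> ('a \<Rightarrow> real) set" where
  "test_functions \<Omega> = {\<psi>. C1_on UNIV \<psi> \<and> (\<exists>K. compact K \<and> K \<subseteq> \<Omega> \<and> (\<forall>x. x \<notin> K \<longrightarrow> \<psi> x = 0))}"

definition weak_gradient ::
  "'a::euclidean_space set \<Rightarrow> ('a \<Rightarrow> real) \<Rightarrow> ('a \<Rightarrow> 'a) \<Rightarrow> bool" where
  "weak_gradient \<Omega> u g \<longleftrightarrow>
     square_integrable (lebesgue_on \<Omega>) g \<and>
     (\<forall>\<psi>\<in>test_functions \<Omega>.
        (LINT x|lebesgue_on \<Omega>. u x *\<^sub>R grad \<psi> x) = - (LINT x|lebesgue_on \<Omega>. \<psi> x *\<^sub>R g x))"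

definition H1 :: "'a::euclidean_space set \<Rightarrow> ('a \<Rightarrow> real) set" where
  "H1 \<Omega> = {u. square_integrable (lebesgue_on \<Omega>) u \<and> (\<exists>g. weak_gradient \<Omega> u g)}"

text \<open>A representative of the weak gradient, which is unique up to null sets.\<close>

definition wgrad :: "'a::euclidean_space set \<Rightarrow> ('a \<Rightarrow> real) \<Rightarrow> 'a \<Rightarrow> 'a" where
  "wgrad \<Omega> u = (SOME g. weak_gradient \<Omega> u g)"

definition H1_norm :: "'a::euclidean_space set \<Rightarrow> ('a \<Rightarrow> real) \<Rightarrow> real" where
  "H1_norm \<Omega> u =
     sqrt ((L2_norm (lebesgue_on \<Omega>) u)\<^sup>2 + (L2_norm (lebesgue_on \<Omega>) (wgrad \<Omega> u))\<^sup>2)"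

definition H10 :: "'a::euclidean_space set \<Rightarrow> ('a \<Rightarrow> real) set" where
  "H10 \<Omega> = {u \<in> H1 \<Omega>. \<exists>\<psi>. (\<forall>k. \<psi> k \<in> test_functions \<Omega>) \<and>
                (\<lambda>k::nat. H1_norm \<Omega> (\<lambda>x. u x - \<psi> k x)) \<longlonglongrightarrow> 0}"

subsection \<open>Surface measure and traces on the boundary of a polytope\<close>

text \<open>From here on, \<open>P\<close> is a closed full-dimensional convex polytope and \<open>\<Omega>\<close> is its interior.\<close>

definition outward_normal :: "'a::euclidean_space set \<Rightarrow> 'a set \<Rightarrow> 'a" where
  "outward_normal P F =
     (THE \<nu>. norm \<nu> = 1 \<and> (\<exists>b. P \<subseteq> {x. \<nu> \<bullet> x \<le> b} \<and> F = P \<inter> {x. \<nu> \<bullet> x = b}))"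

text \<open>The \<open>(n-1)\<close>-dimensional measure of a subset of a facet is the \<open>n\<close>-dimensional Lebesgue measure of
  the right prism of height 1 over it.\<close>

definition surface_measure :: "'a::euclidean_space set \<Rightarrow> 'a measure" where
  "surface_measure P =
     measure_of (frontier P) (sets (restrict_space borel (frontier P)))
       (\<lambda>S. \<Sum>F | F facet_of P.
              emeasure lborel {y + t *\<^sub>R outward_normal P F | y t. y \<in> S \<inter> F \<and> 0 \<le> t \<and> t \<le> 1})"

text \<open>The trace operator is the bounded linear operator \<open>H\<^sup>1(\<Omega>) \<rightarrow> L\<^sup>2(\<partial>\<Omega>)\<close> that restricts functions
  continuous up to the boundary; it exists by the trace theorem and is unique by density.\<close>

definition trace_operator ::
  "'a::euclidean_space set \<Rightarrow> (('a \<Rightarrow> real) \<Rightarrow> 'a \<Rightarrow> real) \<Rightarrow> bool" where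
  "trace_operator P tr \<longleftrightarrow>
     (\<forall>u\<in>H1 (interior P). square_integrable (surface_measure P) (tr u)) \<and>
     (\<forall>u\<in>H1 (interior P). \<forall>v\<in>H1 (interior P). \<forall>\<alpha> \<beta>.
        AE y in surface_measure P. tr (\<lambda>x. \<alpha> * u x + \<beta> * v x) y = \<alpha> * tr u y + \<beta> * tr v y) \<and>
     (\<exists>K. \<forall>u\<in>H1 (interior P). L2_norm (surface_measure P) (tr u) \<le> K * H1_norm (interior P) u) \<and>
     (\<forall>u\<in>H1 (interior P). continuous_on P u \<longrightarrow> (AE y in surface_measure P. tr u y = u y))"

subsection \<open>Boundary value problems for the Laplacian\<close>

text \<open>\<open>neg_laplacian \<Omega> u g\<close> means \<open>- \<Delta> u = g\<close> in \<open>\<Omega>\<close> in the sense of distributions.\<close>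

definition neg_laplacian ::
  "'a::euclidean_space set \<Rightarrow> ('a \<Rightarrow> real) \<Rightarrow> ('a \<Rightarrow> real) \<Rightarrow> bool" where
  "neg_laplacian \<Omega> u g \<longleftrightarrow>
     u \<in> H1 \<Omega> \<and> square_integrable (lebesgue_on \<Omega>) g \<and>
     (\<forall>\<psi>\<in>test_functions \<Omega>.
        L2_inner (lebesgue_on \<Omega>) (wgrad \<Omega> u) (grad \<psi>) = L2_inner (lebesgue_on \<Omega>) g \<psi>)"

text \<open>\<open>q = \<partial>u/\<partial>\<nu>\<close> on \<open>\<partial>\<Omega>\<close>, by Green's formula
  \<open>\<integral>\<^sub>\<Omega> \<nabla>u \<cdot> \<nabla>v + \<integral>\<^sub>\<Omega> \<Delta>u v = \<integral>\<^sub>\<partial>\<^sub>\<Omega> q v\<close> for all \<open>v \<in> H\<^sup>1(\<Omega>)\<close>.\<close>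

definition normal_derivative ::
  "'a::euclidean_space set \<Rightarrow> (('a \<Rightarrow> real) \<Rightarrow> 'a \<Rightarrow> real) \<Rightarrow> ('a \<Rightarrow> real) \<Rightarrow> ('a \<Rightarrow> real) \<Rightarrow> bool" where
  "normal_derivative P tr u q \<longleftrightarrow>
     square_integrable (surface_measure P) q \<and>
     (\<exists>g. neg_laplacian (interior P) u g \<and>
       (\<forall>v\<in>H1 (interior P).
          L2_inner (lebesgue_on (interior P)) (wgrad (interior P) u) (wgrad (interior P) v)
            - L2_inner (lebesgue_on (interior P)) g v
          = L2_inner (surface_measure P) q (tr v)))"

datatype 'a boundary_operator = Dirichlet | Neumann | Robin "'a \<Rightarrow> real"

text \<open>The Robin coefficient is \<open>C\<^sup>1\<close> in \<open>\<Omega>\<close>, and its values on \<open>\<partial>\<Omega>\<close> are those of its continuous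
  extension.\<close>

fun admissible_operator :: "'a::euclidean_space set \<Rightarrow> 'a boundary_operator \<Rightarrow> bool" where
  "admissible_operator P (Robin \<kappa>) \<longleftrightarrow>
     C1_on (interior P) \<kappa> \<and> continuous_on P \<kappa> \<and> (\<forall>y\<in>frontier P. 0 < \<kappa> y)"
| "admissible_operator P _ \<longleftrightarrow> True"

text \<open>\<open>\<B>(u) = 0\<close> on \<open>\<partial>\<Omega>\<close>.\<close>

fun boundary_condition ::
  "'a::euclidean_space set \<Rightarrow> (('a \<Rightarrow> real) \<Rightarrow> 'a \<Rightarrow> real) \<Rightarrow> 'a boundary_operator
     \<Rightarrow> ('a \<Rightarrow> real) \<Rightarrow> bool" where
  "boundary_condition P tr Dirichlet u \<longleftrightarrow> u \<in> H10 (interior P)"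
| "boundary_condition P tr Neumann u \<longleftrightarrow> normal_derivative P tr u (\<lambda>y. 0)"
| "boundary_condition P tr (Robin \<kappa>) u \<longleftrightarrow> normal_derivative P tr u (\<lambda>y. - (\<kappa> y * tr u y))"

text \<open>\<open>L\<^sup>2(\<Omega>)\<close>, restricted to functions of zero mean in the Neumann case.\<close>

definition data_space ::
  "'a::euclidean_space set \<Rightarrow> 'a boundary_operator \<Rightarrow> ('a \<Rightarrow> real) set" where
  "data_space P bc = {g. square_integrable (lebesgue_on (interior P)) g \<and>
                         (bc = Neumann \<longrightarrow> (LINT x|lebesgue_on (interior P). g x) = 0)}"

definition exact_solution_operator ::
  "'a::euclidean_space set \<Rightarrow> (('a \<Rightarrow> real) \<Rightarrow> 'a \<Rightarrow> real) \<Rightarrow> 'a boundary_operator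
     \<Rightarrow> (('a \<Rightarrow> real) \<Rightarrow> 'a \<Rightarrow> real) \<Rightarrow> bool" where
  "exact_solution_operator P tr bc E \<longleftrightarrow>
     (\<forall>g\<in>data_space P bc. E g \<in> data_space P bc \<and>
        neg_laplacian (interior P) (E g) g \<and> boundary_condition P tr bc (E g))"

subsection \<open>Eigenpairs and fractional powers\<close>

definition fourier_coeff ::
  "'a::euclidean_space set \<Rightarrow> (nat \<Rightarrow> 'a \<Rightarrow> real) \<Rightarrow> ('a \<Rightarrow> real) \<Rightarrow> nat \<Rightarrow> real" where
  "fourier_coeff P \<phi> \<psi> m = L2_inner (lebesgue_on (interior P)) \<psi> (\<phi> m)"

text \<open>The eigenpairs are enumerated from 0, in any order.\<close>

definition eigenpairs ::
  "'a::euclidean_space set \<Rightarrow> (('a \<Rightarrow> real) \<Rightarrow> 'a \<Rightarrow> real) \<Rightarrow> 'a boundary_operator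
     \<Rightarrow> (nat \<Rightarrow> 'a \<Rightarrow> real) \<Rightarrow> (nat \<Rightarrow> real) \<Rightarrow> bool" where
  "eigenpairs P tr bc \<phi> lam \<longleftrightarrow>
     (\<forall>m. neg_laplacian (interior P) (\<phi> m) (\<lambda>x. lam m * \<phi> m x) \<and>
          boundary_condition P tr bc (\<phi> m)) \<and>
     (\<forall>m l. L2_inner (lebesgue_on (interior P)) (\<phi> m) (\<phi> l) = (if m = l then 1 else 0)) \<and>
     (\<forall>\<psi>. square_integrable (lebesgue_on (interior P)) \<psi> \<longrightarrow>
        (\<lambda>n. L2_norm (lebesgue_on (interior P))
               (\<lambda>x. \<psi> x - (\<Sum>m<n. fourier_coeff P \<phi> \<psi> m * \<phi> m x))) \<longlonglongrightarrow> 0)"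

definition first_positive_eigenvalue :: "(nat \<Rightarrow> real) \<Rightarrow> real \<Rightarrow> bool" where
  "first_positive_eigenvalue lam \<mu> \<longleftrightarrow>
     0 < \<mu> \<and> \<mu> \<in> range lam \<and> (\<forall>m. 0 < lam m \<longrightarrow> \<mu> \<le> lam m)"

text \<open>The index set of all sums over the eigenpairs.\<close>

definition modes :: "'a boundary_operator \<Rightarrow> (nat \<Rightarrow> real) \<Rightarrow> nat set" where
  "modes bc lam = (if bc = Neumann then {m. lam m \<noteq> 0} else UNIV)"

definition HB ::
  "'a::euclidean_space set \<Rightarrow> 'a boundary_operator \<Rightarrow> (nat \<Rightarrow> 'a \<Rightarrow> real) \<Rightarrow> (nat \<Rightarrow> real)
     \<Rightarrow> real \<Rightarrow> ('a \<Rightarrow> real) set" where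
  "HB P bc \<phi> lam r = {\<psi>. square_integrable (lebesgue_on (interior P)) \<psi> \<and>
     (\<lambda>m. lam m powr r * (fourier_coeff P \<phi> \<psi> m)\<^sup>2) summable_on modes bc lam}"

definition HB_norm ::
  "'a::euclidean_space set \<Rightarrow> 'a boundary_operator \<Rightarrow> (nat \<Rightarrow> 'a \<Rightarrow> real) \<Rightarrow> (nat \<Rightarrow> real)
     \<Rightarrow> real \<Rightarrow> ('a \<Rightarrow> real) \<Rightarrow> real" where
  "HB_norm P bc \<phi> lam r \<psi> =
     sqrt (\<Sum>\<^sub>\<infinity>m\<in>modes bc lam. lam m powr r * (fourier_coeff P \<phi> \<psi> m)\<^sup>2)"

text \<open>\<open>(- \<Delta>\<^sub>\<B>)\<^sup>-\<^sup>s f\<close>: a representative of the sum in \<open>L\<^sup>2(\<Omega>)\<close> of the eigenfunction series.\<close>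

definition frac_inverse ::
  "'a::euclidean_space set \<Rightarrow> 'a boundary_operator \<Rightarrow> (nat \<Rightarrow> 'a \<Rightarrow> real) \<Rightarrow> (nat \<Rightarrow> real)
     \<Rightarrow> real \<Rightarrow> ('a \<Rightarrow> real) \<Rightarrow> 'a \<Rightarrow> real" where
  "frac_inverse P bc \<phi> lam s f =
     (SOME g. square_integrable (lebesgue_on (interior P)) g \<and>
        (\<lambda>n. L2_norm (lebesgue_on (interior P))
               (\<lambda>x. g x - (\<Sum>m\<in>modes bc lam \<inter> {..<n}.
                              lam m powr (- s) * fourier_coeff P \<phi> f m * \<phi> m x))) \<longlonglongrightarrow> 0)"

subsection \<open>Quadrature\<close>

definition second_diff :: "real \<Rightarrow> nat \<Rightarrow> real" where
  "second_diff s j =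
     (real j + 1) powr (1 + s) - 2 * real j powr (1 + s) + (real j - 1) powr (1 + s)"

definition last_b :: "real \<Rightarrow> nat \<Rightarrow> real" where
  "last_b s NT =
     (real NT - 1) powr (1 + s) + (1 + s) * real NT powr s - real NT powr (1 + s)"

definition quad_weight :: "real \<Rightarrow> real \<Rightarrow> real \<Rightarrow> nat \<Rightarrow> nat \<Rightarrow> real" where
  "quad_weight s r dt NT j =
     (if r \<le> 2 - 2 * s then
        (if j < NT then dt powr s / s * ((real j + 1) powr s - real j powr s) else 0)
      else if r < 2 then
        dt powr s / (s * (1 + s)) *
          (if j = 0 then 0 else if j = 1 then 2 powr (1 + s) - 1
           else if j < NT then second_diff s j else last_b s NT)
      else
        dt powr s / (s * (1 + s)) *
          (if j = 0 then 1 else if j < NT then second_diff s j else last_b s NT))"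

text \<open>\<open>\<rho> j\<close> stands for the value of the integrand at the node \<open>t\<^sub>j = j \<Delta>t\<close>.\<close>

definition quadrature :: "real \<Rightarrow> real \<Rightarrow> real \<Rightarrow> nat \<Rightarrow> (nat \<Rightarrow> real) \<Rightarrow> real" where
  "quadrature s r dt NT \<rho> = 1 / Gamma s * (\<Sum>j\<le>NT. \<rho> j * quad_weight s r dt NT j)"

subsection \<open>Finite elements\<close>

definition quasi_uniform_triangulations ::
  "'a::euclidean_space set \<Rightarrow> real \<Rightarrow> (real \<Rightarrow> 'a set set) \<Rightarrow> bool" where
  "quasi_uniform_triangulations P h0 \<T> \<longleftrightarrow>
     (\<forall>h\<in>{0<..h0}. triangulation (\<T> h) \<and> \<Union>(\<T> h) = P \<and> (\<forall>K\<in>\<T> h. int DIM('a) simplex K)) \<and>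
     (\<exists>\<rho>>0. \<forall>h\<in>{0<..h0}. \<forall>K\<in>\<T> h. diameter K \<le> h \<and> (\<exists>x. cball x (\<rho> * h) \<subseteq> K))"

fun energy_space :: "'a::euclidean_space set \<Rightarrow> 'a boundary_operator \<Rightarrow> ('a \<Rightarrow> real) set" where
  "energy_space P Dirichlet = H10 (interior P)"
| "energy_space P _ = H1 (interior P)"

definition bilinear_form ::
  "'a::euclidean_space set \<Rightarrow> (('a \<Rightarrow> real) \<Rightarrow> 'a \<Rightarrow> real) \<Rightarrow> 'a boundary_operator
     \<Rightarrow> ('a \<Rightarrow> real) \<Rightarrow> ('a \<Rightarrow> real) \<Rightarrow> real" where
  "bilinear_form P tr bc w v =
     L2_inner (lebesgue_on (interior P)) (wgrad (interior P) w) (wgrad (interior P) v) +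
     (case bc of Robin \<kappa> \<Rightarrow> (LINT y|surface_measure P. \<kappa> y * tr w y * tr v y) | _ \<Rightarrow> 0)"

definition fe_fun :: "nat \<Rightarrow> (nat \<Rightarrow> 'a \<Rightarrow> real) \<Rightarrow> (nat \<Rightarrow> real) \<Rightarrow> 'a \<Rightarrow> real" where
  "fe_fun N b c = (\<lambda>x. \<Sum>i<N. c i * b i x)"

definition fe_space :: "nat \<Rightarrow> (nat \<Rightarrow> 'a \<Rightarrow> real) \<Rightarrow> ('a \<Rightarrow> real) set" where
  "fe_space N b = range (fe_fun N b)"

text \<open>\<open>b 0, \<dots>, b (N - 1)\<close> is a basis of \<open>V\<^sub>h = fe_space N b\<close>, on which the bilinear form is defined.\<close>

definition fe_basis ::
  "'a::euclidean_space set \<Rightarrow> 'a boundary_operator \<Rightarrow> nat \<Rightarrow> (nat \<Rightarrow> 'a \<Rightarrow> real) \<Rightarrow> bool" where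
  "fe_basis P bc N b \<longleftrightarrow>
     (\<forall>i<N. b i \<in> energy_space P bc) \<and>
     (\<forall>c. (AE x in lebesgue_on (interior P). fe_fun N b c x = 0) \<longrightarrow> (\<forall>i<N. c i = 0))"

definition fe_solution_operator ::
  "'a::euclidean_space set \<Rightarrow> (('a \<Rightarrow> real) \<Rightarrow> 'a \<Rightarrow> real) \<Rightarrow> 'a boundary_operator
     \<Rightarrow> nat \<Rightarrow> (nat \<Rightarrow> 'a \<Rightarrow> real) \<Rightarrow> (('a \<Rightarrow> real) \<Rightarrow> 'a \<Rightarrow> real) \<Rightarrow> bool" where
  "fe_solution_operator P tr bc N b Eh \<longleftrightarrow>
     (\<forall>g\<in>data_space P bc. Eh g \<in> fe_space N b \<inter> data_space P bc \<and>
        (\<forall>v\<in>fe_space N b.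
           bilinear_form P tr bc (Eh g) v = L2_inner (lebesgue_on (interior P)) g v))"

definition selfadjoint_positive ::
  "'a::euclidean_space set \<Rightarrow> 'a boundary_operator
     \<Rightarrow> nat \<Rightarrow> (nat \<Rightarrow> 'a \<Rightarrow> real) \<Rightarrow> (('a \<Rightarrow> real) \<Rightarrow> 'a \<Rightarrow> real) \<Rightarrow> bool" where
  "selfadjoint_positive P bc N b Eh \<longleftrightarrow>
     (\<forall>g\<in>data_space P bc. \<forall>g'\<in>data_space P bc.
        L2_inner (lebesgue_on (interior P)) (Eh g) g' =
        L2_inner (lebesgue_on (interior P)) g (Eh g')) \<and>
     (\<forall>g\<in>data_space P bc. 0 \<le> L2_inner (lebesgue_on (interior P)) (Eh g) g) \<and>
     (\<forall>v\<in>fe_space N b \<inter> data_space P bc. L2_norm (lebesgue_on (interior P)) v \<noteq> 0 \<longrightarrow>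
        0 < L2_inner (lebesgue_on (interior P)) (Eh v) v)"

subsection \<open>Time stepping\<close>

definition mass_matrix ::
  "'a::euclidean_space set \<Rightarrow> (nat \<Rightarrow> 'a \<Rightarrow> real) \<Rightarrow> nat \<Rightarrow> nat \<Rightarrow> real" where
  "mass_matrix P b i l = L2_inner (lebesgue_on (interior P)) (b i) (b l)"

definition stiffness_matrix ::
  "'a::euclidean_space set \<Rightarrow> (('a \<Rightarrow> real) \<Rightarrow> 'a \<Rightarrow> real) \<Rightarrow> 'a boundary_operator
     \<Rightarrow> (nat \<Rightarrow> 'a \<Rightarrow> real) \<Rightarrow> nat \<Rightarrow> nat \<Rightarrow> real" where
  "stiffness_matrix P tr bc b i l = bilinear_form P tr bc (b i) (b l)"

text \<open>\<open>W j i\<close> is the \<open>i\<close>-th coefficient at time \<open>t\<^sub>j\<close>; only the indices \<open>i < N\<close> and \<open>j \<le> NT\<close> matter.\<close>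

definition theta_scheme ::
  "'a::euclidean_space set \<Rightarrow> (('a \<Rightarrow> real) \<Rightarrow> 'a \<Rightarrow> real) \<Rightarrow> 'a boundary_operator
     \<Rightarrow> nat \<Rightarrow> (nat \<Rightarrow> 'a \<Rightarrow> real) \<Rightarrow> real \<Rightarrow> real \<Rightarrow> nat \<Rightarrow> (nat \<Rightarrow> nat \<Rightarrow> real) \<Rightarrow> bool" where
  "theta_scheme P tr bc N b \<theta> dt NT W \<longleftrightarrow>
     (\<forall>j\<in>{1..NT}. \<forall>i<N.
        (\<Sum>l<N. (mass_matrix P b i l + \<theta> * dt * stiffness_matrix P tr bc b i l) * W j l) =
        (\<Sum>l<N. (mass_matrix P b i l + (\<theta> - 1) * dt * stiffness_matrix P tr bc b i l)
                  * W (j - 1) l))"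

definition L2_projection ::
  "'a::euclidean_space set \<Rightarrow> nat \<Rightarrow> (nat \<Rightarrow> 'a \<Rightarrow> real) \<Rightarrow> ('a \<Rightarrow> real) \<Rightarrow> (nat \<Rightarrow> real) \<Rightarrow> bool" where
  "L2_projection P N b f c \<longleftrightarrow>
     (\<forall>v\<in>fe_space N b. L2_inner (lebesgue_on (interior P)) (\<lambda>x. f x - fe_fun N b c x) v = 0)"

definition fe_heat_solution ::
  "'a::euclidean_space set \<Rightarrow> (('a \<Rightarrow> real) \<Rightarrow> 'a \<Rightarrow> real) \<Rightarrow> 'a boundary_operator
     \<Rightarrow> nat \<Rightarrow> (nat \<Rightarrow> 'a \<Rightarrow> real) \<Rightarrow> real \<Rightarrow> real \<Rightarrow> nat \<Rightarrow> ('a \<Rightarrow> real)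
     \<Rightarrow> (nat \<Rightarrow> 'a \<Rightarrow> real) \<Rightarrow> bool" where
  "fe_heat_solution P tr bc N b \<theta> dt NT f w \<longleftrightarrow>
     (\<exists>W. L2_projection P N b f (W 0) \<and> theta_scheme P tr bc N b \<theta> dt NT W \<and>
          (\<forall>j\<le>NT. w j = fe_fun N b (W j)))"

definition time_order :: "real \<Rightarrow> nat" where
  "time_order \<theta> = (if \<theta> = 1/2 then 2 else 1)"

text \<open>\<open>\<Delta>t \<le> Cst h\<^sup>2\<close> guarantees that the discrete solutions are bounded in \<open>L\<^sup>2(\<Omega>)\<close> by their initial
  values, uniformly in the number of steps, the step size and the mesh.\<close>

definition stability_constant ::
  "'a::euclidean_space set \<Rightarrow> (('a \<Rightarrow> real) \<Rightarrow> 'a \<Rightarrow> real) \<Rightarrow> 'a boundary_operator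
     \<Rightarrow> real \<Rightarrow> (real \<Rightarrow> nat) \<Rightarrow> (real \<Rightarrow> nat \<Rightarrow> 'a \<Rightarrow> real) \<Rightarrow> real \<Rightarrow> real \<Rightarrow> bool" where
  "stability_constant P tr bc h0 N b \<theta> Cst \<longleftrightarrow>
     (\<exists>K. \<forall>h\<in>{0<..h0}. \<forall>dt. 0 < dt \<and> dt \<le> Cst * h\<^sup>2 \<longrightarrow>
        (\<forall>J W. theta_scheme P tr bc (N h) (b h) \<theta> dt J W \<longrightarrow>
           L2_norm (lebesgue_on (interior P)) (fe_fun (N h) (b h) (W J))
           \<le> K * L2_norm (lebesgue_on (interior P)) (fe_fun (N h) (b h) (W 0))))"

end

theory Submission
  imports Defs
begin

text \<open>The eigenfunctions of the discrete solution operator \<open>S = E\<^sub>h\<close> reduce the quadrature of the scheme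
  to scalars: \<open>w\<close> at time \<open>j dt\<close> has in the mode with eigenvalue \<open>\<mu>\<close> the factor \<open>R(dt \<mu>)\<^sup>j\<close> for the
  rational function \<open>R\<close> of the scheme. If \<open>z = dt \<mu>\<close> is small, this is \<open>exp(- j y)\<close> with
  \<open>y = - ln (R(z))\<close>, where \<open>y - z\<close> is of the order of consistency, and the weights integrate its interpolant
  against \<open>x\<^sup>s\<^sup>-\<^sup>1\<close>; if \<open>z\<close> is large, the possibly alternating sum is bounded by summation by parts. So the
  quadrature differs from \<open>\<mu>\<^sup>-\<^sup>s\<close> by at most \<open>C dt\<^sup>s (min 1 z)\<^bsup>r/2\<^esup>\<close>, apart from a tail that the lower bound
  for \<open>T\<close> controls.

  It remains to compare \<open>S\<^sup>s\<close> with \<open>E\<^sup>s\<close> on data \<open>f = E\<^sup>\<sigma> g\<close>, \<open>\<sigma> = r/2\<close>. The formula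
  \<open>x\<^sup>s = \<kappa>\<^sup>-\<^sup>1 \<integral> l\<^sup>s\<^sup>-\<^sup>1 x/(l + x) dl\<close> turns this into bounds for
  \<open>S(l + S)\<^sup>-\<^sup>1 - E(l + E)\<^sup>-\<^sup>1 = l (l + S)\<^sup>-\<^sup>1 (S - E) (l + E)\<^sup>-\<^sup>1\<close>, where \<open>S - E\<close> has norm at most \<open>C h\<^sup>2\<close>.
  Applied to \<open>E\<^sup>\<sigma> g\<close>, the integral is of size \<open>h\<^sup>2\<close> for \<open>s + \<sigma> > 1\<close>, of size \<open>h\<^bsup>2(s + \<sigma>)\<^esup>\<close> for
  \<open>s + \<sigma> < 1\<close>, and a logarithm appears in between.\<close>

section \<open>Powers as integrals of resolvents\<close>

text \<open>\<open>S\<close> and \<open>E\<close> do not commute, so the error cannot be computed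
  mode by mode: the scheme is diagonal in the discrete eigenvectors, the data are smooth with
  respect to the exact ones, and one norm bound for \<open>S - E\<close> is all that links the two
  families. A scalar error of size \<open>(min 1 z) powr \<sigma>\<close> is small only against
  \<open>S powr \<sigma>\<close>, whereas the data supply \<open>E powr \<sigma>\<close>. For
  \<sigma> \<le> 1 the two powers differ by order \<open>h powr (2 * \<sigma>)\<close>, which
  suffices. For \<sigma> > 1 the difference is controlled only to order \<open>h\<^sup>2\<close>, so
  a single factor \<open>E\<close> is split off and exchanged. Infinitely many modes enter only at
  the end: the estimates concern finite sums over eigenvectors, with constants independent of their
  number, and \<open>f\<close> is reached by truncation. Since functions agree only almost
  everywhere, the estimates take place in the space of square-summable coefficient sequences. The
  eigenvectors span only the zero-mean part, and the matrices of the scheme have to be identified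
  beyond it.\<close>

lemma has_integral_affine_ray:
  fixes f :: "real \<Rightarrow> real"
  assumes f: "(f has_integral I) {d<..}" and nonneg: "\<And>x. d < x \<Longrightarrow> 0 \<le> f x" and c: "0 < c"
  shows "((\<lambda>x. c * f (c * x + d)) has_integral I) {0<..}"
proof -
  have "x \<in> (\<lambda>x. c * x + d) ` {0<..}" if "d < x" for x
    using c that by (intro image_eqI[of _ _ "(x - d) / c"]) auto
  hence im: "(\<lambda>x. c * x + d) ` {0<..} = {d<..}"
    using c by auto
  have "f absolutely_integrable_on {d<..} \<and> integral {d<..} f = I"
    using f nonneg nonnegative_absolutely_integrable_1[of f "{d<..}"] by (auto simp: has_integral_iff)
  hence "(\<lambda>x. \<bar>c\<bar> * f (c * x + d)) absolutely_integrable_on {0<..} \<and>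
         integral {0<..} (\<lambda>x. \<bar>c\<bar> * f (c * x + d)) = I"
    by (subst has_absolute_integral_change_of_variables_1'[where g = "\<lambda>x. c * x + d"])
       (use c in \<open>auto intro!: derivative_eq_intros inj_onI simp: im\<close>)
  thus ?thesis
    using c set_lebesgue_integral_eq_integral(1) by (auto simp: has_integral_iff)
qed

lemma has_integral_Ici_iff_Ioi:
  fixes f :: "real \<Rightarrow> 'a :: banach"
  shows "(f has_integral I) {a..} \<longleftrightarrow> (f has_integral I) {a<..}"
  by (rule has_integral_spike_set_eq; rule negligible_subset[of "{a}"]; force)

lemma has_integral_powr_exp:
  assumes s: "0 < s" and y: "0 < (y::real)"
  shows "((\<lambda>x. x powr (s - 1) * exp (- (y * x))) has_integral Gamma s * y powr (- s)) {0<..}"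
proof -
  have "((\<lambda>x. y * ((y * x + 0) powr (s - 1) / exp (y * x + 0))) has_integral Gamma s) {0<..}"
    using Gamma_integral_real[OF s] y
    by (intro has_integral_affine_ray) (auto simp: has_integral_Ici_iff_Ioi)
  hence "((\<lambda>x. y * (y powr (s - 1) * x powr (s - 1) / exp (y * x))) has_integral Gamma s) {0<..}"
    by (rule has_integral_eq[rotated]) (use y in \<open>auto simp: powr_mult\<close>)
  hence "((\<lambda>x. y powr (- s) * (y * (y powr (s - 1) * x powr (s - 1) / exp (y * x))))
          has_integral y powr (- s) * Gamma s) {0<..}"
    by (rule has_integral_mult_right)
  moreover have "y powr (- s) * (y * (y powr (s - 1) * x powr (s - 1) / exp (y * x)))
      = x powr (s - 1) * exp (- (y * x))" for x
    using y by (simp add: powr_minus powr_diff exp_minus divide_simps)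
  ultimately show ?thesis
    by (simp only: mult.commute[of "y powr (- s)" "Gamma s"])
qed

text \<open>The substitution \<open>l = x * u\<close> reduces the formula to \<open>x = 1\<close>.
  There the integral converges at 0 because \<open>s > 0\<close> and at infinity because
  \<open>s < 1\<close>; its value is \<pi> / sin (\<pi> s). For \<open>x = 0\<close> both sides
  vanish, as \<open>0 powr s = 0\<close>.\<close>

lemma has_integral_powr_resolvent:
  assumes s: "0 < s" "s < (1::real)"
  shows "\<exists>\<kappa>>0. \<forall>x\<ge>0. ((\<lambda>l. l powr (s - 1) * (x / (l + x))) has_integral \<kappa> * x powr s) {0<..}"
proof -
  define f where "f = (\<lambda>l::real. l powr (s - 1) * (1 / (l + 1)))"
  have 1: "f integrable_on {0<..1}"
  proof (rule set_lebesgue_integral_eq_integral(1),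
      rule measurable_bounded_by_integrable_imp_absolutely_integrable)
    show "f \<in> borel_measurable (lebesgue_on {0<..1})"
      unfolding f_def by (intro continuous_imp_measurable_on_sets_lebesgue continuous_intros) auto
    show "(\<lambda>l. l powr (s - 1)) integrable_on {0<..1}"
      by (rule integrable_on_powr_from_0') (use s in auto)
  qed (auto simp: f_def abs_mult divide_simps mult_left_le)
  have 2: "f integrable_on {1..}"
  proof (rule set_lebesgue_integral_eq_integral(1),
      rule measurable_bounded_by_integrable_imp_absolutely_integrable)
    show "f \<in> borel_measurable (lebesgue_on {1..})"
      unfolding f_def by (intro continuous_imp_measurable_on_sets_lebesgue continuous_intros) auto
    show "(\<lambda>l. l powr (s - 2)) integrable_on {1..}"
      using has_integral_powr_to_inf[of "s - 2" 1] s by (auto simp: integrable_on_def)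
    show "norm (f l) \<le> l powr (s - 2)" if "l \<in> {1..}" for l
    proof -
      have "l powr (s - 2) = l powr (s - 1) * (1 / l)"
        using powr_diff[of l "s - 1" 1] that by (simp add: algebra_simps)
      thus ?thesis
        using that by (simp add: f_def abs_mult) (intro mult_left_mono divide_left_mono; simp)
    qed
  qed auto
  have int: "f integrable_on {0<..}"
  proof -
    have "f integrable_on ({0<..1} \<union> {1..})"
      by (rule integrable_Un[OF _ 1 2]) (rule negligible_subset[of "{1}"]; force)
    moreover have "{0<..1} \<union> {1..} = {(0::real)<..}" by auto
    ultimately show ?thesis by simp
  qed
  define \<kappa> where "\<kappa> = integral {0<..} f"
  have \<kappa>: "(f has_integral \<kappa>) {0<..}"
    using int by (simp add: \<kappa>_def has_integral_integral)
  have f0: "0 \<le> f l" if "0 < l" for l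
    using that by (simp add: f_def)
  have pos: "0 < \<kappa>"
  proof -
    have "((\<lambda>l. (1/2) * l powr (s - 1)) has_integral (1/2) * (1 powr (s - 1 + 1) / (s - 1 + 1))) {0..1}"
      by (intro has_integral_mult_right has_integral_powr_from_0) (use s in auto)
    hence h: "((\<lambda>l. (1/2) * l powr (s - 1)) has_integral 1 / (2 * s)) {0<..<1}"
      by (simp add: has_integral_Icc_iff_Ioo)
    have "((\<lambda>l. if l \<in> {0<..<1} then (1/2) * l powr (s - 1) else 0) has_integral 1 / (2 * s)) {0<..}"
      by (subst has_integral_restrict) (use h in auto)
    hence "1 / (2 * s) \<le> \<kappa>"
    proof (rule has_integral_le[OF _ \<kappa>])
      fix l :: real
      assume l: "l \<in> {0<..}"
      have "1 / 2 * l powr (s - 1) \<le> f l" if "l < 1"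
        using l that by (auto simp: f_def divide_simps intro!: mult_left_mono)
      thus "(if l \<in> {0<..<1} then (1/2) * l powr (s - 1) else 0) \<le> f l"
        using f0[of l] l by auto
    qed
    moreover have "0 < 1 / (2 * s)"
      using s by simp
    ultimately show ?thesis by linarith
  qed
  have "((\<lambda>l. l powr (s - 1) * (x / (l + x))) has_integral \<kappa> * x powr s) {0<..}" if x: "0 < x" for x
  proof -
    have "((\<lambda>l. 1 / x * f (1 / x * l + 0)) has_integral \<kappa>) {0<..}"
      by (rule has_integral_affine_ray[OF \<kappa> f0]) (use x in auto)
    hence "((\<lambda>l. x powr s * (1 / x * f (1 / x * l + 0))) has_integral x powr s * \<kappa>) {0<..}"
      by (rule has_integral_mult_right)
    moreover have "x powr s * (1 / x * f (1 / x * l + 0)) = l powr (s - 1) * (x / (l + x))" if "0 < l" for l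
      using x that by (simp add: f_def powr_divide powr_diff divide_simps)
    ultimately have "((\<lambda>l. l powr (s - 1) * (x / (l + x))) has_integral x powr s * \<kappa>) {0<..}"
      by (rule has_integral_eq[rotated]) auto
    thus ?thesis
      by (simp only: mult.commute)
  qed
  thus ?thesis
    using pos by (intro exI[of _ \<kappa>] conjI allI impI) (auto simp: order_le_less)
qed

subsection \<open>Integration of exponentials against \<open>x powr (s - 1)\<close>\<close>

text \<open>\<open>lweight s j\<close> and \<open>rweight s j\<close> are the integrals over \<open>[j, j + 1]\<close> of \<open>x powr (s - 1)\<close> times the
  decreasing and the increasing linear nodal function of this interval.\<close>

definition lweight :: "real \<Rightarrow> nat \<Rightarrow> real" where
  "lweight s j = ((real j + 1) powr (1 + s) - real j powr (1 + s)) / (s * (1 + s)) - real j powr s / s"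

definition rweight :: "real \<Rightarrow> nat \<Rightarrow> real" where
  "rweight s j = (real j + 1) powr s / s - ((real j + 1) powr (1 + s) - real j powr (1 + s)) / (s * (1 + s))"

lemma has_integral_lweight:
  assumes s: "0 < s"
  shows "((\<lambda>u. (real j + u) powr (s - 1) * (1 - u)) has_integral lweight s j) {0..1}"
proof -
  define F where "F = (\<lambda>u. (real j + u) powr s / s * (1 - u) + (real j + u) powr (1 + s) / (s * (1 + s)))"
  have "((\<lambda>u. (real j + u) powr (s - 1) * (1 - u)) has_integral (F 1 - F 0)) {0..1}"
  proof (rule fundamental_theorem_of_calculus_interior)
    show "continuous_on {0..1} F"
      unfolding F_def using s by (intro continuous_intros continuous_on_powr') auto
    fix u :: real
    assume u: "u \<in> {0<..<1}"
    hence "(F has_field_derivative (real j + u) powr (s - 1) * (1 - u)) (at u)"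
      unfolding F_def using s
      by (auto intro!: derivative_eq_intros simp: add_pos_nonneg add_nonneg_pos)
         (auto simp: field_simps)
    thus "(F has_vector_derivative (real j + u) powr (s - 1) * (1 - u)) (at u)"
      by (simp add: has_real_derivative_iff_has_vector_derivative)
  qed simp
  also have "F 1 - F 0 = lweight s j"
    by (simp add: F_def lweight_def diff_divide_distrib)
  finally show ?thesis .
qed

lemma has_integral_rweight:
  assumes s: "0 < s"
  shows "((\<lambda>u. (real j + u) powr (s - 1) * u) has_integral rweight s j) {0..1}"
proof -
  define F where "F = (\<lambda>u. (real j + u) powr s / s * u - (real j + u) powr (1 + s) / (s * (1 + s)))"
  have "((\<lambda>u. (real j + u) powr (s - 1) * u) has_integral (F 1 - F 0)) {0..1}"
  proof (rule fundamental_theorem_of_calculus_interior)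
    show "continuous_on {0..1} F"
      unfolding F_def using s by (intro continuous_intros continuous_on_powr') auto
    fix u :: real
    assume u: "u \<in> {0<..<1}"
    hence "(F has_field_derivative (real j + u) powr (s - 1) * u) (at u)"
      unfolding F_def using s
      by (auto intro!: derivative_eq_intros simp: add_pos_nonneg add_nonneg_pos)
         (auto simp: field_simps)
    thus "(F has_vector_derivative (real j + u) powr (s - 1) * u) (at u)"
      by (simp add: has_real_derivative_iff_has_vector_derivative)
  qed simp
  also have "F 1 - F 0 = rweight s j"
    by (simp add: F_def rweight_def diff_divide_distrib)
  finally show ?thesis .
qed

lemma weights_nonneg:
  assumes "0 < s"
  shows "0 \<le> lweight s j" "0 \<le> rweight s j"
  using has_integral_nonneg[OF has_integral_lweight[OF assms, of j]]
        has_integral_nonneg[OF has_integral_rweight[OF assms, of j]] by auto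

text \<open>The density \<open>x powr (s - 1)\<close> decreases for s \<le> 1, hence so do its
  integrals against shifted copies of a nodal function. Summation by parts relies on this.\<close>

lemma weights_decreasing:
  assumes s: "0 < s" "s \<le> 1"
  shows "lweight s (Suc j) \<le> lweight s j" "rweight s (Suc j) \<le> rweight s j"
proof -
  \<comment> \<open>Positivity of \<open>u\<close> matters: at \<open>j = 0\<close>,
    \<open>u = 0\<close> the convention \<open>0 powr (s - 1) = 0\<close> reverses the inequality.
    Hence the passage to open intervals below.\<close>
  have *: "(real (Suc j) + u) powr (s - 1) \<le> (real j + u) powr (s - 1)" if "0 < u" for u
    using that s by (intro powr_mono2') auto
  show "lweight s (Suc j) \<le> lweight s j"
    by (rule has_integral_le[OF has_integral_lweight[THEN has_integral_Icc_iff_Ioo[THEN iffD1]]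
          has_integral_lweight[THEN has_integral_Icc_iff_Ioo[THEN iffD1]]])
       (use s in \<open>auto intro!: mult_right_mono *[simplified]\<close>)
  show "rweight s (Suc j) \<le> rweight s j"
    by (rule has_integral_le[OF has_integral_rweight[THEN has_integral_Icc_iff_Ioo[THEN iffD1]]
          has_integral_rweight[THEN has_integral_Icc_iff_Ioo[THEN iffD1]]])
       (use s in \<open>auto intro!: mult_right_mono *[simplified]\<close>)
qed

text \<open>\<open>R\<close> may equal -1, where the powers do not decay and a geometric series
  gives no bound. Multiplication by \<open>1 - R\<close> leaves differences of \<open>d\<close>,
  which add up to at most \<open>d 0\<close>, and boundary terms; the resulting bound
  \<open>2 * d 0\<close> is divided by \<open>1 - R \<ge> 1/3\<close>.\<close>

lemma abs_sum_powers_decreasing_le: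
  fixes d :: "nat \<Rightarrow> real"
  assumes d: "\<And>j. d (Suc j) \<le> d j" "\<And>j. 0 \<le> d j" and R: "-1 \<le> R" "R \<le> 2/3"
  shows "\<bar>\<Sum>j<n. R ^ j * d j\<bar> \<le> 6 * d 0"
proof -
  have abel: "(1 - R) * (\<Sum>j<n. R ^ j * d j) = d 0 - (\<Sum>j<n. R ^ Suc j * (d j - d (Suc j))) - R ^ n * d n"
    by (induction n) (auto simp: algebra_simps)
  have Rp: "\<bar>R ^ k\<bar> \<le> 1" for k
    using R by (simp add: power_abs power_le_one)
  have "\<bar>\<Sum>j<n. R ^ Suc j * (d j - d (Suc j))\<bar> \<le> (\<Sum>j<n. d j - d (Suc j))"
    by (rule order_trans[OF sum_abs], rule sum_mono)
       (use Rp[of "Suc _"] d in \<open>simp add: abs_mult del: power_Suc, intro mult_left_le_one_le, auto\<close>)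
  also have "\<dots> = d 0 - d n"
    by (rule sum_lessThan_telescope')
  finally have "\<bar>\<Sum>j<n. R ^ Suc j * (d j - d (Suc j))\<bar> \<le> d 0 - d n" .
  moreover have "\<bar>R ^ n * d n\<bar> \<le> d n"
    using Rp[of n] d by (simp add: abs_mult mult_left_le_one_le)
  ultimately have "\<bar>(1 - R) * (\<Sum>j<n. R ^ j * d j)\<bar> \<le> 2 * d 0"
    unfolding abel using d(2)[of 0] by linarith
  moreover have "1 / 3 * \<bar>\<Sum>j<n. R ^ j * d j\<bar> \<le> (1 - R) * \<bar>\<Sum>j<n. R ^ j * d j\<bar>"
    using R by (intro mult_right_mono) auto
  moreover have "\<bar>(1 - R) * (\<Sum>j<n. R ^ j * d j)\<bar> = (1 - R) * \<bar>\<Sum>j<n. R ^ j * d j\<bar>"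
    using R by (simp only: abs_mult abs_of_nonneg)
  ultimately show ?thesis
    by linarith
qed

text \<open>The product of the quadratic Taylor polynomials of \<open>exp (- x)\<close> and
  \<open>exp x\<close> is \<open>1 + x ^ 4 / 4\<close>, hence at least 1, and \<open>exp x\<close>
  is at least its own polynomial.\<close>

lemma exp_minus_le_quadratic:
  fixes x :: real
  assumes "0 \<le> x"
  shows "exp (- x) \<le> 1 - x + x\<^sup>2 / 2"
proof -
  have "1 \<le> (1 - x + x\<^sup>2 / 2) * (1 + x + x\<^sup>2 / 2)"
    using zero_le_power[of "x\<^sup>2" 2] by (simp add: algebra_simps power2_eq_square)
  also have "\<dots> \<le> (1 - x + x\<^sup>2 / 2) * exp x"
    using exp_lower_Taylor_quadratic[OF assms] sum_squares_ge_zero[of "x - 1" 1]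
    by (intro mult_left_mono) (auto simp: power2_eq_square algebra_simps)
  finally show ?thesis
    by (simp add: exp_minus divide_simps)
qed

text \<open>The errors are relative to \<open>exp (- (y * u))\<close>, so that integration against
  the kernel bounds them by multiples of the exact integral. This costs a factor 2, since
  \<open>y \<le> ln 2\<close> keeps the exponential above 1/2.\<close>

lemma interpolation_error_exp:
  fixes y u :: real
  assumes y: "0 \<le> y" "y \<le> ln 2" and u: "0 \<le> u" "u \<le> 1"
  shows "\<bar>1 - exp (- (y * u))\<bar> \<le> 2 * y * exp (- (y * u))"
    and "\<bar>(1 - u) + u * exp (- y) - exp (- (y * u))\<bar> \<le> y\<^sup>2 * exp (- (y * u))"
proof -
  have yu: "0 \<le> y * u" "y * u \<le> y"
    using assms by (auto simp: mult_left_le)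
  have "exp (y * u) \<le> exp (ln 2)"
    using yu y by (subst exp_le_cancel_iff) linarith
  hence half: "1/2 \<le> exp (- (y * u))"
    by (simp add: exp_minus divide_simps)
  have "1 - exp (- (y * u)) \<le> y * u"
    using exp_ge_add_one_self[of "- (y * u)"] by simp
  moreover have "0 \<le> 1 - exp (- (y * u))"
    using yu by simp
  moreover have "y * (1/2) \<le> y * exp (- (y * u))"
    using half y by (intro mult_left_mono)
  ultimately show "\<bar>1 - exp (- (y * u))\<bar> \<le> 2 * y * exp (- (y * u))"
    using yu by linarith
  have e1: "exp (- y) \<le> 1 - y + y\<^sup>2 / 2" "1 - y \<le> exp (- y)"
    using exp_minus_le_quadratic[of y] exp_ge_add_one_self[of "- y"] y by auto
  have e2: "exp (- (y * u)) \<le> 1 - y * u + (y * u)\<^sup>2 / 2" "1 - y * u \<le> exp (- (y * u))"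
    using exp_minus_le_quadratic[of "y * u"] exp_ge_add_one_self[of "- (y * u)"] yu by auto
  have "u * exp (- y) \<le> u * (1 - y + y\<^sup>2 / 2)" "u * (1 - y) \<le> u * exp (- y)"
    using e1 u by (auto intro: mult_left_mono)
  moreover have "u * y\<^sup>2 \<le> y\<^sup>2" "(y * u)\<^sup>2 \<le> y\<^sup>2"
    using u yu by (auto simp: mult_left_le_one_le power_mono)
  ultimately have "(1 - u) + u * exp (- y) - exp (- (y * u)) \<le> y\<^sup>2 * (1/2)"
    "- ((1 - u) + u * exp (- y) - exp (- (y * u))) \<le> y\<^sup>2 * (1/2)"
    using e2 by (simp_all add: algebra_simps)
  hence "\<bar>(1 - u) + u * exp (- y) - exp (- (y * u))\<bar> \<le> y\<^sup>2 * (1/2)"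
    by (rule abs_leI)
  also have "\<dots> \<le> y\<^sup>2 * exp (- (y * u))"
    using half by (intro mult_left_mono) auto
  finally show "\<bar>(1 - u) + u * exp (- y) - exp (- (y * u))\<bar> \<le> y\<^sup>2 * exp (- (y * u))" .
qed

lemma has_integral_translate_unit:
  fixes f :: "real \<Rightarrow> real"
  assumes "(f has_integral I) {a..a + 1}"
  shows "((\<lambda>u. f (a + u)) has_integral I) {0..1}"
  using has_integral_affinity'[of f I a "a + 1" 1 a] assms by (simp add: add.commute)

text \<open>\<open>k j\<close> is the exact integral over the cell from \<open>j\<close> to
  \<open>j + 1\<close>. Shifting the tail beyond \<open>n\<close> back to the origin pulls out the
  factor \<open>exp (- (y * real n))\<close>, and for s \<le> 1 the shift only increases the weight
  \<open>x powr (s - 1)\<close>; so the tail is at most this factor times the whole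
  integral.\<close>

lemma exp_kernel_partial:
  fixes y s :: real
  assumes s: "0 < s" and y: "0 < y"
  defines "f \<equiv> \<lambda>x. x powr (s - 1) * exp (- (y * x))"
  shows "\<exists>k. (\<forall>j. ((\<lambda>u. f (real j + u)) has_integral k j) {0..1}) \<and> (\<forall>j. 0 \<le> k j) \<and>
    (\<forall>n. (\<Sum>j<n. k j) \<le> Gamma s * y powr (- s) \<and>
     (s \<le> 1 \<longrightarrow> Gamma s * y powr (- s) - (\<Sum>j<n. k j) \<le> Gamma s * y powr (- s) * exp (- (y * real n))))"
proof -
  define G where "G = Gamma s * y powr (- s)"
  have f0: "0 \<le> f x" for x by (simp add: f_def)
  have G: "(f has_integral G) {0<..}"
    unfolding f_def G_def by (rule has_integral_powr_exp[OF s y])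
  have ac: "f absolutely_integrable_on {0<..}"
    using G f0 by (intro nonnegative_absolutely_integrable_1) (auto simp: integrable_on_def)
  have int: "f integrable_on S" if "S \<subseteq> {0<..}" "S \<in> sets lebesgue" for S
    using set_integrable_subset[OF ac] that set_lebesgue_integral_eq_integral(1) by blast
  have int01: "f integrable_on {real j..real j + 1}" for j
    using int[of "{real j<..<real j + 1}"] by (subst integrable_on_Icc_iff_Ioo) (auto simp: subset_eq)
  define k where "k j = integral {real j..real j + 1} f" for j
  have k: "(f has_integral k j) {real j..real j + 1}" for j
    using int01[of j] by (simp add: k_def has_integral_integral)
  have sum: "(f has_integral (\<Sum>j<n. k j)) {0..real n}" for n
  proof (induction n)
    case (Suc n)
    have "(f has_integral ((\<Sum>j<n. k j) + k n)) {0..real n + 1}"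
      by (rule has_integral_combine[OF _ _ Suc k]) auto
    thus ?case by (simp add: add.commute)
  qed auto
  have tail: "(f has_integral (G - (\<Sum>j<n. k j))) {real n<..}" for n
  proof -
    have "(f has_integral (\<Sum>j<n. k j)) {0<..real n}"
      using sum[of n] by (subst (asm) has_integral_spike_set_eq[of _ "{0<..real n}"])
        (rule negligible_subset[of "{0}"]; force)+
    moreover have "{0<..real n} - {0<..} = {}" by auto
    ultimately have "(f has_integral (G - (\<Sum>j<n. k j))) ({0<..} - {0<..real n})"
      by (intro has_integral_setdiff[OF G]) auto
    moreover have "{0<..} - {0<..real n} = {real n<..}" by auto
    ultimately show ?thesis by simp
  qed
  have 1: "((\<lambda>u. f (real j + u)) has_integral k j) {0..1}" for j
    by (rule has_integral_translate_unit[OF k])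
  have 2: "0 \<le> k j" for j
    using has_integral_nonneg[OF k] f0 by blast
  have 3: "(\<Sum>j<n. k j) \<le> G" for n
    using has_integral_nonneg[OF tail[of n]] f0 by auto
  have 4: "G - (\<Sum>j<n. k j) \<le> G * exp (- (y * real n))" if "s \<le> 1" for n
  proof -
    have "((\<lambda>x. 1 * f (1 * x + real n)) has_integral (G - (\<Sum>j<n. k j))) {0<..}"
      by (rule has_integral_affine_ray[OF tail]) (use f0 in auto)
    moreover have "((\<lambda>x. f x * exp (- (y * real n))) has_integral G * exp (- (y * real n))) {0<..}"
      by (rule has_integral_mult_left[OF G])
    ultimately show ?thesis
    proof (rule has_integral_le)
      fix x :: real
      assume x: "x \<in> {0<..}"
      have "(x + real n) powr (s - 1) \<le> x powr (s - 1)"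
        using x that by (intro powr_mono2') auto
      moreover have ex: "exp (- (y * (x + real n))) = exp (- (y * x)) * exp (- (y * real n))"
        by (simp add: exp_add[symmetric] algebra_simps)
      ultimately have "(x + real n) powr (s - 1) * exp (- (y * (x + real n)))
             \<le> x powr (s - 1) * exp (- (y * (x + real n)))"
        by (intro mult_right_mono) auto
      thus "1 * f (1 * x + real n) \<le> f x * exp (- (y * real n))"
        by (simp add: f_def ex mult.assoc)
    qed
  qed
  show ?thesis
    using 1 2 3 4 by (intro exI[of _ k]) (auto simp: G_def)
qed

text \<open>The sums are the integrals of \<open>x powr (s - 1)\<close> against the piecewise constant and piecewise linear
  interpolants of \<open>exp (- y x)\<close> on \<open>[0, n]\<close>.\<close>

lemma exp_quadrature_error:
  fixes y s :: real
  assumes s: "0 < s" "s \<le> 1" and y: "0 < y" "y \<le> ln 2"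
  shows "\<bar>(\<Sum>j<n. exp (- y) ^ j * (lweight s j + rweight s j)) - Gamma s * y powr (- s)\<bar>
           \<le> Gamma s * y powr (- s) * (2 * y + exp (- y) ^ n)"
    and "\<bar>(\<Sum>j<n. exp (- y) ^ j * lweight s j + exp (- y) ^ Suc j * rweight s j) - Gamma s * y powr (- s)\<bar>
           \<le> Gamma s * y powr (- s) * (y\<^sup>2 + exp (- y) ^ n)"
proof -
  define G where "G = Gamma s * y powr (- s)"
  obtain k where k: "\<And>j. ((\<lambda>u. (real j + u) powr (s - 1) * exp (- (y * (real j + u)))) has_integral k j) {0..1}"
    and kG: "\<And>n. (\<Sum>j<n. k j) \<le> G"
    and kt: "\<And>n. G - (\<Sum>j<n. k j) \<le> G * exp (- (y * real n))"
    using exp_kernel_partial[OF s(1) y(1)] s(2) unfolding G_def by blast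
  have ej: "exp (- y) ^ j = exp (- (y * real j))" for j
    by (simp add: exp_of_nat_mult[symmetric] mult.commute)
  \<comment> \<open>An error of relative size \<open>c\<close> on every cell sums to at most
    \<open>c * G\<close>; the term \<open>exp (- y) ^ n\<close> accounts for the missing
    tail.\<close>
  have close: "\<bar>(\<Sum>j<n. q j) - G\<bar> \<le> G * (c + exp (- y) ^ n)"
    if q: "\<And>j. \<bar>q j - k j\<bar> \<le> c * k j" and c: "0 \<le> c" for q c
  proof -
    have "\<bar>(\<Sum>j<n. q j) - (\<Sum>j<n. k j)\<bar> \<le> (\<Sum>j<n. c * k j)"
      unfolding sum_subtractf[symmetric] by (rule order_trans[OF sum_abs sum_mono[OF q]])
    also have "\<dots> \<le> c * G"
      unfolding sum_distrib_left[symmetric] by (rule mult_left_mono[OF kG c])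
    finally show ?thesis
      using kG[of n] kt[of n] by (simp add: ej algebra_simps)
  qed
  \<comment> \<open>\<open>e\<close> is the exponential at the left end of the cell, and
    \<open>e * a\<close>, \<open>e * b\<close> are the values of the interpolant at its two ends.
    The pair \<open>a\<close>, \<open>b\<close> is \<open>1\<close>, \<open>1\<close> for the
    constant rule and \<open>1\<close>, \<open>exp (- y)\<close> for the linear one.\<close>
  have cell: "\<bar>e * (a * lweight s j + b * rweight s j) - k j\<bar> \<le> c * k j"
    if e: "e = exp (- (y * real j))"
    and ab: "\<And>u. 0 \<le> u \<Longrightarrow> u \<le> 1 \<Longrightarrow> \<bar>a * (1 - u) + b * u - exp (- (y * u))\<bar> \<le> c * exp (- (y * u))"
    for e a b c :: real and j
  proof -
    let ?p = "\<lambda>u. (real j + u) powr (s - 1)"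
    have "((\<lambda>u. e * (a * (?p u * (1 - u)) + b * (?p u * u)) - ?p u * exp (- (y * (real j + u))))
            has_integral (e * (a * lweight s j + b * rweight s j) - k j)) {0..1}"
      by (intro has_integral_diff has_integral_mult_right has_integral_add has_integral_lweight
            has_integral_rweight s k)
    moreover have "((\<lambda>u. c * (?p u * exp (- (y * (real j + u))))) has_integral c * k j) {0..1}"
      by (intro has_integral_mult_right k)
    moreover have "norm (e * (a * (?p u * (1 - u)) + b * (?p u * u)) - ?p u * exp (- (y * (real j + u))))
        \<le> c * (?p u * exp (- (y * (real j + u))))" if "u \<in> {0..1}" for u
    proof -
      have eu: "exp (- (y * (real j + u))) = e * exp (- (y * u))"
        by (simp add: e exp_add[symmetric] algebra_simps)
      have "e * (a * (?p u * (1 - u)) + b * (?p u * u)) - ?p u * exp (- (y * (real j + u)))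
          = (e * ?p u) * (a * (1 - u) + b * u - exp (- (y * u)))"
        unfolding eu by (simp add: algebra_simps)
      also have "norm \<dots> \<le> (e * ?p u) * (c * exp (- (y * u)))"
        unfolding real_norm_def abs_mult using ab[of u] that
        by (intro mult_mono) (auto simp: e abs_mult)
      also have "\<dots> = c * (?p u * exp (- (y * (real j + u))))"
        unfolding eu by (simp add: algebra_simps)
      finally show ?thesis .
    qed
    ultimately show ?thesis
      using integral_norm_bound_integral[of _ "{0..1}"]
      by (metis (no_types, lifting) has_integral_integrable has_integral_integrable_integral real_norm_def)
  qed
  have "\<bar>(\<Sum>j<n. exp (- y) ^ j * (1 * lweight s j + 1 * rweight s j)) - G\<bar> \<le> G * (2 * y + exp (- y) ^ n)"
    using interpolation_error_exp(1)[of y] y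
    by (intro close cell) (auto simp: ej)
  thus "\<bar>(\<Sum>j<n. exp (- y) ^ j * (lweight s j + rweight s j)) - Gamma s * y powr (- s)\<bar>
           \<le> Gamma s * y powr (- s) * (2 * y + exp (- y) ^ n)"
    by (simp add: G_def)
  have "\<bar>(\<Sum>j<n. exp (- y) ^ j * (1 * lweight s j + exp (- y) * rweight s j)) - G\<bar> \<le> G * (y\<^sup>2 + exp (- y) ^ n)"
    using interpolation_error_exp(2)[of y] y
    by (intro close cell) (auto simp: ej mult.commute)
  thus "\<bar>(\<Sum>j<n. exp (- y) ^ j * lweight s j + exp (- y) ^ Suc j * rweight s j) - Gamma s * y powr (- s)\<bar>
           \<le> Gamma s * y powr (- s) * (y\<^sup>2 + exp (- y) ^ n)"
    by (simp add: G_def algebra_simps)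
qed

text \<open>The prescribed weights are regrouped by cells. Up to \<open>r = 2 - 2 * s\<close> they
  integrate the interpolant that is constant on each cell with the value at the left node, beyond it
  the piecewise linear one. For \<open>2 - 2 * s < r < 2\<close> the first cell carries the constant
  \<open>\<rho> 1\<close> instead, which moves the weight
  \<open>lweight s 0 = 1 / (s * (1 + s))\<close> from node 0 to node 1.\<close>

lemma quadrature_as_cell_sum:
  assumes s: "0 < s" and NT: "2 \<le> NT"
  shows "r \<le> 2 - 2 * s \<Longrightarrow> quadrature s r dt NT \<rho> =
      dt powr s / Gamma s * (\<Sum>j<NT. \<rho> j * (lweight s j + rweight s j))"
    and "2 - 2 * s < r \<Longrightarrow> quadrature s r dt NT \<rho> =
      dt powr s / Gamma s * ((\<Sum>j<NT. \<rho> j * lweight s j + \<rho> (Suc j) * rweight s j)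
        - (if r < 2 then (\<rho> 0 - \<rho> 1) / (s * (1 + s)) else 0))"
proof -
  have split: "{..NT} = insert NT {..<NT}" by auto
  have "(\<Sum>j\<le>NT. \<rho> j * quad_weight s r dt NT j)
      = dt powr s * (\<Sum>j<NT. \<rho> j * (lweight s j + rweight s j))" if "r \<le> 2 - 2 * s"
    using that unfolding split sum_distrib_left
    by (auto simp: quad_weight_def lweight_def rweight_def diff_divide_distrib[symmetric] add.commute
        intro!: sum.cong)
  thus "r \<le> 2 - 2 * s \<Longrightarrow> quadrature s r dt NT \<rho> =
      dt powr s / Gamma s * (\<Sum>j<NT. \<rho> j * (lweight s j + rweight s j))"
    by (simp add: quadrature_def)
  obtain M where M: "NT = Suc (Suc M)"
    using NT by (metis Suc_le_D numeral_2_eq_2 Suc_le_mono)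
  have cells: "(\<Sum>j<NT. \<rho> j * lweight s j + \<rho> (Suc j) * rweight s j)
      = \<rho> 0 * lweight s 0 + (\<Sum>j\<in>{1..<NT}. \<rho> j * (lweight s j + rweight s (j - 1)))
        + \<rho> NT * rweight s (NT - 1)"
  proof -
    have "(\<Sum>j<NT. \<rho> j * lweight s j) = \<rho> 0 * lweight s 0 + (\<Sum>j\<in>{1..<NT}. \<rho> j * lweight s j)"
      using NT by (simp add: lessThan_atLeast0 sum.atLeast_Suc_lessThan)
    moreover have "(\<Sum>j<NT. \<rho> (Suc j) * rweight s j) = (\<Sum>j\<in>{1..<NT}. \<rho> j * rweight s (j - 1)) + \<rho> NT * rweight s (NT - 1)"
      unfolding M lessThan_atLeast0 sum.atLeast_Suc_lessThan_Suc_shift One_nat_def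
      by (simp add: sum.atLeastLessThan_Suc)
    ultimately show ?thesis
      by (simp add: sum.distrib algebra_simps)
  qed
  let ?d = "\<lambda>j. s * (1 + s) * (lweight s j + rweight s (j - 1))"
  have lw: "s * (1 + s) * lweight s j = (real j + 1) powr (1 + s) - real j powr (1 + s) - (1 + s) * real j powr s" for j
    using s unfolding lweight_def by (subst right_diff_distrib) simp
  have rw: "s * (1 + s) * rweight s j = (1 + s) * (real j + 1) powr s - ((real j + 1) powr (1 + s) - real j powr (1 + s))" for j
    using s unfolding rweight_def by (subst right_diff_distrib) simp
  have w: "?d j = second_diff s j" if "1 \<le> j" for j
    unfolding distrib_left[of "s * (1 + s)"] lw rw using that by (simp add: second_diff_def of_nat_diff)
  have wN: "s * (1 + s) * rweight s (NT - 1) = last_b s NT"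
    using NT by (simp add: rw last_b_def of_nat_diff)
  have w0: "s * (1 + s) * lweight s 0 = 1"
    using s by (simp add: lweight_def)
  have nodes: "{..NT} = insert 0 (insert NT {1..<NT})"
    using NT by auto
  have "(\<Sum>j\<le>NT. \<rho> j * quad_weight s r dt NT j)
      = dt powr s / (s * (1 + s)) * (s * (1 + s) * (\<rho> 0 * lweight s 0 + (\<Sum>j\<in>{1..<NT}. \<rho> j * (lweight s j + rweight s (j - 1)))
        + \<rho> NT * rweight s (NT - 1)) - (if r < 2 then \<rho> 0 - \<rho> 1 else 0))" if r: "2 - 2 * s < r"
  proof -
    have q1: "quad_weight s r dt NT j = dt powr s / (s * (1 + s)) * (?d j + (if r < 2 \<and> j = 1 then 1 else 0))"
      if "j \<in> {1..<NT}" for j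
    proof -
      \<comment> \<open>The last summand of \<open>second_diff s 1\<close> is
        \<open>0 powr (1 + s) = 0\<close>.\<close>
      have "2 powr (1 + s) - 1 = second_diff s 1 + 1"
        by (simp add: second_diff_def)
      thus ?thesis
        using r that w[of j] by (auto simp: quad_weight_def)
    qed
    have "(\<Sum>j\<in>{1..<NT}. \<rho> j * quad_weight s r dt NT j)
        = (\<Sum>j\<in>{1..<NT}. dt powr s / (s * (1 + s)) * (s * (1 + s) * (\<rho> j * (lweight s j + rweight s (j - 1)))
            + (if 1 = j then (if r < 2 then \<rho> j else 0) else 0)))"
      by (rule sum.cong) (auto simp: q1 algebra_simps)
    also have "\<dots> = dt powr s / (s * (1 + s)) * (s * (1 + s) * (\<Sum>j\<in>{1..<NT}. \<rho> j * (lweight s j + rweight s (j - 1)))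
            + (if r < 2 then \<rho> 1 else 0))"
      using NT unfolding sum_distrib_left[symmetric] sum.distrib by (subst sum.delta') auto
    finally have mid: "(\<Sum>j\<in>{1..<NT}. \<rho> j * quad_weight s r dt NT j) = \<dots>" .
    have q0: "quad_weight s r dt NT 0 = dt powr s / (s * (1 + s)) * (s * (1 + s) * lweight s 0 - (if r < 2 then 1 else 0))"
      using r NT by (simp add: quad_weight_def w0)
    \<comment> \<open>\<open>2 \<le> NT\<close> keeps the last node apart from node 1, which has a
      weight of its own for \<open>r < 2\<close>.\<close>
    have qN: "quad_weight s r dt NT NT = dt powr s / (s * (1 + s)) * (s * (1 + s) * rweight s (NT - 1))"
      unfolding wN using r NT by (simp add: quad_weight_def)
    have "(\<Sum>j\<le>NT. \<rho> j * quad_weight s r dt NT j) = \<rho> 0 * quad_weight s r dt NT 0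
        + \<rho> NT * quad_weight s r dt NT NT + (\<Sum>j\<in>{1..<NT}. \<rho> j * quad_weight s r dt NT j)"
      unfolding nodes using NT by (subst sum.insert; (subst sum.insert)?; auto)
    moreover have "\<rho>0 * (K * (v * l - (if r < 2 then 1 else 0))) + \<rho>N * (K * (v * w)) + K * (v * m + (if r < 2 then \<rho>1 else 0))
        = K * (v * (\<rho>0 * l + m + \<rho>N * w) - (if r < 2 then \<rho>0 - \<rho>1 else 0))"
      for \<rho>0 \<rho>1 \<rho>N K v l w m :: real
      by (auto simp: algebra_simps)
    ultimately show ?thesis
      unfolding mid q0 qN by (simp only:)
  qed
  moreover have "1 / \<Gamma> * (d / v * (v * x - (if r < 2 then y else 0))) = d / \<Gamma> * (x - (if r < 2 then y / v else 0))"
    if "v \<noteq> 0" for \<Gamma> d v x y :: real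
    using that by (simp add: right_diff_distrib)
  moreover have "s * (1 + s) \<noteq> 0"
    using s by simp
  ultimately show "2 - 2 * s < r \<Longrightarrow> quadrature s r dt NT \<rho> =
      dt powr s / Gamma s * ((\<Sum>j<NT. \<rho> j * lweight s j + \<rho> (Suc j) * rweight s j)
        - (if r < 2 then (\<rho> 0 - \<rho> 1) / (s * (1 + s)) else 0))"
    unfolding cells quadrature_def by simp
qed

section \<open>The quadrature error in one mode\<close>

text \<open>The expression is odd in \<open>x\<close>, so there is no quadratic term; its derivative
  at \<xi> is \<open>2 * \<xi>\<^sup>2 / (1 - \<xi>\<^sup>2)\<close>. With \<open>x = z / 2\<close>
  it is the consistency error of the Crank-Nicolson factor.\<close>

lemma ln_quotient_cubic:
  fixes x :: real
  assumes "0 \<le> x" "x \<le> 1/2"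
  shows "\<bar>ln (1 + x) - ln (1 - x) - 2 * x\<bar> \<le> 4 * x ^ 3"
proof (cases "x = 0")
  case False
  define g where "g = (\<lambda>x::real. ln (1 + x) - ln (1 - x) - 2 * x)"
  have "\<exists>\<xi>. 0 < \<xi> \<and> \<xi> < x \<and> g x - g 0 = (x - 0) * (1 / (1 + \<xi>) + 1 / (1 - \<xi>) - 2)"
    by (rule MVT2) (use assms False in \<open>auto simp: g_def intro!: derivative_eq_intros\<close>)
  then obtain \<xi> where \<xi>: "0 < \<xi>" "\<xi> < x" and g: "g x = x * (1 / (1 + \<xi>) + 1 / (1 - \<xi>) - 2)"
    by (auto simp: g_def)
  have sq: "\<xi>\<^sup>2 \<le> x\<^sup>2" "\<xi>\<^sup>2 \<le> (1/2)\<^sup>2"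
    using \<xi> assms by (auto intro!: power_mono)
  have "1 / (1 + \<xi>) + 1 / (1 - \<xi>) - 2 = 2 * \<xi>\<^sup>2 / (1 - \<xi>\<^sup>2)"
    using \<xi> assms sq by (simp add: field_simps power2_eq_square)
  moreover have "2 * \<xi>\<^sup>2 / (1 - \<xi>\<^sup>2) \<le> 4 * x\<^sup>2"
  proof -
    have "2 * \<xi>\<^sup>2 / (1 - \<xi>\<^sup>2) \<le> 2 * x\<^sup>2 / (1 / 2)"
      by (rule frac_le) (use sq in \<open>auto simp: power2_eq_square\<close>)
    thus ?thesis by simp
  qed
  moreover have "0 \<le> 2 * \<xi>\<^sup>2 / (1 - \<xi>\<^sup>2)"
    using sq by (intro divide_nonneg_nonneg) (auto simp: power2_eq_square)
  ultimately have "\<bar>1 / (1 + \<xi>) + 1 / (1 - \<xi>) - 2\<bar> \<le> 4 * x\<^sup>2"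
    by (simp only: abs_of_nonneg)
  hence "\<bar>g x\<bar> \<le> x * (4 * x\<^sup>2)"
    unfolding g using assms by (subst abs_mult, intro mult_mono) auto
  thus ?thesis
    by (simp add: g_def power2_eq_square power3_eq_cube)
qed simp

text \<open>All points between \<open>y\<close> and \<open>z\<close> are at least
  \<open>z / 2\<close>. There the derivative of \<open>x powr (- s)\<close> is at most
  \<open>2 powr (s + 1) * z powr (- s - 1)\<close> in absolute value, and 4 bounds the first
  factor.\<close>

lemma powr_minus_diff_le:
  fixes y z s :: real
  assumes z: "0 < z" and y: "z / 2 \<le> y" and s: "0 \<le> s" "s \<le> 1"
  shows "\<bar>y powr (- s) - z powr (- s)\<bar> \<le> 4 * z powr (- s - 1) * \<bar>y - z\<bar>"
proof -
  have *: "\<bar>b powr (- s) - a powr (- s)\<bar> \<le> 4 * z powr (- s - 1) * \<bar>b - a\<bar>"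
    if ab: "z / 2 \<le> a" "a < b" for a b
  proof -
    have "\<exists>\<xi>. a < \<xi> \<and> \<xi> < b \<and> b powr (- s) - a powr (- s) = (b - a) * (- s * \<xi> powr (- s - 1))"
      using ab z by (intro MVT2) (auto intro!: derivative_eq_intros)
    then obtain \<xi> where \<xi>: "a < \<xi>" "\<xi> < b"
      and eq: "b powr (- s) - a powr (- s) = (b - a) * (- s * \<xi> powr (- s - 1))" by blast
    have "s * \<xi> powr (- s - 1) \<le> 1 * (z / 2) powr (- s - 1)"
      using \<xi> ab z s by (intro mult_mono powr_mono2') auto
    also have "(z / 2) powr (- s - 1) = z powr (- s - 1) * 2 powr (s + 1)"
    proof -
      have "- s - 1 = - (s + 1)" by simp
      hence 2: "2 powr (- s - 1) = inverse (2 powr (s + 1) :: real)"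
        by (simp only: powr_minus)
      have "(z / 2) powr (- s - 1) = z powr (- s - 1) / 2 powr (- s - 1)"
        by (rule powr_divide)
      thus ?thesis
        unfolding 2 by (simp only: divide_inverse inverse_inverse_eq)
    qed
    also have "2 powr (s + 1) \<le> 2 powr 2"
      using s by (intro powr_mono) auto
    finally have "s * \<xi> powr (- s - 1) \<le> 4 * z powr (- s - 1)"
      using z by (simp add: mult_left_mono)
    thus ?thesis
      unfolding eq using ab s by (auto simp: abs_mult mult.commute intro!: mult_mono)
  qed
  consider "y < z" | "y = z" | "z < y" by linarith
  thus ?thesis
  proof cases
    case 1 thus ?thesis using *[of y z] y by (simp add: abs_minus_commute)
  next
    case 3 thus ?thesis using *[of z y] z by simp
  qed simp
qed

section \<open>The amplification factor of the theta scheme: stability, damping and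
  consistency\<close>

definition amplification :: "real \<Rightarrow> real \<Rightarrow> real" where
  "amplification \<theta> z = (1 - (1 - \<theta>) * z) / (1 + \<theta> * z)"

lemma amplification_alt:
  assumes "0 \<le> \<theta>" "0 \<le> z"
  shows "amplification \<theta> z = 1 - z / (1 + \<theta> * z)"
proof -
  have "0 < 1 + \<theta> * z"
    using assms by (simp add: add_pos_nonneg)
  thus ?thesis
    by (simp add: amplification_def field_simps)
qed

text \<open>A-stability: \<open>z / (1 + \<theta> * z)\<close> stays below
  \<open>1 / \<theta>\<close>, hence below 2.\<close>

lemma amplification_ge_minus_1:
  assumes "1/2 \<le> \<theta>" "0 \<le> z"
  shows "-1 \<le> amplification \<theta> z"
proof -
  have "z / (1 + \<theta> * z) \<le> 2"
    using assms mult_right_mono[of "1/2" \<theta> z] by (subst divide_le_eq) (auto simp: algebra_simps)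
  thus ?thesis
    using assms by (simp add: amplification_alt)
qed

text \<open>The factor decreases in \<open>z\<close> and increases in \<theta>. The extreme case is
  \<open>\<theta> = 1\<close>, \<open>z = 1/2\<close>, where 2/3 is attained.\<close>

lemma amplification_large:
  assumes "0 \<le> \<theta>" "\<theta> \<le> 1" "1/2 \<le> z"
  shows "amplification \<theta> z \<le> 2/3"
proof -
  have "0 \<le> \<theta> * z" "\<theta> * z \<le> 1 * z"
    using assms by (auto intro: mult_right_mono)
  moreover have "1 / 3 * (1 + p) \<le> z" if "p \<le> 1 * z" for p
    using assms(3) that by simp
  ultimately have "1 / 3 \<le> z / (1 + \<theta> * z)"
    by (subst pos_le_divide_eq) (auto intro: add_pos_nonneg)
  thus ?thesis
    using assms by (simp add: amplification_alt)
qed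

text \<open>With \<open>R\<close> for the factor, \<open>- ln R\<close> lies between
  \<open>1 - R\<close> and \<open>1 / R - 1\<close>, and both are \<open>z\<close> up to a quadratic
  error, which is first-order consistency for every \<theta>. For \<open>\<theta> = 1/2\<close> it
  equals \<open>ln (1 + z / 2) - ln (1 - z / 2)\<close>, with a cubic error. The lower bound
  \<open>z / (1 + z)\<close> is \<open>1 - R\<close> for backward Euler, where \<open>R\<close> is
  largest.\<close>

lemma amplification_small:
  assumes \<theta>: "0 \<le> \<theta>" "\<theta> \<le> 1" and z: "0 < z" "z \<le> 1/2"
  defines "y \<equiv> - ln (amplification \<theta> z)"
  shows "1/2 \<le> amplification \<theta> z" "amplification \<theta> z = exp (- y)" "z / (1 + z) \<le> y" "z / 2 \<le> y" "y \<le> 2 * z" "y \<le> ln 2"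
    "\<bar>y - z\<bar> \<le> 2 * z\<^sup>2" "\<theta> = 1/2 \<Longrightarrow> \<bar>y - z\<bar> \<le> z ^ 3"
proof -
  define R where "R = amplification \<theta> z"
  have "\<theta> * z \<le> 1 * z" "(1 - \<theta>) * z \<le> 1 * z"
    using \<theta> z by (intro mult_right_mono; simp)+
  moreover have "0 \<le> \<theta> * z" "0 \<le> (1 - \<theta>) * z"
    using \<theta> z by auto
  ultimately have \<theta>z: "0 \<le> \<theta> * z" "\<theta> * z \<le> z" "0 \<le> (1 - \<theta>) * z" "(1 - \<theta>) * z \<le> 1/2"
    using z by linarith+
  have R1: "1 - R = z / (1 + \<theta> * z)"
    using \<theta> z by (simp add: R_def amplification_alt)
  have w: "z / (1 + z) \<le> 1 - R" "1 - R \<le> z"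
  proof -
    show "z / (1 + z) \<le> 1 - R"
      unfolding R1 using \<theta>z z by (intro divide_left_mono mult_pos_pos) linarith+
    have "z / (1 + \<theta> * z) \<le> z / 1"
      using \<theta>z z by (intro divide_left_mono mult_pos_pos) linarith+
    thus "1 - R \<le> z"
      by (simp add: R1)
  qed
  show R: "1/2 \<le> amplification \<theta> z"
    using w z by (simp add: R_def)
  show "amplification \<theta> z = exp (- y)"
    using R by (simp add: y_def)
  have y: "1 - R \<le> y"
    using ln_le_minus_one[of R] R by (simp add: y_def R_def)
  have "y = ln (1 / R)"
    using R by (simp add: y_def R_def ln_div)
  also have "\<dots> \<le> 1 / R - 1"
    using R by (intro ln_le_minus_one) (simp add: R_def)
  also have "1 / R - 1 = z / (1 - (1 - \<theta>) * z)"
  proof -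
    have "1 + \<theta> * z \<noteq> 0" "1 - (1 - \<theta>) * z \<noteq> 0" using \<theta>z by linarith+
    thus ?thesis unfolding R_def amplification_def by (simp add: field_simps)
  qed
  finally have yu: "y \<le> z / (1 - (1 - \<theta>) * z)" .
  also have "\<dots> \<le> z / (1 / 2)"
    using \<theta>z z by (intro divide_left_mono) auto
  finally show "y \<le> 2 * z" by simp
  show "z / (1 + z) \<le> y" using w y by linarith
  have "z / 2 \<le> z / (1 + z)"
    using z by (intro divide_left_mono) auto
  thus "z / 2 \<le> y" using w y by linarith
  have "ln (1/2) \<le> ln R"
    using R by (subst ln_le_cancel_iff) (auto simp: R_def)
  thus "y \<le> ln 2"
    by (simp add: y_def R_def ln_div)
  have "z - z\<^sup>2 \<le> z / (1 + z)"
    using z by (simp add: le_divide_eq algebra_simps power2_eq_square)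
  moreover have "z / (1 - (1 - \<theta>) * z) \<le> z + 2 * z\<^sup>2"
  proof -
    have "0 \<le> z\<^sup>2 * (1 - 2 * ((1 - \<theta>) * z))" "z\<^sup>2 \<ge> z * ((1 - \<theta>) * z)"
      using \<theta>z z \<theta> by (auto simp: power2_eq_square intro!: mult_left_mono mult_right_le_one_le mult_left_le_one_le)
    hence "z \<le> (z + 2 * z\<^sup>2) * (1 - (1 - \<theta>) * z)"
      by (simp add: algebra_simps)
    thus ?thesis
      using \<theta>z by (subst divide_le_eq) auto
  qed
  ultimately show "\<bar>y - z\<bar> \<le> 2 * z\<^sup>2"
    using w y yu by (intro abs_leI) (auto intro: order_trans[OF _ add_mono])
  show "\<bar>y - z\<bar> \<le> z ^ 3" if "\<theta> = 1/2"
  proof -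
    have "y = ln (1 + z / 2) - ln (1 - z / 2)"
      using z unfolding y_def amplification_def that by (subst ln_div) auto
    hence "\<bar>y - z\<bar> \<le> 4 * (z / 2) ^ 3"
      using ln_quotient_cubic[of "z / 2"] z by simp
    also have "\<dots> \<le> z ^ 3"
      using z by (simp add: power3_eq_cube)
    finally show ?thesis .
  qed
qed

text \<open>For small \<open>z = dt \<mu>\<close> the iterates of the scheme are the exponentials \<open>exp (- y j)\<close> with
  \<open>y = - ln R\<close>, where \<open>y - z\<close> has the order of consistency; for large \<open>z\<close> the possibly alternating sum
  is bounded by summation by parts.\<close>

lemma quadrature_mode_error:
  assumes s: "0 < s" "s < 1" and r: "0 \<le> r" "r \<le> 4 - 2 * s"
    and \<theta>: "0 \<le> \<theta>" "\<theta> \<le> 1" "2 - 2 * s \<le> r \<Longrightarrow> \<theta> = 1/2"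
  shows "\<exists>C>0. \<forall>NT dt \<mu>. 2 \<le> NT \<and> 0 < dt \<and> 0 < \<mu> \<and> -1 \<le> amplification \<theta> (dt * \<mu>) \<longrightarrow>
     \<bar>quadrature s r dt NT (\<lambda>j. amplification \<theta> (dt * \<mu>) ^ j) - \<mu> powr (- s)\<bar>
     \<le> C * dt powr s * min 1 (dt * \<mu>) powr (r / 2)
       + (if dt * \<mu> \<le> 1/2 then C * \<mu> powr (- s) * amplification \<theta> (dt * \<mu>) ^ NT else 0)"
proof -
  define \<Gamma> where "\<Gamma> = Gamma s"
  have \<Gamma>: "0 < \<Gamma>" using s by (simp add: \<Gamma>_def Gamma_real_pos)
  define w where "w = lweight s 0 + rweight s 0"
  have w: "0 \<le> lweight s 0" "0 \<le> rweight s 0" "0 \<le> w"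
    using weights_nonneg[OF s(1)] by (auto simp: w_def)
  define v where "v = 1 / (s * (1 + s))"
  have v: "0 < v" using s by (simp add: v_def)
  \<comment> \<open>\<open>C1\<close> serves large \<open>z\<close>: summation by parts gives
    \<open>6 * w\<close>, the correction of the first cell \<open>2 * v\<close>, and
    \<open>\<mu> powr (- s)\<close> itself the final 2. It enters \<open>C\<close> four times,
    because \<open>min 1 z powr \<sigma>\<close> is only known to be at least 1/4 there.
    \<open>C2\<close> serves small \<open>z\<close>.\<close>
  define C1 where "C1 = (6 * w + 2 * v) / \<Gamma> + 2"
  define C2 where "C2 = 8 + 8 + 16 + 2 * v / \<Gamma>"
  define C where "C = 4 * C1 + C2"
  have C12: "0 < C1" "0 < C2" "C1 * 4 \<le> C" "C2 \<le> C" "2 \<le> C"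
    using w v \<Gamma> by (auto simp: C1_def C2_def C_def add_nonneg_pos add_pos_nonneg divide_nonneg_pos)
  define \<sigma> where "\<sigma> = r / 2"
  have \<sigma>: "0 \<le> \<sigma>" "\<sigma> \<le> 2" using r s by (auto simp: \<sigma>_def)
  have "\<bar>quadrature s r dt NT (\<lambda>j. R ^ j) - \<mu> powr (- s)\<bar>
     \<le> C * dt powr s * min 1 (dt * \<mu>) powr \<sigma> + (if dt * \<mu> \<le> 1/2 then C * \<mu> powr (- s) * R ^ NT else 0)"
    if NT: "2 \<le> NT" and dt: "0 < dt" and \<mu>: "0 < \<mu>" and R1: "-1 \<le> R" and R: "R = amplification \<theta> (dt * \<mu>)"
    for NT dt \<mu> R
  proof -
    define z where "z = dt * \<mu>"
    have z: "0 < z" using dt \<mu> by (simp add: z_def)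
    have \<mu>z: "\<mu> powr (- s) = dt powr s * z powr (- s)"
      using dt \<mu> by (simp add: z_def powr_mult powr_minus)
    have dts: "0 < dt powr s" using dt by simp
    show ?thesis
    proof (cases "z \<le> 1/2")
      case False
      have R2: "R \<le> 2/3"
        using False amplification_large[OF \<theta>(1,2)] by (simp add: R z_def)
      have Rj: "\<bar>R ^ j\<bar> \<le> 1" for j
        using R1 R2 by (simp add: power_abs power_le_one)
      have L: "\<bar>\<Sum>j<NT. R ^ j * lweight s j\<bar> \<le> 6 * lweight s 0"
          "\<bar>\<Sum>j<NT. R ^ j * rweight s j\<bar> \<le> 6 * rweight s 0"
        using weights_decreasing weights_nonneg s R1 R2 by (auto intro!: abs_sum_powers_decreasing_le)
      have "\<bar>quadrature s r dt NT (\<lambda>j. R ^ j)\<bar> \<le> dt powr s / \<Gamma> * (6 * w + 2 * v)"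
      proof (cases "r \<le> 2 - 2 * s")
        case True
        have "\<bar>\<Sum>j<NT. R ^ j * (lweight s j + rweight s j)\<bar> \<le> 6 * w + 2 * v"
          using L v by (simp add: distrib_left sum.distrib w_def)
        thus ?thesis
          unfolding quadrature_as_cell_sum(1)[OF s(1) NT True] abs_mult using dts \<Gamma>
          by (intro mult_mono) (auto simp: \<Gamma>_def)
      next
        case False
        have sums: "(\<Sum>j<NT. R ^ j * lweight s j + R ^ Suc j * rweight s j)
              = (\<Sum>j<NT. R ^ j * lweight s j) + R * (\<Sum>j<NT. R ^ j * rweight s j)"
          by (simp add: sum.distrib sum_distrib_left mult.assoc)
        have Rr: "\<bar>R * (\<Sum>j<NT. R ^ j * rweight s j)\<bar> \<le> 1 * (6 * rweight s 0)"
          unfolding abs_mult using Rj[of 1] L by (intro mult_mono) auto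
        have "(R ^ 0 - R ^ 1) / (s * (1 + s)) = (1 - R) * v"
          by (simp add: v_def)
        moreover have "\<bar>(1 - R) * v\<bar> \<le> 2 * v"
          unfolding abs_mult using R1 R2 v by (intro mult_mono) auto
        ultimately have "\<bar>if r < 2 then (R ^ 0 - R ^ 1) / (s * (1 + s)) else 0\<bar> \<le> 2 * v"
          using v by (simp only: split: if_split) simp
        hence "\<bar>(\<Sum>j<NT. R ^ j * lweight s j + R ^ Suc j * rweight s j)
              - (if r < 2 then (R ^ 0 - R ^ 1) / (s * (1 + s)) else 0)\<bar> \<le> 6 * w + 2 * v"
          unfolding sums w_def distrib_left by (intro order_trans[OF abs_triangle_ineq4] add_mono order_trans[OF abs_triangle_ineq] L(1) Rr[simplified])
        moreover have "2 - 2 * s < r" using False by simp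
        ultimately show ?thesis
          unfolding quadrature_as_cell_sum(2)[OF s(1) NT \<open>2 - 2 * s < r\<close>] abs_mult using dts \<Gamma>
          by (intro mult_mono) (auto simp: \<Gamma>_def)
      qed
      moreover have "\<bar>\<mu> powr (- s)\<bar> \<le> dt powr s * 2"
      proof -
        have "z powr (- s) \<le> (1/2) powr (- s)"
          using False s by (intro powr_mono2') auto
        also have "\<dots> = 2 powr s" by (simp add: powr_minus powr_divide)
        also have "\<dots> \<le> 2 powr 1" using s by (intro powr_mono) auto
        finally show ?thesis unfolding \<mu>z using dts by simp
      qed
      ultimately have "\<bar>quadrature s r dt NT (\<lambda>j. R ^ j) - \<mu> powr (- s)\<bar>
          \<le> dt powr s / \<Gamma> * (6 * w + 2 * v) + dt powr s * 2"
        by (intro order_trans[OF abs_triangle_ineq4] add_mono)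
      also have "\<dots> = C1 * dt powr s"
        by (simp add: C1_def algebra_simps add_divide_distrib)
      finally have "\<bar>quadrature s r dt NT (\<lambda>j. R ^ j) - \<mu> powr (- s)\<bar> \<le> C1 * dt powr s" .
      also have "\<dots> \<le> (C * (1/4)) * dt powr s"
        using C12 dts by (intro mult_right_mono) auto
      also have "\<dots> \<le> (C * min 1 z powr \<sigma>) * dt powr s"
      proof (intro mult_right_mono mult_left_mono)
        have "1/4 = (1/2::real) powr 2" by (simp add: power2_eq_square)
        also have "\<dots> \<le> (1/2) powr \<sigma>" using \<sigma> by (intro powr_mono') auto
        also have "\<dots> \<le> min 1 z powr \<sigma>" using False \<sigma> by (intro powr_mono2) auto
        finally show "1/4 \<le> min 1 z powr \<sigma>" .
      qed (use C12 dts in auto)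
      finally show ?thesis
        using False by (simp add: z_def mult_ac)
    next
      case True
      define y where "y = - ln R"
      have Rs: "1/2 \<le> R" "R = exp (- y)" "z / 2 \<le> y" "y \<le> 2 * z" "y \<le> ln 2" "\<bar>y - z\<bar> \<le> 2 * z\<^sup>2"
        "\<theta> = 1/2 \<Longrightarrow> \<bar>y - z\<bar> \<le> z ^ 3"
        using amplification_small[OF \<theta>(1,2) z True] by (simp_all add: R z_def y_def)
      have y: "0 < y" using Rs z by linarith
      have ys: "y powr (- s) \<le> 2 * z powr (- s)"
      proof -
        have "y powr (- s) \<le> (z / 2) powr (- s)"
          using Rs s z by (intro powr_mono2') auto
        also have "\<dots> = 2 powr s * z powr (- s)" using z by (simp add: powr_divide powr_minus field_simps)
        also have "\<dots> \<le> 2 powr 1 * z powr (- s)" using s by (intro mult_right_mono powr_mono) auto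
        finally show ?thesis by simp
      qed
      have zz: "z powr (- s) * z = z powr (1 - s)" "z powr (- s) * z\<^sup>2 = z powr (2 - s)"
        "z powr (- s - 1) * z\<^sup>2 = z powr (1 - s)" "z powr (- s - 1) * z ^ 3 = z powr (2 - s)"
      proof -
        have "z powr 1 = z" "z powr 2 = z\<^sup>2" "z powr 3 = z ^ 3"
          using z by (simp_all add: powr_numeral)
        moreover have "z powr (- s) * z powr 1 = z powr (- s + 1)" "z powr (- s) * z powr 2 = z powr (- s + 2)"
          "z powr (- s - 1) * z powr 2 = z powr (- s - 1 + 2)" "z powr (- s - 1) * z powr 3 = z powr (- s - 1 + 3)"
          by (simp_all only: powr_add)
        ultimately show "z powr (- s) * z = z powr (1 - s)" "z powr (- s) * z\<^sup>2 = z powr (2 - s)"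
          "z powr (- s - 1) * z\<^sup>2 = z powr (1 - s)" "z powr (- s - 1) * z ^ 3 = z powr (2 - s)"
          by simp_all
      qed
      define e where "e = R ^ NT"
      have e: "0 \<le> e" using Rs by (simp add: e_def)
      define S where "S = quadrature s r dt NT (\<lambda>j. R ^ j)"
      have "\<bar>S / dt powr s - z powr (- s)\<bar> \<le> C2 * z powr \<sigma> + 2 * z powr (- s) * e"
      proof (cases "r \<le> 2 - 2 * s")
        case r: True
        define Q where "Q = (\<Sum>j<NT. R ^ j * (lweight s j + rweight s j))"
        have S: "S = dt powr s / \<Gamma> * Q"
          unfolding S_def Q_def \<Gamma>_def by (rule quadrature_as_cell_sum(1)[OF s(1) NT r])
        have "\<bar>Q - \<Gamma> * y powr (- s)\<bar> \<le> \<Gamma> * (y powr (- s) * (2 * y + e))"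
          using exp_quadrature_error(1)[OF s(1) _ y Rs(5), of NT] s
          unfolding Q_def \<Gamma>_def e_def Rs(2)[symmetric] by (simp add: mult.assoc)
        hence "\<bar>Q / \<Gamma> - y powr (- s)\<bar> \<le> y powr (- s) * (2 * y + e)"
          using \<Gamma> by (simp add: abs_le_iff field_simps)
        also have "\<dots> \<le> 2 * z powr (- s) * (4 * z + e)"
          using ys Rs z y e by (intro mult_mono) auto
        also have "\<dots> = 8 * z powr (1 - s) + 2 * z powr (- s) * e"
          by (simp add: algebra_simps zz(1)[symmetric])
        finally have a: "\<bar>Q / \<Gamma> - y powr (- s)\<bar> \<le> 8 * z powr (1 - s) + 2 * z powr (- s) * e" .
        have "\<bar>y powr (- s) - z powr (- s)\<bar> \<le> 4 * z powr (- s - 1) * (2 * z\<^sup>2)"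
          by (intro order_trans[OF powr_minus_diff_le[OF z Rs(3)]] mult_left_mono Rs(6)) (use s in auto)
        also have "\<dots> = 8 * z powr (1 - s)" using zz(3) by simp
        finally have "\<bar>Q / \<Gamma> - z powr (- s)\<bar> \<le> 16 * z powr (1 - s) + 2 * z powr (- s) * e"
          using a by linarith
        \<comment> \<open>Here \<open>r \<le> 2 - 2 * s\<close> means \<sigma> \<le> 1 - s, so first
          order in both rule and scheme is enough.\<close>
        also have "z powr (1 - s) \<le> z powr \<sigma>"
          using r True z by (intro powr_mono') (auto simp: \<sigma>_def)
        finally have "\<bar>Q / \<Gamma> - z powr (- s)\<bar> \<le> 16 * z powr \<sigma> + 2 * z powr (- s) * e" by simp
        moreover have "16 * z powr \<sigma> \<le> C2 * z powr \<sigma>"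
          using v \<Gamma> by (intro mult_right_mono) (auto simp: C2_def)
        ultimately show ?thesis
          using dts by (simp add: S)
      next
        case r: False
        hence th: "\<theta> = 1/2" using \<theta> by simp
        define Q where "Q = (\<Sum>j<NT. R ^ j * lweight s j + R ^ Suc j * rweight s j)"
        define d where "d = (if r < 2 then (R ^ 0 - R ^ 1) / (s * (1 + s)) else 0)"
        have S: "S = dt powr s / \<Gamma> * (Q - d)"
          unfolding S_def Q_def \<Gamma>_def d_def
          using quadrature_as_cell_sum(2)[OF s(1) NT, of r dt "\<lambda>j. R ^ j"] r by simp
        have "\<bar>Q - \<Gamma> * y powr (- s)\<bar> \<le> \<Gamma> * (y powr (- s) * (y\<^sup>2 + e))"
          using exp_quadrature_error(2)[OF s(1) _ y Rs(5), of NT] s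
          unfolding Q_def \<Gamma>_def e_def Rs(2)[symmetric] by (simp add: mult.assoc)
        hence "\<bar>Q / \<Gamma> - y powr (- s)\<bar> \<le> y powr (- s) * (y\<^sup>2 + e)"
          using \<Gamma> by (simp add: abs_le_iff field_simps)
        also have "\<dots> \<le> 2 * z powr (- s) * ((2 * z)\<^sup>2 + e)"
          using ys Rs z y e by (intro mult_mono add_mono power_mono) auto
        also have "\<dots> = 8 * z powr (2 - s) + 2 * z powr (- s) * e"
          by (simp add: algebra_simps power_mult_distrib zz(2)[symmetric])
        finally have a: "\<bar>Q / \<Gamma> - y powr (- s)\<bar> \<le> 8 * z powr (2 - s) + 2 * z powr (- s) * e" .
        have "\<bar>y powr (- s) - z powr (- s)\<bar> \<le> 4 * z powr (- s - 1) * z ^ 3"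
          by (intro order_trans[OF powr_minus_diff_le[OF z Rs(3)]] mult_left_mono Rs(7)[OF th]) (use s in auto)
        also have "\<dots> = 4 * z powr (2 - s)" using zz(4) by simp
        finally have "\<bar>Q / \<Gamma> - z powr (- s)\<bar> \<le> 12 * z powr (2 - s) + 2 * z powr (- s) * e"
          using a by linarith
        \<comment> \<open>Second order reaches all \<sigma> \<le> 2 - s, that is,
          \<open>r \<le> 4 - 2 * s\<close>.\<close>
        also have "z powr (2 - s) \<le> z powr \<sigma>"
          using that assms True z by (intro powr_mono') (auto simp: \<sigma>_def)
        finally have b: "\<bar>Q / \<Gamma> - z powr (- s)\<bar> \<le> 12 * z powr \<sigma> + 2 * z powr (- s) * e" by simp
        \<comment> \<open>The constant first cell is only first-order accurate, but it occurs only
          for \<open>r < 2\<close>, where \<sigma> < 1 and hence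
          \<open>z \<le> z powr \<sigma>\<close>.\<close>
        have "\<bar>d\<bar> \<le> 2 * v * z powr \<sigma>"
        proof (cases "r < 2")
          case r2: True
          have "1 - R \<le> 2 * z"
            using exp_ge_add_one_self[of "- y"] Rs by linarith
          moreover have "R \<le> 1" using y by (simp add: Rs(2))
          ultimately have "\<bar>d\<bar> \<le> 2 * v * z powr 1"
            using r2 s z by (simp add: d_def v_def divide_right_mono)
          also have "\<dots> \<le> 2 * v * z powr \<sigma>"
            using v z True r2 by (intro mult_left_mono powr_mono') (auto simp: \<sigma>_def)
          finally show ?thesis .
        qed (use v in \<open>simp add: d_def\<close>)
        hence "\<bar>d / \<Gamma>\<bar> \<le> 2 * v / \<Gamma> * z powr \<sigma>"
          using \<Gamma> by (simp add: divide_right_mono abs_mult)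
        with b have "\<bar>Q / \<Gamma> - d / \<Gamma> - z powr (- s)\<bar> \<le> 12 * z powr \<sigma> + 2 * z powr (- s) * e + 2 * v / \<Gamma> * z powr \<sigma>"
          by linarith
        also have "\<dots> \<le> C2 * z powr \<sigma> + 2 * z powr (- s) * e"
          by (simp add: C2_def algebra_simps)
        finally show ?thesis
          using dts by (simp add: S diff_divide_distrib)
      qed
      hence "dt powr s * \<bar>S / dt powr s - z powr (- s)\<bar> \<le> dt powr s * (C2 * z powr \<sigma> + 2 * z powr (- s) * e)"
        using dts by (intro mult_left_mono) auto
      moreover have "dt powr s * \<bar>S / dt powr s - z powr (- s)\<bar> = \<bar>dt powr s * (S / dt powr s - z powr (- s))\<bar>"
        using dts by (simp add: abs_mult)
      moreover have "dt powr s * (S / dt powr s - z powr (- s)) = S - \<mu> powr (- s)"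
        using dts by (simp add: \<mu>z right_diff_distrib)
      ultimately have "\<bar>S - \<mu> powr (- s)\<bar> \<le> C2 * (dt powr s * z powr \<sigma>) + 2 * (\<mu> powr (- s) * e)"
        by (simp add: \<mu>z algebra_simps)
      also have "\<dots> \<le> C * (dt powr s * z powr \<sigma>) + C * (\<mu> powr (- s) * e)"
        using C12 dts e by (intro add_mono mult_right_mono) auto
      finally show ?thesis
        using True by (simp add: S_def e_def z_def[symmetric] mult.assoc min_def)
    qed
  qed
  thus ?thesis
    using C12 unfolding \<sigma>_def by (intro exI[of _ C]) auto
qed

text \<open>Decay at the exact rate \<open>lam\<close> would give \<open>dt powr q\<close> by the
  choice of \<open>T\<close>. The discrete rate is bounded below only by
  \<open>lam / (1 + E * dt)\<close> with \<open>E = lam * (D + 1)\<close>, because \<mu> may lie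
  slightly below \<open>lam\<close> and the scheme may damp less than the exponential. The loss in
  the exponent is at most \<open>q * E * dt * ln (1 / dt) \<le> q * E\<close>, whence the constant
  factor.\<close>

lemma amplification_tail:
  assumes \<theta>: "0 \<le> \<theta>" "\<theta> \<le> 1" and lam: "0 < lam" and D: "0 \<le> D" and q: "0 < q"
    and dt: "0 < dt" and \<mu>: "0 < \<mu>" "1 / \<mu> \<le> 1 / lam + D * dt"
    and small: "dt * \<mu> \<le> 1/2" and T: "real NT * dt > 1 / lam * ln (1 / dt powr q)"
  shows "amplification \<theta> (dt * \<mu>) ^ NT \<le> exp (q * (lam * (D + 1))) * dt powr q"
proof -
  define z where "z = dt * \<mu>"
  define E where "E = lam * (D + 1)"
  have z: "0 < z" "z \<le> 1/2" and E: "0 < E"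
    using dt \<mu> small lam D by (auto simp: z_def E_def)
  note A = amplification_small[OF \<theta> z]
  define y where "y = - ln (amplification \<theta> z)"
  have Ry: "amplification \<theta> z = exp (- y)" and y: "z / (1 + z) \<le> y"
    using A unfolding y_def by auto
  have y0: "0 < y"
    using A(4) z unfolding y_def by linarith
  have pw: "amplification \<theta> z ^ NT = exp (- (real NT * y))"
    unfolding Ry by (simp add: exp_of_nat_mult[symmetric])
  show ?thesis
  proof (cases "1 \<le> dt")
    case True
    have "amplification \<theta> z ^ NT \<le> 1 * 1"
      unfolding pw using y0 by simp
    also have "\<dots> \<le> exp (q * E) * dt powr q"
      using True q E by (intro mult_mono ge_one_powr_ge_zero) auto
    finally show ?thesis by (simp add: z_def E_def)
  next
    case False
    have "0 < 1 / \<mu> + dt" "1 / \<mu> + dt \<le> 1 / lam + D * dt + dt"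
      using \<mu> dt by (simp_all add: add_pos_pos)
    hence "dt / (1 / lam + D * dt + dt) \<le> dt / (1 / \<mu> + dt)"
      using dt by (intro divide_left_mono mult_pos_pos) auto
    also have "\<dots> = z / (1 + z)"
      using \<mu> dt by (simp add: z_def field_simps)
    also have "1 / lam + D * dt + dt = (1 + E * dt) / lam"
      using lam by (simp add: E_def field_simps)
    finally have "dt * lam / (1 + E * dt) \<le> y"
      using y by simp
    hence "real NT * (dt * lam / (1 + E * dt)) \<le> real NT * y"
      by (rule mult_left_mono) simp
    moreover have "q * ln (1 / dt) * (1 - E * dt) \<le> real NT * (dt * lam / (1 + E * dt))"
    proof -
      have l: "0 \<le> q * ln (1 / dt)"
        using q dt False by simp
      have "(1 - E * dt) * (1 + E * dt) \<le> 1"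
        using zero_le_square[of "E * dt"] by (simp add: algebra_simps)
      hence "q * ln (1 / dt) * ((1 - E * dt) * (1 + E * dt)) \<le> q * ln (1 / dt) * 1"
        using l by (rule mult_left_mono)
      also have "q * ln (1 / dt) = ln (1 / dt powr q)"
        using dt by (simp add: ln_div ln_powr)
      also have "\<dots> * 1 \<le> real NT * dt * lam"
        using T lam by (simp add: field_simps)
      finally have "q * ln (1 / dt) * ((1 - E * dt) * (1 + E * dt)) \<le> real NT * dt * lam"
        using dt by (simp add: ln_div ln_powr)
      moreover have "0 < 1 + E * dt" using E dt by (simp add: add_pos_pos)
      ultimately show ?thesis
        by (simp add: le_divide_eq mult.assoc)
    qed
    moreover have "q * ln (1 / dt) * (E * dt) \<le> q * E"
    proof -
      have "ln (1 / dt) \<le> 1 / dt"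
        using ln_le_minus_one[of "1 / dt"] dt by simp
      hence "q * E * (ln (1 / dt) * dt) \<le> q * E * 1"
        using q E dt by (intro mult_left_mono) (auto simp: field_simps)
      thus ?thesis by (simp add: algebra_simps)
    qed
    ultimately have "- (real NT * y) \<le> q * E + q * ln dt"
      using dt by (simp add: ln_div algebra_simps)
    hence "exp (- (real NT * y)) \<le> exp (q * E + q * ln dt)"
      by simp
    also have "\<dots> = exp (q * E) * dt powr q"
      using dt by (simp add: exp_add powr_def)
    finally show ?thesis
      unfolding pw[symmetric] by (simp add: z_def E_def)
  qed
qed

section \<open>Diagonal operators in inner product spaces\<close>

definition orthonormal_set :: "'a::real_inner set \<Rightarrow> bool" where
  "orthonormal_set A \<longleftrightarrow> finite A \<and> (\<forall>a\<in>A. \<forall>b\<in>A. a \<bullet> b = (if a = b then 1 else 0))"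

text \<open>The functional calculus of a symmetric operator of finite rank with eigenvectors
  \<open>A\<close>, where the orthogonal complement of \<open>A\<close> is mapped to 0. In
  particular \<open>diag A (\<lambda>a. 1)\<close> is the orthogonal projection onto the
  span.\<close>

definition diag :: "'a::real_inner set \<Rightarrow> ('a \<Rightarrow> real) \<Rightarrow> 'a \<Rightarrow> 'a" where
  "diag A f x = (\<Sum>a\<in>A. (f a * (a \<bullet> x)) *\<^sub>R a)"

lemma linear_diag: "linear (diag A f)"
  by (rule linearI) (simp_all add: diag_def inner_add_right distrib_left scaleR_add_left sum.distrib
      scaleR_sum_right mult.assoc mult.left_commute)

lemmas diag_add = linear_add[OF linear_diag]
  and diag_diff = linear_diff[OF linear_diag]
  and diag_scaleR = linear_cmul[OF linear_diag]
  and diag_zero = linear_0[OF linear_diag]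

lemma diag_fun_add: "diag A (\<lambda>a. f a + g a) x = diag A f x + diag A g x"
  by (simp add: diag_def distrib_right scaleR_add_left sum.distrib)

lemma diag_fun_diff: "diag A (\<lambda>a. f a - g a) x = diag A f x - diag A g x"
  by (simp add: diag_def left_diff_distrib scaleR_diff_left sum_subtractf)

lemma diag_fun_cmult: "diag A (\<lambda>a. c * f a) x = c *\<^sub>R diag A f x"
  by (simp add: diag_def scaleR_sum_right mult.assoc)

lemma diag_cong: "(\<And>a. a \<in> A \<Longrightarrow> f a = g a) \<Longrightarrow> diag A f x = diag A g x"
  by (simp add: diag_def)

lemma inner_diag: "y \<bullet> diag A f x = (\<Sum>a\<in>A. f a * (a \<bullet> x) * (a \<bullet> y))"
  by (simp add: diag_def inner_sum_right inner_commute[of y])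

lemma diag_symmetric: "diag A f x \<bullet> y = x \<bullet> diag A f y"
  by (simp add: inner_diag inner_commute[of "diag A f x"] mult_ac)

lemma diag_in_span: "diag A f x \<in> span A"
  unfolding diag_def by (intro span_sum span_scale span_base)

context
  fixes A :: "'a::real_inner set"
  assumes A: "orthonormal_set A"
begin

lemma inner_diag_basis: "a \<in> A \<Longrightarrow> a \<bullet> diag A f x = f a * (a \<bullet> x)"
  using A by (subst inner_diag, subst sum.remove[of _ a]) (auto simp: orthonormal_set_def intro!: sum.neutral)

lemma diag_diag: "diag A f (diag A g x) = diag A (\<lambda>a. f a * g a) x"
  unfolding diag_def[of A f] diag_def[of A "\<lambda>a. f a * g a"]
  by (rule sum.cong) (simp_all add: inner_diag_basis mult.assoc)

lemma diag_one_span: "x \<in> span A \<Longrightarrow> diag A (\<lambda>a. 1) x = x"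
proof (induction rule: span_induct_alt)
  case (step c a y)
  have "diag A (\<lambda>a. 1) a = a"
    using A step by (subst diag_def, subst sum.remove[of _ a])
      (auto simp: orthonormal_set_def intro!: sum.neutral)
  thus ?case
    using step by (simp add: diag_add diag_scaleR)
qed (simp add: diag_zero)

lemma norm_diag_sq: "(norm (diag A f x))\<^sup>2 = (\<Sum>a\<in>A. (f a)\<^sup>2 * (a \<bullet> x)\<^sup>2)"
proof -
  have "(norm (diag A f x))\<^sup>2 = x \<bullet> diag A (\<lambda>a. f a * f a) x"
    by (simp only: power2_norm_eq_inner diag_symmetric[of A f x "diag A f x"] diag_diag)
  thus ?thesis
    by (simp add: inner_diag power2_eq_square mult_ac)
qed

lemma bessel_inequality: "(\<Sum>a\<in>A. (a \<bullet> x)\<^sup>2) \<le> (norm x)\<^sup>2"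
proof -
  have "0 \<le> (norm (x - diag A (\<lambda>a. 1) x))\<^sup>2" by simp
  also have "\<dots> = (norm x)\<^sup>2 - 2 * (x \<bullet> diag A (\<lambda>a. 1) x) + (norm (diag A (\<lambda>a. 1) x))\<^sup>2"
    by (simp add: power2_norm_eq_inner algebra_simps inner_diff_left inner_commute)
  also have "x \<bullet> diag A (\<lambda>a. 1) x = (\<Sum>a\<in>A. (a \<bullet> x)\<^sup>2)"
    by (simp add: inner_diag power2_eq_square)
  finally show ?thesis
    by (simp add: norm_diag_sq)
qed

lemma norm_diag_le:
  assumes "\<And>a. a \<in> A \<Longrightarrow> \<bar>f a\<bar> \<le> C" "0 \<le> C"
  shows "norm (diag A f x) \<le> C * norm x"
proof -
  have "(norm (diag A f x))\<^sup>2 \<le> (\<Sum>a\<in>A. C\<^sup>2 * (a \<bullet> x)\<^sup>2)"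
    unfolding norm_diag_sq using assms
    by (intro sum_mono mult_right_mono) (auto simp: abs_le_square_iff[symmetric])
  also have "\<dots> \<le> C\<^sup>2 * (norm x)\<^sup>2"
    unfolding sum_distrib_left[symmetric] by (intro mult_left_mono bessel_inequality) auto
  finally show ?thesis
    using assms by (intro power2_le_imp_le[of "norm (diag A f x)"]) (auto simp: power_mult_distrib)
qed

text \<open>On the span of \<open>A\<close> the factor \<open>1 - f\<close> lies between 0 and 1; on
  the orthogonal complement the map is the identity. In squared norms this is
  \<open>(1 - f)\<^sup>2 = 1 - (2 * f - f\<^sup>2)\<close> with a nonnegative bracket.\<close>

lemma norm_minus_diag_le:
  assumes "\<And>a. a \<in> A \<Longrightarrow> 0 \<le> f a" "\<And>a. a \<in> A \<Longrightarrow> f a \<le> 1"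
  shows "norm (x - diag A f x) \<le> norm x"
proof -
  have "(norm (x - diag A f x))\<^sup>2 = (norm x)\<^sup>2 - 2 * (x \<bullet> diag A f x) + (norm (diag A f x))\<^sup>2"
    by (simp add: power2_norm_eq_inner algebra_simps inner_diff_left inner_commute)
  also have "\<dots> = (norm x)\<^sup>2 - (\<Sum>a\<in>A. (2 * f a - (f a)\<^sup>2) * (a \<bullet> x)\<^sup>2)"
  proof -
    have "2 * (x \<bullet> diag A f x) = (\<Sum>a\<in>A. 2 * f a * (a \<bullet> x)\<^sup>2)"
      by (simp add: inner_diag sum_distrib_left power2_eq_square mult_ac)
    thus ?thesis
      by (simp add: norm_diag_sq sum_subtractf left_diff_distrib)
  qed
  also have "\<dots> \<le> (norm x)\<^sup>2"
  proof -
    have "(f a)\<^sup>2 \<le> 2 * f a" if "a \<in> A" for a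
      using assms[OF that] mult_mono[of "f a" 2 "f a" "f a"] by (simp add: power2_eq_square)
    thus ?thesis by (simp add: sum_nonneg)
  qed
  finally show ?thesis
    by (rule power2_le_imp_le) simp
qed

lemma orthonormal_independent: "independent A"
proof (rule pairwise_orthogonal_independent)
  show "pairwise orthogonal A"
    using A by (auto simp: pairwise_def orthogonal_def orthonormal_set_def)
  have "0 \<bullet> (0::'a) = 1" if "0 \<in> A"
    using A that unfolding orthonormal_set_def by metis
  thus "0 \<notin> A" by auto
qed

text \<open>The ambient space may be infinite-dimensional, so closed and bounded does not mean
  compact. The vectors with all coefficients in [-1, 1] form a compact set, being built up by
  continuous images of products with an interval, and the sphere is a closed part of it.\<close>

lemma compact_sphere_span: "compact {x \<in> span A. norm x = 1}"
proof -
  define Q where "Q C = {x. \<exists>r. (\<forall>c\<in>C. \<bar>r c\<bar> \<le> 1) \<and> x = (\<Sum>c\<in>C. r c *\<^sub>R c)}" for C :: "'a set"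
  have "finite A" using A by (simp add: orthonormal_set_def)
  hence "compact (Q A)"
  proof (induction A rule: finite_induct)
    case (insert c C)
    have "Q (insert c C) = (\<lambda>(t, y). t *\<^sub>R c + y) ` ({-1..1} \<times> Q C)"
    proof (intro equalityI subsetI)
      fix x assume "x \<in> Q (insert c C)"
      then obtain r where "\<forall>d\<in>insert c C. \<bar>r d\<bar> \<le> 1" "x = r c *\<^sub>R c + (\<Sum>d\<in>C. r d *\<^sub>R d)"
        using insert unfolding Q_def by auto
      thus "x \<in> (\<lambda>(t, y). t *\<^sub>R c + y) ` ({-1..1} \<times> Q C)"
        by (intro image_eqI[of _ _ "(r c, \<Sum>d\<in>C. r d *\<^sub>R d)"]) (auto simp: Q_def abs_le_iff)
    next
      fix x assume "x \<in> (\<lambda>(t, y). t *\<^sub>R c + y) ` ({-1..1} \<times> Q C)"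
      then obtain t r where t: "\<bar>t\<bar> \<le> 1" and r: "\<forall>d\<in>C. \<bar>r d\<bar> \<le> 1" "x = t *\<^sub>R c + (\<Sum>d\<in>C. r d *\<^sub>R d)"
        unfolding Q_def by (auto simp: abs_le_iff)
      have "(\<Sum>d\<in>C. (r(c := t)) d *\<^sub>R d) = (\<Sum>d\<in>C. r d *\<^sub>R d)"
        using insert by (intro sum.cong) auto
      thus "x \<in> Q (insert c C)"
        using insert t r unfolding Q_def by (intro CollectI exI[of _ "r(c := t)"]) auto
    qed
    thus ?case
      using insert by (auto intro!: compact_continuous_image compact_Times continuous_intros simp: case_prod_beta)
  qed (simp add: Q_def)
  hence "compact (Q A \<inter> {x. norm x = 1})"
    by (intro compact_Int_closed closed_Collect_eq continuous_intros)
  also have "Q A \<inter> {x. norm x = 1} = {x \<in> span A. norm x = 1}"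
  proof (intro equalityI subsetI)
    fix x assume "x \<in> Q A \<inter> {x. norm x = 1}"
    then obtain r where "norm x = 1" "x = (\<Sum>c\<in>A. r c *\<^sub>R c)" by (auto simp: Q_def)
    moreover have "(\<Sum>c\<in>A. r c *\<^sub>R c) \<in> span A"
      by (intro span_sum span_scale span_base)
    ultimately show "x \<in> {x \<in> span A. norm x = 1}" by simp
  next
    fix x assume x: "x \<in> {x \<in> span A. norm x = 1}"
    have "\<bar>a \<bullet> x\<bar> \<le> 1" if "a \<in> A" for a
      using Cauchy_Schwarz_ineq2[of a x] A x that by (auto simp: orthonormal_set_def norm_eq_sqrt_inner)
    moreover have "x = (\<Sum>a\<in>A. (a \<bullet> x) *\<^sub>R a)"
      using diag_one_span[of x] x by (simp add: diag_def)
    ultimately show "x \<in> Q A \<inter> {x. norm x = 1}"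
      using x by (auto simp: Q_def intro!: exI[of _ "\<lambda>a. a \<bullet> x"])
  qed
  finally show ?thesis .
qed

end

section \<open>The spectral theorem on a finite-dimensional subspace\<close>

lemma orthonormal_basis_exists:
  fixes B :: "'a::real_inner set"
  assumes "finite B"
  shows "\<exists>A. orthonormal_set A \<and> span A = span B"
proof -
  obtain C where C: "finite C" "span C = span B" "pairwise orthogonal C"
    using basis_orthogonal[OF assms] by blast
  define A where "A = (\<lambda>c. c /\<^sub>R norm c) ` (C - {0})"
  have orth: "c \<bullet> d = 0" if "c \<in> C" "d \<in> C" "c \<noteq> d" for c d
    using C(3) that by (auto simp: pairwise_def orthogonal_def)
  have "orthonormal_set A"
    unfolding orthonormal_set_def
  proof (intro conjI ballI)
    fix a b assume "a \<in> A" "b \<in> A"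
    then obtain c d where cd: "c \<in> C" "c \<noteq> 0" "a = c /\<^sub>R norm c" "d \<in> C" "d \<noteq> 0" "b = d /\<^sub>R norm d"
      by (auto simp: A_def)
    have "a \<bullet> a = 1"
      using cd by (simp add: dot_square_norm power2_eq_square)
    moreover have "a \<bullet> b = 0" if "a \<noteq> b"
      using cd orth[of c d] that by auto
    ultimately show "a \<bullet> b = (if a = b then 1 else 0)" by auto
  qed (use C in \<open>simp add: A_def\<close>)
  moreover have "span A = span C"
  proof (rule span_eq[THEN iffD2], intro conjI subsetI)
    fix c assume c: "c \<in> C"
    show "c \<in> span A"
    proof (cases "c = 0")
      case False
      hence "norm c *\<^sub>R (c /\<^sub>R norm c) \<in> span A"
        using c by (intro span_scale span_base) (auto simp: A_def)
      thus ?thesis using False by simp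
    qed (simp add: span_zero)
  next
    fix a assume "a \<in> A"
    then obtain c where "c \<in> C" "a = c /\<^sub>R norm c" by (auto simp: A_def)
    thus "a \<in> span C" by (simp add: span_scale span_base)
  qed
  ultimately show ?thesis
    using C by auto
qed

text \<open>The first-order condition at a minimum. At \<open>t = - b / (1 + \<bar>c\<bar>)\<close>
  the linear term dominates, and the denominator is positive also for \<open>c = 0\<close>.\<close>

lemma nonneg_quadratic_imp_zero:
  fixes b c :: real
  assumes "\<And>t. 0 \<le> 2 * t * b + t\<^sup>2 * c"
  shows "b = 0"
proof (rule ccontr)
  assume b: "b \<noteq> 0"
  have k: "2 * (- b / k) * b + (- b / k)\<^sup>2 * k = - (b\<^sup>2 / k)" if "0 < k" for k :: real
    using that by (simp add: field_simps power2_eq_square)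
  have c: "0 \<le> 1 + \<bar>c\<bar>" "0 < 1 + \<bar>c\<bar>" by auto
  have "0 \<le> 2 * (- b / (1 + \<bar>c\<bar>)) * b + (- b / (1 + \<bar>c\<bar>))\<^sup>2 * c"
    by (rule assms)
  also have "\<dots> \<le> 2 * (- b / (1 + \<bar>c\<bar>)) * b + (- b / (1 + \<bar>c\<bar>))\<^sup>2 * (1 + \<bar>c\<bar>)"
    by (intro add_left_mono mult_left_mono) auto
  also have "\<dots> = - (b\<^sup>2 / (1 + \<bar>c\<bar>))"
    by (rule k[OF c(2)])
  also have "\<dots> < 0"
    using b c by simp
  finally show False by simp
qed

text \<open>An eigenvector orthogonal to the eigenvectors in \<open>A\<close> maximizes the quadratic form over the unit
  sphere of the orthogonal complement of \<open>A\<close>.\<close>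

lemma symmetric_next_eigenvector:
  fixes S :: "'a::real_inner \<Rightarrow> 'a"
  assumes C: "orthonormal_set C" and lin: "linear S" and cont: "continuous_on UNIV S"
    and inv: "\<And>x. x \<in> span C \<Longrightarrow> S x \<in> span C"
    and sym: "\<And>x y. x \<in> span C \<Longrightarrow> y \<in> span C \<Longrightarrow> S x \<bullet> y = x \<bullet> S y"
    and A: "A \<subseteq> span C" "\<And>a. a \<in> A \<Longrightarrow> \<exists>\<mu>. S a = \<mu> *\<^sub>R a"
    and x0: "x0 \<in> span C" "x0 \<noteq> 0" "\<And>a. a \<in> A \<Longrightarrow> a \<bullet> x0 = 0"
  shows "\<exists>v \<mu>. v \<in> span C \<and> norm v = 1 \<and> (\<forall>a\<in>A. a \<bullet> v = 0) \<and> S v = \<mu> *\<^sub>R v"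
proof -
  define W where "W = {x \<in> span C. \<forall>a\<in>A. a \<bullet> x = 0}"
  define K where "K = {x \<in> span C. norm x = 1} \<inter> (\<Inter>a\<in>A. {x. a \<bullet> x = 0})"
  have W: "x + y \<in> W" "x - y \<in> W" if "x \<in> W" "y \<in> W" for x y
    using that by (auto simp: W_def span_add span_diff inner_add_right inner_diff_right)
  have Ws: "c *\<^sub>R x \<in> W" if "x \<in> W" for x c
    using that by (auto simp: W_def span_scale)
  have K: "compact K"
    unfolding K_def by (intro compact_Int_closed compact_sphere_span[OF C] closed_INT ballI
        closed_Collect_eq continuous_intros)
  have KW: "x /\<^sub>R norm x \<in> K" if "x \<in> W" "x \<noteq> 0" for x
    using that by (auto simp: K_def W_def span_scale)
  have "K \<noteq> {}"
    using KW[of x0] x0 by (auto simp: W_def)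
  moreover have "continuous_on K (\<lambda>x. S x \<bullet> x)"
    by (intro continuous_on_inner continuous_on_id continuous_on_subset[OF cont]) auto
  ultimately obtain v where v: "v \<in> K" and max: "\<And>x. x \<in> K \<Longrightarrow> S x \<bullet> x \<le> S v \<bullet> v"
    using continuous_attains_sup[OF K] by blast
  define m where "m = S v \<bullet> v"
  have vW: "v \<in> W" and nv: "norm v = 1"
    using v by (auto simp: K_def W_def)
  have vv: "v \<bullet> v = 1" using nv by (simp add: dot_square_norm)
  define q where "q x = m * (x \<bullet> x) - S x \<bullet> x" for x
  have q0: "0 \<le> q x" if "x \<in> W" for x
  proof (cases "x = 0")
    case False
    have "S (x /\<^sub>R norm x) \<bullet> (x /\<^sub>R norm x) \<le> m"
      unfolding m_def by (rule max[OF KW[OF that False]])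
    hence "S x \<bullet> x / (norm x)\<^sup>2 \<le> m"
      using lin by (simp add: linear_cmul divide_inverse power2_eq_square mult_ac)
    thus ?thesis
      using False by (simp add: q_def divide_le_eq dot_square_norm)
  qed (simp add: q_def)
  have SW: "S x \<in> W" if "x \<in> W" for x
  proof -
    have "a \<bullet> S x = 0" if aA: "a \<in> A" for a
    proof -
      obtain \<mu> where "S a = \<mu> *\<^sub>R a" using A(2)[OF aA] by blast
      moreover have "S a \<bullet> x = a \<bullet> S x"
        using sym[of a x] A(1) aA \<open>x \<in> W\<close> by (auto simp: W_def)
      ultimately show ?thesis
        using aA \<open>x \<in> W\<close> by (auto simp: W_def)
    qed
    thus ?thesis using that inv by (auto simp: W_def)
  qed
  \<comment> \<open>The variation is taken along the residual \<open>w\<close>: the linear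
    coefficient of \<open>q\<close> at \<open>v\<close> in this direction is
    \<open>w \<bullet> w\<close>, up to a factor 2, and vanishes because \<open>q\<close> is minimal
    at \<open>v\<close>.\<close>
  define w where "w = m *\<^sub>R v - S v"
  have wW: "w \<in> W" unfolding w_def by (intro W Ws SW vW)
  have "0 \<le> 2 * t * (w \<bullet> w) + t\<^sup>2 * q w" for t
  proof -
    have "0 \<le> q (v + t *\<^sub>R w)" by (intro q0 W Ws vW wW)
    also have "q (v + t *\<^sub>R w) = q v + 2 * t * (m * (v \<bullet> w) - S v \<bullet> w) + t\<^sup>2 * q w"
      using sym[of w v] vW wW lin
      by (simp add: q_def W_def linear_add linear_cmul inner_add_left inner_add_right algebra_simps
          power2_eq_square inner_commute)
    also have "m * (v \<bullet> w) - S v \<bullet> w = w \<bullet> w"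
      by (subst (3) w_def) (simp add: inner_diff_left)
    finally show ?thesis by (simp add: q_def m_def vv)
  qed
  hence "w \<bullet> w = 0" by (rule nonneg_quadratic_imp_zero)
  hence "S v = m *\<^sub>R v" by (simp add: w_def)
  thus ?thesis using vW nv by (auto simp: W_def)
qed

text \<open>Symmetry makes \<open>S\<close> agree on the span with the linear, continuous map
  \<open>S'\<close> determined by its values on an orthonormal basis, and further eigenvectors are
  found for \<open>S'\<close>. This can only end with a basis, as orthonormal eigenvectors cannot
  outnumber the dimension.\<close>

theorem symmetric_eigenbasis:
  fixes S :: "'a::real_inner \<Rightarrow> 'a"
  assumes B: "finite B" and inv: "\<And>x. x \<in> span B \<Longrightarrow> S x \<in> span B"
    and sym: "\<And>x y. x \<in> span B \<Longrightarrow> y \<in> span B \<Longrightarrow> S x \<bullet> y = x \<bullet> S y"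
  shows "\<exists>A \<nu>. orthonormal_set A \<and> span A = span B \<and> (\<forall>a\<in>A. S a = \<nu> a *\<^sub>R a)"
proof -
  obtain C where C: "orthonormal_set C" and CB: "span C = span B"
    using orthonormal_basis_exists[OF B] by blast
  define S' where "S' x = (\<Sum>c\<in>C. (c \<bullet> x) *\<^sub>R S c)" for x
  have lin: "linear S'"
    by (rule linearI) (simp_all add: S'_def inner_add_right scaleR_add_left sum.distrib scaleR_sum_right)
  have cont: "continuous_on UNIV S'"
    unfolding S'_def by (intro continuous_intros)
  have CC: "c \<in> span B" if "c \<in> C" for c
    using span_base[OF that] CB by simp
  have SC: "S c \<in> span C" if "c \<in> C" for c
    using inv[OF CC[OF that]] CB by simp
  have S': "S' x = S x" if x: "x \<in> span C" for x
  proof -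
    have mem: "S' x - S x \<in> span C"
      unfolding S'_def using inv x SC by (intro span_diff span_sum span_scale) (auto simp: CB)
    have "(S' x - S x) \<bullet> w = 0" if w: "w \<in> span C" for w
    proof -
      have "S' x \<bullet> w = diag C (\<lambda>c. 1) x \<bullet> S w"
        unfolding S'_def diag_def inner_sum_left using sym[OF CC] w
        by (intro sum.cong) (auto simp: CB)
      thus ?thesis
        using diag_one_span[OF C x] sym[of x w] x w by (simp add: inner_diff_left CB)
    qed
    from this[OF mem] show ?thesis by simp
  qed
  have "\<exists>A. orthonormal_set A \<and> A \<subseteq> span C \<and> (\<forall>a\<in>A. \<exists>\<mu>. S a = \<mu> *\<^sub>R a) \<and> (card A = k \<or> span A = span C)" for k
  proof (induction k)
    case 0
    show ?case by (intro exI[of _ "{}"]) (auto simp: orthonormal_set_def)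
  next
    case (Suc k)
    then obtain A where A: "orthonormal_set A" "A \<subseteq> span C" "\<And>a. a \<in> A \<Longrightarrow> \<exists>\<mu>. S a = \<mu> *\<^sub>R a"
      "card A = k \<or> span A = span C" by blast
    show ?case
    proof (cases "span A = span C")
      case False
      have "span A \<subseteq> span C"
        using A(2) by (intro span_minimal subspace_span)
      with False obtain y where y: "y \<in> span C" "y \<notin> span A" by blast
      define x where "x = y - diag A (\<lambda>a. 1) y"
      have "diag A (\<lambda>a. 1) y \<in> span A" by (rule diag_in_span)
      hence x: "x \<in> span C" "x \<noteq> 0"
        using y \<open>span A \<subseteq> span C\<close> by (auto simp: x_def intro: span_diff)
      have xA: "a \<bullet> x = 0" if "a \<in> A" for a
        using inner_diag_basis[OF A(1) that] by (simp add: x_def inner_diff_right)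
      have "\<exists>v \<mu>. v \<in> span C \<and> norm v = 1 \<and> (\<forall>a\<in>A. a \<bullet> v = 0) \<and> S' v = \<mu> *\<^sub>R v"
      proof (rule symmetric_next_eigenvector[OF C lin cont _ _ A(2) _ x xA])
        show "\<exists>\<mu>. S' a = \<mu> *\<^sub>R a" if "a \<in> A" for a
          using A(2,3) that S' by (metis subsetD)
      qed (use S' inv sym CB in auto)
      then obtain v \<mu> where v: "v \<in> span C" "norm v = 1" "\<And>a. a \<in> A \<Longrightarrow> a \<bullet> v = 0" "S v = \<mu> *\<^sub>R v"
        using S' by metis
      have "v \<notin> A" using v(2) v(3)[of v] by (auto simp: dot_square_norm)
      moreover have "v \<bullet> v = 1" "v \<bullet> a = 0" if "a \<in> A" for a
        using v(2) v(3)[OF that] by (simp_all add: dot_square_norm inner_commute)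
      hence "orthonormal_set (insert v A)"
        using A(1) v(2,3) \<open>v \<notin> A\<close> unfolding orthonormal_set_def by (auto simp: dot_square_norm)
      ultimately show ?thesis
        using A v False by (intro exI[of _ "insert v A"]) (auto simp: orthonormal_set_def)
    qed (use A in blast)
  qed
  \<comment> \<open>One more than the dimension: the alternative
    \<open>card A = Suc (card C)\<close> contradicts independence.\<close>
  from this[of "Suc (card C)"] obtain A where A: "orthonormal_set A" "A \<subseteq> span C"
    "\<And>a. a \<in> A \<Longrightarrow> \<exists>\<mu>. S a = \<mu> *\<^sub>R a" "card A = Suc (card C) \<or> span A = span C" by blast
  have "finite C" using C by (simp add: orthonormal_set_def)
  hence "card A \<le> card C"
    using independent_span_bound[OF _ orthonormal_independent[OF A(1)] A(2)] by simp
  hence "span A = span B" using A(4) CB by simp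
  moreover obtain \<nu> where "\<And>a. a \<in> A \<Longrightarrow> S a = \<nu> a *\<^sub>R a" using A(3) by metis
  ultimately show ?thesis using A(1) by blast
qed

section \<open>Fractional powers of close operators\<close>

text \<open>\<open>A\<close> and \<nu> describe the discrete operator \<open>S\<close>;
  \<open>B\<close> and \<open>t\<close> describe the restriction \<open>T\<close> of the exact one
  to finitely many modes. Closeness is required only on the span of \<open>B\<close> but in the norm
  of the whole space, since \<open>S\<close> need not leave this span invariant.\<close>

definition diag_close ::
  "'a::real_inner set \<Rightarrow> ('a \<Rightarrow> real) \<Rightarrow> 'a set \<Rightarrow> ('a \<Rightarrow> real) \<Rightarrow> real \<Rightarrow> bool" where
  "diag_close A \<nu> B t \<delta> \<longleftrightarrow> orthonormal_set A \<and> orthonormal_set B \<and> (\<forall>a\<in>A. 0 < \<nu> a) \<and> (\<forall>b\<in>B. 0 < t b) \<and>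
     (\<forall>g\<in>span B. norm (diag A \<nu> g - diag B t g) \<le> \<delta> * norm g)"

text \<open>The left-hand side is \<open>l powr \<sigma>\<close> times
  \<open>(t / (l + t)) powr \<sigma>\<close> times \<open>(l / (l + t)) powr (1 - \<sigma>)\<close>;
  the last two factors are at most 1 as long as 0 \<le> \<sigma> \<le> 1.\<close>

lemma abs_powr_div_add_le:
  fixes l t \<sigma> :: real
  assumes "0 < l" "0 < t" "0 \<le> \<sigma>" "\<sigma> \<le> 1"
  shows "\<bar>t powr \<sigma> * (l / (l + t))\<bar> \<le> l powr \<sigma>"
proof -
  have "t powr \<sigma> * (l / (l + t)) \<le> l powr \<sigma>"
  proof (cases "t \<le> l")
    case True
    have "t powr \<sigma> * (l / (l + t)) \<le> l powr \<sigma> * 1"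
      using assms True by (intro mult_mono powr_mono2) auto
    thus ?thesis by simp
  next
    case False
    have "t powr \<sigma> * (l / (l + t)) \<le> t powr \<sigma> * (l / t)"
      using assms by (intro mult_left_mono divide_left_mono) auto
    also have "\<dots> = l * t powr (\<sigma> - 1)"
      using assms by (simp add: powr_diff)
    also have "\<dots> \<le> l * l powr (\<sigma> - 1)"
      using assms False by (intro mult_left_mono powr_mono2') auto
    also have "\<dots> = l powr \<sigma>"
      using assms by (simp add: powr_diff)
    finally show ?thesis .
  qed
  thus ?thesis using assms by simp
qed

context
  fixes A B :: "'a::real_inner set" and \<nu> t :: "'a \<Rightarrow> real" and \<delta> :: real
  assumes close: "diag_close A \<nu> B t \<delta>"
begin

lemma diag_closeD:
  "orthonormal_set A" "orthonormal_set B" "\<And>a. a \<in> A \<Longrightarrow> 0 < \<nu> a" "\<And>b. b \<in> B \<Longrightarrow> 0 < t b"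
  "\<And>g. g \<in> span B \<Longrightarrow> norm (diag A \<nu> g - diag B t g) \<le> \<delta> * norm g"
  using close by (auto simp: diag_close_def)

text \<open>\<open>S/(l+S) - T/(l+T) = l (l+S)\<^sup>-\<^sup>1 (S - T) (l+T)\<^sup>-\<^sup>1\<close> on the span of \<open>B\<close>, where the norm of
  \<open>l (l+S)\<^sup>-\<^sup>1\<close> is at most 1.\<close>

lemma resolvent_diff_le:
  assumes l: "0 < l" and g: "g \<in> span B"
  shows "\<bar>u \<bullet> (diag A (\<lambda>a. \<nu> a / (l + \<nu> a)) g - diag B (\<lambda>b. t b / (l + t b)) g)\<bar>
    \<le> norm u * (\<delta> * norm (diag B (\<lambda>b. 1 / (l + t b)) g))"
proof -
  note D = diag_closeD
  define w where "w = (\<lambda>a. \<nu> a / (l + \<nu> a))"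
  define Tg where "Tg = diag B (\<lambda>b. t b / (l + t b)) g"
  \<comment> \<open>The left resolvent factor is moved onto the test vector: \<open>u'\<close> is
    \<open>l * (l + S)\<^sup>-\<^sup>1 u\<close> on the span of \<open>A\<close> and agrees with
    \<open>u\<close> on the orthogonal complement.\<close>
  define u' where "u' = u - diag A w u"
  define g' where "g' = diag B (\<lambda>b. 1 / (l + t b)) g"
  have pos: "0 < l + \<nu> a" if "a \<in> A" for a using D(3)[OF that] l by simp
  have post: "0 < l + t b" if "b \<in> B" for b using D(4)[OF that] l by simp
  have w: "0 \<le> w a" "w a \<le> 1" "\<nu> a - \<nu> a * w a = l * w a" "1 - w a = l / (l + \<nu> a)" if "a \<in> A" for a
    using pos[OF that] D(3)[OF that] l by (auto simp: w_def field_simps)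
  have u': "diag A \<nu> u' = l *\<^sub>R diag A w u"
    unfolding u'_def diag_diff diag_diag[OF D(1)] diag_fun_diff[symmetric] diag_fun_cmult[symmetric]
    by (intro diag_cong w(3))
  have Tg': "diag B t g' = Tg"
    unfolding g'_def Tg_def diag_diag[OF D(2)] by (intro diag_cong) simp
  have gsum: "g = l *\<^sub>R g' + Tg"
  proof -
    have "l *\<^sub>R g' + Tg = diag B (\<lambda>b. 1) g"
      unfolding g'_def Tg_def diag_fun_cmult[symmetric] diag_fun_add[symmetric]
      using post by (intro diag_cong) (simp add: add_divide_distrib[symmetric] less_imp_neq[symmetric])
    thus ?thesis using diag_one_span[OF D(2) g] by simp
  qed
  have "u' \<bullet> (diag A \<nu> g' - diag B t g') = l *\<^sub>R diag A w u \<bullet> g' - u' \<bullet> Tg"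
    by (simp only: inner_diff_right diag_symmetric[symmetric] u' Tg')
  also have "\<dots> = diag A w u \<bullet> g - u \<bullet> Tg"
    by (subst gsum) (simp add: u'_def inner_add_right inner_diff_left)
  also have "\<dots> = u \<bullet> (diag A w g - Tg)"
    by (simp add: diag_symmetric inner_diff_right)
  finally have "\<bar>u \<bullet> (diag A w g - Tg)\<bar> = \<bar>u' \<bullet> (diag A \<nu> g' - diag B t g')\<bar>" by simp
  also have "\<dots> \<le> norm u' * norm (diag A \<nu> g' - diag B t g')"
    by (rule Cauchy_Schwarz_ineq2)
  also have "\<dots> \<le> norm u * (\<delta> * norm g')"
  proof (intro mult_mono)
    show "norm u' \<le> norm u"
      unfolding u'_def by (intro norm_minus_diag_le[OF D(1)] w)
    show "norm (diag A \<nu> g' - diag B t g') \<le> \<delta> * norm g'"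
      unfolding g'_def by (intro D(5) diag_in_span)
  qed auto
  finally show ?thesis by (simp add: w_def Tg_def g'_def)
qed

text \<open>Near \<open>l = 0\<close> the first-order bound is too singular to be integrated when s
  + \<sigma> \<le> 1. Instead both operators are compared with the identity:
  \<open>T / (l + T)\<close> differs from it by at most \<open>l powr \<sigma>\<close> on the range
  of \<open>T powr \<sigma>\<close>, and the same holds for \<open>S\<close> on
  \<open>S powr \<sigma>\<close>, where \<omega> is the price of exchanging the two powers.\<close>

lemma resolvent_diff_le_small:
  assumes l: "0 < l" and g: "g \<in> span B" and \<sigma>: "0 \<le> \<sigma>" "\<sigma> \<le> 1"
    and \<omega>: "norm (diag B (\<lambda>b. t b powr \<sigma>) g - diag A (\<lambda>a. \<nu> a powr \<sigma>) g) \<le> \<omega> * norm g"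
  shows "\<bar>u \<bullet> (diag A (\<lambda>a. \<nu> a / (l + \<nu> a)) (diag B (\<lambda>b. t b powr \<sigma>) g)
      - diag B (\<lambda>b. t b / (l + t b)) (diag B (\<lambda>b. t b powr \<sigma>) g))\<bar>
    \<le> norm u * ((2 * l powr \<sigma> + \<omega>) * norm g)"
proof -
  note D = diag_closeD
  define w where "w = (\<lambda>a. \<nu> a / (l + \<nu> a))"
  define x where "x = diag B (\<lambda>b. t b powr \<sigma>) g"
  define u' where "u' = u - diag A w u"
  have pos: "0 < l + \<nu> a" if "a \<in> A" for a using D(3)[OF that] l by simp
  have post: "0 < l + t b" if "b \<in> B" for b using D(4)[OF that] l by simp
  have w: "0 \<le> w a" "w a \<le> 1" "\<nu> a - \<nu> a * w a = l * w a" "1 - w a = l / (l + \<nu> a)" if "a \<in> A" for a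
    using pos[OF that] D(3)[OF that] l by (auto simp: w_def field_simps)
  have nu': "norm u' \<le> norm u"
    unfolding u'_def by (intro norm_minus_diag_le[OF D(1)] w)
  have "x - diag B (\<lambda>b. t b / (l + t b)) x = diag B (\<lambda>b. t b powr \<sigma> * (l / (l + t b))) g"
    unfolding x_def diag_diag[OF D(2)] diag_fun_diff[symmetric]
  proof (intro diag_cong)
    fix b assume "b \<in> B"
    from post[OF this] show "t b powr \<sigma> - t b / (l + t b) * t b powr \<sigma> = t b powr \<sigma> * (l / (l + t b))"
      by (simp add: field_simps)
  qed
  also have "norm \<dots> \<le> l powr \<sigma> * norm g"
    by (intro norm_diag_le[OF D(2)] abs_powr_div_add_le l \<sigma> D(4)) auto
  finally have 1: "\<bar>u \<bullet> (x - diag B (\<lambda>b. t b / (l + t b)) x)\<bar> \<le> norm u * (l powr \<sigma> * norm g)"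
    by (intro order_trans[OF Cauchy_Schwarz_ineq2] mult_left_mono) auto
  have "u \<bullet> (x - diag A w x) = u' \<bullet> x"
    by (simp add: u'_def inner_diff_left inner_diff_right diag_symmetric)
  also have "\<dots> = u' \<bullet> (x - diag A (\<lambda>a. \<nu> a powr \<sigma>) g) + diag A (\<lambda>a. \<nu> a powr \<sigma>) u' \<bullet> g"
    by (simp add: diag_symmetric inner_diff_right)
  also have "diag A (\<lambda>a. \<nu> a powr \<sigma>) u' = diag A (\<lambda>a. \<nu> a powr \<sigma> * (l / (l + \<nu> a))) u"
    unfolding u'_def diag_diff diag_diag[OF D(1)] diag_fun_diff[symmetric]
    by (intro diag_cong) (simp add: w(4)[symmetric] right_diff_distrib)
  finally have eq: "u \<bullet> (x - diag A w x) = u' \<bullet> (x - diag A (\<lambda>a. \<nu> a powr \<sigma>) g)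
      + diag A (\<lambda>a. \<nu> a powr \<sigma> * (l / (l + \<nu> a))) u \<bullet> g" .
  have "\<bar>u' \<bullet> (x - diag A (\<lambda>a. \<nu> a powr \<sigma>) g)\<bar> \<le> norm u * (\<omega> * norm g)"
    using \<omega> nu' unfolding x_def
    by (intro order_trans[OF Cauchy_Schwarz_ineq2] mult_mono) auto
  moreover have "norm (diag A (\<lambda>a. \<nu> a powr \<sigma> * (l / (l + \<nu> a))) u) \<le> l powr \<sigma> * norm u"
    by (intro norm_diag_le[OF D(1)] abs_powr_div_add_le l \<sigma> D(3)) auto
  hence "\<bar>diag A (\<lambda>a. \<nu> a powr \<sigma> * (l / (l + \<nu> a))) u \<bullet> g\<bar> \<le> l powr \<sigma> * norm u * norm g"
    by (intro order_trans[OF Cauchy_Schwarz_ineq2] mult_right_mono) auto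
  ultimately have 2: "\<bar>u \<bullet> (x - diag A w x)\<bar> \<le> norm u * (\<omega> * norm g) + l powr \<sigma> * norm u * norm g"
    unfolding eq by (intro order_trans[OF abs_triangle_ineq] add_mono)
  have "u \<bullet> (diag A w x - diag B (\<lambda>b. t b / (l + t b)) x)
      = u \<bullet> (x - diag B (\<lambda>b. t b / (l + t b)) x) - u \<bullet> (x - diag A w x)"
    by (simp add: inner_diff_right)
  hence "\<bar>u \<bullet> (diag A w x - diag B (\<lambda>b. t b / (l + t b)) x)\<bar>
      \<le> norm u * (l powr \<sigma> * norm g) + (norm u * (\<omega> * norm g) + l powr \<sigma> * norm u * norm g)"
    using 1 2 by linarith
  thus ?thesis
    by (simp add: w_def x_def algebra_simps)
qed

lemma has_integral_diag_powr_diff: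
  assumes \<kappa>: "\<And>x. 0 \<le> x \<Longrightarrow> ((\<lambda>l. l powr (s - 1) * (x / (l + x))) has_integral \<kappa> * x powr s) {0<..}"
  shows "((\<lambda>l. l powr (s - 1) * (u \<bullet> (diag A (\<lambda>a. \<nu> a / (l + \<nu> a)) g - diag B (\<lambda>b. t b / (l + t b)) g)))
    has_integral \<kappa> * (u \<bullet> (diag A (\<lambda>a. \<nu> a powr s) g - diag B (\<lambda>b. t b powr s) g))) {0<..}"
proof -
  have *: "((\<lambda>l. l powr (s - 1) * (u \<bullet> diag C (\<lambda>a. f a / (l + f a)) g))
      has_integral \<kappa> * (u \<bullet> diag C (\<lambda>a. f a powr s) g)) {0<..}"
    if C: "finite C" and f: "\<And>a. a \<in> C \<Longrightarrow> 0 < f a" for C and f :: "'a \<Rightarrow> real"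
  proof -
    have "((\<lambda>l. \<Sum>a\<in>C. l powr (s - 1) * (f a / (l + f a)) * ((a \<bullet> g) * (a \<bullet> u)))
        has_integral (\<Sum>a\<in>C. \<kappa> * f a powr s * ((a \<bullet> g) * (a \<bullet> u)))) {0<..}"
      using f by (intro has_integral_sum C has_integral_mult_left \<kappa>) (auto simp: less_imp_le)
    thus ?thesis
      by (simp add: inner_diag sum_distrib_left mult.assoc)
  qed
  have "finite A" "finite B" using diag_closeD by (auto simp: orthonormal_set_def)
  thus ?thesis
    unfolding inner_diff_right right_diff_distrib
    by (intro has_integral_diff * diag_closeD)
qed

text \<open>The integral formula is tested with the difference \<open>v\<close> itself. The bound on
  the integrand then estimates the square of \<open>norm v\<close> by a multiple of
  \<open>norm v\<close>, and one factor cancels.\<close>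

lemma diag_powr_diff_le:
  assumes \<kappa>: "0 < \<kappa>" "\<And>x. 0 \<le> x \<Longrightarrow> ((\<lambda>l. l powr (s - 1) * (x / (l + x))) has_integral \<kappa> * x powr s) {0<..}"
    and F: "(F has_integral J) {0<..}" and J: "0 \<le> J" and c: "0 \<le> c"
    and bound: "\<And>l u. 0 < l \<Longrightarrow> l powr (s - 1) * \<bar>u \<bullet> (diag A (\<lambda>a. \<nu> a / (l + \<nu> a)) x - diag B (\<lambda>b. t b / (l + t b)) x)\<bar>
        \<le> F l * (norm u * c)"
  shows "norm (diag A (\<lambda>a. \<nu> a powr s) x - diag B (\<lambda>b. t b powr s) x) \<le> J / \<kappa> * c"
proof -
  define v where "v = diag A (\<lambda>a. \<nu> a powr s) x - diag B (\<lambda>b. t b powr s) x"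
  have int: "((\<lambda>l. l powr (s - 1) * (v \<bullet> (diag A (\<lambda>a. \<nu> a / (l + \<nu> a)) x - diag B (\<lambda>b. t b / (l + t b)) x)))
    has_integral \<kappa> * (v \<bullet> v)) {0<..}"
    using has_integral_diag_powr_diff[OF \<kappa>(2), of v x] by (simp add: v_def)
  have "\<kappa> * (v \<bullet> v) \<le> J * (norm v * c)"
  proof (rule has_integral_le[OF int has_integral_mult_left[OF F]])
    fix l :: real assume "l \<in> {0<..}"
    thus "l powr (s - 1) * (v \<bullet> (diag A (\<lambda>a. \<nu> a / (l + \<nu> a)) x - diag B (\<lambda>b. t b / (l + t b)) x)) \<le> F l * (norm v * c)"
      by (intro order_trans[OF _ bound] mult_left_mono) auto
  qed
  hence "norm v * (\<kappa> * norm v) \<le> norm v * (J * c)"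
    by (simp add: dot_square_norm power2_eq_square mult_ac)
  hence "v = 0 \<or> \<kappa> * norm v \<le> J * c"
    by (auto simp: mult_le_cancel_left)
  hence "\<kappa> * norm v \<le> J * c"
    using J c by auto
  thus ?thesis using \<kappa>(1) by (simp add: v_def field_simps)
qed

end

section \<open>Comparison of fractional powers by splitting the integral\<close>

lemma has_integral_powr_below:
  fixes p \<epsilon> :: real
  assumes "0 < p" "0 < \<epsilon>"
  shows "((\<lambda>l. if l \<in> {0<..\<epsilon>} then l powr (p - 1) else 0) has_integral \<epsilon> powr p / p) {0<..}"
proof -
  have "((\<lambda>l. l powr (p - 1)) has_integral \<epsilon> powr (p - 1 + 1) / (p - 1 + 1)) {0..\<epsilon>}"
    using assms by (intro has_integral_powr_from_0) auto
  hence "((\<lambda>l. l powr (p - 1)) has_integral \<epsilon> powr p / p) {0<..\<epsilon>}"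
    by (subst (asm) has_integral_spike_set_eq[of _ "{0<..\<epsilon>}"])
       ((rule negligible_subset[of "{0}"]; force)+, simp)
  thus ?thesis
    by (subst has_integral_restrict) auto
qed

lemma has_integral_powr_above:
  fixes p \<epsilon> :: real
  assumes "p < 0" "0 < \<epsilon>"
  shows "((\<lambda>l. if l \<in> {\<epsilon><..} then l powr (p - 1) else 0) has_integral - (\<epsilon> powr p / p)) {0<..}"
proof -
  have "((\<lambda>l. l powr (p - 1)) has_integral - (\<epsilon> powr (p - 1 + 1)) / (p - 1 + 1)) {\<epsilon>..}"
    using assms by (intro has_integral_powr_to_inf) auto
  hence "((\<lambda>l. l powr (p - 1)) has_integral - (\<epsilon> powr p / p)) {\<epsilon><..}"
    by (simp add: has_integral_Ici_iff_Ioi)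
  thus ?thesis
    using assms by (subst has_integral_restrict) auto
qed

lemma has_integral_inverse_between:
  fixes \<epsilon> :: real
  assumes "0 < \<epsilon>" "\<epsilon> \<le> 1"
  shows "((\<lambda>l. if l \<in> {\<epsilon><..1} then l powr - 1 else 0) has_integral ln (1 / \<epsilon>)) {0<..}"
proof -
  have "((\<lambda>l. l powr - 1) has_integral (ln 1 - ln \<epsilon>)) {\<epsilon>..1}"
  proof (rule fundamental_theorem_of_calculus)
    fix l :: real assume "l \<in> {\<epsilon>..1}"
    hence "(ln has_field_derivative l powr - 1) (at l within {\<epsilon>..1})"
      using assms by (auto intro!: derivative_eq_intros simp: powr_minus_divide)
    thus "(ln has_vector_derivative l powr - 1) (at l within {\<epsilon>..1})"
      by (simp add: has_real_derivative_iff_has_vector_derivative)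
  qed (use assms in auto)
  hence "((\<lambda>l. l powr - 1) has_integral ln (1 / \<epsilon>)) {\<epsilon><..1}"
    using assms by (subst (asm) has_integral_spike_set_eq[of _ "{\<epsilon><..1}"])
       ((rule negligible_subset[of "{\<epsilon>}"]; force)+, simp add: ln_div)
  thus ?thesis
    using assms by (subst has_integral_restrict) auto
qed

text \<open>Two regimes of the right resolvent factor. The bound
  \<open>l powr (\<sigma> - 1)\<close> serves small \<open>l\<close>; for large \<open>l\<close> it
  may decay too slowly against \<open>l powr (s - 1)\<close>, and the upper bound \<open>tm\<close>
  of the eigenvalues then gives \<open>l powr - 1\<close>, which makes the product integrable at
  infinity because \<open>s < 1\<close>.\<close>

lemma norm_diag_resolvent_powr_le:
  fixes l \<sigma> tm :: real
  assumes B: "orthonormal_set B" and t: "\<And>b. b \<in> B \<Longrightarrow> 0 < t b" and l: "0 < l" and \<sigma>: "0 \<le> \<sigma>"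
  shows "\<sigma> \<le> 1 \<Longrightarrow> norm (diag B (\<lambda>b. 1 / (l + t b)) (diag B (\<lambda>b. t b powr \<sigma>) g)) \<le> l powr (\<sigma> - 1) * norm g"
    and "(\<And>b. b \<in> B \<Longrightarrow> t b \<le> tm) \<Longrightarrow>
      norm (diag B (\<lambda>b. 1 / (l + t b)) (diag B (\<lambda>b. t b powr \<sigma>) g)) \<le> tm powr \<sigma> * l powr - 1 * norm g"
proof -
  assume "\<sigma> \<le> 1"
  have "\<bar>1 / (l + t b) * t b powr \<sigma>\<bar> \<le> l powr (\<sigma> - 1)" if "b \<in> B" for b
  proof -
    have "l * \<bar>1 / (l + t b) * t b powr \<sigma>\<bar> = \<bar>t b powr \<sigma> * (l / (l + t b))\<bar>"
      using l by (simp add: abs_mult)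
    also have "\<dots> \<le> l powr \<sigma>"
      using l \<sigma> \<open>\<sigma> \<le> 1\<close> t[OF that] by (intro abs_powr_div_add_le) auto
    finally show ?thesis
      using l by (simp add: powr_diff field_simps)
  qed
  thus "norm (diag B (\<lambda>b. 1 / (l + t b)) (diag B (\<lambda>b. t b powr \<sigma>) g)) \<le> l powr (\<sigma> - 1) * norm g"
    unfolding diag_diag[OF B] by (intro norm_diag_le[OF B]) auto
next
  assume tm: "\<And>b. b \<in> B \<Longrightarrow> t b \<le> tm"
  have "\<bar>1 / (l + t b) * t b powr \<sigma>\<bar> \<le> tm powr \<sigma> * l powr - 1" if "b \<in> B" for b
  proof -
    have "1 / (l + t b) * t b powr \<sigma> \<le> 1 / l * tm powr \<sigma>"
      using l t[OF that] tm[OF that] \<sigma> by (intro mult_mono divide_left_mono powr_mono2) auto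
    moreover have "0 < l + t b" using l t[OF that] by simp
    ultimately show ?thesis
      using l by (simp add: powr_minus_divide)
  qed
  thus "norm (diag B (\<lambda>b. 1 / (l + t b)) (diag B (\<lambda>b. t b powr \<sigma>) g)) \<le> tm powr \<sigma> * l powr - 1 * norm g"
    unfolding diag_diag[OF B] by (intro norm_diag_le[OF B]) auto
qed

text \<open>Below the threshold \<open>l = \<epsilon>\<close> the trivial bound for the resolvent difference is integrated, above
  it the one of first order in \<open>S - T\<close>.\<close>

lemma diag_powr_diff_subcritical:
  assumes s: "0 < s" "s < 1" and \<sigma>: "0 \<le> \<sigma>" "s + \<sigma> < 1" and D: "0 < D" and \<Omega>: "0 < \<Omega>"
  shows "\<exists>K>0. \<forall>A \<nu> B t \<epsilon>. \<forall>g::'a::real_inner.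
    0 < \<epsilon> \<and> diag_close A \<nu> B t (D * \<epsilon>) \<and> g \<in> span B \<and>
    norm (diag B (\<lambda>b. t b powr \<sigma>) g - diag A (\<lambda>a. \<nu> a powr \<sigma>) g) \<le> \<Omega> * \<epsilon> powr \<sigma> * norm g \<longrightarrow>
    norm (diag A (\<lambda>a. \<nu> a powr s) (diag B (\<lambda>b. t b powr \<sigma>) g) - diag B (\<lambda>b. t b powr s) (diag B (\<lambda>b. t b powr \<sigma>) g))
      \<le> K * \<epsilon> powr (s + \<sigma>) * norm g"
proof -
  obtain \<kappa> where \<kappa>: "0 < \<kappa>" "\<And>x. 0 \<le> x \<Longrightarrow> ((\<lambda>l. l powr (s - 1) * (x / (l + x))) has_integral \<kappa> * x powr s) {0<..}"
    using has_integral_powr_resolvent[OF s] by blast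
  \<comment> \<open>The three integrals, up to the factor
    \<open>\<epsilon> powr (s + \<sigma>)\<close>: the two parts of the bound below \<epsilon> and
    the first-order bound above \<epsilon>, which converges at infinity because
    \<open>s + \<sigma> < 1\<close>.\<close>
  define K where "K = (2 / (s + \<sigma>) + \<Omega> / s + D / (1 - s - \<sigma>)) / \<kappa>"
  have "norm (diag A (\<lambda>a. \<nu> a powr s) (diag B (\<lambda>b. t b powr \<sigma>) g) - diag B (\<lambda>b. t b powr s) (diag B (\<lambda>b. t b powr \<sigma>) g))
      \<le> K * \<epsilon> powr (s + \<sigma>) * norm g"
    if \<epsilon>: "0 < \<epsilon>" and close: "diag_close A \<nu> B t (D * \<epsilon>)" and g: "g \<in> span B"
      and \<omega>: "norm (diag B (\<lambda>b. t b powr \<sigma>) g - diag A (\<lambda>a. \<nu> a powr \<sigma>) g) \<le> \<Omega> * \<epsilon> powr \<sigma> * norm g"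
    for A B \<nu> t \<epsilon> and g :: 'a
  proof -
    note C = diag_closeD[OF close]
    define F where "F l = (2 * (if l \<in> {0<..\<epsilon>} then l powr (s + \<sigma> - 1) else 0)
      + \<Omega> * \<epsilon> powr \<sigma> * (if l \<in> {0<..\<epsilon>} then l powr (s - 1) else 0))
      + D * \<epsilon> * (if l \<in> {\<epsilon><..} then l powr ((s + \<sigma> - 1) - 1) else 0)" for l
    have "(F has_integral (2 * (\<epsilon> powr (s + \<sigma>) / (s + \<sigma>)) + \<Omega> * \<epsilon> powr \<sigma> * (\<epsilon> powr s / s))
        + D * \<epsilon> * - (\<epsilon> powr (s + \<sigma> - 1) / (s + \<sigma> - 1))) {0<..}"
      unfolding F_def using s \<sigma> \<epsilon>
      by (intro has_integral_add has_integral_mult_right has_integral_powr_below has_integral_powr_above) auto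
    moreover have "(2 * (\<epsilon> powr (s + \<sigma>) / (s + \<sigma>)) + \<Omega> * \<epsilon> powr \<sigma> * (\<epsilon> powr s / s))
        + D * \<epsilon> * - (\<epsilon> powr (s + \<sigma> - 1) / (s + \<sigma> - 1)) = K * \<kappa> * \<epsilon> powr (s + \<sigma>)"
    proof -
      have "\<epsilon> * \<epsilon> powr (s + \<sigma> - 1) = \<epsilon> powr (s + \<sigma>)" "\<epsilon> powr \<sigma> * \<epsilon> powr s = \<epsilon> powr (s + \<sigma>)"
        using \<epsilon> by (simp_all add: powr_diff powr_add)
      hence "D * \<epsilon> * - (\<epsilon> powr (s + \<sigma> - 1) / (s + \<sigma> - 1)) = D / (1 - s - \<sigma>) * \<epsilon> powr (s + \<sigma>)"
        "\<Omega> * \<epsilon> powr \<sigma> * (\<epsilon> powr s / s) = \<Omega> / s * \<epsilon> powr (s + \<sigma>)"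
        using minus_divide_right[of "D * \<epsilon> powr (s + \<sigma>)" "s + \<sigma> - 1"]
        by (simp_all add: algebra_simps)
      moreover have "K * \<kappa> = 2 / (s + \<sigma>) + \<Omega> / s + D / (1 - s - \<sigma>)"
        using \<kappa>(1) by (simp add: K_def)
      ultimately show ?thesis
        by (simp only: distrib_right) simp
    qed
    ultimately have F: "(F has_integral K * \<kappa> * \<epsilon> powr (s + \<sigma>)) {0<..}" by simp
    have "norm (diag A (\<lambda>a. \<nu> a powr s) (diag B (\<lambda>b. t b powr \<sigma>) g) - diag B (\<lambda>b. t b powr s) (diag B (\<lambda>b. t b powr \<sigma>) g))
      \<le> K * \<kappa> * \<epsilon> powr (s + \<sigma>) / \<kappa> * norm g"
    proof (rule diag_powr_diff_le[OF close \<kappa> F])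
      show "0 \<le> K * \<kappa> * \<epsilon> powr (s + \<sigma>)"
        using s \<sigma> D \<Omega> \<kappa>(1) by (auto simp: K_def)
      fix l :: real and u :: 'a
      assume l: "0 < l"
      let ?d = "u \<bullet> (diag A (\<lambda>a. \<nu> a / (l + \<nu> a)) (diag B (\<lambda>b. t b powr \<sigma>) g) - diag B (\<lambda>b. t b / (l + t b)) (diag B (\<lambda>b. t b powr \<sigma>) g))"
      show "l powr (s - 1) * \<bar>?d\<bar> \<le> F l * (norm u * norm g)"
      proof (cases "l \<le> \<epsilon>")
        case True
        have "\<bar>?d\<bar> \<le> norm u * ((2 * l powr \<sigma> + \<Omega> * \<epsilon> powr \<sigma>) * norm g)"
          using \<sigma> s \<omega> by (intro resolvent_diff_le_small[OF close l g]) auto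
        hence "l powr (s - 1) * \<bar>?d\<bar> \<le> l powr (s - 1) * (norm u * ((2 * l powr \<sigma> + \<Omega> * \<epsilon> powr \<sigma>) * norm g))"
          by (rule mult_left_mono) auto
        also have "\<dots> = F l * (norm u * norm g)"
          using True l powr_add[of l \<sigma> "s - 1"] by (simp add: F_def algebra_simps)
        finally show ?thesis .
      next
        case False
        have "\<bar>?d\<bar> \<le> norm u * (D * \<epsilon> * (l powr (\<sigma> - 1) * norm g))"
          using \<sigma> s D \<epsilon> C(2,4)
          by (intro order_trans[OF resolvent_diff_le[OF close l diag_in_span]] mult_left_mono norm_diag_resolvent_powr_le(1) l) auto
        hence "l powr (s - 1) * \<bar>?d\<bar> \<le> l powr (s - 1) * (norm u * (D * \<epsilon> * (l powr (\<sigma> - 1) * norm g)))"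
          by (rule mult_left_mono) auto
        also have "\<dots> = F l * (norm u * norm g)"
          using False l powr_add[of l "\<sigma> - 1" "s - 1"] by (simp add: F_def algebra_simps)
        finally show ?thesis .
      qed
    qed auto
    thus ?thesis using \<kappa>(1) by simp
  qed
  moreover have "0 < K"
  proof -
    have "0 < 2 / (s + \<sigma>)" using s \<sigma> by simp
    moreover have "0 < \<Omega> / s" using s \<Omega> by simp
    moreover have "0 < D / (1 - s - \<sigma>)" using \<sigma> D by simp
    ultimately show ?thesis
      using \<kappa>(1) unfolding K_def by (intro divide_pos_pos[OF add_pos_pos[OF add_pos_pos]])
  qed
  ultimately show ?thesis by blast
qed

text \<open>The subcritical estimate, with \<sigma> in the role of \<open>s\<close> and smoothness
  0, asks only for the claim with exponent 0. There the difference is the identity minus an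
  orthogonal projection, bounded by 1; exponent 1 is the assumed closeness. The result supplies the
  exchange of powers for data of positive smoothness.\<close>

lemma diag_powr_diff:
  assumes \<sigma>: "0 \<le> \<sigma>" "\<sigma> \<le> 1" and D: "0 < D"
  shows "\<exists>K>0. \<forall>A \<nu> B t \<epsilon>. \<forall>g::'a::real_inner. 0 < \<epsilon> \<and> diag_close A \<nu> B t (D * \<epsilon>) \<and> g \<in> span B \<longrightarrow>
    norm (diag B (\<lambda>b. t b powr \<sigma>) g - diag A (\<lambda>a. \<nu> a powr \<sigma>) g) \<le> K * \<epsilon> powr \<sigma> * norm g"
proof -
  have one: "diag C (\<lambda>c. f c powr 0) x = diag C (\<lambda>c. 1) x" if "\<And>c. c \<in> C \<Longrightarrow> 0 < f c" for C f and x :: 'a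
    using that by (intro diag_cong) (force simp: powr_zero_eq_one)
  have id: "diag C (\<lambda>c. f c powr 1) x = diag C f x" if "\<And>c. c \<in> C \<Longrightarrow> 0 < f c" for C f and x :: 'a
    using that by (intro diag_cong) (simp add: less_imp_le)
  have zero: "norm (diag B (\<lambda>b. t b powr 0) g - diag A (\<lambda>a. \<nu> a powr 0) g) \<le> 1 * \<epsilon> powr 0 * norm g"
    if "0 < \<epsilon>" "diag_close A \<nu> B t (D * \<epsilon>)" "g \<in> span B" for A B \<nu> t \<epsilon> and g :: 'a
  proof -
    note C = diag_closeD[OF that(2)]
    have "diag B (\<lambda>b. t b powr 0) g = g" "diag A (\<lambda>a. \<nu> a powr 0) g = diag A (\<lambda>a. 1) g"
      using one[of B t g, OF C(4)] one[of A \<nu> g, OF C(3)] diag_one_span[OF C(2) that(3)] by simp_all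
    thus ?thesis
      using norm_minus_diag_le[OF C(1), of "\<lambda>a. 1" g] that(1) by simp
  qed
  consider "\<sigma> = 0" | "\<sigma> = 1" | "0 < \<sigma>" "\<sigma> < 1" using \<sigma> by linarith
  thus ?thesis
  proof cases
    case 1
    thus ?thesis using zero by (intro exI[of _ 1]) auto
  next
    case 2
    have "norm (diag B (\<lambda>b. t b powr 1) g - diag A (\<lambda>a. \<nu> a powr 1) g) \<le> D * \<epsilon> powr 1 * norm g"
      if "0 < \<epsilon>" "diag_close A \<nu> B t (D * \<epsilon>)" "g \<in> span B" for A B \<nu> t \<epsilon> and g :: 'a
    proof -
      note C = diag_closeD[OF that(2)]
      have "diag B (\<lambda>b. t b powr 1) g = diag B t g" "diag A (\<lambda>a. \<nu> a powr 1) g = diag A \<nu> g"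
        using id[of B t g, OF C(4)] id[of A \<nu> g, OF C(3)] by simp_all
      thus ?thesis
        using C(5)[OF that(3)] that(1) by (simp add: norm_minus_commute)
    qed
    thus ?thesis using D 2 by blast
  next
    case 3
    then obtain K where K: "0 < K" "\<And>A \<nu> B t \<epsilon>. \<And>g::'a. 0 < \<epsilon> \<Longrightarrow> diag_close A \<nu> B t (D * \<epsilon>) \<Longrightarrow> g \<in> span B \<Longrightarrow>
        norm (diag B (\<lambda>b. t b powr 0) g - diag A (\<lambda>a. \<nu> a powr 0) g) \<le> 1 * \<epsilon> powr 0 * norm g \<Longrightarrow>
        norm (diag A (\<lambda>a. \<nu> a powr \<sigma>) (diag B (\<lambda>b. t b powr 0) g) - diag B (\<lambda>b. t b powr \<sigma>) (diag B (\<lambda>b. t b powr 0) g))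
        \<le> K * \<epsilon> powr (\<sigma> + 0) * norm g"
      using diag_powr_diff_subcritical[of \<sigma> 0 D 1, where 'a = 'a] D by (auto simp: mult.assoc)
    have "norm (diag B (\<lambda>b. t b powr \<sigma>) g - diag A (\<lambda>a. \<nu> a powr \<sigma>) g) \<le> K * \<epsilon> powr \<sigma> * norm g"
      if h: "0 < \<epsilon>" "diag_close A \<nu> B t (D * \<epsilon>)" "g \<in> span B" for A B \<nu> t \<epsilon> and g :: 'a
    proof -
      note C = diag_closeD[OF h(2)]
      have "diag B (\<lambda>b. t b powr 0) g = g"
        using one[of B t g, OF C(4)] diag_one_span[OF C(2) h(3)] by simp
      thus ?thesis
        using K(2)[OF h zero[OF h]] by (simp only: norm_minus_commute add_0_right)
    qed
    thus ?thesis using K(1) by blast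
  qed
qed

text \<open>Between \<epsilon> and 1 the first-order bound is a multiple of
  \<open>\<epsilon> * l powr - 1\<close>, whose integral is the logarithm. The pieces below
  \<epsilon> and above 1 contribute multiples of \<epsilon>.\<close>

lemma diag_powr_diff_critical:
  assumes s: "0 < s" "s < 1" and \<sigma>: "s + \<sigma> = 1" and D: "0 < D" and tm: "0 < tm"
  shows "\<exists>K>0. \<forall>A \<nu> B t \<epsilon>. \<forall>g::'a::real_inner.
    0 < \<epsilon> \<and> \<epsilon> \<le> 1 \<and> diag_close A \<nu> B t (D * \<epsilon>) \<and> g \<in> span B \<and> (\<forall>b\<in>B. t b \<le> tm) \<longrightarrow>
    norm (diag A (\<lambda>a. \<nu> a powr s) (diag B (\<lambda>b. t b powr \<sigma>) g) - diag B (\<lambda>b. t b powr s) (diag B (\<lambda>b. t b powr \<sigma>) g))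
      \<le> K * \<epsilon> * (1 + ln (1 / \<epsilon>)) * norm g"
proof -
  have \<sigma>': "0 < \<sigma>" "\<sigma> < 1" using s \<sigma> by auto
  obtain \<kappa> where \<kappa>: "0 < \<kappa>" "\<And>x. 0 \<le> x \<Longrightarrow> ((\<lambda>l. l powr (s - 1) * (x / (l + x))) has_integral \<kappa> * x powr s) {0<..}"
    using has_integral_powr_resolvent[OF s] by blast
  obtain \<Omega> where \<Omega>: "0 < \<Omega>" "\<And>A \<nu> B t \<epsilon>. \<And>g::'a. 0 < \<epsilon> \<Longrightarrow> diag_close A \<nu> B t (D * \<epsilon>) \<Longrightarrow> g \<in> span B \<Longrightarrow>
    norm (diag B (\<lambda>b. t b powr \<sigma>) g - diag A (\<lambda>a. \<nu> a powr \<sigma>) g) \<le> \<Omega> * \<epsilon> powr \<sigma> * norm g"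
    using diag_powr_diff[of \<sigma> D, where 'a = 'a] \<sigma>' D by auto
  define E where "E = D * tm powr \<sigma>"
  define K where "K = (2 + \<Omega> / s + D + E / (1 - s)) / \<kappa>"
  have E: "0 < E" using D tm by (simp add: E_def)
  have K: "0 < K"
    using s E D \<Omega>(1) \<kappa>(1) unfolding K_def by (intro divide_pos_pos add_pos_pos) auto
  have "norm (diag A (\<lambda>a. \<nu> a powr s) (diag B (\<lambda>b. t b powr \<sigma>) g) - diag B (\<lambda>b. t b powr s) (diag B (\<lambda>b. t b powr \<sigma>) g))
      \<le> K * \<epsilon> * (1 + ln (1 / \<epsilon>)) * norm g"
    if \<epsilon>: "0 < \<epsilon>" "\<epsilon> \<le> 1" and close: "diag_close A \<nu> B t (D * \<epsilon>)" and g: "g \<in> span B"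
      and t: "\<And>b. b \<in> B \<Longrightarrow> t b \<le> tm"
    for A B \<nu> t \<epsilon> and g :: 'a
  proof -
    note C = diag_closeD[OF close]
    define F where "F l = (2 * (if l \<in> {0<..\<epsilon>} then l powr (1 - 1) else 0)
      + \<Omega> * \<epsilon> powr \<sigma> * (if l \<in> {0<..\<epsilon>} then l powr (s - 1) else 0))
      + (D * \<epsilon> * (if l \<in> {\<epsilon><..1} then l powr - 1 else 0)
      + E * \<epsilon> * (if l \<in> {1<..} then l powr ((s - 1) - 1) else 0))" for l
    define J where "J = (2 * (\<epsilon> powr 1 / 1) + \<Omega> * \<epsilon> powr \<sigma> * (\<epsilon> powr s / s))
        + (D * \<epsilon> * ln (1 / \<epsilon>) + E * \<epsilon> * - (1 powr (s - 1) / (s - 1)))"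
    have F: "(F has_integral J) {0<..}"
      unfolding F_def J_def using s \<epsilon>
      by (intro has_integral_add has_integral_mult_right has_integral_powr_below has_integral_powr_above
          has_integral_inverse_between) auto
    have ln: "0 \<le> ln (1 / \<epsilon>)" using \<epsilon> by simp
    have "\<epsilon> powr \<sigma> * \<epsilon> powr s = \<epsilon>"
      using \<epsilon> \<sigma> by (simp add: powr_add[symmetric] add.commute)
    hence "\<Omega> * \<epsilon> powr \<sigma> * (\<epsilon> powr s / s) = \<Omega> / s * \<epsilon>" by (simp add: algebra_simps)
    moreover have "- (1 / (s - 1)) = 1 / (1 - s)"
      using minus_divide_right[of 1 "s - 1"] by simp
    ultimately have J: "J = 2 * \<epsilon> + \<Omega> / s * \<epsilon> + (D * \<epsilon> * ln (1 / \<epsilon>) + E / (1 - s) * \<epsilon>)"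
      using \<epsilon> by (simp add: J_def)
    have J0: "0 \<le> J"
      unfolding J using s E D \<Omega>(1) \<epsilon> ln by (intro add_nonneg_nonneg mult_nonneg_nonneg) auto
    have "J \<le> K * \<kappa> * \<epsilon> * (1 + ln (1 / \<epsilon>))"
    proof -
      have "0 \<le> (2 + \<Omega> / s + E / (1 - s)) * \<epsilon> * ln (1 / \<epsilon>) + D * \<epsilon>"
        using s E D \<Omega>(1) \<epsilon> ln by (intro add_nonneg_nonneg mult_nonneg_nonneg) auto
      moreover have "K * \<kappa> = 2 + \<Omega> / s + D + E / (1 - s)"
        using \<kappa>(1) by (simp add: K_def)
      ultimately show ?thesis by (simp add: J algebra_simps add_divide_distrib)
    qed
    hence JK: "J / \<kappa> * norm g \<le> K * \<epsilon> * (1 + ln (1 / \<epsilon>)) * norm g"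
      using \<kappa>(1) by (intro mult_right_mono) (auto simp: divide_le_eq mult_ac)
    have "norm (diag A (\<lambda>a. \<nu> a powr s) (diag B (\<lambda>b. t b powr \<sigma>) g) - diag B (\<lambda>b. t b powr s) (diag B (\<lambda>b. t b powr \<sigma>) g))
      \<le> J / \<kappa> * norm g"
    proof (rule diag_powr_diff_le[OF close \<kappa> F J0])
      fix l :: real and u :: 'a
      assume l: "0 < l"
      let ?d = "u \<bullet> (diag A (\<lambda>a. \<nu> a / (l + \<nu> a)) (diag B (\<lambda>b. t b powr \<sigma>) g) - diag B (\<lambda>b. t b / (l + t b)) (diag B (\<lambda>b. t b powr \<sigma>) g))"
      consider "l \<le> \<epsilon>" | "\<epsilon> < l" "l \<le> 1" | "1 < l" by linarith
      thus "l powr (s - 1) * \<bar>?d\<bar> \<le> F l * (norm u * norm g)"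
      proof cases
        case 1
        have "\<bar>?d\<bar> \<le> norm u * ((2 * l powr \<sigma> + \<Omega> * \<epsilon> powr \<sigma>) * norm g)"
          using \<sigma>' \<Omega>(2)[OF \<epsilon>(1) close g] by (intro resolvent_diff_le_small[OF close l g]) auto
        hence "l powr (s - 1) * \<bar>?d\<bar> \<le> l powr (s - 1) * (norm u * ((2 * l powr \<sigma> + \<Omega> * \<epsilon> powr \<sigma>) * norm g))"
          by (rule mult_left_mono) auto
        also have "\<dots> = F l * (norm u * norm g)"
          using 1 l \<epsilon> \<sigma> powr_add[of l \<sigma> "s - 1"] by (simp add: F_def algebra_simps)
        finally show ?thesis .
      next
        case 2
        have "\<bar>?d\<bar> \<le> norm u * (D * \<epsilon> * (l powr (\<sigma> - 1) * norm g))"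
          using \<sigma>' D \<epsilon> C(2,4)
          by (intro order_trans[OF resolvent_diff_le[OF close l diag_in_span]] mult_left_mono norm_diag_resolvent_powr_le(1) l) auto
        hence "l powr (s - 1) * \<bar>?d\<bar> \<le> l powr (s - 1) * (norm u * (D * \<epsilon> * (l powr (\<sigma> - 1) * norm g)))"
          by (rule mult_left_mono) auto
        also have "\<dots> = F l * (norm u * norm g)"
        proof -
          have "l powr (\<sigma> - 1) * l powr (s - 1) = l powr (\<sigma> - 1 + (s - 1))" by (simp only: powr_add)
          also have "\<sigma> - 1 + (s - 1) = - 1" using \<sigma> by simp
          finally have e: "l powr (\<sigma> - 1) * l powr (s - 1) = l powr - 1" .
          have F: "F l = D * \<epsilon> * l powr - 1"
            using 2 l \<epsilon> by (simp add: F_def)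
          show ?thesis
            unfolding F e[symmetric] by (simp only: mult_ac)
        qed
        finally show ?thesis .
      next
        case 3
        have "\<bar>?d\<bar> \<le> norm u * (D * \<epsilon> * (tm powr \<sigma> * l powr - 1 * norm g))"
          using \<sigma>' D \<epsilon> C(2,4) t
          by (intro order_trans[OF resolvent_diff_le[OF close l diag_in_span]] mult_left_mono norm_diag_resolvent_powr_le(2) l) auto
        hence "l powr (s - 1) * \<bar>?d\<bar> \<le> l powr (s - 1) * (norm u * (D * \<epsilon> * (tm powr \<sigma> * l powr - 1 * norm g)))"
          by (rule mult_left_mono) auto
        also have "\<dots> = F l * (norm u * norm g)"
        proof -
          have e: "l powr (s - 1) * l powr - 1 = l powr (s - 1 - 1)"
            by (subst powr_add[symmetric]) simp
          have F: "F l = E * \<epsilon> * l powr (s - 1 - 1)"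
            using 3 l \<epsilon> by (simp add: F_def)
          show ?thesis
            unfolding F e[symmetric] E_def by (simp only: mult_ac)
        qed
        finally show ?thesis .
      qed
    qed auto
    thus ?thesis using JK by linarith
  qed
  thus ?thesis using K by blast
qed

text \<open>For \<open>s + \<sigma> > 1\<close> the first-order bound is integrable down to 0, so
  there is no threshold depending on \<epsilon>; the cut at 1 only switches to the bound that
  converges at infinity.\<close>

lemma diag_powr_diff_supercritical:
  assumes s: "0 < s" "s < 1" and \<sigma>: "1 < s + \<sigma>" "\<sigma> \<le> 1" and D: "0 < D" and tm: "0 < tm"
  shows "\<exists>K>0. \<forall>A \<nu> B t \<epsilon>. \<forall>g::'a::real_inner.
    0 < \<epsilon> \<and> diag_close A \<nu> B t (D * \<epsilon>) \<and> (\<forall>b\<in>B. t b \<le> tm) \<longrightarrow>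
    norm (diag A (\<lambda>a. \<nu> a powr s) (diag B (\<lambda>b. t b powr \<sigma>) g) - diag B (\<lambda>b. t b powr s) (diag B (\<lambda>b. t b powr \<sigma>) g))
      \<le> K * \<epsilon> * norm g"
proof -
  have \<sigma>': "0 \<le> \<sigma>" using s \<sigma> by auto
  obtain \<kappa> where \<kappa>: "0 < \<kappa>" "\<And>x. 0 \<le> x \<Longrightarrow> ((\<lambda>l. l powr (s - 1) * (x / (l + x))) has_integral \<kappa> * x powr s) {0<..}"
    using has_integral_powr_resolvent[OF s] by blast
  define E where "E = D * tm powr \<sigma>"
  define K where "K = (D / (s + \<sigma> - 1) + E / (1 - s)) / \<kappa>"
  have E: "0 < E" using D tm by (simp add: E_def)
  have K: "0 < K"
    using s \<sigma> E D \<kappa>(1) unfolding K_def by (intro divide_pos_pos add_pos_pos) auto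
  have "norm (diag A (\<lambda>a. \<nu> a powr s) (diag B (\<lambda>b. t b powr \<sigma>) g) - diag B (\<lambda>b. t b powr s) (diag B (\<lambda>b. t b powr \<sigma>) g))
      \<le> K * \<epsilon> * norm g"
    if \<epsilon>: "0 < \<epsilon>" and close: "diag_close A \<nu> B t (D * \<epsilon>)" and t: "\<And>b. b \<in> B \<Longrightarrow> t b \<le> tm"
    for A B \<nu> t \<epsilon> and g :: 'a
  proof -
    note C = diag_closeD[OF close]
    define F where "F l = D * \<epsilon> * (if l \<in> {0<..1} then l powr ((s + \<sigma> - 1) - 1) else 0)
      + E * \<epsilon> * (if l \<in> {1<..} then l powr ((s - 1) - 1) else 0)" for l
    define J where "J = D * \<epsilon> * (1 powr (s + \<sigma> - 1) / (s + \<sigma> - 1)) + E * \<epsilon> * - (1 powr (s - 1) / (s - 1))"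
    have F: "(F has_integral J) {0<..}"
      unfolding F_def J_def using s \<sigma>
      by (intro has_integral_add has_integral_mult_right has_integral_powr_below has_integral_powr_above) auto
    have "- (1 / (s - 1)) = 1 / (1 - s)"
      using minus_divide_right[of 1 "s - 1"] by simp
    moreover have "K * \<kappa> = D / (s + \<sigma> - 1) + E / (1 - s)"
      using \<kappa>(1) by (simp add: K_def)
    ultimately have J: "J = K * \<kappa> * \<epsilon>"
      by (simp add: J_def algebra_simps)
    have "norm (diag A (\<lambda>a. \<nu> a powr s) (diag B (\<lambda>b. t b powr \<sigma>) g) - diag B (\<lambda>b. t b powr s) (diag B (\<lambda>b. t b powr \<sigma>) g))
      \<le> J / \<kappa> * norm g"
    proof (rule diag_powr_diff_le[OF close \<kappa> F])
      fix l :: real and u :: 'a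
      assume l: "0 < l"
      let ?d = "u \<bullet> (diag A (\<lambda>a. \<nu> a / (l + \<nu> a)) (diag B (\<lambda>b. t b powr \<sigma>) g) - diag B (\<lambda>b. t b / (l + t b)) (diag B (\<lambda>b. t b powr \<sigma>) g))"
      show "l powr (s - 1) * \<bar>?d\<bar> \<le> F l * (norm u * norm g)"
      proof (cases "l \<le> 1")
        case True
        have "\<bar>?d\<bar> \<le> norm u * (D * \<epsilon> * (l powr (\<sigma> - 1) * norm g))"
          using \<sigma> \<sigma>' D \<epsilon> C(2,4)
          by (intro order_trans[OF resolvent_diff_le[OF close l diag_in_span]] mult_left_mono norm_diag_resolvent_powr_le(1) l) auto
        hence "l powr (s - 1) * \<bar>?d\<bar> \<le> l powr (s - 1) * (norm u * (D * \<epsilon> * (l powr (\<sigma> - 1) * norm g)))"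
          by (rule mult_left_mono) auto
        also have "\<dots> = F l * (norm u * norm g)"
          using True l powr_add[of l "\<sigma> - 1" "s - 1"] by (simp add: F_def algebra_simps)
        finally show ?thesis .
      next
        case False
        have "\<bar>?d\<bar> \<le> norm u * (D * \<epsilon> * (tm powr \<sigma> * l powr - 1 * norm g))"
          using \<sigma>' D \<epsilon> C(2,4) t
          by (intro order_trans[OF resolvent_diff_le[OF close l diag_in_span]] mult_left_mono norm_diag_resolvent_powr_le(2) l) auto
        hence "l powr (s - 1) * \<bar>?d\<bar> \<le> l powr (s - 1) * (norm u * (D * \<epsilon> * (tm powr \<sigma> * l powr - 1 * norm g)))"
          by (rule mult_left_mono) auto
        also have "\<dots> = F l * (norm u * norm g)"
        proof -
          have e: "l powr (s - 1) * l powr - 1 = l powr (s - 1 - 1)"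
            by (subst powr_add[symmetric]) simp
          have F: "F l = E * \<epsilon> * l powr (s - 1 - 1)"
            using False l by (simp add: F_def)
          show ?thesis
            unfolding F e[symmetric] E_def by (simp only: mult_ac)
        qed
        finally show ?thesis .
      qed
    qed (use J K \<kappa>(1) \<epsilon> in auto)
    thus ?thesis using \<kappa>(1) by (simp add: J)
  qed
  thus ?thesis using K by blast
qed

section \<open>Error bounds for the full range of smoothness\<close>

lemma norm_le_add_norm_diff:
  fixes x y :: "'a::real_normed_vector"
  shows "norm y \<le> p \<Longrightarrow> norm (x - y) \<le> q \<Longrightarrow> norm x \<le> p + q"
  by (rule order_trans[OF norm_triangle_sub add_mono])

lemma diag_powr_add:
  assumes "orthonormal_set B"
  shows "diag B (\<lambda>b. t b powr p) (diag B (\<lambda>b. t b powr q) g) = diag B (\<lambda>b. t b powr (p + q)) g"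
  by (simp add: diag_diag[OF assms] powr_add)

lemma norm_diag_powr_le:
  assumes "orthonormal_set B" "\<And>b. b \<in> B \<Longrightarrow> 0 < t b" "\<And>b. b \<in> B \<Longrightarrow> t b \<le> tm" "0 \<le> p"
  shows "norm (diag B (\<lambda>b. t b powr p) g) \<le> tm powr p * norm g"
  using assms by (intro norm_diag_le[OF assms(1)]) (auto intro: powr_mono2 less_imp_le)

text \<open>\<eta> stands for the time step and \<epsilon> for the squared mesh size;
  \<open>\<epsilon> \<le> c1 * \<eta>\<close> lets \<eta> absorb the subcritical rate in \<epsilon>.
  For \<sigma> > 1 the surplus power \<sigma> - 1 is put into the vector \<open>g1\<close>, a
  bounded change, and the case \<sigma> = 1 applies.\<close>

lemma diag_powr_error:
  assumes s: "0 < s" "s < 1" and \<sigma>: "0 \<le> \<sigma>" and D: "0 < D" and tm: "0 < tm" and c1: "0 < c1"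
  shows "\<exists>K>0. \<forall>A \<nu> B t \<epsilon> \<eta>. \<forall>g::'a::real_inner.
    0 < \<epsilon> \<and> \<epsilon> \<le> 1 \<and> \<epsilon> \<le> c1 * \<eta> \<and> diag_close A \<nu> B t (D * \<epsilon>) \<and> g \<in> span B \<and> (\<forall>b\<in>B. t b \<le> tm) \<longrightarrow>
    norm (diag A (\<lambda>a. \<nu> a powr s) (diag B (\<lambda>b. t b powr \<sigma>) g) - diag B (\<lambda>b. t b powr s) (diag B (\<lambda>b. t b powr \<sigma>) g))
      \<le> K * (\<eta> powr (s + \<sigma>) + \<epsilon> * (if s + \<sigma> = 1 then 1 + ln (1 / \<epsilon>) else 1)) * norm g"
    (is "\<exists>K>0. \<forall>A \<nu> B t \<epsilon> \<eta>. \<forall>g. ?P A B \<nu> t \<epsilon> \<eta> g \<longrightarrow> ?e A B \<nu> t g \<le> K * (?h \<eta> + ?l \<epsilon>) * norm g")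
proof -
  consider "s + \<sigma> < 1" | "s + \<sigma> = 1" | "1 < s + \<sigma>" "\<sigma> \<le> 1" | "1 < \<sigma>" by linarith
  thus ?thesis
  proof cases
    case 1
    obtain \<Omega> where \<Omega>: "0 < \<Omega>" "\<And>A \<nu> B t \<epsilon>. \<And>g::'a. 0 < \<epsilon> \<Longrightarrow> diag_close A \<nu> B t (D * \<epsilon>) \<Longrightarrow> g \<in> span B \<Longrightarrow>
      norm (diag B (\<lambda>b. t b powr \<sigma>) g - diag A (\<lambda>a. \<nu> a powr \<sigma>) g) \<le> \<Omega> * \<epsilon> powr \<sigma> * norm g"
      using diag_powr_diff[of \<sigma> D, where 'a = 'a] \<sigma> s 1 D by auto
    obtain K where K: "0 < K" "\<And>A \<nu> B t \<epsilon>. \<And>g::'a. 0 < \<epsilon> \<Longrightarrow> diag_close A \<nu> B t (D * \<epsilon>) \<Longrightarrow> g \<in> span B \<Longrightarrow>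
      ?e A B \<nu> t g \<le> K * \<epsilon> powr (s + \<sigma>) * norm g"
      using diag_powr_diff_subcritical[OF s \<sigma> 1 D \<Omega>(1), where 'a = 'a] \<Omega>(2) by blast
    have "?e A B \<nu> t g \<le> (K * c1 powr (s + \<sigma>)) * (?h \<eta> + ?l \<epsilon>) * norm g" if P: "?P A B \<nu> t \<epsilon> \<eta> g" for A B \<nu> t \<epsilon> \<eta> g
    proof -
      have \<eta>: "0 < \<eta>"
        using P c1 by (meson order_less_le_trans zero_less_mult_pos)
      have "\<epsilon> powr (s + \<sigma>) \<le> (c1 * \<eta>) powr (s + \<sigma>)"
        using P s \<sigma> by (intro powr_mono2) auto
      also have "\<dots> = c1 powr (s + \<sigma>) * \<eta> powr (s + \<sigma>)"
        using c1 \<eta> by (simp add: powr_mult)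
      also have "\<dots> \<le> c1 powr (s + \<sigma>) * (?h \<eta> + ?l \<epsilon>)"
        using P 1 by (intro mult_left_mono) auto
      finally have "K * \<epsilon> powr (s + \<sigma>) * norm g \<le> K * (c1 powr (s + \<sigma>) * (?h \<eta> + ?l \<epsilon>)) * norm g"
        using K(1) by (intro mult_right_mono mult_left_mono) auto
      moreover have "?e A B \<nu> t g \<le> K * \<epsilon> powr (s + \<sigma>) * norm g"
        using P by (intro K(2)) auto
      ultimately show ?thesis
        by (simp only: mult.assoc)
    qed
    thus ?thesis using K(1) c1 by (intro exI[of _ "K * c1 powr (s + \<sigma>)"]) auto
  next
    case 2
    obtain K where K: "0 < K" "\<And>A \<nu> B t \<epsilon>. \<And>g::'a. 0 < \<epsilon> \<Longrightarrow> \<epsilon> \<le> 1 \<Longrightarrow> diag_close A \<nu> B t (D * \<epsilon>) \<Longrightarrow> g \<in> span B \<Longrightarrow>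
      (\<forall>b\<in>B. t b \<le> tm) \<Longrightarrow> ?e A B \<nu> t g \<le> K * \<epsilon> * (1 + ln (1 / \<epsilon>)) * norm g"
      using diag_powr_diff_critical[OF s 2 D tm, where 'a = 'a] by blast
    have "?e A B \<nu> t g \<le> K * (?h \<eta> + ?l \<epsilon>) * norm g" if P: "?P A B \<nu> t \<epsilon> \<eta> g" for A B \<nu> t \<epsilon> \<eta> g
    proof -
      have "K * \<epsilon> * (1 + ln (1 / \<epsilon>)) * norm g = K * ?l \<epsilon> * norm g"
        using 2 by (simp add: mult.assoc)
      also have "\<dots> \<le> K * (?h \<eta> + ?l \<epsilon>) * norm g"
        using K(1) by (intro mult_right_mono mult_left_mono) auto
      finally show ?thesis
        using K(2)[of \<epsilon> A \<nu> B t g] P by linarith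
    qed
    thus ?thesis using K(1) by blast
  next
    case 3
    obtain K where K: "0 < K" "\<And>A \<nu> B t \<epsilon>. \<And>g::'a. 0 < \<epsilon> \<Longrightarrow> diag_close A \<nu> B t (D * \<epsilon>) \<Longrightarrow>
      (\<forall>b\<in>B. t b \<le> tm) \<Longrightarrow> ?e A B \<nu> t g \<le> K * \<epsilon> * norm g"
      using diag_powr_diff_supercritical[OF s 3 D tm, where 'a = 'a] by blast
    have "?e A B \<nu> t g \<le> K * (?h \<eta> + ?l \<epsilon>) * norm g" if P: "?P A B \<nu> t \<epsilon> \<eta> g" for A B \<nu> t \<epsilon> \<eta> g
    proof -
      have "K * \<epsilon> * norm g \<le> K * (?h \<eta> + ?l \<epsilon>) * norm g"
        using K(1) 3 by (intro mult_right_mono mult_left_mono) auto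
      thus ?thesis
        using K(2)[of \<epsilon> A \<nu> B t g] P by linarith
    qed
    thus ?thesis using K(1) by blast
  next
    case 4
    have s1: "1 < s + 1" using s by simp
    obtain K where K: "0 < K" "\<And>A \<nu> B t \<epsilon>. \<And>g::'a. 0 < \<epsilon> \<Longrightarrow> diag_close A \<nu> B t (D * \<epsilon>) \<Longrightarrow>
      (\<forall>b\<in>B. t b \<le> tm) \<Longrightarrow>
      norm (diag A (\<lambda>a. \<nu> a powr s) (diag B (\<lambda>b. t b powr 1) g) - diag B (\<lambda>b. t b powr s) (diag B (\<lambda>b. t b powr 1) g)) \<le> K * \<epsilon> * norm g"
      using diag_powr_diff_supercritical[OF s s1 order_refl D tm, where 'a = 'a] by blast
    have "?e A B \<nu> t g \<le> (K * tm powr (\<sigma> - 1)) * (?h \<eta> + ?l \<epsilon>) * norm g" if P: "?P A B \<nu> t \<epsilon> \<eta> g" for A B \<nu> t \<epsilon> \<eta> g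
    proof -
      have close: "diag_close A \<nu> B t (D * \<epsilon>)" using P by blast
      note C = diag_closeD[OF close]
      define g1 where "g1 = diag B (\<lambda>b. t b powr (\<sigma> - 1)) g"
      have "diag B (\<lambda>b. t b powr \<sigma>) g = diag B (\<lambda>b. t b powr 1) g1"
        unfolding g1_def diag_powr_add[OF C(2)] by simp
      hence "?e A B \<nu> t g \<le> K * \<epsilon> * norm g1"
        using K(2)[of \<epsilon> A \<nu> B t g1] P by simp
      also have "\<dots> \<le> K * \<epsilon> * (tm powr (\<sigma> - 1) * norm g)"
        unfolding g1_def using K(1) P 4 by (intro mult_left_mono norm_diag_powr_le C) auto
      also have "\<dots> = (K * tm powr (\<sigma> - 1)) * \<epsilon> * norm g" by simp
      also have "\<dots> \<le> (K * tm powr (\<sigma> - 1)) * (?h \<eta> + ?l \<epsilon>) * norm g"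
        using K(1) s 4 by (intro mult_right_mono mult_left_mono) auto
      finally show ?thesis .
    qed
    thus ?thesis using K(1) tm by (intro exI[of _ "K * tm powr (\<sigma> - 1)"]) auto
  qed
qed

text \<open>For \<sigma> \<le> 1 the powers are exchanged at once, and the error
  \<open>\<epsilon> powr \<sigma>\<close> meets \<open>e\<close>, of size
  \<open>\<eta> powr s\<close>. For \<sigma> > 1 one factor \<open>T\<close> is exchanged first,
  which costs a multiple of \<epsilon>; the remaining power \<sigma> - 1 is exchanged behind
  \<open>e a * \<nu> a\<close>, of size \<open>\<eta> powr (s + 1)\<close>, so that the total is
  again \<open>\<eta> powr (s + \<sigma>)\<close>.\<close>

lemma diag_remainder_error:
  assumes s: "0 < s" and \<sigma>: "0 \<le> \<sigma>" "\<sigma> \<le> 2" and D: "0 < D" and tm: "0 < tm" and nm: "0 < nm"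
    and c1: "0 < c1" and \<eta>m: "0 < \<eta>m" and C: "0 < C"
  shows "\<exists>K>0. \<forall>A \<nu> B t \<epsilon> \<eta> e. \<forall>g::'a::real_inner.
    0 < \<epsilon> \<and> \<epsilon> \<le> c1 * \<eta> \<and> \<eta> \<le> \<eta>m \<and> diag_close A \<nu> B t (D * \<epsilon>) \<and> g \<in> span B \<and>
    (\<forall>b\<in>B. t b \<le> tm) \<and> (\<forall>a\<in>A. \<nu> a \<le> nm) \<and>
    (\<forall>a\<in>A. \<bar>e a\<bar> \<le> C * \<eta> powr s * min 1 (\<eta> / \<nu> a) powr \<sigma> + C * \<eta> powr (s + \<sigma>)) \<longrightarrow>
    norm (diag A e (diag B (\<lambda>b. t b powr \<sigma>) g)) \<le> K * (\<eta> powr (s + \<sigma>) + \<epsilon>) * norm g"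
    (is "\<exists>K>0. \<forall>A \<nu> B t \<epsilon> \<eta> e. \<forall>g. ?P A B \<nu> t \<epsilon> \<eta> e g \<longrightarrow> norm (?x A B t e g) \<le> K * (?h \<eta> + \<epsilon>) * norm g")
proof -
  \<comment> \<open>Multiplied by \<sigma>, 0 or 1 powers of the eigenvalue, \<open>e\<close> gains
    as many powers of \<eta>.\<close>
  have e: "\<bar>e * \<nu> powr \<sigma>\<bar> \<le> C * (1 + nm powr \<sigma>) * \<eta> powr (s + \<sigma>)"
      "\<bar>e\<bar> \<le> C * (1 + \<eta>m powr \<sigma>) * \<eta> powr s"
      "1 \<le> \<sigma> \<Longrightarrow> \<bar>e * \<nu>\<bar> \<le> C * (1 + nm * \<eta>m powr (\<sigma> - 1)) * \<eta> powr (s + 1)"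
    if h: "0 < \<nu>" "\<nu> \<le> nm" "0 < \<eta>" "\<eta> \<le> \<eta>m"
      and e: "\<bar>e\<bar> \<le> C * \<eta> powr s * min 1 (\<eta> / \<nu>) powr \<sigma> + C * \<eta> powr (s + \<sigma>)" for e \<nu> \<eta> :: real
  proof -
    have m: "0 < min 1 (\<eta> / \<nu>)" "min 1 (\<eta> / \<nu>) \<le> 1" "min 1 (\<eta> / \<nu>) \<le> \<eta> / \<nu>" using h by auto
    have "min 1 (\<eta> / \<nu>) powr \<sigma> * \<nu> powr \<sigma> \<le> (\<eta> / \<nu>) powr \<sigma> * \<nu> powr \<sigma>"
      using m \<sigma> by (intro mult_right_mono powr_mono2) auto
    also have "\<dots> = \<eta> powr \<sigma>" using h by (simp add: powr_divide)
    finally have 1: "min 1 (\<eta> / \<nu>) powr \<sigma> * \<nu> powr \<sigma> \<le> \<eta> powr \<sigma>" .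
    have 2: "\<nu> powr \<sigma> \<le> nm powr \<sigma>" "\<eta> powr \<sigma> \<le> \<eta>m powr \<sigma>" using h \<sigma> by (auto intro: powr_mono2)
    have 3: "min 1 (\<eta> / \<nu>) powr \<sigma> \<le> 1" using m \<sigma> by (intro powr_le1) auto
    have "\<bar>e * \<nu> powr \<sigma>\<bar> \<le> (C * \<eta> powr s * min 1 (\<eta> / \<nu>) powr \<sigma> + C * \<eta> powr (s + \<sigma>)) * \<nu> powr \<sigma>"
      unfolding abs_mult using e by (simp add: mult_right_mono)
    also have "\<dots> = C * (\<eta> powr s * (min 1 (\<eta> / \<nu>) powr \<sigma> * \<nu> powr \<sigma>) + \<eta> powr (s + \<sigma>) * \<nu> powr \<sigma>)"
      by (simp add: algebra_simps)
    also have "\<dots> \<le> C * (\<eta> powr s * \<eta> powr \<sigma> + \<eta> powr (s + \<sigma>) * nm powr \<sigma>)"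
      using 1 2 C by (intro mult_left_mono add_mono) auto
    also have "\<dots> = C * (1 + nm powr \<sigma>) * \<eta> powr (s + \<sigma>)"
      by (simp add: powr_add algebra_simps)
    finally show "\<bar>e * \<nu> powr \<sigma>\<bar> \<le> C * (1 + nm powr \<sigma>) * \<eta> powr (s + \<sigma>)" .
    have "\<bar>e\<bar> \<le> C * \<eta> powr s * 1 + C * (\<eta> powr s * \<eta>m powr \<sigma>)"
    proof (rule order_trans[OF e], intro add_mono mult_left_mono)
      show "\<eta> powr (s + \<sigma>) \<le> \<eta> powr s * \<eta>m powr \<sigma>"
        unfolding powr_add using 2 by (intro mult_left_mono) auto
    qed (use C 3 in auto)
    thus "\<bar>e\<bar> \<le> C * (1 + \<eta>m powr \<sigma>) * \<eta> powr s" by (simp add: algebra_simps)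
    assume \<sigma>1: "1 \<le> \<sigma>"
    have "min 1 (\<eta> / \<nu>) powr \<sigma> * \<nu> \<le> min 1 (\<eta> / \<nu>) powr 1 * \<nu>"
      using m \<sigma>1 h by (intro mult_right_mono powr_mono') auto
    also have "\<dots> \<le> (\<eta> / \<nu>) * \<nu>"
      using m h by (intro mult_right_mono) auto
    finally have 4: "min 1 (\<eta> / \<nu>) powr \<sigma> * \<nu> \<le> \<eta>" using h by simp
    have "\<eta> powr (\<sigma> - 1) \<le> \<eta>m powr (\<sigma> - 1)" using h \<sigma>1 by (intro powr_mono2) auto
    hence "\<eta> powr (s + 1) * \<eta> powr (\<sigma> - 1) \<le> \<eta> powr (s + 1) * \<eta>m powr (\<sigma> - 1)" by (rule mult_left_mono) simp
    hence 5: "\<eta> powr (s + \<sigma>) \<le> \<eta> powr (s + 1) * \<eta>m powr (\<sigma> - 1)" by (simp add: powr_add[symmetric])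
    have "\<bar>e * \<nu>\<bar> \<le> (C * \<eta> powr s * min 1 (\<eta> / \<nu>) powr \<sigma> + C * \<eta> powr (s + \<sigma>)) * \<nu>"
      unfolding abs_mult using e h by (simp add: mult_right_mono)
    also have "\<dots> = C * (\<eta> powr s * (min 1 (\<eta> / \<nu>) powr \<sigma> * \<nu>) + \<eta> powr (s + \<sigma>) * \<nu>)"
      by (simp add: algebra_simps)
    also have "\<dots> \<le> C * (\<eta> powr s * \<eta> + (\<eta> powr (s + 1) * \<eta>m powr (\<sigma> - 1)) * nm)"
      using 4 5 h C by (intro mult_left_mono add_mono mult_mono) auto
    also have "\<dots> = C * (1 + nm * \<eta>m powr (\<sigma> - 1)) * \<eta> powr (s + 1)"
      using h by (simp add: powr_add algebra_simps)
    finally show "\<bar>e * \<nu>\<bar> \<le> C * (1 + nm * \<eta>m powr (\<sigma> - 1)) * \<eta> powr (s + 1)" .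
  qed
  define C1 C2 C3 where "C1 = C * (1 + nm powr \<sigma>)" and "C2 = C * (1 + \<eta>m powr \<sigma>)"
    and "C3 = C * (1 + nm * \<eta>m powr (\<sigma> - 1))"
  have Cp: "0 < C1" "0 < C2" "0 < C3"
    using C nm \<eta>m by (auto simp: C1_def C2_def C3_def intro!: mult_pos_pos add_pos_nonneg)
  have \<eta>: "0 < \<eta>" if "?P A B \<nu> t \<epsilon> \<eta> e g" for A B \<nu> t \<epsilon> \<eta> e g
    using that c1 by (meson order_less_le_trans zero_less_mult_pos)
  have \<epsilon>p: "\<epsilon> powr p \<le> c1 powr p * \<eta> powr p" if "0 < \<epsilon>" "0 < \<eta>" "\<epsilon> \<le> c1 * \<eta>" "0 \<le> p" for \<epsilon> \<eta> p
    using that c1 powr_mono2[of p \<epsilon> "c1 * \<eta>"] by (simp add: powr_mult)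
  show ?thesis
  proof (cases "\<sigma> \<le> 1")
    case True
    obtain \<Omega> where \<Omega>: "0 < \<Omega>" "\<And>A \<nu> B t \<epsilon>. \<And>g::'a. 0 < \<epsilon> \<Longrightarrow> diag_close A \<nu> B t (D * \<epsilon>) \<Longrightarrow> g \<in> span B \<Longrightarrow>
      norm (diag B (\<lambda>b. t b powr \<sigma>) g - diag A (\<lambda>a. \<nu> a powr \<sigma>) g) \<le> \<Omega> * \<epsilon> powr \<sigma> * norm g"
      using diag_powr_diff[OF \<sigma>(1) True D, where 'a = 'a] by auto
    define K where "K = C1 + C2 * \<Omega> * c1 powr \<sigma>"
    have K: "0 < K" using Cp \<Omega>(1) c1 by (auto simp: K_def intro!: add_pos_pos)
    have "norm (?x A B t e g) \<le> K * (?h \<eta> + \<epsilon>) * norm g" if P: "?P A B \<nu> t \<epsilon> \<eta> e g" for A B \<nu> t \<epsilon> \<eta> e g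
    proof -
      have close: "diag_close A \<nu> B t (D * \<epsilon>)" using P by blast
      note D = diag_closeD[OF close]
      have "norm (diag A e (diag A (\<lambda>a. \<nu> a powr \<sigma>) g)) \<le> C1 * \<eta> powr (s + \<sigma>) * norm g"
        unfolding diag_diag[OF D(1)] C1_def
        by (intro norm_diag_le[OF D(1)] e(1)) (use P C \<eta>[OF P] D(3) in auto)
      moreover have "norm (diag A e (diag B (\<lambda>b. t b powr \<sigma>) g - diag A (\<lambda>a. \<nu> a powr \<sigma>) g))
          \<le> C2 * \<eta> powr s * (\<Omega> * (c1 powr \<sigma> * \<eta> powr \<sigma>) * norm g)"
      proof (rule order_trans[OF norm_diag_le[OF D(1)]])
        show "C2 * \<eta> powr s * norm (diag B (\<lambda>b. t b powr \<sigma>) g - diag A (\<lambda>a. \<nu> a powr \<sigma>) g)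
          \<le> C2 * \<eta> powr s * (\<Omega> * (c1 powr \<sigma> * \<eta> powr \<sigma>) * norm g)"
          using P \<eta>[OF P] \<Omega> Cp \<sigma>
          by (intro mult_left_mono order_trans[OF \<Omega>(2)[OF _ close]] mult_right_mono \<epsilon>p) auto
        show "\<bar>e a\<bar> \<le> C2 * \<eta> powr s" if "a \<in> A" for a
          unfolding C2_def using P \<eta>[OF P] D(3) that by (intro e(2)[of "\<nu> a"]) auto
      qed (use Cp in auto)
      ultimately have "norm (?x A B t e g) \<le> C1 * \<eta> powr (s + \<sigma>) * norm g
          + C2 * \<eta> powr s * (\<Omega> * (c1 powr \<sigma> * \<eta> powr \<sigma>) * norm g)"
        unfolding diag_diff by (rule norm_le_add_norm_diff)
      also have "\<dots> = K * ?h \<eta> * norm g"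
        by (simp add: K_def powr_add algebra_simps)
      also have "\<dots> \<le> K * (?h \<eta> + \<epsilon>) * norm g"
        using K P by (intro mult_right_mono mult_left_mono) auto
      finally show ?thesis .
    qed
    thus ?thesis using K by blast
  next
    case False
    hence \<sigma>1: "0 \<le> \<sigma> - 1" "\<sigma> - 1 \<le> 1" "1 \<le> \<sigma>" using \<sigma> by auto
    obtain \<Omega> where \<Omega>: "0 < \<Omega>" "\<And>A \<nu> B t \<epsilon>. \<And>g::'a. 0 < \<epsilon> \<Longrightarrow> diag_close A \<nu> B t (D * \<epsilon>) \<Longrightarrow> g \<in> span B \<Longrightarrow>
      norm (diag B (\<lambda>b. t b powr (\<sigma> - 1)) g - diag A (\<lambda>a. \<nu> a powr (\<sigma> - 1)) g) \<le> \<Omega> * \<epsilon> powr (\<sigma> - 1) * norm g"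
      using diag_powr_diff[OF \<sigma>1(1,2) D, where 'a = 'a] by auto
    define K1 where "K1 = C1 + C3 * \<Omega> * c1 powr (\<sigma> - 1)"
    define K2 where "K2 = C2 * \<eta>m powr s * D * tm powr (\<sigma> - 1)"
    have K: "0 < K1" "0 < K2"
      using Cp \<Omega>(1) c1 \<eta>m D tm by (auto simp: K1_def K2_def intro!: add_pos_pos)
    have "norm (?x A B t e g) \<le> (K1 + K2) * (?h \<eta> + \<epsilon>) * norm g" if P: "?P A B \<nu> t \<epsilon> \<eta> e g" for A B \<nu> t \<epsilon> \<eta> e g
    proof -
      have close: "diag_close A \<nu> B t (D * \<epsilon>)" using P by blast
      note DC = diag_closeD[OF close]
      define g1 where "g1 = diag B (\<lambda>b. t b powr (\<sigma> - 1)) g"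
      have g1: "diag B (\<lambda>b. t b powr \<sigma>) g = diag B t g1"
        unfolding g1_def diag_diag[OF DC(2)]
        by (intro diag_cong) (auto dest!: DC(4) simp: powr_mult_base)
      have "norm (diag A (\<lambda>a. e a * \<nu> a) (diag A (\<lambda>a. \<nu> a powr (\<sigma> - 1)) g)) \<le> C1 * \<eta> powr (s + \<sigma>) * norm g"
      proof -
        have "diag A (\<lambda>a. e a * \<nu> a) (diag A (\<lambda>a. \<nu> a powr (\<sigma> - 1)) g) = diag A (\<lambda>a. e a * \<nu> a powr \<sigma>) g"
          unfolding diag_diag[OF DC(1)] by (intro diag_cong) (auto dest!: DC(3) simp: powr_mult_base)
        thus ?thesis
          unfolding C1_def by (simp only:) (intro norm_diag_le[OF DC(1)] e(1); use P C \<eta>[OF P] DC(3) in auto)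
      qed
      moreover have "norm (diag A (\<lambda>a. e a * \<nu> a) (g1 - diag A (\<lambda>a. \<nu> a powr (\<sigma> - 1)) g))
          \<le> C3 * \<eta> powr (s + 1) * (\<Omega> * (c1 powr (\<sigma> - 1) * \<eta> powr (\<sigma> - 1)) * norm g)"
      proof (rule order_trans[OF norm_diag_le[OF DC(1)]])
        show "C3 * \<eta> powr (s + 1) * norm (g1 - diag A (\<lambda>a. \<nu> a powr (\<sigma> - 1)) g)
          \<le> C3 * \<eta> powr (s + 1) * (\<Omega> * (c1 powr (\<sigma> - 1) * \<eta> powr (\<sigma> - 1)) * norm g)"
          unfolding g1_def using P \<eta>[OF P] \<Omega> Cp \<sigma>1
          by (intro mult_left_mono order_trans[OF \<Omega>(2)[OF _ close]] mult_right_mono \<epsilon>p) auto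
        show "\<bar>e a * \<nu> a\<bar> \<le> C3 * \<eta> powr (s + 1)" if "a \<in> A" for a
          unfolding C3_def using P \<eta>[OF P] DC(3) that \<sigma>1 by (intro e(3)[of "\<nu> a"]) auto
      qed (use Cp in auto)
      ultimately have "norm (diag A (\<lambda>a. e a * \<nu> a) g1) \<le> C1 * \<eta> powr (s + \<sigma>) * norm g
          + C3 * \<eta> powr (s + 1) * (\<Omega> * (c1 powr (\<sigma> - 1) * \<eta> powr (\<sigma> - 1)) * norm g)"
        unfolding diag_diff by (rule norm_le_add_norm_diff)
      also have "\<dots> = K1 * ?h \<eta> * norm g"
      proof -
        have "\<eta> powr (s + 1) * \<eta> powr (\<sigma> - 1) = \<eta> powr (s + \<sigma>)" by (simp add: powr_add[symmetric])
        thus ?thesis by (simp add: K1_def algebra_simps)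
      qed
      finally have 1: "norm (diag A e (diag A \<nu> g1)) \<le> K1 * ?h \<eta> * norm g"
        by (simp add: diag_diag[OF DC(1)])
      have "norm (diag A e (diag B t g1 - diag A \<nu> g1)) \<le> C2 * \<eta>m powr s * (D * \<epsilon> * (tm powr (\<sigma> - 1) * norm g))"
      proof (rule order_trans[OF norm_diag_le[OF DC(1)]])
        show "C2 * \<eta>m powr s * norm (diag B t g1 - diag A \<nu> g1) \<le> C2 * \<eta>m powr s * (D * \<epsilon> * (tm powr (\<sigma> - 1) * norm g))"
        proof (rule mult_left_mono)
          have "norm (diag A \<nu> g1 - diag B t g1) \<le> D * \<epsilon> * norm g1"
            unfolding g1_def by (intro DC(5) diag_in_span)
          also have "\<dots> \<le> D * \<epsilon> * (tm powr (\<sigma> - 1) * norm g)"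
            unfolding g1_def using P D \<sigma>1 by (intro mult_left_mono norm_diag_powr_le DC) auto
          finally show "norm (diag B t g1 - diag A \<nu> g1) \<le> D * \<epsilon> * (tm powr (\<sigma> - 1) * norm g)"
            by (simp only: norm_minus_commute)
        qed (use Cp in auto)
        show "\<bar>e a\<bar> \<le> C2 * \<eta>m powr s" if "a \<in> A" for a
        proof -
          have "\<bar>e a\<bar> \<le> C2 * \<eta> powr s"
            unfolding C2_def using P \<eta>[OF P] DC(3) that by (intro e(2)[of "\<nu> a"]) auto
          also have "\<dots> \<le> C2 * \<eta>m powr s"
            using Cp P \<eta>[OF P] s by (intro mult_left_mono powr_mono2) auto
          finally show ?thesis .
        qed
      qed (use Cp in auto)
      also have "\<dots> = K2 * \<epsilon> * norm g" by (simp add: K2_def)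
      finally have "norm (diag A e (diag B t g1)) \<le> K1 * ?h \<eta> * norm g + K2 * \<epsilon> * norm g"
        unfolding diag_diff by (rule norm_le_add_norm_diff[OF 1])
      also have "\<dots> \<le> (K1 + K2) * (?h \<eta> + \<epsilon>) * norm g"
      proof -
        have "0 \<le> (K1 * \<epsilon> + K2 * ?h \<eta>) * norm g" using K P by (intro mult_nonneg_nonneg) auto
        thus ?thesis by (simp add: algebra_simps)
      qed
      finally show ?thesis unfolding g1 .
    qed
    moreover have "0 < K1 + K2" using K by simp
    ultimately show ?thesis by blast
  qed
qed

text \<open>\<open>G\<close> of the discrete operator is \<open>S powr s\<close> plus a remainder
  that carries the error of scheme and quadrature. The logarithm comes from the comparison of
  \<open>S powr s\<close> with \<open>T powr s\<close> alone.\<close>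

theorem diag_functional_error:
  assumes s: "0 < s" "s < 1" and \<sigma>: "0 \<le> \<sigma>" "\<sigma> \<le> 2" and D: "0 < D" and tm: "0 < tm" and nm: "0 < nm"
    and c1: "0 < c1" and \<eta>m: "0 < \<eta>m" and C: "0 < C"
  shows "\<exists>K>0. \<forall>A \<nu> B t \<epsilon> \<eta> G. \<forall>g::'a::real_inner.
    0 < \<epsilon> \<and> \<epsilon> \<le> 1 \<and> \<epsilon> \<le> c1 * \<eta> \<and> \<eta> \<le> \<eta>m \<and> diag_close A \<nu> B t (D * \<epsilon>) \<and> g \<in> span B \<and>
    (\<forall>b\<in>B. t b \<le> tm) \<and> (\<forall>a\<in>A. \<nu> a \<le> nm) \<and>
    (\<forall>a\<in>A. \<bar>G a - \<nu> a powr s\<bar> \<le> C * \<eta> powr s * min 1 (\<eta> / \<nu> a) powr \<sigma> + C * \<eta> powr (s + \<sigma>)) \<longrightarrow>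
    norm (diag A G (diag B (\<lambda>b. t b powr \<sigma>) g) - diag B (\<lambda>b. t b powr s) (diag B (\<lambda>b. t b powr \<sigma>) g))
      \<le> K * (\<eta> powr (s + \<sigma>) + \<epsilon> * (if s + \<sigma> = 1 then 1 + ln (1 / \<epsilon>) else 1)) * norm g"
proof -
  obtain K1 where K1: "0 < K1" "\<And>A \<nu> B t \<epsilon> \<eta>. \<And>g::'a. 0 < \<epsilon> \<and> \<epsilon> \<le> 1 \<and> \<epsilon> \<le> c1 * \<eta> \<and> diag_close A \<nu> B t (D * \<epsilon>) \<and>
      g \<in> span B \<and> (\<forall>b\<in>B. t b \<le> tm) \<Longrightarrow>
      norm (diag A (\<lambda>a. \<nu> a powr s) (diag B (\<lambda>b. t b powr \<sigma>) g) - diag B (\<lambda>b. t b powr s) (diag B (\<lambda>b. t b powr \<sigma>) g))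
      \<le> K1 * (\<eta> powr (s + \<sigma>) + \<epsilon> * (if s + \<sigma> = 1 then 1 + ln (1 / \<epsilon>) else 1)) * norm g"
    using diag_powr_error[OF s \<sigma>(1) D tm c1, where 'a = 'a] by blast
  obtain K2 where K2: "0 < K2" "\<And>A \<nu> B t \<epsilon> \<eta> e. \<And>g::'a. 0 < \<epsilon> \<and> \<epsilon> \<le> c1 * \<eta> \<and> \<eta> \<le> \<eta>m \<and> diag_close A \<nu> B t (D * \<epsilon>) \<and>
      g \<in> span B \<and> (\<forall>b\<in>B. t b \<le> tm) \<and> (\<forall>a\<in>A. \<nu> a \<le> nm) \<and>
      (\<forall>a\<in>A. \<bar>e a\<bar> \<le> C * \<eta> powr s * min 1 (\<eta> / \<nu> a) powr \<sigma> + C * \<eta> powr (s + \<sigma>)) \<Longrightarrow>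
      norm (diag A e (diag B (\<lambda>b. t b powr \<sigma>) g)) \<le> K2 * (\<eta> powr (s + \<sigma>) + \<epsilon>) * norm g"
    using diag_remainder_error[OF s(1) \<sigma> D tm nm c1 \<eta>m C, where 'a = 'a] by blast
  show ?thesis
  proof (intro exI[of _ "K1 + K2"] conjI allI impI)
    fix A B :: "'a set" and \<nu> t :: "'a \<Rightarrow> real" and \<epsilon> \<eta> :: real and G :: "'a \<Rightarrow> real" and g :: 'a
    let ?x = "diag B (\<lambda>b. t b powr \<sigma>) g" and ?L = "if s + \<sigma> = 1 then 1 + ln (1 / \<epsilon>) else 1"
    assume P: "0 < \<epsilon> \<and> \<epsilon> \<le> 1 \<and> \<epsilon> \<le> c1 * \<eta> \<and> \<eta> \<le> \<eta>m \<and> diag_close A \<nu> B t (D * \<epsilon>) \<and> g \<in> span B \<and>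
      (\<forall>b\<in>B. t b \<le> tm) \<and> (\<forall>a\<in>A. \<nu> a \<le> nm) \<and>
      (\<forall>a\<in>A. \<bar>G a - \<nu> a powr s\<bar> \<le> C * \<eta> powr s * min 1 (\<eta> / \<nu> a) powr \<sigma> + C * \<eta> powr (s + \<sigma>))"
    have split: "diag A G ?x = diag A (\<lambda>a. G a - \<nu> a powr s) ?x + diag A (\<lambda>a. \<nu> a powr s) ?x"
      by (simp add: diag_fun_diff)
    have L: "1 \<le> ?L" using P by (simp add: ln_div)
    have "norm (diag A (\<lambda>a. G a - \<nu> a powr s) ?x) \<le> K2 * (\<eta> powr (s + \<sigma>) + \<epsilon>) * norm g"
      using P by (intro K2(2)[of \<epsilon> \<eta> A \<nu> B t]) blast
    also have "\<dots> \<le> K2 * (\<eta> powr (s + \<sigma>) + \<epsilon> * ?L) * norm g"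
      using K2(1) P L by (intro mult_right_mono mult_left_mono add_left_mono) (auto simp del: if_split)
    finally have "norm (diag A (\<lambda>a. G a - \<nu> a powr s) ?x) \<le> K2 * (\<eta> powr (s + \<sigma>) + \<epsilon> * ?L) * norm g" .
    moreover have "norm (diag A (\<lambda>a. \<nu> a powr s) ?x - diag B (\<lambda>b. t b powr s) ?x) \<le> K1 * (\<eta> powr (s + \<sigma>) + \<epsilon> * ?L) * norm g"
      using P by (intro K1(2)[of \<epsilon> \<eta> A \<nu> B t]) blast
    ultimately have "norm (diag A G ?x - diag B (\<lambda>b. t b powr s) ?x)
      \<le> K2 * (\<eta> powr (s + \<sigma>) + \<epsilon> * ?L) * norm g + K1 * (\<eta> powr (s + \<sigma>) + \<epsilon> * ?L) * norm g"
      unfolding split add_diff_eq[symmetric] by (intro order_trans[OF norm_triangle_ineq] add_mono)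
    thus "norm (diag A G ?x - diag B (\<lambda>b. t b powr s) ?x) \<le> (K1 + K2) * (\<eta> powr (s + \<sigma>) + \<epsilon> * ?L) * norm g"
      by (simp only: distrib_right add.commute)
  qed (use K1 K2 in auto)
qed

section \<open>Square-integrable functions\<close>

lemma square_integrable_measurable: "square_integrable M u \<Longrightarrow> u \<in> borel_measurable M"
  by (simp add: square_integrable_def)

lemma square_integrable_integrable:
  "square_integrable M u \<Longrightarrow> integrable M (\<lambda>x. (norm (u x))\<^sup>2)"
  by (simp add: square_integrable_def)

lemma integrable_inner:
  fixes u v :: "'a \<Rightarrow> 'b::euclidean_space"
  assumes u: "square_integrable M u" and v: "square_integrable M v"
  shows "integrable M (\<lambda>x. u x \<bullet> v x)"
proof (rule Bochner_Integration.integrable_bound)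
  show "integrable M (\<lambda>x. (norm (u x))\<^sup>2 + (norm (v x))\<^sup>2)"
    using u v by (simp add: square_integrable_def)
  show "(\<lambda>x. u x \<bullet> v x) \<in> borel_measurable M"
    using u v by (auto simp: square_integrable_def)
  show "AE x in M. norm (u x \<bullet> v x) \<le> norm ((norm (u x))\<^sup>2 + (norm (v x))\<^sup>2)"
  proof (rule AE_I2)
    fix x
    have "\<bar>u x \<bullet> v x\<bar> \<le> norm (u x) * norm (v x)" by (rule Cauchy_Schwarz_ineq2)
    also have "\<dots> \<le> (norm (u x))\<^sup>2 + (norm (v x))\<^sup>2"
    proof -
      have "p * q \<le> p\<^sup>2 + q\<^sup>2" for p q :: real
        using sum_squares_bound[of p q] sum_power2_ge_zero[of p q] by linarith
      thus ?thesis .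
    qed
    finally show "norm (u x \<bullet> v x) \<le> norm ((norm (u x))\<^sup>2 + (norm (v x))\<^sup>2)" by simp
  qed
qed

lemma square_integrable_add:
  fixes u v :: "'a \<Rightarrow> 'b::euclidean_space"
  assumes u: "square_integrable M u" and v: "square_integrable M v"
  shows "square_integrable M (\<lambda>x. u x + v x)"
proof -
  have "(norm (u x + v x))\<^sup>2 = (norm (u x))\<^sup>2 + 2 * (u x \<bullet> v x) + (norm (v x))\<^sup>2" for x
    by (simp add: power2_norm_eq_inner inner_add_left inner_add_right inner_commute)
  thus ?thesis
    using u v integrable_inner[OF u v] by (auto simp: square_integrable_def)
qed

lemma square_integrable_scaleR:
  "square_integrable M u \<Longrightarrow> square_integrable M (\<lambda>x. c *\<^sub>R u x)"
  by (auto simp: square_integrable_def power_mult_distrib)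

lemma square_integrable_cmult:
  "square_integrable M u \<Longrightarrow> square_integrable M (\<lambda>x. c * u x :: real)"
  using square_integrable_scaleR[of M u c] by simp

lemma square_integrable_diff:
  assumes "square_integrable M u" "square_integrable M v"
  shows "square_integrable M (\<lambda>x. u x - v x)"
  using square_integrable_add[OF assms(1) square_integrable_scaleR[OF assms(2), of "-1"]] by simp

lemma square_integrable_zero: "square_integrable M (\<lambda>x. 0)"
  by (simp add: square_integrable_def)

lemma square_integrable_sum:
  "(\<And>i. i \<in> I \<Longrightarrow> square_integrable M (u i)) \<Longrightarrow> square_integrable M (\<lambda>x. \<Sum>i\<in>I. u i x)"
  by (induction I rule: infinite_finite_induct) (auto intro: square_integrable_add square_integrable_zero)

lemma L2_inner_commute: "L2_inner M u v = L2_inner M v u"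
  by (simp add: L2_inner_def inner_commute)

lemma L2_inner_add_left:
  "square_integrable M u \<Longrightarrow> square_integrable M v \<Longrightarrow> square_integrable M w \<Longrightarrow>
    L2_inner M (\<lambda>x. u x + v x) w = L2_inner M u w + L2_inner M v w"
  by (simp add: L2_inner_def inner_add_left integrable_inner)

lemma L2_inner_diff_left:
  "square_integrable M u \<Longrightarrow> square_integrable M v \<Longrightarrow> square_integrable M w \<Longrightarrow>
    L2_inner M (\<lambda>x. u x - v x) w = L2_inner M u w - L2_inner M v w"
  by (simp add: L2_inner_def inner_diff_left integrable_inner)

lemma L2_inner_scaleR_left: "L2_inner M (\<lambda>x. c *\<^sub>R u x) w = c * L2_inner M u w"
  by (simp add: L2_inner_def)

lemma L2_inner_cmult_left: "L2_inner M (\<lambda>x. c * u x :: real) w = c * L2_inner M u w"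
  using L2_inner_scaleR_left[of M c u w] by simp

lemma L2_inner_diff_right:
  "square_integrable M u \<Longrightarrow> square_integrable M v \<Longrightarrow> square_integrable M w \<Longrightarrow>
    L2_inner M w (\<lambda>x. u x - v x) = L2_inner M w u - L2_inner M w v"
  by (simp add: L2_inner_def inner_diff_right integrable_inner)

lemma L2_inner_add_right:
  "square_integrable M u \<Longrightarrow> square_integrable M v \<Longrightarrow> square_integrable M w \<Longrightarrow>
    L2_inner M w (\<lambda>x. u x + v x) = L2_inner M w u + L2_inner M w v"
  by (simp add: L2_inner_def inner_add_right integrable_inner)

lemma L2_inner_scaleR_right: "L2_inner M w (\<lambda>x. c *\<^sub>R u x) = c * L2_inner M w u"
  by (simp add: L2_inner_def)

lemma L2_inner_sum_left:
  "(\<And>i. i \<in> I \<Longrightarrow> square_integrable M (u i)) \<Longrightarrow> square_integrable M w \<Longrightarrow>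
    L2_inner M (\<lambda>x. \<Sum>i\<in>I. u i x) w = (\<Sum>i\<in>I. L2_inner M (u i) w)"
proof (induction I rule: infinite_finite_induct)
  case (insert i I)
  thus ?case
    by (simp add: L2_inner_add_left square_integrable_sum)
qed (simp_all add: L2_inner_def)

lemma L2_inner_self_nonneg: "0 \<le> L2_inner M u u"
  by (simp add: L2_inner_def)

lemma L2_norm_nonneg: "0 \<le> L2_norm M u"
  by (simp add: L2_norm_def L2_inner_self_nonneg)

lemma L2_norm_sq: "(L2_norm M u)\<^sup>2 = L2_inner M u u"
  by (simp add: L2_norm_def L2_inner_self_nonneg)

lemma L2_inner_cong_AE:
  assumes "square_integrable M u" "square_integrable M v" "square_integrable M u'" "square_integrable M v'"
    "AE x in M. u x = u' x" "AE x in M. v x = v' x"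
  shows "L2_inner M u v = L2_inner M u' v'"
  unfolding L2_inner_def
  using assms(5,6) integrable_inner[OF assms(1,2)] integrable_inner[OF assms(3,4)]
  by (intro Bochner_Integration.integral_cong_AE) auto

lemma L2_norm_eq_0_iff:
  assumes "square_integrable M u"
  shows "L2_norm M u = 0 \<longleftrightarrow> (AE x in M. u x = 0)"
proof -
  have "L2_norm M u = 0 \<longleftrightarrow> (LINT x|M. u x \<bullet> u x) = 0"
    by (simp only: L2_norm_def L2_inner_def real_sqrt_eq_0_iff)
  also have "\<dots> \<longleftrightarrow> (AE x in M. u x \<bullet> u x = 0)"
    by (rule integral_nonneg_eq_0_iff_AE[OF integrable_inner[OF assms assms]]) simp
  finally show ?thesis by simp
qed

lemma L2_norm_diff_eq_0_iff:
  assumes "square_integrable M u" "square_integrable M v"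
  shows "L2_norm M (\<lambda>x. u x - v x) = 0 \<longleftrightarrow> (AE x in M. u x = v x)"
  using L2_norm_eq_0_iff[OF square_integrable_diff[OF assms]] by simp

text \<open>On functions the form is only semidefinite, hence the degenerate case
  \<open>c = 0\<close>: a nonzero \<open>b\<close> would make the quadratic in \<open>t\<close>,
  then affine, negative somewhere.\<close>

lemma L2_Cauchy_Schwarz:
  assumes u: "square_integrable M u" and v: "square_integrable M v"
  shows "\<bar>L2_inner M u v\<bar> \<le> L2_norm M u * L2_norm M v"
proof -
  define a b c where "a = L2_inner M u u" and "b = L2_inner M u v" and "c = L2_inner M v v"
  have ac: "0 \<le> a" "0 \<le> c" by (simp_all add: a_def c_def L2_inner_self_nonneg)
  have q: "0 \<le> a + 2 * t * b + t\<^sup>2 * c" for t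
  proof -
    note sq = u square_integrable_scaleR[OF v, of t]
    have "0 \<le> L2_inner M (\<lambda>x. u x + t *\<^sub>R v x) (\<lambda>x. u x + t *\<^sub>R v x)"
      by (rule L2_inner_self_nonneg)
    also have "\<dots> = L2_inner M u u + t * L2_inner M v u + t * (L2_inner M u v + t * L2_inner M v v)"
      using sq v by (simp add: L2_inner_add_left L2_inner_add_right square_integrable_add
          L2_inner_scaleR_left L2_inner_scaleR_right algebra_simps)
    also have "L2_inner M v u = L2_inner M u v" by (rule L2_inner_commute)
    finally show ?thesis
      by (simp add: a_def b_def c_def power2_eq_square algebra_simps)
  qed
  have "b\<^sup>2 \<le> a * c"
  proof (cases "c = 0")
    case True
    have "b = 0"
    proof (rule ccontr)
      assume b: "b \<noteq> 0"
      have "0 \<le> a + 2 * (- (a + 1) / b) * b + (- (a + 1) / b)\<^sup>2 * c" by (rule q)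
      thus False using True b ac by simp
    qed
    thus ?thesis using ac by simp
  next
    case False
    hence c: "0 < c" using ac by simp
    have "0 \<le> a + 2 * (- b / c) * b + (- b / c)\<^sup>2 * c" by (rule q)
    also have "\<dots> = a - b\<^sup>2 / c" using c by (simp add: field_simps power2_eq_square)
    finally show ?thesis using c by (simp add: field_simps)
  qed
  hence "sqrt (b\<^sup>2) \<le> sqrt (a * c)" by (rule real_sqrt_le_mono)
  thus ?thesis by (simp add: L2_norm_def a_def b_def c_def real_sqrt_mult)
qed

subsection \<open>The sequence space\<close>

text \<open>The results on diagonal operators need a type with a definite inner product.
  Square-integrable functions, equal only up to null sets, do not provide one; their coefficient
  sequences do, isometrically.\<close>

typedef ell2 = "{x::nat \<Rightarrow> real. summable (\<lambda>n. (x n)\<^sup>2)}"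
  morphisms ell2_nth Abs_ell2
  by (rule exI[of _ "\<lambda>_. 0"]) simp

lemma summable_ell2_sq: "summable (\<lambda>n. (ell2_nth x n)\<^sup>2)"
  using ell2_nth[of x] by simp

lemma summable_mult_of_summable_sq:
  fixes x y :: "nat \<Rightarrow> real"
  assumes "summable (\<lambda>n. (x n)\<^sup>2)" "summable (\<lambda>n. (y n)\<^sup>2)"
  shows "summable (\<lambda>n. x n * y n)"
proof (rule summable_comparison_test)
  show "summable (\<lambda>n. (x n)\<^sup>2 + (y n)\<^sup>2)" by (rule summable_add[OF assms])
  have "\<bar>x n * y n\<bar> \<le> (x n)\<^sup>2 + (y n)\<^sup>2" for n
  proof -
    have "p * q \<le> p\<^sup>2 + q\<^sup>2" for p q :: real
      using sum_squares_bound[of p q] sum_power2_ge_zero[of p q] by linarith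
    from this[of "\<bar>x n\<bar>" "\<bar>y n\<bar>"] show ?thesis by (simp add: abs_mult)
  qed
  thus "\<exists>N. \<forall>n\<ge>N. norm (x n * y n) \<le> (x n)\<^sup>2 + (y n)\<^sup>2" by simp
qed

lemmas summable_ell2_mult = summable_mult_of_summable_sq[OF summable_ell2_sq summable_ell2_sq]

lemma ell2_eqI: "(\<And>n. ell2_nth x n = ell2_nth y n) \<Longrightarrow> x = y"
  by (simp add: ell2_nth_inject[symmetric] ext)

instantiation ell2 :: real_vector
begin

definition "0 = Abs_ell2 (\<lambda>n. 0)"
definition "x + y = Abs_ell2 (\<lambda>n. ell2_nth x n + ell2_nth y n)"
definition "c *\<^sub>R x = Abs_ell2 (\<lambda>n. c * ell2_nth x n)"
definition "- x = Abs_ell2 (\<lambda>n. - ell2_nth x n)"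
definition "x - y = Abs_ell2 (\<lambda>n. ell2_nth x n - ell2_nth y n)"

lemma ell2_nth_zero [simp]: "ell2_nth 0 n = 0"
  by (simp add: zero_ell2_def Abs_ell2_inverse)

lemma ell2_nth_add [simp]: "ell2_nth (x + y) n = ell2_nth x n + ell2_nth y n"
proof -
  have "summable (\<lambda>n. (ell2_nth x n)\<^sup>2 + (ell2_nth y n)\<^sup>2 + 2 * (ell2_nth x n * ell2_nth y n))"
    by (intro summable_add summable_mult summable_ell2_sq summable_ell2_mult)
  thus ?thesis
    by (simp add: plus_ell2_def Abs_ell2_inverse power2_sum mult.assoc)
qed

lemma ell2_nth_scaleR [simp]: "ell2_nth (c *\<^sub>R x) n = c * ell2_nth x n"
  using summable_mult[OF summable_ell2_sq, of "c\<^sup>2" x]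
  by (simp add: scaleR_ell2_def Abs_ell2_inverse power_mult_distrib)

lemma ell2_nth_uminus [simp]: "ell2_nth (- x) n = - ell2_nth x n"
  using summable_ell2_sq[of x] by (simp add: uminus_ell2_def Abs_ell2_inverse)

lemma ell2_nth_diff [simp]: "ell2_nth (x - y) n = ell2_nth x n - ell2_nth y n"
proof -
  have "x - y = x + - y" by (simp add: minus_ell2_def plus_ell2_def)
  thus ?thesis by simp
qed

instance
  by standard (auto intro!: ell2_eqI simp: algebra_simps)

end

instantiation ell2 :: real_inner
begin

definition "x \<bullet> y = (\<Sum>n. ell2_nth x n * ell2_nth y n)"
definition "norm x = sqrt (x \<bullet> x)" for x :: ell2
definition "dist x y = norm (x - y)" for x y :: ell2
definition "sgn x = x /\<^sub>R norm x" for x :: ell2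
definition "uniformity = (INF e\<in>{0<..}. principal {(x::ell2, y). dist x y < e})"
definition "open U = (\<forall>x\<in>U. eventually (\<lambda>(x', y). x' = x \<longrightarrow> y \<in> U) uniformity)" for U :: "ell2 set"

instance
proof
  fix x y z :: ell2 and r :: real
  show "x \<bullet> y = y \<bullet> x" by (simp add: inner_ell2_def mult.commute)
  show "(x + y) \<bullet> z = x \<bullet> z + y \<bullet> z"
    by (simp add: inner_ell2_def distrib_right suminf_add summable_ell2_mult)
  show "(r *\<^sub>R x) \<bullet> y = r * (x \<bullet> y)"
    by (simp add: inner_ell2_def mult.assoc suminf_mult summable_ell2_mult)
  show "0 \<le> x \<bullet> x"
    by (simp add: inner_ell2_def suminf_nonneg summable_ell2_mult)
  show "x \<bullet> x = 0 \<longleftrightarrow> x = 0"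
  proof
    assume "x \<bullet> x = 0"
    hence "ell2_nth x n * ell2_nth x n = 0" for n
      using suminf_eq_zero_iff[OF summable_ell2_mult[of x x]] by (simp add: inner_ell2_def)
    thus "x = 0" by (intro ell2_eqI) simp
  qed (simp add: inner_ell2_def)
qed (simp_all add: norm_ell2_def dist_ell2_def sgn_ell2_def uniformity_ell2_def open_ell2_def)

end

lemma nn_integral_norm_sq:
  assumes "square_integrable M u"
  shows "(\<integral>\<^sup>+x. ennreal ((norm (u x))\<^sup>2) \<partial>M) = ennreal ((L2_norm M u)\<^sup>2)"
proof -
  have "(\<integral>\<^sup>+x. ennreal ((norm (u x))\<^sup>2) \<partial>M) = ennreal (LINT x|M. (norm (u x))\<^sup>2)"
    by (rule nn_integral_eq_integral[OF square_integrable_integrable[OF assms]]) simp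
  thus ?thesis
    by (simp add: L2_norm_sq L2_inner_def power2_norm_eq_inner)
qed

text \<open>Riesz--Fischer. For a rapidly converging subsequence the increments \<open>d i\<close> satisfy
  \<open>2 \<bar>d i\<bar> \<le> 2\<^sup>-\<^sup>i + 2\<^sup>i (d i)\<^sup>2\<close>, where the right-hand side is summable almost everywhere.\<close>

lemma L2_Cauchy_subseq_converges:
  fixes v :: "nat \<Rightarrow> 'a \<Rightarrow> real"
  assumes v: "\<And>i. square_integrable M (v i)"
    and step: "\<And>i. (L2_norm M (\<lambda>x. v (Suc i) x - v i x))\<^sup>2 \<le> (1/8) ^ i"
  shows "\<exists>g. g \<in> borel_measurable M \<and> (AE x in M. (\<lambda>i. v i x) \<longlonglongrightarrow> g x)"
proof -
  define d where "d = (\<lambda>i x. v (Suc i) x - v i x)"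
  have dsq: "square_integrable M (d i)" for i
    unfolding d_def by (intro square_integrable_diff v)
  have [measurable]: "v i \<in> borel_measurable M" "d i \<in> borel_measurable M" for i
    using v dsq by (auto intro: square_integrable_measurable)
  have "(\<integral>\<^sup>+x. (\<Sum>i. ennreal (2 ^ i * (d i x)\<^sup>2)) \<partial>M) = (\<Sum>i. \<integral>\<^sup>+x. ennreal (2 ^ i * (d i x)\<^sup>2) \<partial>M)"
    by (rule nn_integral_suminf) measurable
  also have "\<dots> \<le> (\<Sum>i. ennreal ((1/4) ^ i))"
  proof (rule suminf_le)
    fix i
    have "(\<integral>\<^sup>+x. ennreal (2 ^ i * (d i x)\<^sup>2) \<partial>M) = ennreal (2 ^ i) * (\<integral>\<^sup>+x. ennreal ((norm (d i x))\<^sup>2) \<partial>M)"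
      by (subst nn_integral_cmult[symmetric]) (auto simp: ennreal_mult)
    also have "\<dots> = ennreal (2 ^ i * (L2_norm M (d i))\<^sup>2)"
      by (subst nn_integral_norm_sq[OF dsq]) (simp add: ennreal_mult)
    also have "\<dots> \<le> ennreal (2 ^ i * (1/8) ^ i)"
      using step[of i] by (intro ennreal_leI mult_left_mono) (auto simp: d_def)
    \<comment> \<open>The rate 1/8 in \<open>step\<close> still leaves a convergent geometric series
      after weighting by \<open>2 ^ i\<close>.\<close>
    also have "2 ^ i * (1/8) ^ i = (1/4 :: real) ^ i"
      by (simp add: power_mult_distrib[symmetric])
    finally show "(\<integral>\<^sup>+x. ennreal (2 ^ i * (d i x)\<^sup>2) \<partial>M) \<le> ennreal ((1/4) ^ i)" .
  qed auto
  also have "\<dots> = ennreal (\<Sum>i. (1/4) ^ i)"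
    by (intro suminf_ennreal2 summable_geometric) auto
  also have "\<dots> < \<infinity>" by simp
  finally have fin: "(\<integral>\<^sup>+x. (\<Sum>i. ennreal (2 ^ i * (d i x)\<^sup>2)) \<partial>M) \<noteq> \<infinity>" by simp
  have "AE x in M. (\<Sum>i. ennreal (2 ^ i * (d i x)\<^sup>2)) \<noteq> \<infinity>"
    by (rule nn_integral_PInf_AE[OF _ fin]) measurable
  hence "AE x in M. summable (\<lambda>i. d i x)"
  proof eventually_elim
    case (elim x)
    have "summable (\<lambda>i. 2 ^ i * (d i x)\<^sup>2)"
      using elim by (intro summable_suminf_not_top) auto
    hence "summable (\<lambda>i. (1/2) ^ i + 2 ^ i * (d i x)\<^sup>2)"
      by (intro summable_add summable_geometric) auto
    thus ?case
    proof (rule summable_comparison_test[rotated], intro exI[of _ 0] allI impI)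
      fix i
      define p q where "p = (sqrt (1/2)) ^ i" and "q = (sqrt 2) ^ i * \<bar>d i x\<bar>"
      have "p * q = \<bar>d i x\<bar>"
      proof -
        have "(sqrt (1/2)) ^ i * (sqrt 2) ^ i = 1"
          by (simp only: power_mult_distrib[symmetric] real_sqrt_mult[symmetric]) simp
        thus ?thesis by (simp only: p_def q_def mult.assoc[symmetric] mult_1)
      qed
      moreover have "p\<^sup>2 = (1/2) ^ i" "q\<^sup>2 = 2 ^ i * (d i x)\<^sup>2"
      proof -
        have "(y ^ i)\<^sup>2 = (y\<^sup>2) ^ i" for y :: real
          by (simp only: power_mult[symmetric] mult.commute)
        thus "p\<^sup>2 = (1/2) ^ i" "q\<^sup>2 = 2 ^ i * (d i x)\<^sup>2"
          by (simp_all only: p_def q_def power_mult_distrib power2_abs real_sqrt_pow2)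
      qed
      moreover have "p * q \<le> p\<^sup>2 + q\<^sup>2"
        using sum_squares_bound[of p q] sum_power2_ge_zero[of p q] by linarith
      ultimately show "norm (d i x) \<le> (1/2) ^ i + 2 ^ i * (d i x)\<^sup>2" by simp
    qed
  qed
  hence "AE x in M. (\<lambda>i. v i x) \<longlonglongrightarrow> v 0 x + (\<Sum>i. d i x)"
  proof eventually_elim
    case (elim x)
    have "(\<lambda>i. v 0 x + (\<Sum>j<i. d j x)) \<longlonglongrightarrow> v 0 x + (\<Sum>i. d i x)"
      by (intro tendsto_intros summable_LIMSEQ elim)
    thus ?case
      by (simp add: d_def sum_lessThan_telescope[of "\<lambda>j. v j x"])
  qed
  thus ?thesis
    by (intro exI[of _ "\<lambda>x. v 0 x + (\<Sum>i. d i x)"]) measurable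
qed

text \<open>Orthonormality bounds differences of partial sums by tails. Along indices where the
  tails drop below \<open>(1/8) ^ i\<close> the sums converge almost everywhere, and Fatou's lemma
  carries the tail bound to the limit for every partial sum, not only the selected ones.\<close>

lemma L2_series_converges:
  fixes \<phi> :: "nat \<Rightarrow> 'a \<Rightarrow> real"
  assumes \<phi>: "\<And>m. square_integrable M (\<phi> m)"
    and orth: "\<And>m l. L2_inner M (\<phi> m) (\<phi> l) = (if m = l then 1 else 0)"
    and c: "summable (\<lambda>m. (c m)\<^sup>2)"
  shows "\<exists>g. square_integrable M g \<and> (\<lambda>n. L2_norm M (\<lambda>x. g x - (\<Sum>m<n. c m * \<phi> m x))) \<longlonglongrightarrow> 0"
proof -
  define S where "S n x = (\<Sum>m<n. c m * \<phi> m x)" for n x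
  have S: "square_integrable M (S n)" for n
    unfolding S_def by (intro square_integrable_sum square_integrable_cmult \<phi>)
  have [measurable]: "S n \<in> borel_measurable M" for n
    using S by (rule square_integrable_measurable)
  define tail where "tail n = (\<Sum>m. (c (m + n))\<^sup>2)" for n
  have tail_nonneg: "0 \<le> tail n" for n
    unfolding tail_def by (intro suminf_nonneg summable_ignore_initial_segment[OF c]) auto
  have tail0: "tail \<longlonglongrightarrow> 0"
    unfolding tail_def by (rule suminf_exist_split2[OF c])
  have diff: "(L2_norm M (\<lambda>x. S n x - S k x))\<^sup>2 \<le> tail k" if "k \<le> n" for n k
  proof -
    have eq: "(\<lambda>x. S n x - S k x) = (\<lambda>x. \<Sum>m\<in>{k..<n}. c m * \<phi> m x)"
      using that sum_diff_nat_ivl[of 0 k n] by (auto simp: S_def lessThan_atLeast0 fun_eq_iff)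
    have sq: "square_integrable M (\<lambda>x. \<Sum>m\<in>{k..<n}. c m * \<phi> m x)"
      by (intro square_integrable_sum square_integrable_cmult \<phi>)
    have "(L2_norm M (\<lambda>x. S n x - S k x))\<^sup>2 = (\<Sum>m\<in>{k..<n}. c m * L2_inner M (\<phi> m) (\<lambda>x. \<Sum>m\<in>{k..<n}. c m * \<phi> m x))"
      unfolding eq L2_norm_sq
      by (subst L2_inner_sum_left) (auto intro: sq \<phi> square_integrable_cmult simp: L2_inner_cmult_left)
    also have "\<dots> = (\<Sum>m\<in>{k..<n}. c m * c m)"
    proof (rule sum.cong[OF refl])
      fix m assume m: "m \<in> {k..<n}"
      have "L2_inner M (\<phi> m) (\<lambda>x. \<Sum>m\<in>{k..<n}. c m * \<phi> m x) = (\<Sum>l\<in>{k..<n}. c l * L2_inner M (\<phi> l) (\<phi> m))"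
        by (subst L2_inner_commute, subst L2_inner_sum_left)
           (auto intro: \<phi> square_integrable_cmult simp: L2_inner_cmult_left)
      also have "\<dots> = c m"
        using m by (simp add: orth if_distrib cong: if_cong)
      finally show "c m * L2_inner M (\<phi> m) (\<lambda>x. \<Sum>m\<in>{k..<n}. c m * \<phi> m x) = c m * c m" by simp
    qed
    also have "\<dots> = (\<Sum>m<n - k. (c (m + k))\<^sup>2)"
      using that sum.shift_bounds_nat_ivl[of "\<lambda>m. c m * c m" 0 k "n - k"]
      by (simp add: power2_eq_square lessThan_atLeast0)
    also have "\<dots> \<le> tail k"
      unfolding tail_def by (rule sum_le_suminf[OF summable_ignore_initial_segment[OF c]]) auto
    finally show ?thesis .
  qed
  have "\<exists>n. \<forall>k\<ge>n. tail k < (1/8) ^ i" for i :: nat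
    using order_tendstoD(2)[OF tail0, of "(1/8) ^ i"] by (simp add: eventually_sequentially)
  then obtain N where N: "\<And>i k. N i \<le> k \<Longrightarrow> tail k < (1/8) ^ i" by metis
  \<comment> \<open>This choice is nondecreasing in \<open>i\<close>, beyond \<open>N i\<close> and
    unbounded.\<close>
  define r where "r i = (\<Sum>j\<le>i. N j) + i" for i
  have rN: "N i \<le> r i" for i
    by (simp add: r_def trans_le_add1 member_le_sum)
  have r: "r i \<le> r (Suc i)" "i \<le> r i" for i by (auto simp: r_def)
  have "\<exists>g. g \<in> borel_measurable M \<and> (AE x in M. (\<lambda>i. S (r i) x) \<longlonglongrightarrow> g x)"
    using diff[OF r(1)] N[OF rN] by (intro L2_Cauchy_subseq_converges S) (meson order_trans less_imp_le)
  then obtain g where g[measurable]: "g \<in> borel_measurable M" and lim: "AE x in M. (\<lambda>i. S (r i) x) \<longlonglongrightarrow> g x"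
    by blast
  have le: "(\<integral>\<^sup>+x. ennreal ((norm (g x - S n x))\<^sup>2) \<partial>M) \<le> ennreal (tail n)" for n
  proof -
    have "(\<integral>\<^sup>+x. ennreal ((norm (g x - S n x))\<^sup>2) \<partial>M)
        = (\<integral>\<^sup>+x. liminf (\<lambda>i. ennreal ((norm (S (r i) x - S n x))\<^sup>2)) \<partial>M)"
    proof (rule nn_integral_cong_AE, use lim in eventually_elim)
      case (elim x)
      have "(\<lambda>i. ennreal ((norm (S (r i) x - S n x))\<^sup>2)) \<longlonglongrightarrow> ennreal ((norm (g x - S n x))\<^sup>2)"
        by (intro tendsto_ennrealI tendsto_intros elim)
      from lim_imp_Liminf[OF _ this] show ?case by simp
    qed
    also have "\<dots> \<le> liminf (\<lambda>i. \<integral>\<^sup>+x. ennreal ((norm (S (r i) x - S n x))\<^sup>2) \<partial>M)"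
      by (rule nn_integral_liminf) measurable
    also have "\<dots> \<le> ennreal (tail n)"
    proof (rule Liminf_le)
      show "\<forall>\<^sub>F i in sequentially. (\<integral>\<^sup>+x. ennreal ((norm (S (r i) x - S n x))\<^sup>2) \<partial>M) \<le> ennreal (tail n)"
        using eventually_ge_at_top[of n]
      proof eventually_elim
        case (elim i)
        show ?case
          unfolding nn_integral_norm_sq[OF square_integrable_diff[OF S S]]
          by (intro ennreal_leI diff) (use elim r(2)[of i] in linarith)
      qed
    qed simp
    finally show ?thesis .
  qed
  have gS: "square_integrable M (\<lambda>x. g x - S n x)" for n
    unfolding square_integrable_def
  proof
    show "integrable M (\<lambda>x. (norm (g x - S n x))\<^sup>2)"
      using le[of n] by (intro integrableI_nonneg) (auto simp: order_le_less_trans)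
  qed measurable
  have "square_integrable M (\<lambda>x. g x - S 0 x)" by (rule gS)
  hence gsq: "square_integrable M g" by (simp add: S_def)
  have le': "L2_norm M (\<lambda>x. g x - S n x) \<le> sqrt (tail n)" for n
    using le[of n] unfolding nn_integral_norm_sq[OF gS]
    by (intro real_le_rsqrt) (simp add: tail_nonneg)
  have "(\<lambda>n. sqrt (tail n)) \<longlonglongrightarrow> 0"
    using tendsto_real_sqrt[OF tail0] by simp
  hence "(\<lambda>n. L2_norm M (\<lambda>x. g x - S n x)) \<longlonglongrightarrow> 0"
    by (rule Lim_null_comparison[OF always_eventually, rotated]) (simp add: L2_norm_nonneg le')
  thus ?thesis
    using gsq unfolding S_def by blast
qed

section \<open>The isometry onto coefficient sequences with respect to an orthonormal basis\<close>

locale L2_basis =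
  fixes M :: "'a measure" and \<phi> :: "nat \<Rightarrow> 'a \<Rightarrow> real"
  assumes basis_sq: "\<And>m. square_integrable M (\<phi> m)"
    and basis_orth: "\<And>m l. L2_inner M (\<phi> m) (\<phi> l) = (if m = l then 1 else 0)"
    and basis_complete: "\<And>u. square_integrable M u \<Longrightarrow>
      (\<lambda>n. L2_norm M (\<lambda>x. u x - (\<Sum>m<n. L2_inner M u (\<phi> m) * \<phi> m x))) \<longlonglongrightarrow> 0"
begin

definition seq :: "('a \<Rightarrow> real) \<Rightarrow> ell2" where
  "seq u = Abs_ell2 (\<lambda>m. L2_inner M u (\<phi> m))"

lemma partial_sq: "square_integrable M (\<lambda>x. \<Sum>m\<in>I. c m * \<phi> m x)"
  by (intro square_integrable_sum square_integrable_cmult basis_sq)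

lemma L2_inner_partial:
  "square_integrable M u \<Longrightarrow> L2_inner M (\<lambda>x. \<Sum>m\<in>I. c m * \<phi> m x) u = (\<Sum>m\<in>I. c m * L2_inner M u (\<phi> m))"
  by (subst L2_inner_sum_left)
     (auto intro: square_integrable_cmult basis_sq simp: L2_inner_cmult_left L2_inner_commute[of M "\<phi> _"])

lemma coeff_partial:
  "finite I \<Longrightarrow> L2_inner M (\<lambda>x. \<Sum>m\<in>I. c m * \<phi> m x) (\<phi> l) = (if l \<in> I then c l else 0)"
  by (simp add: L2_inner_partial basis_sq basis_orth if_distrib cong: if_cong)

lemma parseval:
  assumes u: "square_integrable M u"
  shows "(\<lambda>m. (L2_inner M u (\<phi> m))\<^sup>2) sums (L2_norm M u)\<^sup>2"
proof -
  define p where "p n x = (\<Sum>m<n. L2_inner M u (\<phi> m) * \<phi> m x)" for n x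
  have p: "square_integrable M (p n)" for n unfolding p_def by (rule partial_sq)
  have "(L2_norm M (\<lambda>x. u x - p n x))\<^sup>2 = (L2_norm M u)\<^sup>2 - (\<Sum>m<n. (L2_inner M u (\<phi> m))\<^sup>2)" for n
  proof -
    have up: "L2_inner M (p n) u = (\<Sum>m<n. (L2_inner M u (\<phi> m))\<^sup>2)"
      using L2_inner_partial[OF u, of "\<lambda>m. L2_inner M u (\<phi> m)" "{..<n}"]
      by (simp add: p_def[abs_def] power2_eq_square)
    have pp: "L2_inner M (p n) (p n) = (\<Sum>m<n. (L2_inner M u (\<phi> m))\<^sup>2)"
      using L2_inner_partial[OF p, of "\<lambda>m. L2_inner M u (\<phi> m)" "{..<n}" n]
        coeff_partial[of "{..<n}" "\<lambda>m. L2_inner M u (\<phi> m)"]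
      by (simp add: p_def[abs_def] power2_eq_square)
    show ?thesis
      using u p[of n] up pp L2_inner_commute[of M u "p n"]
      by (simp add: L2_norm_sq L2_inner_diff_left L2_inner_diff_right square_integrable_diff)
  qed
  moreover have "(\<lambda>n. (L2_norm M (\<lambda>x. u x - p n x))\<^sup>2) \<longlonglongrightarrow> 0"
    using tendsto_power[OF basis_complete[OF u], of 2] by (simp add: p_def)
  ultimately have "(\<lambda>n. (L2_norm M u)\<^sup>2 - ((L2_norm M u)\<^sup>2 - (\<Sum>m<n. (L2_inner M u (\<phi> m))\<^sup>2))) \<longlonglongrightarrow> (L2_norm M u)\<^sup>2 - 0"
    by (intro tendsto_diff tendsto_const) simp
  thus ?thesis by (simp add: sums_def)
qed

lemma seq_nth:
  assumes "square_integrable M u"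
  shows "ell2_nth (seq u) m = L2_inner M u (\<phi> m)"
  using sums_summable[OF parseval[OF assms]] by (simp add: seq_def Abs_ell2_inverse)

lemma norm_seq:
  assumes "square_integrable M u"
  shows "norm (seq u) = L2_norm M u"
proof -
  have "(norm (seq u))\<^sup>2 = (L2_norm M u)\<^sup>2"
  proof -
    have "(norm (seq u))\<^sup>2 = (\<Sum>m. L2_inner M u (\<phi> m) * L2_inner M u (\<phi> m))"
      by (simp add: power2_norm_eq_inner inner_ell2_def seq_nth[OF assms])
    thus ?thesis
      using sums_unique[OF parseval[OF assms]] by (simp add: power2_eq_square)
  qed
  thus ?thesis by (simp add: power2_eq_iff_nonneg L2_norm_nonneg)
qed

lemma seq_add: "square_integrable M u \<Longrightarrow> square_integrable M v \<Longrightarrow> seq (\<lambda>x. u x + v x) = seq u + seq v"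
  by (rule ell2_eqI) (simp add: seq_nth square_integrable_add L2_inner_add_left basis_sq)

lemma seq_diff: "square_integrable M u \<Longrightarrow> square_integrable M v \<Longrightarrow> seq (\<lambda>x. u x - v x) = seq u - seq v"
  by (rule ell2_eqI) (simp add: seq_nth square_integrable_diff L2_inner_diff_left basis_sq)

lemma seq_cmult: "square_integrable M u \<Longrightarrow> seq (\<lambda>x. c * u x) = c *\<^sub>R seq u"
  by (rule ell2_eqI) (simp add: seq_nth square_integrable_cmult L2_inner_cmult_left)

lemma seq_sum:
  "(\<And>i. i \<in> I \<Longrightarrow> square_integrable M (u i)) \<Longrightarrow> seq (\<lambda>x. \<Sum>i\<in>I. u i x) = (\<Sum>i\<in>I. seq (u i))"
proof (induction I rule: infinite_finite_induct)
  case (insert i I)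
  thus ?case by (simp add: seq_add square_integrable_sum)
next
  case (infinite I)
  thus ?case using seq_cmult[OF square_integrable_zero, of 0] by simp
next
  case empty
  thus ?case using seq_cmult[OF square_integrable_zero, of 0] by simp
qed

text \<open>Polarization: the norms of both functions and of their sum are preserved.\<close>

lemma inner_seq:
  assumes u: "square_integrable M u" and v: "square_integrable M v"
  shows "seq u \<bullet> seq v = L2_inner M u v"
proof -
  have "(norm (seq u + seq v))\<^sup>2 = (L2_norm M (\<lambda>x. u x + v x))\<^sup>2"
    using norm_seq[OF square_integrable_add[OF u v]] seq_add[OF u v] by simp
  hence "(norm (seq u))\<^sup>2 + 2 * (seq u \<bullet> seq v) + (norm (seq v))\<^sup>2
      = (L2_norm M u)\<^sup>2 + 2 * L2_inner M u v + (L2_norm M v)\<^sup>2"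
    using u v L2_inner_commute[of M v u]
    by (simp add: power2_norm_eq_inner L2_norm_sq inner_add_left inner_add_right inner_commute
        L2_inner_add_left L2_inner_add_right square_integrable_add)
  thus ?thesis by (simp add: norm_seq u v)
qed

lemma seq_basis_orth: "seq (\<phi> m) \<bullet> seq (\<phi> l) = (if m = l then 1 else 0)"
  by (simp add: inner_seq basis_sq basis_orth)

lemma seq_basis_eq_iff: "seq (\<phi> m) = seq (\<phi> l) \<longleftrightarrow> m = l"
  using seq_basis_orth[of m l] seq_basis_orth[of m m] by (cases "m = l") auto

lemma orthonormal_seq_basis: "finite I \<Longrightarrow> orthonormal_set ((\<lambda>m. seq (\<phi> m)) ` I)"
  by (auto simp: orthonormal_set_def seq_basis_orth seq_basis_eq_iff)

lemma seq_partial: "seq (\<lambda>x. \<Sum>m\<in>I. c m * \<phi> m x) = (\<Sum>m\<in>I. c m *\<^sub>R seq (\<phi> m))"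
  by (simp add: seq_sum square_integrable_cmult basis_sq seq_cmult)

end

section \<open>Weak gradients\<close>

lemma GDERIV_unique:
  fixes f :: "'a::euclidean_space \<Rightarrow> real"
  assumes "GDERIV f x :> D" "GDERIV f x :> D'"
  shows "D = D'"
proof -
  have "(\<lambda>h. h \<bullet> D) = (\<lambda>h. h \<bullet> D')"
    using assms unfolding gderiv_def by (rule has_derivative_unique)
  hence "(D - D') \<bullet> D = (D - D') \<bullet> D'" by (rule fun_cong)
  hence "(D - D') \<bullet> (D - D') = 0" by (simp add: inner_diff_right)
  thus ?thesis by simp
qed

lemma grad_eq:
  fixes f :: "'a::euclidean_space \<Rightarrow> real"
  assumes "GDERIV f x :> D"
  shows "grad f x = D"
  unfolding grad_def using assms GDERIV_unique by (intro the_equality) auto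

lemma test_functionE:
  fixes \<psi> :: "'a::euclidean_space \<Rightarrow> real"
  assumes "\<psi> \<in> test_functions \<Omega>"
  obtains K where "compact K" "K \<subseteq> \<Omega>" "\<And>x. x \<notin> K \<Longrightarrow> \<psi> x = 0" "\<And>x. GDERIV \<psi> x :> grad \<psi> x"
    "continuous_on UNIV \<psi>" "continuous_on UNIV (grad \<psi>)" "\<And>x. x \<notin> K \<Longrightarrow> grad \<psi> x = 0"
proof -
  obtain g K where g: "continuous_on UNIV g" "\<And>x. GDERIV \<psi> x :> g x"
    and K: "compact K" "K \<subseteq> \<Omega>" "\<And>x. x \<notin> K \<Longrightarrow> \<psi> x = 0"
    using assms by (auto simp: test_functions_def C1_on_def)
  have gg: "grad \<psi> = g"
    using grad_eq[OF g(2)] by auto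
  have "continuous_on UNIV \<psi>"
    using g(2) by (intro has_derivative_continuous_on[of _ _ "\<lambda>x h. h \<bullet> g x"]) (simp add: gderiv_def)
  moreover have "grad \<psi> x = 0" if "x \<notin> K" for x
  proof (rule grad_eq)
    have "((\<lambda>x. 0) has_derivative (\<lambda>h. h \<bullet> 0)) (at x)" by simp
    thus "GDERIV \<psi> x :> 0"
      unfolding gderiv_def using K that
      by (intro has_derivative_transform_within_open[of "\<lambda>x. 0" _ x UNIV "- K" \<psi>])
         (auto simp: compact_imp_closed open_Compl)
  qed
  ultimately show ?thesis
    using that[of K] K g unfolding gg by blast
qed

lemma bounded_continuous_compact_support:
  fixes f :: "'a::euclidean_space \<Rightarrow> 'b::euclidean_space"
  assumes "continuous_on UNIV f" "compact K" "\<And>x. x \<notin> K \<Longrightarrow> f x = 0"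
  obtains B where "0 \<le> B" "\<And>x. norm (f x) \<le> B"
proof -
  have "bounded (f ` K)"
    by (intro compact_imp_bounded compact_continuous_image continuous_on_subset[OF assms(1)] assms) auto
  then obtain B where B: "\<And>x. x \<in> K \<Longrightarrow> norm (f x) \<le> B"
    by (auto simp: bounded_iff)
  have "norm (f x) \<le> max B 0" for x
    using B[of x] assms(3)[of x] by (cases "x \<in> K") auto
  thus ?thesis by (intro that[of "max B 0"]) auto
qed

lemma integrable_lborel_compact_support:
  fixes f :: "'a::euclidean_space \<Rightarrow> 'b::euclidean_space"
  assumes f: "f \<in> borel_measurable borel" and K: "compact K" "\<And>x. x \<notin> K \<Longrightarrow> f x = 0" and B: "\<And>x. norm (f x) \<le> B"
  shows "integrable lborel f"
proof (rule Bochner_Integration.integrable_bound)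
  show "integrable lborel (\<lambda>x. indicator K x * B)"
    using K(1) by (intro integrable_mult_left integrable_real_indicator emeasure_compact_finite) (auto simp: compact_imp_closed)
  show "AE x in lborel. norm (f x) \<le> norm (indicator K x * B)"
  proof (rule AE_I2)
    fix x show "norm (f x) \<le> norm (indicator K x * B)"
      using K(2)[of x] B[of x] norm_ge_zero[of "f x"] by (cases "x \<in> K") (auto simp del: norm_ge_zero)
  qed
qed (use f in simp)

lemma integral_lborel_translate:
  fixes f :: "'a::euclidean_space \<Rightarrow> 'b::euclidean_space"
  assumes "f \<in> borel_measurable borel"
  shows "(LINT x|lborel. f (v + x)) = (LINT x|lborel. f x)"
  using integral_distr[of "(+) v" lborel borel f] assms by (simp add: lborel_distr_plus)

text \<open>The difference quotients have integral zero by translation invariance.\<close>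

lemma integral_directional_derivative_zero:
  fixes \<psi> :: "'a::euclidean_space \<Rightarrow> real"
  assumes \<psi>: "\<psi> \<in> test_functions \<Omega>"
  shows "(LINT x|lborel. grad \<psi> x \<bullet> v) = 0"
proof -
  obtain K where K: "compact K" "\<And>x. x \<notin> K \<Longrightarrow> \<psi> x = 0" and D: "\<And>x. GDERIV \<psi> x :> grad \<psi> x"
    and cont: "continuous_on UNIV \<psi>" "continuous_on UNIV (grad \<psi>)" "\<And>x. x \<notin> K \<Longrightarrow> grad \<psi> x = 0"
    using test_functionE[OF \<psi>] by metis
  obtain B where B: "0 \<le> B" "\<And>x. norm (grad \<psi> x) \<le> B"
    using bounded_continuous_compact_support[OF cont(2) K(1) cont(3)] by metis
  obtain B0 where B0: "\<And>x. norm (\<psi> x) \<le> B0"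
    using bounded_continuous_compact_support[OF cont(1) K] by metis
  have meas[measurable]: "\<psi> \<in> borel_measurable borel" "grad \<psi> \<in> borel_measurable borel"
    using cont by (auto intro: borel_measurable_continuous_onI)
  have lip: "\<bar>\<psi> x - \<psi> y\<bar> \<le> B * norm (x - y)" for x y
  proof -
    have "norm (\<psi> x - \<psi> y) \<le> B * norm (x - y)"
    proof (rule differentiable_bound[of UNIV])
      fix z
      show "(\<psi> has_derivative (\<lambda>h. h \<bullet> grad \<psi> z)) (at z within UNIV)"
        using D[of z] by (simp add: gderiv_def)
      have "norm (h \<bullet> grad \<psi> z) \<le> B * norm h" for h
      proof -
        have "norm (h \<bullet> grad \<psi> z) \<le> norm h * norm (grad \<psi> z)" by (simp add: Cauchy_Schwarz_ineq2)
        also have "\<dots> \<le> norm h * B" by (intro mult_left_mono B) auto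
        finally show ?thesis by (simp add: mult.commute)
      qed
      thus "onorm (\<lambda>h. h \<bullet> grad \<psi> z) \<le> B" by (rule onorm_le)
    qed auto
    thus ?thesis by simp
  qed
  define t where "t n = 1 / (1 + real n)" for n
  have t: "0 < t n" "t n \<le> 1" for n by (auto simp: t_def)
  define F where "F n x = (\<psi> (t n *\<^sub>R v + x) - \<psi> x) / t n" for n x
  \<comment> \<open>The shifts \<open>t n *\<^sub>R v\<close> are no longer than \<open>v\<close>,
    so this enlargement of \<open>K\<close> contains the supports of all difference quotients and
    carries the dominating function.\<close>
  define K' where "K' = {x + y | x y. x \<in> K \<and> y \<in> cball 0 (norm v)}"
  have "compact K'" unfolding K'_def by (intro compact_sums K) auto
  have KK': "K \<subseteq> K'" by (force simp: K'_def)
  have FK': "F n x = 0" if "x \<notin> K'" for n x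
  proof -
    have "x \<notin> K" using that KK' by auto
    moreover have "t n *\<^sub>R v + x \<notin> K"
    proof
      assume k: "t n *\<^sub>R v + x \<in> K"
      have "norm (- (t n *\<^sub>R v)) \<le> norm v"
        using t[of n] by (simp add: mult_left_le_one_le)
      hence "- (t n *\<^sub>R v) \<in> cball 0 (norm v)" by simp
      with k have "(t n *\<^sub>R v + x) + - (t n *\<^sub>R v) \<in> K'" unfolding K'_def by blast
      with that show False by simp
    qed
    ultimately show ?thesis using K by (simp add: F_def)
  qed
  have FB: "norm (F n x) \<le> B * norm v" for n x
  proof -
    have "\<bar>\<psi> (t n *\<^sub>R v + x) - \<psi> x\<bar> \<le> B * norm (t n *\<^sub>R v)"
      using lip[of "t n *\<^sub>R v + x" x] by simp
    thus ?thesis using t[of n] by (simp add: F_def divide_le_eq mult_ac)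
  qed
  have int: "integrable lborel \<psi>"
    by (rule integrable_lborel_compact_support[OF meas(1) K B0])
  have int_t: "integrable lborel (\<lambda>x. \<psi> (w + x))" for w
  proof -
    have "integrable (distr lborel borel ((+) w)) \<psi>" using int by (simp add: lborel_distr_plus)
    thus ?thesis by (subst (asm) integrable_distr_eq) auto
  qed
  have F0: "(LINT x|lborel. F n x) = 0" for n
    using int int_t integral_lborel_translate[OF meas(1)] by (simp add: F_def)
  have "(\<lambda>n. LINT x|lborel. F n x) \<longlonglongrightarrow> (LINT x|lborel. grad \<psi> x \<bullet> v)"
  proof (rule integral_dominated_convergence[where w = "\<lambda>x. indicator K' x * (B * norm v)"])
    show "integrable lborel (\<lambda>x. indicator K' x * (B * norm v))"
      using \<open>compact K'\<close> by (intro integrable_mult_left integrable_real_indicator emeasure_compact_finite) (auto simp: compact_imp_closed)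
    show "AE x in lborel. norm (F n x) \<le> indicator K' x * (B * norm v)" for n
      using FK' FB by (intro AE_I2) (auto split: split_indicator)
    show "AE x in lborel. (\<lambda>n. F n x) \<longlonglongrightarrow> grad \<psi> x \<bullet> v"
    proof (rule AE_I2)
      fix x
      have "((\<lambda>h::real. \<psi> (x + h *\<^sub>R v)) has_derivative (\<lambda>h. (h *\<^sub>R v) \<bullet> grad \<psi> x)) (at 0)"
        using D[of x] by (intro has_derivative_compose[of "\<lambda>h::real. x + h *\<^sub>R v", where g = \<psi>])
          (auto simp: gderiv_def intro!: derivative_eq_intros)
      hence "((\<lambda>h::real. \<psi> (x + h *\<^sub>R v)) has_field_derivative (grad \<psi> x \<bullet> v)) (at 0)"
        by (simp add: has_field_derivative_def inner_commute mult_commute_abs)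
      hence lim: "(\<lambda>h. (\<psi> (x + h *\<^sub>R v) - \<psi> x) / h) \<midarrow>0\<rightarrow> grad \<psi> x \<bullet> v"
        by (simp add: DERIV_def)
      have "t \<longlonglongrightarrow> 0"
        using LIMSEQ_inverse_real_of_nat by (simp add: t_def[abs_def] divide_inverse add.commute)
      moreover have "\<forall>\<^sub>F n in sequentially. t n \<noteq> 0"
        using t by (intro always_eventually allI) (simp add: less_imp_neq[symmetric])
      ultimately have "filterlim t (at 0) sequentially" by (simp add: filterlim_at)
      from filterlim_compose[OF lim this] show "(\<lambda>n. F n x) \<longlonglongrightarrow> grad \<psi> x \<bullet> v"
        by (simp add: F_def[abs_def] add.commute)
    qed
  qed (auto simp: F_def[abs_def])
  thus ?thesis
    unfolding F0 by (simp add: LIMSEQ_const_iff)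
qed

subsection \<open>Test functions\<close>

lemma C1_on_const: "C1_on S (\<lambda>x. c)"
  unfolding C1_on_def by (intro exI[of _ "\<lambda>x. 0"]) (auto intro: GDERIV_const)

lemma C1_on_imp_continuous_on:
  assumes "C1_on S u"
  shows "continuous_on S u"
  using assms unfolding C1_on_def gderiv_def
  by (metis continuous_at_imp_continuous_on has_derivative_continuous)

lemma C1_on_mult:
  assumes "C1_on S u" "C1_on S v"
  shows "C1_on S (\<lambda>x. u x * v x)"
proof -
  obtain u' v' where "continuous_on S u'" "\<forall>x\<in>S. GDERIV u x :> u' x" "continuous_on S v'" "\<forall>x\<in>S. GDERIV v x :> v' x"
    using assms by (auto simp: C1_on_def)
  thus ?thesis
    unfolding C1_on_def using assms
    by (intro exI[of _ "\<lambda>x. u x *\<^sub>R v' x + v x *\<^sub>R u' x"])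
       (auto intro!: continuous_intros GDERIV_mult C1_on_imp_continuous_on)
qed

lemma C1_on_prod: "(\<And>i. i \<in> I \<Longrightarrow> C1_on S (u i)) \<Longrightarrow> C1_on S (\<lambda>x. \<Prod>i\<in>I. u i x)"
  by (induction I rule: infinite_finite_induct) (auto intro: C1_on_mult C1_on_const)

lemma C1_on_compose:
  fixes f f' :: "real \<Rightarrow> real"
  assumes "C1_on S u" "\<And>t. (f has_field_derivative f' t) (at t)" "continuous_on UNIV f'"
  shows "C1_on S (\<lambda>x. f (u x))"
proof -
  obtain u' where "continuous_on S u'" "\<forall>x\<in>S. GDERIV u x :> u' x"
    using assms by (auto simp: C1_on_def)
  moreover have "continuous_on S (\<lambda>x. f' (u x))"
    by (rule continuous_on_compose2[OF assms(3) C1_on_imp_continuous_on[OF assms(1)]]) simp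
  ultimately show ?thesis
    unfolding C1_on_def using GDERIV_DERIV_compose[OF _ assms(2)]
    by (intro exI[of _ "\<lambda>x. f' (u x) *\<^sub>R u' x"]) (auto intro!: continuous_on_scaleR)
qed

lemma has_field_derivative_max_sq:
  "((\<lambda>t::real. (max 0 t)\<^sup>2) has_field_derivative 2 * max 0 t) (at t)"
proof (cases t "0::real" rule: linorder_cases)
  case less
  have "((\<lambda>t. 0) has_field_derivative 0) (at t)" by simp
  hence "((\<lambda>t::real. (max 0 t)\<^sup>2) has_field_derivative 0) (at t)"
    by (rule has_field_derivative_transform_within_open[of _ _ _ "{..<0}"]) (use less in auto)
  thus ?thesis using less by simp
next
  case equal
  have "(\<lambda>h::real. (max 0 h)\<^sup>2 / h) \<midarrow>0\<rightarrow> 0"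
  proof (rule Lim_null_comparison)
    have "norm ((max 0 h)\<^sup>2 / h) \<le> \<bar>h\<bar>" for h :: real
      by (cases "0 < h") (auto simp: max_def power2_eq_square)
    thus "\<forall>\<^sub>F h in at (0::real). norm ((max 0 h)\<^sup>2 / h) \<le> \<bar>h\<bar>"
      by (intro always_eventually allI)
    show "(\<lambda>h::real. \<bar>h\<bar>) \<midarrow>0\<rightarrow> 0" by (intro tendsto_rabs_zero tendsto_ident_at)
  qed
  thus ?thesis using equal by (simp add: DERIV_def)
next
  case greater
  have "((\<lambda>t. t\<^sup>2) has_field_derivative 2 * t) (at t)" by (auto intro!: derivative_eq_intros)
  hence "((\<lambda>t::real. (max 0 t)\<^sup>2) has_field_derivative 2 * t) (at t)"
    by (rule has_field_derivative_transform_within_open[of _ _ _ "{0<..}"]) (use greater in auto)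
  thus ?thesis using greater by simp
qed

text \<open>\<open>k b\<^sup>2 / (1 + k b\<^sup>2)\<close> tends to the indicator function of the box for a \<open>C\<^sup>1\<close> function \<open>b\<close> that is
  positive exactly there.\<close>

lemma box_test_functions:
  fixes p q :: "'a::euclidean_space"
  assumes "cbox p q \<subseteq> \<Omega>"
  shows "\<exists>\<psi>. (\<forall>k::nat. \<psi> k \<in> test_functions \<Omega>) \<and> (\<forall>k x. \<bar>\<psi> k x\<bar> \<le> 1) \<and>
    (\<forall>x. (\<lambda>k. \<psi> k x) \<longlonglongrightarrow> indicator (box p q) x)"
proof -
  define b where "b x = (\<Prod>i\<in>Basis. (max 0 (x \<bullet> i - p \<bullet> i))\<^sup>2 * (max 0 (q \<bullet> i - x \<bullet> i))\<^sup>2)" for x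
  define f where "f k y = real k * y\<^sup>2 / (1 + real k * y\<^sup>2)" for k and y :: real
  define \<psi> where "\<psi> k x = f k (b x)" for k x
  have lin: "C1_on UNIV (\<lambda>x. c * (x \<bullet> i) + d)" for c d :: real and i :: 'a
    unfolding C1_on_def gderiv_def
    by (intro exI[of _ "\<lambda>x. c *\<^sub>R i"] conjI ballI) (auto intro!: derivative_eq_intros continuous_intros)
  have "C1_on UNIV (\<lambda>x. (max 0 (1 * (x \<bullet> i) + - (p \<bullet> i)))\<^sup>2)" "C1_on UNIV (\<lambda>x. (max 0 (- 1 * (x \<bullet> i) + q \<bullet> i))\<^sup>2)" for i
    by (intro C1_on_compose[OF lin has_field_derivative_max_sq] continuous_intros)+
  hence b1: "C1_on UNIV b"
    unfolding b_def by (intro C1_on_prod C1_on_mult) simp_all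
  have pos: "1 + real k * y\<^sup>2 > 0" for k and y :: real
    by (simp add: add_pos_nonneg)
  have "(f k has_field_derivative 2 * real k * y / (1 + real k * y\<^sup>2)\<^sup>2) (at y)" for k y
    unfolding f_def using pos[of k y]
    by (auto intro!: derivative_eq_intros simp: field_simps power2_eq_square)
  moreover have "1 + real k * y\<^sup>2 \<noteq> 0" for k and y :: real using pos[of k y] by simp
  ultimately have C1: "C1_on UNIV (\<psi> k)" for k
    unfolding \<psi>_def by (intro C1_on_compose[OF b1]) (auto intro!: continuous_intros)
  have b0: "b x = 0" if "x \<notin> box p q" for x
  proof -
    from that obtain i where "i \<in> Basis" "\<not> (p \<bullet> i < x \<bullet> i \<and> x \<bullet> i < q \<bullet> i)"
      unfolding mem_box by blast
    thus ?thesis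
      unfolding b_def by (intro prod_zero[OF finite_Basis] bexI[of _ i]) (auto simp: max_def)
  qed
  have "b x \<noteq> 0" if "x \<in> box p q" for x
    using that unfolding b_def mem_box by (auto simp: max_def)
  have "\<psi> k \<in> test_functions \<Omega>" for k
    unfolding test_functions_def using C1 assms b0 box_subset_cbox[of p q]
    by (auto simp: \<psi>_def f_def intro!: exI[of _ "cbox p q"])
  moreover have "\<bar>\<psi> k x\<bar> \<le> 1" for k x
    using pos[of k "b x"] by (simp add: \<psi>_def f_def divide_le_eq)
  moreover have "(\<lambda>k. \<psi> k x) \<longlonglongrightarrow> indicator (box p q) x" for x
  proof (cases "x \<in> box p q")
    case True
    hence c: "0 < (b x)\<^sup>2" using \<open>\<And>x. x \<in> box p q \<Longrightarrow> b x \<noteq> 0\<close> by simp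
    have "(\<lambda>k. 1 - 1 / (1 + real k * (b x)\<^sup>2)) \<longlonglongrightarrow> 1 - 0"
    proof (intro tendsto_diff tendsto_const tendsto_divide_0[OF tendsto_const] filterlim_at_top_imp_at_infinity)
      show "filterlim (\<lambda>k. 1 + real k * (b x)\<^sup>2) at_top sequentially"
        by (intro filterlim_tendsto_add_at_top[OF tendsto_const] filterlim_at_top_mult_tendsto_pos[OF tendsto_const c]
            filterlim_real_sequentially)
    qed
    moreover have "1 - 1 / (1 + real k * (b x)\<^sup>2) = \<psi> k x" for k
      using pos[of k "b x"] by (simp add: \<psi>_def f_def field_simps)
    ultimately show ?thesis using True by simp
  qed (simp add: \<psi>_def f_def b0)
  ultimately show ?thesis by blast
qed

lemma integrable_scaleR_square_integrable:
  fixes u :: "'a \<Rightarrow> real" and v :: "'a \<Rightarrow> 'b::euclidean_space"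
  assumes u: "square_integrable M u" and v: "square_integrable M v"
  shows "integrable M (\<lambda>x. u x *\<^sub>R v x)"
proof (rule Bochner_Integration.integrable_bound)
  show "integrable M (\<lambda>x. (norm (u x))\<^sup>2 + (norm (v x))\<^sup>2)"
    using u v by (simp add: square_integrable_def)
  show "(\<lambda>x. u x *\<^sub>R v x) \<in> borel_measurable M"
    using u v by (auto simp: square_integrable_def)
  have pq: "p * q \<le> p\<^sup>2 + q\<^sup>2" for p q :: real
    using sum_squares_bound[of p q] sum_power2_ge_zero[of p q] by linarith
  show "AE x in M. norm (u x *\<^sub>R v x) \<le> norm ((norm (u x))\<^sup>2 + (norm (v x))\<^sup>2)"
  proof (rule AE_I2)
    fix x show "norm (u x *\<^sub>R v x) \<le> norm ((norm (u x))\<^sup>2 + (norm (v x))\<^sup>2)"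
      using pq[of "\<bar>u x\<bar>" "norm (v x)"] by simp
  qed
qed

section \<open>Weak gradients and Green's formula on bounded open sets\<close>

locale bounded_open =
  fixes \<Omega> :: "'a::euclidean_space set"
  assumes opn: "open \<Omega>" and bdd: "bounded \<Omega>"
begin

abbreviation "M \<equiv> lebesgue_on \<Omega>"

lemma lmeas: "\<Omega> \<in> lmeasurable"
  using bdd opn by (simp add: lmeasurable_open)

lemma sets_lebesgue: "\<Omega> \<in> sets lebesgue"
  using lmeas by (rule fmeasurableD)

lemma finite_measure_M: "finite_measure M"
  by (rule finite_measure_lebesgue_on[OF lmeas])

lemma integrable_M_bounded:
  fixes f :: "'a \<Rightarrow> 'b::euclidean_space"
  assumes "f \<in> borel_measurable M" "\<And>x. norm (f x) \<le> B"
  shows "integrable M f"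
  by (rule finite_measure.integrable_const_bound[OF finite_measure_M, of f B]) (use assms in auto)

lemma square_integrable_bounded:
  fixes f :: "'a \<Rightarrow> 'b::euclidean_space"
  assumes f: "f \<in> borel_measurable M" and B: "\<And>x. norm (f x) \<le> B"
  shows "square_integrable M f"
  unfolding square_integrable_def
proof
  show "integrable M (\<lambda>x. (norm (f x))\<^sup>2)"
    by (rule integrable_M_bounded[of _ "B\<^sup>2"]) (use f B in \<open>auto intro: power_mono\<close>)
qed (rule f)

lemma square_integrable_const: "square_integrable M (\<lambda>x. c :: 'b::euclidean_space)"
  by (rule square_integrable_bounded[of _ "norm c"]) auto

lemma square_integrable_imp_integrable:
  fixes f :: "'a \<Rightarrow> 'b::euclidean_space"
  assumes "square_integrable M f"
  shows "integrable M f"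
  using integrable_scaleR_square_integrable[OF square_integrable_const[of 1] assms] by simp

lemma test_function_square_integrable:
  assumes "\<psi> \<in> test_functions \<Omega>"
  shows "square_integrable M \<psi>" "square_integrable M (grad \<psi>)"
proof -
  obtain K where K: "compact K" "\<And>x. x \<notin> K \<Longrightarrow> \<psi> x = 0"
    "continuous_on UNIV \<psi>" "continuous_on UNIV (grad \<psi>)" "\<And>x. x \<notin> K \<Longrightarrow> grad \<psi> x = 0"
    using test_functionE[OF assms] by metis
  have meas: "f \<in> borel_measurable M" if "continuous_on UNIV f" for f :: "'a \<Rightarrow> 'b::euclidean_space"
    by (intro continuous_imp_measurable_on_sets_lebesgue continuous_on_subset[OF that] sets_lebesgue) auto
  obtain B where "\<And>x. norm (\<psi> x) \<le> B"
    using bounded_continuous_compact_support[OF K(3) K(1,2)] by metis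
  thus "square_integrable M \<psi>" by (rule square_integrable_bounded[OF meas[OF K(3)]])
  obtain B where "\<And>x. norm (grad \<psi> x) \<le> B"
    using bounded_continuous_compact_support[OF K(4) K(1,5)] by metis
  thus "square_integrable M (grad \<psi>)" by (rule square_integrable_bounded[OF meas[OF K(4)]])
qed

lemma integral_M_lborel:
  fixes f :: "'a \<Rightarrow> 'b::euclidean_space"
  assumes "f \<in> borel_measurable borel" "\<And>x. x \<notin> \<Omega> \<Longrightarrow> f x = 0"
  shows "(LINT x|M. f x) = (LINT x|lborel. f x)"
proof -
  have "(LINT x|M. f x) = (LINT x|lebesgue. indicator \<Omega> x *\<^sub>R f x)"
    using sets_lebesgue by (intro integral_restrict_space) simp
  also have "(\<lambda>x. indicator \<Omega> x *\<^sub>R f x) = f"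
    using assms(2) by (auto simp: fun_eq_iff split: split_indicator)
  also have "(LINT x|lebesgue. f x) = (LINT x|lborel. f x)"
    using assms(1) by (intro integral_completion) simp
  finally show ?thesis .
qed

lemma integral_grad_zero:
  assumes \<psi>: "\<psi> \<in> test_functions \<Omega>"
  shows "(LINT x|M. grad \<psi> x) = 0"
proof -
  obtain K where K: "compact K" "K \<subseteq> \<Omega>" "continuous_on UNIV (grad \<psi>)" "\<And>x. x \<notin> K \<Longrightarrow> grad \<psi> x = 0"
    using test_functionE[OF \<psi>] by metis
  obtain B where B: "\<And>x. norm (grad \<psi> x) \<le> B"
    using bounded_continuous_compact_support[OF K(3) K(1,4)] by metis
  have meas: "grad \<psi> \<in> borel_measurable borel" using K by (intro borel_measurable_continuous_onI)
  have int: "integrable lborel (grad \<psi>)"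
    by (rule integrable_lborel_compact_support[OF meas K(1,4) B])
  have "(LINT x|lborel. grad \<psi> x) \<bullet> (LINT x|lborel. grad \<psi> x) = 0"
    using integral_directional_derivative_zero[OF \<psi>] integral_inner_left[OF int] by simp
  hence "(LINT x|lborel. grad \<psi> x) = 0" by simp
  moreover have "(LINT x|M. grad \<psi> x) = (LINT x|lborel. grad \<psi> x)"
    using K by (intro integral_M_lborel meas) auto
  ultimately show ?thesis by simp
qed

lemma test_functions_mult:
  assumes "\<psi> \<in> test_functions \<Omega>" "\<zeta> \<in> test_functions \<Omega>"
  shows "(\<lambda>x. \<psi> x * \<zeta> x) \<in> test_functions \<Omega>"
  using assms unfolding test_functions_def by (auto intro: C1_on_mult)

text \<open>The product of two test functions is a test function, and the integral of its gradient
  vanishes; by the product rule this is integration by parts.\<close>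

lemma weak_gradient_test_function:
  assumes \<psi>: "\<psi> \<in> test_functions \<Omega>"
  shows "weak_gradient \<Omega> \<psi> (grad \<psi>)"
  unfolding weak_gradient_def
proof (intro conjI ballI)
  fix \<zeta> assume \<zeta>: "\<zeta> \<in> test_functions \<Omega>"
  have "grad (\<lambda>x. \<psi> x * \<zeta> x) x = \<psi> x *\<^sub>R grad \<zeta> x + \<zeta> x *\<^sub>R grad \<psi> x" for x
  proof (intro grad_eq GDERIV_mult)
    show "GDERIV \<psi> x :> grad \<psi> x" using test_functionE[OF \<psi>] by metis
    show "GDERIV \<zeta> x :> grad \<zeta> x" using test_functionE[OF \<zeta>] by metis
  qed
  hence "(LINT x|M. \<psi> x *\<^sub>R grad \<zeta> x + \<zeta> x *\<^sub>R grad \<psi> x) = 0"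
    using integral_grad_zero[OF test_functions_mult[OF \<psi> \<zeta>]] by simp
  thus "(LINT x|M. \<psi> x *\<^sub>R grad \<zeta> x) = - (LINT x|M. \<zeta> x *\<^sub>R grad \<psi> x)"
    using test_function_square_integrable[OF \<psi>] test_function_square_integrable[OF \<zeta>]
    by (subst (asm) Bochner_Integration.integral_add)
       (auto intro: integrable_scaleR_square_integrable simp: eq_neg_iff_add_eq_0)
qed (rule test_function_square_integrable[OF \<psi>])

lemma weak_gradient_diff:
  assumes "square_integrable M u" "square_integrable M v" "weak_gradient \<Omega> u g" "weak_gradient \<Omega> v k"
  shows "weak_gradient \<Omega> (\<lambda>x. u x - v x) (\<lambda>x. g x - k x)"
  using assms unfolding weak_gradient_def
  by (auto simp: scaleR_diff_left scaleR_diff_right square_integrable_diff integrable_scaleR_square_integrable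
      test_function_square_integrable)

text \<open>Testing with approximations of the indicator function of a box shows that the integral over
  every box in \<open>\<Omega>\<close> vanishes, and almost every point is a Lebesgue point.\<close>

lemma fundamental_lemma:
  fixes g :: "'a \<Rightarrow> 'b::euclidean_space"
  assumes g: "integrable M g" and orth: "\<And>\<psi>. \<psi> \<in> test_functions \<Omega> \<Longrightarrow> (LINT x|M. \<psi> x *\<^sub>R g x) = 0"
  shows "AE x in M. g x = 0"
proof -
  define G where "G x = (if x \<in> \<Omega> then g x else 0)" for x
  have Gind: "(\<lambda>x. indicator \<Omega> x *\<^sub>R g x) = G"
    by (auto simp: G_def fun_eq_iff)
  have G: "integrable lebesgue G"
    using g sets_lebesgue by (simp add: integrable_restrict_space Gind)
  have Gabs: "G absolutely_integrable_on S" if "S \<in> sets lebesgue" for S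
    using G that by (intro set_integrable_subset[of lebesgue UNIV G S]) (auto simp: set_integrable_def)
  have box0: "integral (cbox p q) G = 0" if pq: "cbox p q \<subseteq> \<Omega>" for p q
  proof -
    obtain \<psi> where \<psi>: "\<And>k::nat. \<psi> k \<in> test_functions \<Omega>" "\<And>k x. \<bar>\<psi> k x\<bar> \<le> 1"
      "\<And>x. (\<lambda>k. \<psi> k x) \<longlonglongrightarrow> indicator (box p q) x"
      using box_test_functions[OF pq] by metis
    have "(\<lambda>k. LINT x|M. \<psi> k x *\<^sub>R g x) \<longlonglongrightarrow> (LINT x|M. indicator (box p q) x *\<^sub>R g x)"
    proof (rule integral_dominated_convergence[where w = "\<lambda>x. norm (g x)"])
      have "{x \<in> \<Omega>. x \<in> box p q} = box p q \<inter> \<Omega>" by auto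
      moreover have "box p q \<inter> space M \<in> sets M"
        using sets_lebesgue by (auto simp: sets_restrict_space)
      ultimately show "(\<lambda>x. indicator (box p q) x *\<^sub>R g x) \<in> borel_measurable M"
        using g by (intro borel_measurable_scaleR borel_measurable_indicator') auto
      show "(\<lambda>x. \<psi> k x *\<^sub>R g x) \<in> borel_measurable M" for k
        using g test_function_square_integrable(1)[OF \<psi>(1), of k]
        by (intro borel_measurable_scaleR) (auto simp: square_integrable_def)
      show "AE x in M. (\<lambda>k. \<psi> k x *\<^sub>R g x) \<longlonglongrightarrow> indicator (box p q) x *\<^sub>R g x"
        by (intro AE_I2 tendsto_intros \<psi>)
      show "AE x in M. norm (\<psi> k x *\<^sub>R g x) \<le> norm (g x)" for k
        using \<psi>(2) by (intro AE_I2) (simp add: mult_left_le_one_le)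
    qed (use g in auto)
    hence "(LINT x|M. indicator (box p q) x *\<^sub>R g x) = 0"
      by (simp add: orth[OF \<psi>(1)] LIMSEQ_const_iff)
    moreover have "(LINT x|M. indicator (box p q) x *\<^sub>R g x) = (LINT x:box p q|lebesgue. G x)"
      unfolding set_lebesgue_integral_def using sets_lebesgue
      by (subst integral_restrict_space) (auto intro!: Bochner_Integration.integral_cong simp: G_def split: split_indicator)
    moreover have "(LINT x:box p q|lebesgue. G x) = integral (box p q) G"
      by (rule set_lebesgue_integral_eq_integral(2)[OF Gabs]) simp
    ultimately show ?thesis
      by (simp add: integral_open_interval)
  qed
  have "G integrable_on cbox p q" for p q
    by (rule set_lebesgue_integral_eq_integral(1)[OF Gabs]) simp
  then obtain N where N: "negligible N" "\<And>x e. x \<notin> N \<Longrightarrow> 0 < e \<Longrightarrow> \<exists>d>0. \<forall>h. 0 < h \<and> h < d \<longrightarrow>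
      norm (integral (cbox x (x + h *\<^sub>R One)) G /\<^sub>R h ^ DIM('a) - G x) < e"
    using integrable_ccontinuous_explicit[of G] by metis
  have "g x = 0" if x: "x \<in> \<Omega>" "x \<notin> N" for x
  proof (rule ccontr)
    assume "g x \<noteq> 0"
    hence "0 < norm (G x)" using x by (simp add: G_def)
    with N(2)[OF x(2)] obtain d where d: "0 < d" "\<And>h. 0 < h \<and> h < d \<Longrightarrow>
      norm (integral (cbox x (x + h *\<^sub>R One)) G /\<^sub>R h ^ DIM('a) - G x) < norm (G x)" by blast
    obtain \<rho> where \<rho>: "0 < \<rho>" "ball x \<rho> \<subseteq> \<Omega>"
      using opn x openE by blast
    define h where "h = min (d / 2) (\<rho> / (2 * (1 + norm (One::'a))))"
    have n: "0 < 1 + norm (One::'a)" by (simp add: add_pos_nonneg)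
    have h: "0 < h" "h < d" using d \<rho> n by (auto simp: h_def)
    have "h * norm (One::'a) < \<rho>"
    proof -
      have "h * norm (One::'a) \<le> h * (1 + norm (One::'a))" using h by (intro mult_left_mono) auto
      also have "\<dots> \<le> \<rho> / (2 * (1 + norm (One::'a))) * (1 + norm (One::'a))"
        using n by (intro mult_right_mono) (auto simp: h_def)
      also have "\<dots> = \<rho> / 2"
      proof -
        have "a / (2 * b) * b = a / 2" if "0 < b" for a b :: real
          using that by simp
        from this[OF n] show ?thesis .
      qed
      also have "\<dots> < \<rho>" using \<rho> by simp
      finally show ?thesis .
    qed
    hence "cbox x (x + h *\<^sub>R One) \<subseteq> ball x \<rho>"
    proof (intro subsetI)
      fix y assume y: "y \<in> cbox x (x + h *\<^sub>R One)"
      have "norm (y - x) \<le> norm (h *\<^sub>R (One::'a))"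
        using y h by (intro norm_le_componentwise) (auto simp: mem_box inner_diff_left inner_add_left)
      hence "norm (y - x) < \<rho>"
        using \<open>h * norm (One::'a) < \<rho>\<close> h by simp
      thus "y \<in> ball x \<rho>" by (simp add: dist_norm norm_minus_commute)
    qed
    hence "integral (cbox x (x + h *\<^sub>R One)) G = 0"
      using \<rho> by (intro box0) auto
    with d(2)[of h] h show False by simp
  qed
  hence "AE x in lebesgue. x \<in> \<Omega> \<longrightarrow> g x = 0"
    using N(1) by (intro AE_I'[of N]) (auto simp: negligible_iff_null_sets)
  thus ?thesis
    using sets_lebesgue by (simp add: AE_restrict_space_iff)
qed

lemma fundamental_lemma_inner:
  assumes "square_integrable M u" "square_integrable M v"
    and "\<And>\<psi>. \<psi> \<in> test_functions \<Omega> \<Longrightarrow> L2_inner M u \<psi> = L2_inner M v \<psi>"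
  shows "AE x in M. u x = v x"
proof -
  note sq = square_integrable_diff[OF assms(1,2)]
  have "AE x in M. u x - v x = 0"
  proof (rule fundamental_lemma[OF square_integrable_imp_integrable[OF sq]])
    fix \<psi> assume \<psi>: "\<psi> \<in> test_functions \<Omega>"
    have "L2_inner M (\<lambda>x. u x - v x) \<psi> = 0"
      using assms \<psi> by (simp add: L2_inner_diff_left test_function_square_integrable)
    thus "(LINT x|M. \<psi> x *\<^sub>R (u x - v x)) = 0" by (simp add: L2_inner_def mult.commute)
  qed
  thus ?thesis by simp
qed

lemma weak_gradient_unique:
  assumes "weak_gradient \<Omega> u g" "weak_gradient \<Omega> u k"
  shows "AE x in M. g x = k x"
proof -
  have sq: "square_integrable M g" "square_integrable M k"
    using assms by (auto simp: weak_gradient_def)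
  have "AE x in M. g x - k x = 0"
  proof (rule fundamental_lemma[OF square_integrable_imp_integrable[OF square_integrable_diff[OF sq]]])
    fix \<psi> assume \<psi>: "\<psi> \<in> test_functions \<Omega>"
    have "(LINT x|M. \<psi> x *\<^sub>R g x) = (LINT x|M. \<psi> x *\<^sub>R k x)"
      using assms \<psi> unfolding weak_gradient_def by (metis neg_equal_iff_equal)
    thus "(LINT x|M. \<psi> x *\<^sub>R (g x - k x)) = 0"
      using sq test_function_square_integrable[OF \<psi>]
      by (simp add: scaleR_diff_right integrable_scaleR_square_integrable)
  qed
  thus ?thesis by simp
qed

lemma weak_gradient_wgrad: "u \<in> H1 \<Omega> \<Longrightarrow> weak_gradient \<Omega> u (wgrad \<Omega> u)"
  using someI_ex[of "weak_gradient \<Omega> u"] by (simp add: H1_def wgrad_def)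

lemma H1_D:
  assumes "u \<in> H1 \<Omega>"
  shows "square_integrable M u" "square_integrable M (wgrad \<Omega> u)"
  using assms weak_gradient_wgrad[OF assms] by (auto simp: H1_def weak_gradient_def)

lemma weak_gradient_const: "weak_gradient \<Omega> (\<lambda>x. c) (\<lambda>x. 0)"
  using integral_grad_zero square_integrable_const[of "0::'a"] by (simp add: weak_gradient_def)

lemma const_H1: "(\<lambda>x. c) \<in> H1 \<Omega>"
  using weak_gradient_const square_integrable_const by (auto simp: H1_def)

text \<open>Not only are the weak gradients of functions that differ by a constant equal almost everywhere,
  but the representatives \<open>wgrad\<close> are the same, as the predicates selecting them agree.\<close>

lemma wgrad_eq_of_diff_const:
  assumes u: "square_integrable M u" and v: "square_integrable M v" and uv: "AE x in M. u x = v x + c"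
  shows "wgrad \<Omega> u = wgrad \<Omega> v"
proof -
  have "(LINT x|M. u x *\<^sub>R grad \<psi> x) = (LINT x|M. v x *\<^sub>R grad \<psi> x)" if \<psi>: "\<psi> \<in> test_functions \<Omega>" for \<psi>
  proof -
    note tf = test_function_square_integrable[OF \<psi>]
    have "(LINT x|M. u x *\<^sub>R grad \<psi> x) = (LINT x|M. v x *\<^sub>R grad \<psi> x + c *\<^sub>R grad \<psi> x)"
    proof (rule Bochner_Integration.integral_cong_AE)
      show "AE x in M. u x *\<^sub>R grad \<psi> x = v x *\<^sub>R grad \<psi> x + c *\<^sub>R grad \<psi> x"
        using uv by eventually_elim (simp add: scaleR_add_left)
    qed (use u v tf in \<open>auto simp: square_integrable_def\<close>)
    also have "\<dots> = (LINT x|M. v x *\<^sub>R grad \<psi> x) + c *\<^sub>R (LINT x|M. grad \<psi> x)"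
      using v tf by (simp add: integrable_scaleR_square_integrable square_integrable_imp_integrable)
    finally show ?thesis by (simp add: integral_grad_zero[OF \<psi>])
  qed
  hence "weak_gradient \<Omega> u = weak_gradient \<Omega> v"
    unfolding weak_gradient_def by (intro ext) auto
  thus ?thesis by (simp add: wgrad_def)
qed

text \<open>The identity is known for test functions. Hence its defect \<open>d\<close> at
  \<open>v\<close> equals the defect at \<open>v - \<psi> k\<close>, which is at most a constant
  times the \<open>H1_norm\<close> of this difference and so tends to 0.\<close>

lemma green_H10:
  assumes u: "neg_laplacian \<Omega> u f" and v: "v \<in> H10 \<Omega>"
  shows "L2_inner M (wgrad \<Omega> u) (wgrad \<Omega> v) = L2_inner M f v"
proof -
  have uH: "u \<in> H1 \<Omega>" and f: "square_integrable M f"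
    and weak: "\<And>\<psi>. \<psi> \<in> test_functions \<Omega> \<Longrightarrow> L2_inner M (wgrad \<Omega> u) (grad \<psi>) = L2_inner M f \<psi>"
    using u by (auto simp: neg_laplacian_def)
  obtain \<psi> where vH: "v \<in> H1 \<Omega>" and \<psi>: "\<And>k::nat. \<psi> k \<in> test_functions \<Omega>"
    and lim: "(\<lambda>k. H1_norm \<Omega> (\<lambda>x. v x - \<psi> k x)) \<longlonglongrightarrow> 0"
    using v by (auto simp: H10_def)
  note U = H1_D[OF uH] and V = H1_D[OF vH] and T = test_function_square_integrable[OF \<psi>]
  define d where "d = L2_inner M (wgrad \<Omega> u) (wgrad \<Omega> v) - L2_inner M f v"
  define C where "C = L2_norm M (wgrad \<Omega> u) + L2_norm M f"
  have "\<bar>d\<bar> \<le> C * H1_norm \<Omega> (\<lambda>x. v x - \<psi> k x)" for k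
  proof -
    define w where "w x = v x - \<psi> k x" for x
    have w: "w \<in> H1 \<Omega>" "weak_gradient \<Omega> w (\<lambda>x. wgrad \<Omega> v x - grad (\<psi> k) x)"
      using weak_gradient_diff[OF V(1) T(1) weak_gradient_wgrad[OF vH] weak_gradient_test_function[OF \<psi>], of k]
        square_integrable_diff[OF V(1) T(1)] by (auto simp: H1_def w_def[abs_def])
    note W = H1_D[OF w(1)]
    have ae: "AE x in M. wgrad \<Omega> w x = wgrad \<Omega> v x - grad (\<psi> k) x"
      by (rule weak_gradient_unique[OF weak_gradient_wgrad[OF w(1)] w(2)])
    have "L2_inner M (wgrad \<Omega> u) (wgrad \<Omega> w) = L2_inner M (wgrad \<Omega> u) (\<lambda>x. wgrad \<Omega> v x - grad (\<psi> k) x)"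
      by (rule L2_inner_cong_AE[OF U(2) W(2) U(2) square_integrable_diff[OF V(2) T(2)] _ ae]) simp
    also have "\<dots> = L2_inner M (wgrad \<Omega> u) (wgrad \<Omega> v) - L2_inner M f (\<psi> k)"
      using L2_inner_diff_right[OF V(2) T(2) U(2)] weak[OF \<psi>] by simp
    finally have d: "d = L2_inner M (wgrad \<Omega> u) (wgrad \<Omega> w) - L2_inner M f w"
      using L2_inner_diff_right[OF V(1) T(1) f] by (simp add: d_def w_def[abs_def])
    have n: "L2_norm M w \<le> H1_norm \<Omega> w" "L2_norm M (wgrad \<Omega> w) \<le> H1_norm \<Omega> w"
      unfolding H1_norm_def by (auto intro!: real_le_rsqrt)
    have "\<bar>d\<bar> \<le> L2_norm M (wgrad \<Omega> u) * L2_norm M (wgrad \<Omega> w) + L2_norm M f * L2_norm M w"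
      unfolding d using L2_Cauchy_Schwarz[OF U(2) W(2)] L2_Cauchy_Schwarz[OF f W(1)] by linarith
    also have "\<dots> \<le> L2_norm M (wgrad \<Omega> u) * H1_norm \<Omega> w + L2_norm M f * H1_norm \<Omega> w"
      using n by (intro add_mono mult_left_mono L2_norm_nonneg)
    finally show ?thesis by (simp add: C_def w_def[abs_def] distrib_right)
  qed
  moreover have "(\<lambda>k. C * H1_norm \<Omega> (\<lambda>x. v x - \<psi> k x)) \<longlonglongrightarrow> C * 0"
    by (intro tendsto_intros lim)
  ultimately have "\<bar>d\<bar> \<le> C * 0"
    by (intro tendsto_lowerbound[where F = sequentially]) (auto intro: always_eventually)
  thus ?thesis by (simp add: d_def)
qed

end

text \<open>\<open>normal_derivative\<close> provides the formula with some right-hand side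
  \<open>g\<close>. A function has at most one distributional Laplacian up to null sets, so
  \<open>g\<close> equals \<open>f\<close> almost everywhere.\<close>

lemma green_normal_derivative:
  fixes P :: "'a::euclidean_space set"
  assumes P: "bounded P" and u: "neg_laplacian (interior P) u f" and q: "normal_derivative P tr u q" and v: "v \<in> H1 (interior P)"
  shows "L2_inner (lebesgue_on (interior P)) (wgrad (interior P) u) (wgrad (interior P) v)
    - L2_inner (lebesgue_on (interior P)) f v = L2_inner (surface_measure P) q (tr v)"
proof -
  interpret bounded_open "interior P"
    using P by unfold_locales (auto intro: bounded_interior)
  obtain g where g: "neg_laplacian (interior P) u g"
    and eq: "L2_inner M (wgrad (interior P) u) (wgrad (interior P) v) - L2_inner M g v = L2_inner (surface_measure P) q (tr v)"
    using q v by (auto simp: normal_derivative_def)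
  have sq: "square_integrable M f" "square_integrable M g"
    using u g by (auto simp: neg_laplacian_def)
  have "AE x in M. f x = g x"
    using u g by (intro fundamental_lemma_inner[OF sq]) (simp add: neg_laplacian_def)
  hence "L2_inner M f v = L2_inner M g v"
    using H1_D[OF v] sq by (intro L2_inner_cong_AE) auto
  thus ?thesis using eq by simp
qed

section \<open>The boundary value problem\<close>

text \<open>The nonnegativity of \<open>E\<close> is inherited from the discrete operators as the
  mesh size tends to 0. It takes the place of the energy form in the proof that the eigenvalues are
  positive.\<close>

locale heat_problem =
  fixes P :: "'a::euclidean_space set" and tr :: "('a \<Rightarrow> real) \<Rightarrow> 'a \<Rightarrow> real" and bc :: "'a boundary_operator"
    and \<phi> :: "nat \<Rightarrow> 'a \<Rightarrow> real" and lam :: "nat \<Rightarrow> real" and \<mu> :: real and E :: "('a \<Rightarrow> real) \<Rightarrow> 'a \<Rightarrow> real"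
  assumes bounded_P: "bounded P"
    and eigen: "eigenpairs P tr bc \<phi> lam"
    and first: "first_positive_eigenvalue lam \<mu>"
    and E: "exact_solution_operator P tr bc E"
    and E_pos: "\<And>g. g \<in> data_space P bc \<Longrightarrow> 0 \<le> L2_inner (lebesgue_on (interior P)) (E g) g"
begin

sublocale bounded_open "interior P"
  using bounded_P by unfold_locales (auto intro: bounded_interior)

lemma eigenfunction: "neg_laplacian (interior P) (\<phi> m) (\<lambda>x. lam m * \<phi> m x)"
  "boundary_condition P tr bc (\<phi> m)"
  using eigen by (auto simp: eigenpairs_def)

lemma eigenfunction_H1: "\<phi> m \<in> H1 (interior P)"
  using eigenfunction(1)[of m] by (simp add: neg_laplacian_def)

sublocale L2_basis M \<phi>
proof
  show "square_integrable M (\<phi> m)" for m by (rule H1_D(1)[OF eigenfunction_H1])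
qed (use eigen in \<open>auto simp: eigenpairs_def fourier_coeff_def\<close>)

abbreviation "data \<equiv> data_space P bc"

lemma data_sq: "g \<in> data \<Longrightarrow> square_integrable M g"
  by (simp add: data_space_def)

lemma data_mean: "g \<in> data \<Longrightarrow> bc = Neumann \<Longrightarrow> L2_inner M g (\<lambda>x. 1) = 0"
  by (simp add: data_space_def L2_inner_def)

lemma dataI: "square_integrable M g \<Longrightarrow> (bc = Neumann \<Longrightarrow> L2_inner M g (\<lambda>x. 1) = 0) \<Longrightarrow> g \<in> data"
  by (simp add: data_space_def L2_inner_def)

lemma data_cmult: "g \<in> data \<Longrightarrow> (\<lambda>x. c * g x) \<in> data"
  by (rule dataI) (auto intro: square_integrable_cmult data_sq simp: L2_inner_cmult_left data_mean)

lemma data_sum: "(\<And>i. i \<in> I \<Longrightarrow> g i \<in> data) \<Longrightarrow> (\<lambda>x. \<Sum>i\<in>I. g i x) \<in> data"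
  by (rule dataI)
     (auto intro: square_integrable_sum data_sq simp: L2_inner_sum_left data_sq data_mean square_integrable_const)

lemma E_data: "g \<in> data \<Longrightarrow> E g \<in> data"
  and E_solves: "g \<in> data \<Longrightarrow> neg_laplacian (interior P) (E g) g"
  and E_boundary: "g \<in> data \<Longrightarrow> boundary_condition P tr bc (E g)"
  using E by (auto simp: exact_solution_operator_def)

text \<open>Both sides of Green's formula are symmetric in the two functions.\<close>

lemma lam_E_coeff:
  assumes g: "g \<in> data"
  shows "lam m * L2_inner M (E g) (\<phi> m) = L2_inner M g (\<phi> m)"
proof -
  note u = eigenfunction[of m] and v = E_solves[OF g] E_boundary[OF g]
  have vH: "E g \<in> H1 (interior P)" using v by (simp add: neg_laplacian_def)
  have "L2_inner M (\<lambda>x. lam m * \<phi> m x) (E g) = L2_inner M g (\<phi> m)"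
  proof (cases bc)
    case Dirichlet
    have "L2_inner M (wgrad (interior P) (\<phi> m)) (wgrad (interior P) (E g)) = L2_inner M (\<lambda>x. lam m * \<phi> m x) (E g)"
      using u v Dirichlet by (intro green_H10) auto
    moreover have "L2_inner M (wgrad (interior P) (E g)) (wgrad (interior P) (\<phi> m)) = L2_inner M g (\<phi> m)"
      using u v Dirichlet by (intro green_H10) auto
    ultimately show ?thesis
      using L2_inner_commute[of M "wgrad (interior P) (\<phi> m)" "wgrad (interior P) (E g)"] by simp
  next
    case Neumann
    have q: "normal_derivative P tr (\<phi> m) (\<lambda>y. 0)" "normal_derivative P tr (E g) (\<lambda>y. 0)"
      using u v Neumann by auto
    show ?thesis
      using green_normal_derivative[OF bounded_P u(1) q(1) vH]
        green_normal_derivative[OF bounded_P v(1) q(2) eigenfunction_H1[of m]]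
        L2_inner_commute[of M "wgrad (interior P) (\<phi> m)" "wgrad (interior P) (E g)"]
      by (simp add: L2_inner_def[of "surface_measure P"])
  next
    case (Robin \<kappa>)
    have q: "normal_derivative P tr (\<phi> m) (\<lambda>y. - (\<kappa> y * tr (\<phi> m) y))"
      "normal_derivative P tr (E g) (\<lambda>y. - (\<kappa> y * tr (E g) y))"
      using u v Robin by auto
    have "L2_inner (surface_measure P) (\<lambda>y. - (\<kappa> y * tr (\<phi> m) y)) (tr (E g))
        = L2_inner (surface_measure P) (\<lambda>y. - (\<kappa> y * tr (E g) y)) (tr (\<phi> m))"
      by (simp add: L2_inner_def mult_ac)
    thus ?thesis
      using green_normal_derivative[OF bounded_P u(1) q(1) vH]
        green_normal_derivative[OF bounded_P v(1) q(2) eigenfunction_H1[of m]]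
        L2_inner_commute[of M "wgrad (interior P) (\<phi> m)" "wgrad (interior P) (E g)"]
      by simp
  qed
  thus ?thesis
    by (simp add: L2_inner_cmult_left L2_inner_commute[of M "\<phi> m"])
qed

text \<open>The constant 1 has vanishing weak gradient, so Green's formula with it says, in the
  Neumann case, that \<open>lam m\<close> times the integral of the eigenfunction is 0.\<close>

lemma eigenfunction_data:
  assumes m: "m \<in> modes bc lam"
  shows "\<phi> m \<in> data"
proof (rule dataI[OF basis_sq])
  assume N: "bc = Neumann"
  hence q: "normal_derivative P tr (\<phi> m) (\<lambda>y. 0)" using eigenfunction[of m] by auto
  have "weak_gradient (interior P) (\<lambda>x. 1) (wgrad (interior P) (\<lambda>x. 1))"
    by (rule weak_gradient_wgrad[OF const_H1])
  hence "AE x in M. wgrad (interior P) (\<lambda>x. 1) x = 0"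
    by (rule weak_gradient_unique) (rule weak_gradient_const)
  hence "L2_inner M (wgrad (interior P) (\<phi> m)) (wgrad (interior P) (\<lambda>x. 1)) = L2_inner M (wgrad (interior P) (\<phi> m)) (\<lambda>x. 0)"
    using H1_D[OF eigenfunction_H1] H1_D[OF const_H1] by (intro L2_inner_cong_AE square_integrable_zero) auto
  also have "\<dots> = 0" by (simp add: L2_inner_def)
  finally have "L2_inner M (\<lambda>x. lam m * \<phi> m x) (\<lambda>x. 1) = 0"
    using green_normal_derivative[OF bounded_P eigenfunction(1) q const_H1[of 1]]
    by (simp add: L2_inner_def[of "surface_measure P"])
  thus "L2_inner M (\<phi> m) (\<lambda>x. 1) = 0"
    using m N by (simp add: L2_inner_cmult_left modes_def)
qed

text \<open>For \<open>g = \<phi> m\<close>, \<open>lam_E_coeff\<close> says that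
  \<open>lam m\<close> times the nonnegative number
  \<open>L2_inner M (E (\<phi> m)) (\<phi> m)\<close> is 1.\<close>

lemma lam_pos:
  assumes m: "m \<in> modes bc lam"
  shows "0 < lam m"
proof -
  note d = eigenfunction_data[OF m]
  have "lam m * L2_inner M (E (\<phi> m)) (\<phi> m) = 1"
    using lam_E_coeff[OF d, of m] by (simp add: basis_orth)
  thus ?thesis
    using mult_nonpos_nonneg[OF _ E_pos[OF d], of "lam m"] by (cases "0 < lam m") auto
qed

lemma mu_le_lam: "m \<in> modes bc lam \<Longrightarrow> \<mu> \<le> lam m"
  using first lam_pos[of m] unfolding first_positive_eigenvalue_def by blast

lemma mu_pos: "0 < \<mu>"
  using first by (simp add: first_positive_eigenvalue_def)

text \<open>Outside \<open>modes\<close> the eigenvalue is 0, and \<open>lam_E_coeff\<close> reads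
  \<open>0 = L2_inner M g (\<phi> m)\<close>. So the omitted modes carry nothing of the
  data.\<close>

lemma coeff_outside_modes:
  assumes g: "g \<in> data" and m: "m \<notin> modes bc lam"
  shows "L2_inner M g (\<phi> m) = 0"
  using lam_E_coeff[OF g, of m] m by (auto simp: modes_def split: if_splits)

lemma E_coeff:
  assumes g: "g \<in> data"
  shows "L2_inner M (E g) (\<phi> m) = (if m \<in> modes bc lam then L2_inner M g (\<phi> m) / lam m else 0)"
proof (cases "m \<in> modes bc lam")
  case True
  have "L2_inner M (E g) (\<phi> m) = (lam m * L2_inner M (E g) (\<phi> m)) / lam m"
    using lam_pos[OF True] by simp
  thus ?thesis using True unfolding lam_E_coeff[OF g] by simp
qed (simp add: coeff_outside_modes[OF E_data[OF g]])

lemma E_le: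
  assumes g: "g \<in> data"
  shows "L2_inner M (E g) g \<le> 1 / \<mu> * (L2_norm M g)\<^sup>2"
proof -
  note sq = data_sq[OF g] data_sq[OF E_data[OF g]]
  have "L2_inner M (E g) g = (\<Sum>m. ell2_nth (seq (E g)) m * ell2_nth (seq g) m)"
    using inner_seq[OF sq(2,1)] by (simp add: inner_ell2_def)
  also have "\<dots> \<le> (\<Sum>m. 1 / \<mu> * (ell2_nth (seq g) m * ell2_nth (seq g) m))"
  proof (intro suminf_le summable_mult summable_ell2_mult)
    fix m
    show "ell2_nth (seq (E g)) m * ell2_nth (seq g) m \<le> 1 / \<mu> * (ell2_nth (seq g) m * ell2_nth (seq g) m)"
    proof (cases "m \<in> modes bc lam")
      case True
      have "1 / lam m * (L2_inner M g (\<phi> m))\<^sup>2 \<le> 1 / \<mu> * (L2_inner M g (\<phi> m))\<^sup>2"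
        using mu_le_lam[OF True] mu_pos by (intro mult_right_mono divide_left_mono) auto
      thus ?thesis
        using True by (simp add: seq_nth sq E_coeff[OF g] power2_eq_square)
    next
      case False
      thus ?thesis
        using coeff_outside_modes[OF g] by (simp add: seq_nth sq)
    qed
  qed
  also have "\<dots> = 1 / \<mu> * (seq g \<bullet> seq g)"
    unfolding inner_ell2_def by (rule suminf_mult[OF summable_ell2_mult])
  also have "seq g \<bullet> seq g = (L2_norm M g)\<^sup>2"
    by (simp add: inner_seq sq L2_norm_sq)
  finally show ?thesis .
qed

text \<open>The inverse eigenvalues as a function on the images of the eigenfunctions in \<open>\<ell>\<^sup>2\<close>.\<close>

definition inv_lam :: "ell2 \<Rightarrow> real" where
  "inv_lam b = 1 / lam (inv (\<lambda>m. seq (\<phi> m)) b)"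

lemma inv_lam_basis: "inv_lam (seq (\<phi> m)) = 1 / lam m"
proof -
  have "inj (\<lambda>m. seq (\<phi> m))" by (rule injI) (simp add: seq_basis_eq_iff)
  from inv_f_f[OF this, of m] show ?thesis by (simp add: inv_lam_def)
qed

lemma sum_seq_basis: "(\<Sum>b\<in>(\<lambda>m. seq (\<phi> m)) ` I. F b) = (\<Sum>m\<in>I. F (seq (\<phi> m)))"
  by (rule sum.reindex_cong[of "\<lambda>m. seq (\<phi> m)"]) (auto intro!: inj_onI simp: seq_basis_eq_iff)

lemma diag_seq_basis:
  "diag ((\<lambda>m. seq (\<phi> m)) ` I) F (\<Sum>m\<in>I. c m *\<^sub>R seq (\<phi> m)) = (\<Sum>m\<in>I. (F (seq (\<phi> m)) * c m) *\<^sub>R seq (\<phi> m))"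
  if "finite I"
proof -
  have "seq (\<phi> m) \<bullet> (\<Sum>m\<in>I. c m *\<^sub>R seq (\<phi> m)) = c m" if "m \<in> I" for m
    using \<open>finite I\<close> that by (simp add: inner_sum_right seq_basis_orth if_distrib cong: if_cong)
  thus ?thesis
    unfolding diag_def sum_seq_basis by (intro sum.cong) auto
qed

lemma seq_E_finite:
  fixes c :: "nat \<Rightarrow> real"
  assumes I: "finite I" "I \<subseteq> modes bc lam"
  defines "u \<equiv> \<lambda>x. \<Sum>m\<in>I. c m * \<phi> m x"
  shows "u \<in> data" "seq (E u) = diag ((\<lambda>m. seq (\<phi> m)) ` I) inv_lam (seq u)"
proof -
  show u: "u \<in> data"
    unfolding u_def using I by (intro data_sum data_cmult eigenfunction_data) auto
  have eq: "diag ((\<lambda>m. seq (\<phi> m)) ` I) inv_lam (seq u) = seq (\<lambda>x. \<Sum>m\<in>I. c m / lam m * \<phi> m x)"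
    unfolding u_def seq_partial diag_seq_basis[OF I(1)] by (simp add: inv_lam_basis)
  show "seq (E u) = diag ((\<lambda>m. seq (\<phi> m)) ` I) inv_lam (seq u)"
    unfolding eq
  proof (rule ell2_eqI)
    fix m
    show "ell2_nth (seq (E u)) m = ell2_nth (seq (\<lambda>x. \<Sum>m\<in>I. c m / lam m * \<phi> m x)) m"
      using I coeff_partial[OF I(1), of c m, folded u_def]
      unfolding seq_nth[OF data_sq[OF E_data[OF u]]] seq_nth[OF partial_sq] E_coeff[OF u]
        coeff_partial[OF I(1)] by auto
  qed
qed

end

section \<open>The discrete solution operator\<close>

locale fe_level = heat_problem P tr bc \<phi> lam \<mu> E
  for P :: "'a::euclidean_space set" and tr bc \<phi> lam \<mu> E +
  fixes N :: nat and b :: "nat \<Rightarrow> 'a \<Rightarrow> real" and Eh :: "('a \<Rightarrow> real) \<Rightarrow> 'a \<Rightarrow> real" and \<delta> :: real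
  assumes basis: "fe_basis P bc N b"
    and sol: "fe_solution_operator P tr bc N b Eh"
    and pos: "selfadjoint_positive P bc N b Eh"
    and close: "\<And>g. g \<in> data_space P bc \<Longrightarrow>
      L2_norm (lebesgue_on (interior P)) (\<lambda>x. Eh g x - E g x) \<le> \<delta> * L2_norm (lebesgue_on (interior P)) g"
begin

abbreviation "V \<equiv> fe_space N b"
abbreviation "V0 \<equiv> V \<inter> data"

lemma b_H1: "i < N \<Longrightarrow> b i \<in> H1 (interior P)"
  using basis by (cases bc) (auto simp: fe_basis_def H10_def)

lemma b_sq: "i < N \<Longrightarrow> square_integrable M (b i)"
  by (rule H1_D(1)[OF b_H1])

lemma fe_fun_sq: "square_integrable M (fe_fun N b c)"
  unfolding fe_fun_def by (intro square_integrable_sum square_integrable_cmult b_sq) auto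

lemma V_sq: "v \<in> V \<Longrightarrow> square_integrable M v"
  using fe_fun_sq by (auto simp: fe_space_def)

lemma fe_fun_in_V: "fe_fun N b c \<in> V"
  by (simp add: fe_space_def)

lemma V_diff: "u \<in> V \<Longrightarrow> v \<in> V \<Longrightarrow> (\<lambda>x. u x - v x) \<in> V"
proof -
  have "(\<lambda>x. fe_fun N b c x - fe_fun N b d x) = fe_fun N b (\<lambda>i. c i - d i)" for c d
    by (simp add: fe_fun_def fun_eq_iff sum_subtractf left_diff_distrib)
  thus "u \<in> V \<Longrightarrow> v \<in> V \<Longrightarrow> (\<lambda>x. u x - v x) \<in> V"
    by (auto simp: fe_space_def)
qed

lemma V_cmult: "u \<in> V \<Longrightarrow> (\<lambda>x. c * u x) \<in> V"
proof -
  have "(\<lambda>x. c * fe_fun N b d x) = fe_fun N b (\<lambda>i. c * d i)" for d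
    by (simp add: fe_fun_def fun_eq_iff sum_distrib_left mult.assoc)
  thus "u \<in> V \<Longrightarrow> (\<lambda>x. c * u x) \<in> V"
    by (auto simp: fe_space_def)
qed

lemma V_sum: "(\<And>i. i \<in> I \<Longrightarrow> u i \<in> V) \<Longrightarrow> (\<lambda>x. \<Sum>i\<in>I. u i x) \<in> V"
proof (induction I rule: infinite_finite_induct)
  case (insert i I)
  have "(\<lambda>x. u i x - - 1 * (\<Sum>i\<in>I. u i x)) \<in> V"
    using insert by (intro V_diff V_cmult) auto
  thus ?case using insert by simp
qed (auto simp: fe_space_def fe_fun_def intro!: image_eqI[of _ _ "\<lambda>_. 0"])

lemma b_in_V: "i < N \<Longrightarrow> b i \<in> V"
proof -
  assume "i < N"
  hence "b i = fe_fun N b (\<lambda>j. if j = i then 1 else 0)"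
    by (simp add: fe_fun_def fun_eq_iff if_distrib[of "\<lambda>c. c * _"] cong: if_cong)
  thus "b i \<in> V" by (simp add: fe_space_def)
qed

text \<open>By linear independence, elements of \<open>V\<^sub>h\<close> that agree almost everywhere are equal as functions, so
  that \<open>bilinear_form\<close> can be rewritten.\<close>

lemma V_eqI:
  assumes uv: "u \<in> V" "v \<in> V" and eq: "seq u = seq v"
  shows "u = v"
proof -
  obtain c d where c: "u = fe_fun N b c" and d: "v = fe_fun N b d"
    using uv by (auto simp: fe_space_def)
  have "L2_norm M (\<lambda>x. u x - v x) = 0"
    using norm_seq[OF square_integrable_diff[OF V_sq[OF uv(1)] V_sq[OF uv(2)]]]
      seq_diff[OF V_sq[OF uv(1)] V_sq[OF uv(2)]] eq by simp
  hence "AE x in M. u x = v x"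
    using V_sq uv by (simp add: L2_norm_diff_eq_0_iff)
  hence "AE x in M. fe_fun N b (\<lambda>i. c i - d i) x = 0"
    by eventually_elim (simp add: c d fe_fun_def sum_subtractf left_diff_distrib)
  hence "\<forall>i<N. c i - d i = 0"
    using basis unfolding fe_basis_def by blast
  thus ?thesis by (simp add: c d fe_fun_def fun_eq_iff)
qed

lemma Eh_V0: "g \<in> data \<Longrightarrow> Eh g \<in> V0"
  and Eh_bilinear: "g \<in> data \<Longrightarrow> v \<in> V \<Longrightarrow> bilinear_form P tr bc (Eh g) v = L2_inner M g v"
  using sol by (auto simp: fe_solution_operator_def)

lemma Eh_symmetric: "g \<in> data \<Longrightarrow> k \<in> data \<Longrightarrow> L2_inner M (Eh g) k = L2_inner M g (Eh k)"
  and Eh_positive: "v \<in> V0 \<Longrightarrow> L2_norm M v \<noteq> 0 \<Longrightarrow> 0 < L2_inner M (Eh v) v"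
  using pos by (auto simp: selfadjoint_positive_def)

lemma seq_fe_fun: "seq (fe_fun N b c) = (\<Sum>i<N. c i *\<^sub>R seq (b i))"
proof -
  have "seq (fe_fun N b c) = (\<Sum>i<N. seq (\<lambda>x. c i * b i x))"
    unfolding fe_fun_def by (rule seq_sum) (auto intro: square_integrable_cmult b_sq)
  thus ?thesis by (simp add: seq_cmult b_sq)
qed

lemma seq_V: "seq ` V = span ((\<lambda>i. seq (b i)) ` {..<N})"
proof -
  show ?thesis
  proof (intro equalityI subsetI)
    fix x assume "x \<in> seq ` V"
    then obtain c where x: "x = (\<Sum>i<N. c i *\<^sub>R seq (b i))" by (auto simp: fe_space_def seq_fe_fun)
    show "x \<in> span ((\<lambda>i. seq (b i)) ` {..<N})"
      unfolding x by (intro span_sum span_scale span_base imageI)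
  next
    fix x assume "x \<in> span ((\<lambda>i. seq (b i)) ` {..<N})"
    thus "x \<in> seq ` V"
    proof (induction rule: span_induct_alt)
      case base
      have "seq (fe_fun N b (\<lambda>i. 0)) = 0" by (simp add: seq_fe_fun)
      thus ?case using fe_fun_in_V by (metis imageI)
    next
      case (step c x y)
      then obtain i v where iv: "i < N" "x = seq (b i)" "v \<in> V" "y = seq v" by auto
      have "c *\<^sub>R x + y = seq (\<lambda>z. v z - (- c) * b i z)"
        unfolding seq_diff[OF V_sq[OF iv(3)] square_integrable_cmult[OF b_sq[OF iv(1)]]]
          seq_cmult[OF b_sq[OF iv(1)]] iv(2,4) by simp
      moreover have "(\<lambda>z. v z - (- c) * b i z) \<in> V"
        using iv by (intro V_diff V_cmult b_in_V)
      ultimately show ?case by blast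
    qed
  qed
qed

lemma V0_sum: "(\<And>i. i \<in> I \<Longrightarrow> u i \<in> V0) \<Longrightarrow> (\<lambda>x. \<Sum>i\<in>I. c i * u i x) \<in> V0"
  by (intro IntI V_sum V_cmult data_sum data_cmult) auto

lemma seq_V0_finite: "\<exists>B. finite B \<and> seq ` V0 = span B"
proof -
  have sub: "subspace (seq ` V0)"
    unfolding subspace_def
  proof (intro conjI ballI allI)
    have "(\<lambda>x. \<Sum>i\<in>({}::nat set). 0 * b i x) \<in> V0" by (rule V0_sum) simp
    moreover have "seq (\<lambda>x. \<Sum>i\<in>({}::nat set). 0 * b i x) = 0" by (subst seq_sum) auto
    ultimately show "0 \<in> seq ` V0" by (metis imageI)
  next
    fix x y c assume "x \<in> seq ` V0" "y \<in> seq ` V0"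
    then obtain u v where uv: "u \<in> V0" "v \<in> V0" "x = seq u" "y = seq v" by auto
    have "(\<lambda>z. \<Sum>k\<in>{True,False}. 1 * (if k then u else v) z) \<in> V0"
      using uv by (intro V0_sum) auto
    hence "(\<lambda>z. u z + v z) \<in> V0" by simp
    moreover have "seq (\<lambda>z. u z + v z) = x + y"
      using uv by (simp add: seq_add data_sq)
    ultimately show "x + y \<in> seq ` V0" by (metis imageI)
    have "(\<lambda>z. c * u z) \<in> V0" using uv by (auto intro: V_cmult data_cmult)
    moreover have "seq (\<lambda>z. c * u z) = c *\<^sub>R x"
      using uv by (simp add: seq_cmult data_sq)
    ultimately show "c *\<^sub>R x \<in> seq ` V0" by (metis imageI)
  qed
  obtain B where B: "B \<subseteq> seq ` V0" "independent B" "seq ` V0 \<subseteq> span B"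
    using basis_exists[of "seq ` V0"] by metis
  have "B \<subseteq> span ((\<lambda>i. seq (b i)) ` {..<N})" using B(1) seq_V by blast
  hence "finite B" using independent_span_bound[of "(\<lambda>i. seq (b i)) ` {..<N}" B] B(2) by auto
  moreover have "seq ` V0 = span B"
    using B sub by (intro equalityI) (auto intro: span_minimal[THEN subsetD])
  ultimately show ?thesis by blast
qed

text \<open>Eigenvectors live in the sequence space while \<open>Eh\<close> acts on functions; this
  map leads back.\<close>

definition lift :: "ell2 \<Rightarrow> 'a \<Rightarrow> real" where
  "lift x = (SOME u. u \<in> V0 \<and> seq u = x)"

lemma lift: "x \<in> seq ` V0 \<Longrightarrow> lift x \<in> V0" "x \<in> seq ` V0 \<Longrightarrow> seq (lift x) = x"
proof -
  assume "x \<in> seq ` V0"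
  hence "\<exists>u. u \<in> V0 \<and> seq u = x" by auto
  from someI_ex[OF this] show "lift x \<in> V0" "seq (lift x) = x" by (auto simp: lift_def)
qed

text \<open>\<open>Eh\<close> is transported to the image of \<open>V0\<close> in the sequence
  space, where the spectral theorem applies. Symmetry and definiteness are assumed on
  \<open>data\<close>, which is why the space is \<open>V0\<close> and not \<open>V\<close>.\<close>

lemma discrete_eigenbasis:
  "\<exists>A \<nu>. orthonormal_set A \<and> span A = seq ` V0 \<and> (\<forall>a\<in>A. 0 < \<nu> a \<and> seq (Eh (lift a)) = \<nu> a *\<^sub>R a)"
proof -
  obtain B where B: "finite B" "seq ` V0 = span B" using seq_V0_finite by blast
  have L: "lift x \<in> V0" "seq (lift x) = x" if "x \<in> span B" for x
    using lift[of x] that B by auto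
  define S where "S x = seq (Eh (lift x))" for x
  have inner: "S x \<bullet> y = L2_inner M (Eh (lift x)) (lift y)" if "x \<in> span B" "y \<in> span B" for x y
    using L that Eh_V0[of "lift x"] inner_seq[of "Eh (lift x)" "lift y"] data_sq by (simp add: S_def)
  have "\<exists>A \<nu>. orthonormal_set A \<and> span A = span B \<and> (\<forall>a\<in>A. S a = \<nu> a *\<^sub>R a)"
  proof (rule symmetric_eigenbasis[OF B(1)])
    show "S x \<in> span B" if "x \<in> span B" for x
      unfolding S_def B(2)[symmetric] using L[OF that] Eh_V0 by auto
    show "S x \<bullet> y = x \<bullet> S y" if "x \<in> span B" "y \<in> span B" for x y
      using inner[OF that] inner[OF that(2,1)] Eh_symmetric[of "lift x" "lift y"] L that
      by (simp add: inner_commute[of x] L2_inner_commute[of M "lift x"])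
  qed
  then obtain A \<nu> where A: "orthonormal_set A" "span A = span B" "\<And>a. a \<in> A \<Longrightarrow> S a = \<nu> a *\<^sub>R a" by blast
  have "0 < \<nu> a" if a: "a \<in> A" for a
  proof -
    have aB: "a \<in> span B" using a A(2) span_base by blast
    have aa: "a \<bullet> a = 1" using A(1) a by (simp add: orthonormal_set_def)
    have "L2_norm M (lift a) = norm a"
      using norm_seq[of "lift a"] L[OF aB] data_sq by simp
    hence "L2_norm M (lift a) \<noteq> 0" using aa by auto
    hence "0 < S a \<bullet> a" using Eh_positive[of "lift a"] L[OF aB] inner[OF aB aB] by simp
    thus ?thesis by (simp add: A(3)[OF a] aa)
  qed
  thus ?thesis using A B by (intro exI[of _ A] exI[of _ \<nu>]) (auto simp: S_def)
qed

definition modesh :: "ell2 set" where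
  "modesh = (SOME A. \<exists>\<nu>. orthonormal_set A \<and> span A = seq ` V0 \<and> (\<forall>a\<in>A. 0 < \<nu> a \<and> seq (Eh (lift a)) = \<nu> a *\<^sub>R a))"

definition nu :: "ell2 \<Rightarrow> real" where
  "nu = (SOME \<nu>. \<forall>a\<in>modesh. 0 < \<nu> a \<and> seq (Eh (lift a)) = \<nu> a *\<^sub>R a)"

lemma modesh: "orthonormal_set modesh" "span modesh = seq ` V0"
  and nu_pos: "a \<in> modesh \<Longrightarrow> 0 < nu a"
  and seq_Eh_lift: "a \<in> modesh \<Longrightarrow> seq (Eh (lift a)) = nu a *\<^sub>R a"
proof -
  have 1: "\<exists>\<nu>. orthonormal_set modesh \<and> span modesh = seq ` V0 \<and>
      (\<forall>a\<in>modesh. 0 < \<nu> a \<and> seq (Eh (lift a)) = \<nu> a *\<^sub>R a)"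
    unfolding modesh_def by (rule someI_ex[OF discrete_eigenbasis])
  thus "orthonormal_set modesh" "span modesh = seq ` V0" by auto
  from 1 have "\<exists>\<nu>. \<forall>a\<in>modesh. 0 < \<nu> a \<and> seq (Eh (lift a)) = \<nu> a *\<^sub>R a" by blast
  from someI_ex[OF this] have "\<forall>a\<in>modesh. 0 < nu a \<and> seq (Eh (lift a)) = nu a *\<^sub>R a"
    by (simp only: nu_def)
  thus "a \<in> modesh \<Longrightarrow> 0 < nu a" "a \<in> modesh \<Longrightarrow> seq (Eh (lift a)) = nu a *\<^sub>R a" by auto
qed

lemma modesh_lift: "a \<in> modesh \<Longrightarrow> lift a \<in> V0" "a \<in> modesh \<Longrightarrow> seq (lift a) = a"
  using lift[of a] modesh(2) span_base[of a modesh] by auto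

lemma inner_modesh: "a \<in> modesh \<Longrightarrow> square_integrable M u \<Longrightarrow> a \<bullet> seq u = L2_inner M (lift a) u"
  using inner_seq[of "lift a" u] modesh_lift[of a] data_sq by auto

lemma seq_V0_diag: "v \<in> V0 \<Longrightarrow> diag modesh (\<lambda>a. 1) (seq v) = seq v"
  using modesh(2) by (intro diag_one_span modesh) auto

text \<open>By symmetry the component of \<open>Eh g\<close> along an eigenvector is the eigenvalue
  times the component of \<open>g\<close>. Hence the diagonal form holds for all data, with value 0
  on what is orthogonal to \<open>V0\<close>.\<close>

lemma seq_Eh: "g \<in> data \<Longrightarrow> seq (Eh g) = diag modesh nu (seq g)"
proof -
  assume g: "g \<in> data"
  have "a \<bullet> seq (Eh g) = nu a * (a \<bullet> seq g)" if a: "a \<in> modesh" for a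
  proof -
    have "a \<bullet> seq (Eh g) = L2_inner M (Eh (lift a)) g"
      using Eh_symmetric[of "lift a" g] modesh_lift[OF a] g Eh_V0[OF g] data_sq
      by (simp add: inner_modesh[OF a])
    also have "\<dots> = seq (Eh (lift a)) \<bullet> seq g"
      using inner_seq[of "Eh (lift a)" g] Eh_V0[of "lift a"] modesh_lift[OF a] g data_sq by simp
    finally show ?thesis by (simp add: seq_Eh_lift[OF a])
  qed
  hence "diag modesh (\<lambda>a. 1) (seq (Eh g)) = diag modesh nu (seq g)" by (simp add: diag_def)
  thus ?thesis using seq_V0_diag[OF Eh_V0[OF g]] by simp
qed

text \<open>A discrete eigenvalue is a Rayleigh quotient of \<open>Eh\<close>, which exceeds that of
  \<open>E\<close> by at most \<delta>. This bounds the discrete decay rates \<open>1 / nu a\<close>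
  from below, as the tail estimate requires.\<close>

lemma nu_le: "a \<in> modesh \<Longrightarrow> nu a \<le> 1 / \<mu> + \<delta>"
proof -
  assume a: "a \<in> modesh"
  define X where "X = lift a"
  have X: "X \<in> data" "seq X = a" using modesh_lift[OF a] by (auto simp: X_def)
  have aa: "a \<bullet> a = 1" using modesh(1) a by (simp add: orthonormal_set_def)
  have nX: "L2_norm M X = 1"
    using norm_seq[OF data_sq[OF X(1)]] X aa by (simp add: norm_eq_sqrt_inner)
  note sq = data_sq[OF X(1)] data_sq[OF E_data[OF X(1)]] V_sq[of "Eh X"]
  have EhV: "Eh X \<in> V" using Eh_V0[OF X(1)] by simp
  have "nu a = seq (Eh X) \<bullet> seq X"
    using seq_Eh_lift[OF a] by (simp add: X(2) aa) (simp add: X_def[symmetric] aa)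
  also have "\<dots> = L2_inner M (\<lambda>x. Eh X x - E X x) X + L2_inner M (E X) X"
    using sq EhV by (simp add: inner_seq L2_inner_diff_left)
  also have "\<dots> \<le> \<delta> * 1 * 1 + 1 / \<mu> * 1\<^sup>2"
  proof (rule add_mono)
    have "L2_inner M (\<lambda>x. Eh X x - E X x) X \<le> L2_norm M (\<lambda>x. Eh X x - E X x) * L2_norm M X"
      using L2_Cauchy_Schwarz[OF square_integrable_diff[OF sq(3)[OF EhV] sq(2)] sq(1)] by linarith
    also have "\<dots> \<le> \<delta> * 1 * 1"
      using close[OF X(1)] by (simp add: nX)
    finally show "L2_inner M (\<lambda>x. Eh X x - E X x) X \<le> \<delta> * 1 * 1" .
  qed (use E_le[OF X(1)] in \<open>simp add: nX\<close>)
  finally show ?thesis by simp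
qed

lemma diag_close_modesh:
  assumes I: "finite I" "I \<subseteq> modes bc lam"
  shows "diag_close modesh nu ((\<lambda>m. seq (\<phi> m)) ` I) inv_lam \<delta>"
  unfolding diag_close_def
proof (intro conjI ballI)
  fix g assume g: "g \<in> span ((\<lambda>m. seq (\<phi> m)) ` I)"
  define u where "u = (\<lambda>x. \<Sum>m\<in>I. (seq (\<phi> m) \<bullet> g) * \<phi> m x)"
  have "g = diag ((\<lambda>m. seq (\<phi> m)) ` I) (\<lambda>b. 1) g"
    using diag_one_span[OF orthonormal_seq_basis[OF I(1)] g] by simp
  also have "\<dots> = seq u"
    unfolding diag_def sum_seq_basis u_def seq_partial by simp
  finally have gu: "g = seq u" .
  note S = seq_E_finite[OF I, of "\<lambda>m. seq (\<phi> m) \<bullet> g", folded u_def]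
  have sq: "square_integrable M (Eh u)" "square_integrable M (E u)"
    using Eh_V0[OF S(1)] E_data[OF S(1)] data_sq by auto
  have "norm (diag modesh nu g - diag ((\<lambda>m. seq (\<phi> m)) ` I) inv_lam g) = L2_norm M (\<lambda>x. Eh u x - E u x)"
    unfolding gu seq_Eh[OF S(1), symmetric] S(2)[symmetric]
    by (simp add: seq_diff[symmetric] norm_seq square_integrable_diff sq)
  also have "\<dots> \<le> \<delta> * L2_norm M u" by (rule close[OF S(1)])
  also have "L2_norm M u = norm g"
    using norm_seq[OF data_sq[OF S(1)]] by (simp add: gu)
  finally show "norm (diag modesh nu g - diag ((\<lambda>m. seq (\<phi> m)) ` I) inv_lam g) \<le> \<delta> * norm g" .
qed (use modesh nu_pos I lam_pos in \<open>auto simp: orthonormal_seq_basis inv_lam_basis\<close>)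

subsection \<open>The stiffness matrix\<close>

lemma seq_lift_sum: "seq (\<lambda>x. \<Sum>a\<in>modesh. c a * lift a x) = (\<Sum>a\<in>modesh. c a *\<^sub>R a)"
proof -
  have sq: "square_integrable M (lift a)" if "a \<in> modesh" for a
    using modesh_lift[OF that] data_sq by blast
  have "seq (\<lambda>x. \<Sum>a\<in>modesh. c a * lift a x) = (\<Sum>a\<in>modesh. seq (\<lambda>x. c a * lift a x))"
    by (rule seq_sum) (intro square_integrable_cmult sq)
  also have "\<dots> = (\<Sum>a\<in>modesh. c a *\<^sub>R a)"
    by (rule sum.cong) (simp_all add: seq_cmult sq modesh_lift)
  finally show ?thesis .
qed

lemma V0_range_Eh:
  assumes v: "v \<in> V0"
  shows "\<exists>g\<in>V0. Eh g = v"
proof -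
  define g where "g = (\<lambda>x. \<Sum>a\<in>modesh. ((a \<bullet> seq v) / nu a) * lift a x)"
  have g: "g \<in> V0" unfolding g_def by (intro V0_sum modesh_lift)
  have "seq g = (\<Sum>a\<in>modesh. ((a \<bullet> seq v) / nu a) *\<^sub>R a)"
    unfolding g_def by (rule seq_lift_sum)
  also have "\<dots> = diag modesh (\<lambda>a. 1 / nu a) (seq v)" by (simp add: diag_def)
  finally have "seq (Eh g) = diag modesh (\<lambda>a. nu a * (1 / nu a)) (seq v)"
    using seq_Eh[of g] g by (simp add: diag_diag[OF modesh(1)])
  also have "\<dots> = diag modesh (\<lambda>a. 1) (seq v)"
    using nu_pos by (intro diag_cong) (force simp: less_imp_neq)
  also have "\<dots> = seq v" by (rule seq_V0_diag[OF v])
  finally have "Eh g = v" using Eh_V0[of g] g v by (intro V_eqI) auto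
  thus ?thesis using g by blast
qed

text \<open>If \<open>d \<in> V\<close> is orthogonal to \<open>V0\<close>, the discrete functions in \<open>data\<close>, then
  \<open>\<langle>g, d\<rangle> = a(E\<^sub>h g, d) = a(E\<^sub>h g', d) = \<langle>g', d\<rangle> = 0\<close> for some \<open>g' \<in> V0\<close>.
  In the Neumann case it follows that \<open>d\<close> is constant.\<close>

lemma orthogonal_to_data:
  assumes d: "d \<in> V" and orth: "\<And>a. a \<in> modesh \<Longrightarrow> a \<bullet> seq d = 0" and g: "g \<in> data"
  shows "L2_inner M g d = 0"
proof -
  obtain g' where g': "g' \<in> V0" "Eh g' = Eh g"
    using V0_range_Eh[OF Eh_V0[OF g]] by blast
  have "L2_inner M g d = L2_inner M g' d"
    using Eh_bilinear[OF g d] Eh_bilinear[of g' d] g' d by simp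
  also have "\<dots> = seq g' \<bullet> seq d"
    using g' d by (simp add: inner_seq data_sq V_sq)
  also have "\<dots> = seq d \<bullet> diag modesh (\<lambda>a. 1) (seq g')"
    using seq_V0_diag[OF g'(1)] by (simp add: inner_commute)
  also have "\<dots> = 0" using orth by (simp add: inner_diag)
  finally show ?thesis .
qed

text \<open>\<open>k\<close> is \<open>d\<close> minus its mean value, so it belongs to
  \<open>data\<close> and is orthogonal both to \<open>d\<close> and to constants, hence to
  itself.\<close>

lemma orthogonal_to_data_const:
  assumes d: "square_integrable M d" and orth: "\<And>g. g \<in> data \<Longrightarrow> L2_inner M g d = 0" and N: "bc = Neumann"
  shows "\<exists>c. AE x in M. d x = c"
proof -
  define w where "w = measure M (space M)"
  have one: "L2_inner M (\<lambda>x. 1 :: real) (\<lambda>x. 1) = w"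
    by (simp add: L2_inner_def w_def)
  note sq1 = square_integrable_const[of "1::real"]
  define c where "c = L2_inner M d (\<lambda>x. 1) / w"
  define k where "k x = d x - c * 1" for x
  have k: "square_integrable M k"
    unfolding k_def by (intro square_integrable_diff square_integrable_cmult d sq1)
  have k1: "L2_inner M k (\<lambda>x. 1) = 0"
  \<comment> \<open>On a null set division by 0 yields \<open>c = 0\<close>, and the integral of
    \<open>k\<close> vanishes because the constant 1 has norm 0.\<close>
  proof (cases "w = 0")
    case True
    hence "L2_norm M (\<lambda>x. 1::real) = 0" using one by (simp add: L2_norm_def)
    thus ?thesis using L2_Cauchy_Schwarz[OF k sq1] by simp
  next
    case False
    have "L2_inner M k (\<lambda>x. 1) = L2_inner M d (\<lambda>x. 1) - c * w"
      unfolding k_def one[symmetric] L2_inner_cmult_left[symmetric]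
      by (rule L2_inner_diff_left[OF d square_integrable_cmult[OF sq1] sq1])
    thus ?thesis using False by (simp add: c_def)
  qed
  hence "k \<in> data" using k by (rule dataI[rotated])
  hence "L2_inner M k d = 0" by (rule orth)
  moreover have "L2_inner M k k = L2_inner M k d - c * L2_inner M k (\<lambda>x. 1)"
  proof -
    have "L2_inner M k k = L2_inner M k d - L2_inner M k (\<lambda>x. c * 1)"
      by (subst (2) k_def[abs_def]) (rule L2_inner_diff_right[OF d square_integrable_cmult[OF sq1] k])
    thus ?thesis
      using L2_inner_scaleR_right[of M k c "\<lambda>x. 1"] by simp
  qed
  ultimately have "L2_norm M k = 0" using k1 by (simp add: L2_norm_def)
  hence "AE x in M. k x = 0" using L2_norm_eq_0_iff[OF k] by simp
  thus ?thesis by (intro exI[of _ c]) (simp add: k_def)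
qed

text \<open>The stiffness matrix is the weak form of the inverse of \<open>Eh\<close>, also for
  basis functions outside \<open>data\<close>. The projection \<open>u\<close> of \<open>b i\<close>
  onto \<open>V0\<close> has the form \<open>Eh g\<close>, and the defining equation of
  \<open>Eh\<close> turns the form into an inner product with \<open>g\<close>. Passing from
  \<open>b i\<close> to \<open>u\<close> is harmless: in the Neumann case they differ by a constant
  almost everywhere, otherwise they are equal as functions. As \<open>bilinear_form\<close> depends
  on chosen gradients and traces, these exact equalities take the place of linearity.\<close>

lemma stiffness_matrix_eq:
  assumes i: "i < N" and l: "l < N"
  shows "stiffness_matrix P tr bc b i l = seq (b i) \<bullet> diag modesh (\<lambda>a. 1 / nu a) (seq (b l))"
proof -
  define u where "u = (\<lambda>x. \<Sum>a\<in>modesh. (a \<bullet> seq (b i)) * lift a x)"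
  have u: "u \<in> V0" unfolding u_def by (intro V0_sum modesh_lift)
  have su: "seq u = diag modesh (\<lambda>a. 1) (seq (b i))"
    unfolding u_def seq_lift_sum diag_def by simp
  obtain g where g: "g \<in> V0" "Eh g = u" using V0_range_Eh[OF u] by blast
  have sg: "seq g = diag modesh (\<lambda>a. 1 / nu a) (seq (b i))"
  proof -
    have "diag modesh nu (seq g) = diag modesh (\<lambda>a. 1) (seq (b i))"
      using seq_Eh[of g] g su by simp
    hence "diag modesh (\<lambda>a. 1 / nu a) (diag modesh nu (seq g)) = diag modesh (\<lambda>a. 1 / nu a) (seq (b i))"
      by (simp add: diag_diag[OF modesh(1)])
    moreover have "diag modesh (\<lambda>a. 1 / nu a) (diag modesh nu (seq g)) = diag modesh (\<lambda>a. 1) (seq g)"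
      unfolding diag_diag[OF modesh(1)] using nu_pos by (intro diag_cong) (force simp: less_imp_neq)
    ultimately show ?thesis using seq_V0_diag[OF g(1)] by simp
  qed
  define d where "d = (\<lambda>x. b i x - u x)"
  have sqs: "square_integrable M (b i)" "square_integrable M u" using b_sq[OF i] u data_sq by auto
  have d: "d \<in> V" unfolding d_def using u i by (intro V_diff b_in_V) auto
  have "a \<bullet> seq d = 0" if "a \<in> modesh" for a
    unfolding d_def seq_diff[OF sqs] su inner_diff_right inner_diag_basis[OF modesh(1) that] by simp
  hence orth: "L2_inner M k d = 0" if "k \<in> data" for k
    using orthogonal_to_data[OF d _ that] by blast
  have "bilinear_form P tr bc (b i) (b l) = bilinear_form P tr bc u (b l)"
  proof (cases "bc = Neumann")
    case True
    obtain c where "AE x in M. d x = c"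
      using orthogonal_to_data_const[OF V_sq[OF d] orth True] by blast
    hence "AE x in M. b i x = u x + c"
      by eventually_elim (simp add: d_def)
    hence "wgrad (interior P) (b i) = wgrad (interior P) u"
      by (rule wgrad_eq_of_diff_const[OF sqs])
    thus ?thesis using True by (simp add: bilinear_form_def)
  next
    case False
    have "d \<in> data" by (rule dataI) (use False V_sq[OF d] in auto)
    hence "L2_inner M d d = 0" by (rule orth)
    hence "seq d = 0" using norm_seq[OF V_sq[OF d]] by (simp add: L2_norm_def)
    hence "seq (b i) = seq u" using seq_diff[OF sqs] by (simp add: d_def)
    hence "b i = u" using u i by (intro V_eqI b_in_V) auto
    thus ?thesis by simp
  qed
  also have "\<dots> = L2_inner M g (b l)"
    using Eh_bilinear[of g "b l"] g l b_in_V by simp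
  also have "\<dots> = seq g \<bullet> seq (b l)"
    using g l by (simp add: inner_seq data_sq b_sq)
  finally show ?thesis
    by (simp add: stiffness_matrix_def sg diag_symmetric)
qed

end

section \<open>The time-stepping scheme\<close>

context fe_level
begin

lemma scheme_row:
  assumes i: "i < N"
  shows "(\<Sum>l<N. (mass_matrix P b i l + \<xi> * stiffness_matrix P tr bc b i l) * c l)
    = seq (b i) \<bullet> (seq (fe_fun N b c) + \<xi> *\<^sub>R diag modesh (\<lambda>a. 1 / nu a) (seq (fe_fun N b c)))"
proof -
  have "(mass_matrix P b i l + \<xi> * stiffness_matrix P tr bc b i l) * c l
      = seq (b i) \<bullet> (c l *\<^sub>R seq (b l)) + \<xi> * (seq (b i) \<bullet> diag modesh (\<lambda>a. 1 / nu a) (c l *\<^sub>R seq (b l)))"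
    if "l < N" for l
    using i that by (simp add: mass_matrix_def stiffness_matrix_eq inner_seq b_sq diag_scaleR algebra_simps)
  hence "(\<Sum>l<N. (mass_matrix P b i l + \<xi> * stiffness_matrix P tr bc b i l) * c l)
      = (\<Sum>l<N. seq (b i) \<bullet> (c l *\<^sub>R seq (b l)) + \<xi> * (seq (b i) \<bullet> diag modesh (\<lambda>a. 1 / nu a) (c l *\<^sub>R seq (b l))))"
    by (intro sum.cong) auto
  also have "\<dots> = seq (b i) \<bullet> (\<Sum>l<N. c l *\<^sub>R seq (b l))
      + \<xi> * (seq (b i) \<bullet> (\<Sum>l<N. diag modesh (\<lambda>a. 1 / nu a) (c l *\<^sub>R seq (b l))))"
    by (simp only: sum.distrib inner_sum_right sum_distrib_left)
  also have "\<dots> = seq (b i) \<bullet> (seq (fe_fun N b c) + \<xi> *\<^sub>R diag modesh (\<lambda>a. 1 / nu a) (seq (fe_fun N b c)))"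
    by (simp only: linear_sum[OF linear_diag, symmetric] seq_fe_fun[symmetric] inner_add_right inner_scaleR_right)
  finally show ?thesis .
qed

text \<open>Both sides of each equation lie in the image of \<open>V\<close>, whose elements are
  separated by inner products with the basis functions.\<close>

lemma theta_scheme_iff:
  fixes W :: "nat \<Rightarrow> nat \<Rightarrow> real"
  defines "y \<equiv> \<lambda>j. seq (fe_fun N b (W j))" and "D \<equiv> diag modesh (\<lambda>a. 1 / nu a)"
  shows "theta_scheme P tr bc N b \<theta> dt J W \<longleftrightarrow>
    (\<forall>j\<in>{1..J}. y j + (\<theta> * dt) *\<^sub>R D (y j) = y (j - 1) + ((\<theta> - 1) * dt) *\<^sub>R D (y (j - 1)))"
proof -
  have "u = v" if u: "u \<in> seq ` V" "v \<in> seq ` V" and eq: "\<And>i. i < N \<Longrightarrow> seq (b i) \<bullet> u = seq (b i) \<bullet> v" for u v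
  proof -
    have "x \<bullet> (u - v) = 0" if "x \<in> span ((\<lambda>i. seq (b i)) ` {..<N})" for x
      using that by (induction rule: span_induct_alt) (auto simp: inner_add_left inner_diff_right eq)
    moreover have "u - v \<in> span ((\<lambda>i. seq (b i)) ` {..<N})"
      using u unfolding seq_V by (intro span_diff)
    ultimately have "(u - v) \<bullet> (u - v) = 0" by blast
    thus ?thesis by simp
  qed
  moreover have "y j + \<xi> *\<^sub>R D (y k) \<in> seq ` V" for j k \<xi>
  proof -
    have "D (y k) \<in> seq ` V" unfolding D_def using diag_in_span[of modesh] modesh(2) by auto
    moreover have "y j \<in> seq ` V" by (simp add: y_def fe_fun_in_V)
    ultimately show ?thesis unfolding seq_V by (intro span_add span_scale)
  qed
  ultimately have "(\<forall>i<N. seq (b i) \<bullet> (y j + \<xi> *\<^sub>R D (y j)) = seq (b i) \<bullet> (y k + \<zeta> *\<^sub>R D (y k)))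
      \<longleftrightarrow> y j + \<xi> *\<^sub>R D (y j) = y k + \<zeta> *\<^sub>R D (y k)" for j k \<xi> \<zeta>
    by metis
  thus ?thesis
    unfolding theta_scheme_def y_def D_def by (simp add: scheme_row)
qed

lemma amplification_step:
  assumes a: "a \<in> modesh" and \<theta>: "0 \<le> \<theta>" and dt: "0 < dt"
  shows "0 < 1 + \<theta> * dt / nu a" "1 + (\<theta> - 1) * dt / nu a = amplification \<theta> (dt * (1 / nu a)) * (1 + \<theta> * dt / nu a)"
proof -
  have z: "0 < dt * (1 / nu a)" using nu_pos[OF a] dt by simp
  show p: "0 < 1 + \<theta> * dt / nu a" using mult_nonneg_nonneg[OF \<theta> less_imp_le[OF z]] by simp
  show "1 + (\<theta> - 1) * dt / nu a = amplification \<theta> (dt * (1 / nu a)) * (1 + \<theta> * dt / nu a)"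
  proof -
    have "1 + \<theta> * (dt * (1 / nu a)) = 1 + \<theta> * dt / nu a" by simp
    hence "amplification \<theta> (dt * (1 / nu a)) * (1 + \<theta> * dt / nu a) = 1 - (1 - \<theta>) * (dt * (1 / nu a))"
      using p unfolding amplification_def by simp
    thus ?thesis by (simp add: left_diff_distrib diff_divide_distrib)
  qed
qed

text \<open>For \<open>f\<close> in \<open>data\<close> the projection \<open>w\<close> onto
  \<open>V\<close> already lies in \<open>V0\<close>. Its part \<open>d\<close> orthogonal to
  \<open>V0\<close> is orthogonal to all of \<open>data\<close>, in particular to \<open>f\<close>
  and \<open>u\<close>; and \<open>w\<close> tested with \<open>d\<close> gives the same as
  \<open>f\<close>, so \<open>d\<close> has norm 0.\<close>

lemma seq_projection:
  assumes f: "f \<in> data" and proj: "L2_projection P N b f c"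
  shows "seq (fe_fun N b c) = diag modesh (\<lambda>a. 1) (seq f)"
proof -
  define w where "w = fe_fun N b c"
  have w: "w \<in> V" by (simp add: w_def fe_fun_in_V)
  note sq = data_sq[OF f] V_sq[OF w]
  have orth: "L2_inner M f v = L2_inner M w v" if v: "v \<in> V" for v
  proof -
    have "L2_inner M (\<lambda>x. f x - w x) v = 0"
      using proj v by (simp add: L2_projection_def w_def)
    thus ?thesis by (simp only: L2_inner_diff_left[OF sq V_sq[OF v]])
  qed
  define u where "u = (\<lambda>x. \<Sum>a\<in>modesh. (a \<bullet> seq w) * lift a x)"
  have u: "u \<in> V0" unfolding u_def by (intro V0_sum modesh_lift)
  have su: "seq u = diag modesh (\<lambda>a. 1) (seq w)"
    unfolding u_def seq_lift_sum diag_def by simp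
  have squ: "square_integrable M u" using u data_sq by auto
  define d where "d = (\<lambda>x. w x - u x)"
  have d: "d \<in> V" unfolding d_def using u w by (intro V_diff) auto
  have "a \<bullet> seq d = 0" if "a \<in> modesh" for a
    unfolding d_def seq_diff[OF sq(2) squ] su inner_diff_right inner_diag_basis[OF modesh(1) that] by simp
  hence od: "L2_inner M g d = 0" if "g \<in> data" for g
    using orthogonal_to_data[OF d _ that] by blast
  have "L2_inner M d d = L2_inner M w d - L2_inner M u d"
    using L2_inner_diff_left[OF sq(2) squ V_sq[OF d]] by (simp only: d_def)
  also have "\<dots> = 0" using od[OF f] orth[OF d] od[of u] u by simp
  finally have "seq d = 0" using norm_seq[OF V_sq[OF d]] by (simp add: L2_norm_def)
  hence wu: "seq w = diag modesh (\<lambda>a. 1) (seq w)"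
    using seq_diff[OF sq(2) squ] su by (simp add: d_def)
  have "a \<bullet> seq w = a \<bullet> seq f" if a: "a \<in> modesh" for a
    using orth[of "lift a"] modesh_lift[OF a] inner_modesh[OF a] sq
    by (simp add: L2_inner_commute[of M "lift a"])
  hence "diag modesh (\<lambda>a. 1) (seq w) = diag modesh (\<lambda>a. 1) (seq f)" by (simp add: diag_def)
  thus ?thesis using wu by (simp add: w_def)
qed

lemma seq_scheme:
  assumes f: "f \<in> data" and proj: "L2_projection P N b f (W 0)" and scheme: "theta_scheme P tr bc N b \<theta> dt J W"
    and \<theta>: "0 \<le> \<theta>" and dt: "0 < dt"
  shows "j \<le> J \<Longrightarrow> seq (fe_fun N b (W j)) = diag modesh (\<lambda>a. amplification \<theta> (dt * (1 / nu a)) ^ j) (seq f)"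
proof (induction j)
  case 0
  show ?case using seq_projection[OF f proj] by simp
next
  case (Suc j)
  define R where "R a = amplification \<theta> (dt * (1 / nu a))" for a
  define y where "y j = seq (fe_fun N b (W j))" for j
  define D where "D = diag modesh (\<lambda>a. 1 / nu a)"
  have IH: "y j = diag modesh (\<lambda>a. R a ^ j) (seq f)" using Suc by (simp add: y_def R_def)
  have step: "y (Suc j) + (\<theta> * dt) *\<^sub>R D (y (Suc j)) = y j + ((\<theta> - 1) * dt) *\<^sub>R D (y j)"
    using scheme[unfolded theta_scheme_iff] Suc.prems unfolding y_def D_def by force
  have "a \<bullet> y (Suc j) = R a ^ Suc j * (a \<bullet> seq f)" if a: "a \<in> modesh" for a
  proof -
    note A = amplification_step[OF a \<theta> dt]
    have ay: "a \<bullet> D z = (a \<bullet> z) / nu a" for z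
      unfolding D_def inner_diag_basis[OF modesh(1) a] by simp
    have "(1 + \<theta> * dt / nu a) * (a \<bullet> y (Suc j)) = a \<bullet> (y (Suc j) + (\<theta> * dt) *\<^sub>R D (y (Suc j)))"
      by (simp add: inner_add_right ay algebra_simps)
    also have "\<dots> = (1 + (\<theta> - 1) * dt / nu a) * (a \<bullet> y j)"
      unfolding step by (simp add: inner_add_right ay distrib_right)
    also have "a \<bullet> y j = R a ^ j * (a \<bullet> seq f)"
      unfolding IH by (rule inner_diag_basis[OF modesh(1) a])
    also have "(1 + (\<theta> - 1) * dt / nu a) * (R a ^ j * (a \<bullet> seq f)) = (1 + \<theta> * dt / nu a) * (R a ^ Suc j * (a \<bullet> seq f))"
      unfolding A(2) by (simp add: R_def)
    finally show ?thesis using A(1) by simp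
  qed
  hence "diag modesh (\<lambda>a. 1) (y (Suc j)) = diag modesh (\<lambda>a. R a ^ Suc j) (seq f)"
    by (simp add: diag_def)
  \<comment> \<open>The components along \<open>modesh\<close> determine \<open>y (Suc j)\<close>
    only if it lies in their span. The scheme equation itself places it there, since
    \<open>D\<close> maps into the span.\<close>
  moreover have "y (Suc j) \<in> span modesh"
  proof -
    have eq: "y j + ((\<theta> - 1) * dt) *\<^sub>R D (y j) - (\<theta> * dt) *\<^sub>R D (y (Suc j)) = y (Suc j)"
      unfolding step[symmetric] by simp
    have "y j + ((\<theta> - 1) * dt) *\<^sub>R D (y j) - (\<theta> * dt) *\<^sub>R D (y (Suc j)) \<in> span modesh"
      unfolding IH D_def by (intro span_add span_diff span_scale diag_in_span)
    thus ?thesis by (simp only: eq)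
  qed
  ultimately show ?case
    using diag_one_span[OF modesh(1), of "y (Suc j)"] by (simp add: y_def R_def)
qed

text \<open>An amplification factor below \<open>-1\<close> would make the scheme started in the eigenfunction unbounded.\<close>

lemma stable_amplification:
  assumes stable: "\<And>J W. theta_scheme P tr bc N b \<theta> dt J W \<Longrightarrow>
      L2_norm M (fe_fun N b (W J)) \<le> K * L2_norm M (fe_fun N b (W 0))"
    and a: "a \<in> modesh" and \<theta>: "0 \<le> \<theta>" and dt: "0 < dt"
  shows "-1 \<le> amplification \<theta> (dt * (1 / nu a))"
proof (rule ccontr)
  define R where "R = amplification \<theta> (dt * (1 / nu a))"
  assume "\<not> -1 \<le> amplification \<theta> (dt * (1 / nu a))"
  hence R: "1 < \<bar>R\<bar>" by (simp add: R_def)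
  have "lift a \<in> V" using modesh_lift[OF a] by simp
  then obtain c where c: "lift a = fe_fun N b c" by (auto simp: fe_space_def)
  define W where "W j i = R ^ j * c i" for j :: nat and i
  have Wc: "fe_fun N b (W j) = (\<lambda>x. R ^ j * lift a x)" for j
    by (simp add: c fe_fun_def W_def fun_eq_iff sum_distrib_left mult.assoc)
  have sqa: "square_integrable M (lift a)" using modesh_lift[OF a] data_sq by auto
  have y: "seq (fe_fun N b (W j)) = R ^ j *\<^sub>R a" for j
    unfolding Wc seq_cmult[OF sqa] modesh_lift(2)[OF a] ..
  have Da: "diag modesh (\<lambda>a. 1 / nu a) a = (1 / nu a) *\<^sub>R a"
  proof -
    have "(\<lambda>d. (1 / nu d * (d \<bullet> a)) *\<^sub>R d) d = (if d = a then (1 / nu a) *\<^sub>R a else 0)" if "d \<in> modesh" for d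
      using modesh(1) a that by (auto simp: orthonormal_set_def)
    thus ?thesis
      unfolding diag_def using modesh(1) a by (simp add: orthonormal_set_def cong: sum.cong)
  qed
  have "theta_scheme P tr bc N b \<theta> dt J W" for J
    unfolding theta_scheme_iff y diag_scaleR Da
  proof
    fix j assume "j \<in> {1..J}"
    hence Rj: "R ^ j = R ^ (j - 1) * R" by (cases j) auto
    have "R ^ j + (\<theta> * dt) * (R ^ j * (1 / nu a)) = R ^ (j - 1) * (R * (1 + \<theta> * dt / nu a))"
      by (simp add: Rj algebra_simps)
    also have "R * (1 + \<theta> * dt / nu a) = 1 + (\<theta> - 1) * dt / nu a"
      using amplification_step(2)[OF a \<theta> dt] by (simp add: R_def)
    also have "R ^ (j - 1) * (1 + (\<theta> - 1) * dt / nu a) = R ^ (j - 1) + ((\<theta> - 1) * dt) * (R ^ (j - 1) * (1 / nu a))"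
      by (simp add: algebra_simps)
    finally show "R ^ j *\<^sub>R a + (\<theta> * dt) *\<^sub>R R ^ j *\<^sub>R (1 / nu a) *\<^sub>R a
        = R ^ (j - 1) *\<^sub>R a + ((\<theta> - 1) * dt) *\<^sub>R R ^ (j - 1) *\<^sub>R (1 / nu a) *\<^sub>R a"
      by (simp only: scaleR_scaleR scaleR_add_left[symmetric])
  qed
  moreover have "norm a = 1" using modesh(1) a by (simp add: orthonormal_set_def norm_eq_sqrt_inner)
  ultimately have "\<bar>R\<bar> ^ J \<le> K" for J
    using stable[of J W] norm_seq[OF fe_fun_sq, of "W J"] norm_seq[OF fe_fun_sq, of "W 0"]
    by (simp add: y power_abs)
  moreover obtain J where "K < \<bar>R\<bar> ^ J" using real_arch_pow[OF R] by blast
  ultimately show False by (meson not_less)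
qed

lemma seq_quadrature:
  assumes f: "f \<in> data" and w: "fe_heat_solution P tr bc N b \<theta> dt NT f w" and \<theta>: "0 \<le> \<theta>" and dt: "0 < dt"
  shows "square_integrable M (\<lambda>x. quadrature s r dt NT (\<lambda>j. w j x))"
    and "seq (\<lambda>x. quadrature s r dt NT (\<lambda>j. w j x))
      = diag modesh (\<lambda>a. quadrature s r dt NT (\<lambda>j. amplification \<theta> (dt * (1 / nu a)) ^ j)) (seq f)"
proof -
  obtain W where W: "L2_projection P N b f (W 0)" "theta_scheme P tr bc N b \<theta> dt NT W" "\<And>j. j \<le> NT \<Longrightarrow> w j = fe_fun N b (W j)"
    using w by (auto simp: fe_heat_solution_def)
  define q where "q j = 1 / Gamma s * quad_weight s r dt NT j" for j
  have quad: "quadrature s r dt NT \<rho> = (\<Sum>j\<le>NT. q j * \<rho> j)" for \<rho>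
    by (simp add: quadrature_def q_def sum_distrib_left mult_ac)
  have sq: "square_integrable M (w j)" if "j \<le> NT" for j
    unfolding W(3)[OF that] by (rule fe_fun_sq)
  show "square_integrable M (\<lambda>x. quadrature s r dt NT (\<lambda>j. w j x))"
    unfolding quad by (intro square_integrable_sum square_integrable_cmult sq) simp
  have "seq (\<lambda>x. quadrature s r dt NT (\<lambda>j. w j x)) = (\<Sum>j\<le>NT. seq (\<lambda>x. q j * w j x))"
    unfolding quad by (rule seq_sum) (auto intro: square_integrable_cmult sq)
  also have "\<dots> = (\<Sum>j\<le>NT. q j *\<^sub>R diag modesh (\<lambda>a. amplification \<theta> (dt * (1 / nu a)) ^ j) (seq f))"
    using seq_scheme[OF f W(1,2) \<theta> dt] by (intro sum.cong) (auto simp: seq_cmult sq W(3) fe_fun_sq)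
  also have "\<dots> = diag modesh (\<lambda>a. \<Sum>j\<le>NT. q j * amplification \<theta> (dt * (1 / nu a)) ^ j) (seq f)"
    unfolding diag_def scaleR_sum_right
    by (subst sum.swap) (simp add: sum_distrib_left scaleR_sum_left mult_ac)
  finally show "seq (\<lambda>x. quadrature s r dt NT (\<lambda>j. w j x))
      = diag modesh (\<lambda>a. quadrature s r dt NT (\<lambda>j. amplification \<theta> (dt * (1 / nu a)) ^ j)) (seq f)"
    by (simp only: quad)
qed

end

section \<open>Convergence of the eigenfunction series and passage to general data\<close>

context heat_problem
begin

lemma sum_modes:
  "(\<Sum>m\<in>modes bc lam \<inter> {..<n}. F m) = (\<Sum>m<n. if m \<in> modes bc lam then F m else 0)"
  for F :: "nat \<Rightarrow> 'z::comm_monoid_add"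
  by (subst sum.inter_restrict[symmetric]) (auto simp: Int_commute)

text \<open>Riesz-Fischer justifies the choice in the definition: the coefficients are square
  summable because \<open>lam m powr (- s)\<close> is at most
  \<open>\<mu> powr (- s)\<close>.\<close>

lemma frac_inverse:
  assumes f: "square_integrable M f" and s: "0 \<le> s"
  shows "square_integrable M (frac_inverse P bc \<phi> lam s f)"
    and "(\<lambda>n. L2_norm M (\<lambda>x. frac_inverse P bc \<phi> lam s f x - (\<Sum>m\<in>modes bc lam \<inter> {..<n}.
                              lam m powr (- s) * fourier_coeff P \<phi> f m * \<phi> m x))) \<longlonglongrightarrow> 0"
proof -
  define c where "c m = (if m \<in> modes bc lam then lam m powr (- s) * L2_inner M f (\<phi> m) else 0)" for m
  have "summable (\<lambda>m. (c m)\<^sup>2)"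
  proof (rule summable_comparison_test')
    show "summable (\<lambda>m. (\<mu> powr (- s))\<^sup>2 * (L2_inner M f (\<phi> m))\<^sup>2)"
      by (intro summable_mult sums_summable[OF parseval[OF f]])
    fix m
    show "norm ((c m)\<^sup>2) \<le> (\<mu> powr (- s))\<^sup>2 * (L2_inner M f (\<phi> m))\<^sup>2"
    proof (cases "m \<in> modes bc lam")
      case True
      have "lam m powr (- s) \<le> \<mu> powr (- s)"
        using mu_le_lam[OF True] mu_pos s by (intro powr_mono2') auto
      hence "(lam m powr (- s))\<^sup>2 \<le> (\<mu> powr (- s))\<^sup>2" by (intro power_mono) auto
      thus ?thesis using True by (simp add: c_def power_mult_distrib mult_right_mono)
    qed (simp add: c_def)
  qed
  from L2_series_converges[OF basis_sq basis_orth this]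
  obtain g where g: "square_integrable M g" "(\<lambda>n. L2_norm M (\<lambda>x. g x - (\<Sum>m<n. c m * \<phi> m x))) \<longlonglongrightarrow> 0"
    by blast
  have eq: "(\<Sum>m<n. c m * \<phi> m x) = (\<Sum>m\<in>modes bc lam \<inter> {..<n}. lam m powr (- s) * fourier_coeff P \<phi> f m * \<phi> m x)" for n x
    unfolding sum_modes by (rule sum.cong) (auto simp: c_def fourier_coeff_def)
  from g have "\<exists>g. square_integrable M g \<and> (\<lambda>n. L2_norm M (\<lambda>x. g x - (\<Sum>m\<in>modes bc lam \<inter> {..<n}.
                              lam m powr (- s) * fourier_coeff P \<phi> f m * \<phi> m x))) \<longlonglongrightarrow> 0"
    unfolding eq by blast
  from someI_ex[OF this]
  show "square_integrable M (frac_inverse P bc \<phi> lam s f)"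
    and "(\<lambda>n. L2_norm M (\<lambda>x. frac_inverse P bc \<phi> lam s f x - (\<Sum>m\<in>modes bc lam \<inter> {..<n}.
                              lam m powr (- s) * fourier_coeff P \<phi> f m * \<phi> m x))) \<longlonglongrightarrow> 0"
    unfolding frac_inverse_def by auto
qed

lemma seq_frac_inverse_limit:
  assumes f: "square_integrable M f" and s: "0 \<le> s"
  shows "(\<lambda>n. \<Sum>m\<in>modes bc lam \<inter> {..<n}. (lam m powr (- s) * L2_inner M f (\<phi> m)) *\<^sub>R seq (\<phi> m))
    \<longlonglongrightarrow> seq (frac_inverse P bc \<phi> lam s f)"
proof -
  let ?p = "\<lambda>n x. \<Sum>m\<in>modes bc lam \<inter> {..<n}. lam m powr (- s) * fourier_coeff P \<phi> f m * \<phi> m x"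
  note F = frac_inverse[OF f s]
  have "L2_norm M (\<lambda>x. frac_inverse P bc \<phi> lam s f x - ?p n x)
      = norm ((\<Sum>m\<in>modes bc lam \<inter> {..<n}. (lam m powr (- s) * L2_inner M f (\<phi> m)) *\<^sub>R seq (\<phi> m)) - seq (frac_inverse P bc \<phi> lam s f))" for n
    unfolding norm_seq[OF square_integrable_diff[OF F(1) partial_sq], symmetric]
      seq_diff[OF F(1) partial_sq] seq_partial
    by (simp add: fourier_coeff_def norm_minus_commute)
  with F(2) have "(\<lambda>n. norm ((\<Sum>m\<in>modes bc lam \<inter> {..<n}. (lam m powr (- s) * L2_inner M f (\<phi> m)) *\<^sub>R seq (\<phi> m))
      - seq (frac_inverse P bc \<phi> lam s f))) \<longlonglongrightarrow> 0"
    by (simp only:)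
  thus ?thesis by (rule LIM_zero_cancel[OF tendsto_norm_zero_cancel])
qed

lemma seq_limit:
  assumes f: "f \<in> data"
  shows "(\<lambda>n. \<Sum>m\<in>modes bc lam \<inter> {..<n}. L2_inner M f (\<phi> m) *\<^sub>R seq (\<phi> m)) \<longlonglongrightarrow> seq f"
proof -
  have "(\<Sum>m\<in>modes bc lam \<inter> {..<n}. L2_inner M f (\<phi> m) *\<^sub>R seq (\<phi> m)) = seq (\<lambda>x. \<Sum>m<n. L2_inner M f (\<phi> m) * \<phi> m x)" for n
    unfolding seq_partial sum_modes using coeff_outside_modes[OF f] by (intro sum.cong) auto
  moreover have "norm (seq (\<lambda>x. \<Sum>m<n. L2_inner M f (\<phi> m) * \<phi> m x) - seq f)
      = L2_norm M (\<lambda>x. f x - (\<Sum>m<n. L2_inner M f (\<phi> m) * \<phi> m x))" for n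
    unfolding norm_seq[OF square_integrable_diff[OF data_sq[OF f] partial_sq], symmetric]
      seq_diff[OF data_sq[OF f] partial_sq] by (rule norm_minus_commute)
  ultimately have "(\<lambda>n. norm ((\<Sum>m\<in>modes bc lam \<inter> {..<n}. L2_inner M f (\<phi> m) *\<^sub>R seq (\<phi> m)) - seq f)) \<longlonglongrightarrow> 0"
    using basis_complete[OF data_sq[OF f]] by (simp only:)
  thus ?thesis by (rule LIM_zero_cancel[OF tendsto_norm_zero_cancel])
qed

end

context fe_level
begin

text \<open>The error is estimated for the truncations \<open>x n\<close> of \<open>f\<close> with a
  bound independent of \<open>n\<close>. The discrete operator is a sum over finitely many
  eigenvectors, hence continuous, so the bound passes to the limit.\<close>

lemma quadrature_error_le:
  assumes f: "f \<in> data" "f \<in> HB P bc \<phi> lam r" and w: "fe_heat_solution P tr bc N b \<theta> dt NT f w"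
    and \<theta>: "0 \<le> \<theta>" and dt: "0 < dt" and s: "0 < s" and C: "0 \<le> C"
    and bound: "\<And>B g. finite B \<Longrightarrow> B \<subseteq> (\<lambda>m. seq (\<phi> m)) ` modes bc lam \<Longrightarrow> g \<in> span B \<Longrightarrow>
      norm (diag modesh (\<lambda>a. quadrature s r dt NT (\<lambda>j. amplification \<theta> (dt * (1 / nu a)) ^ j))
           (diag B (\<lambda>b. inv_lam b powr (r / 2)) g)
        - diag B (\<lambda>b. inv_lam b powr s) (diag B (\<lambda>b. inv_lam b powr (r / 2)) g)) \<le> C * norm g"
  shows "L2_norm M (\<lambda>x. quadrature s r dt NT (\<lambda>j. w j x) - frac_inverse P bc \<phi> lam s f x)
    \<le> C * HB_norm P bc \<phi> lam r f"
proof -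
  define Q where "Q x = quadrature s r dt NT (\<lambda>j. w j x)" for x
  define G where "G = (\<lambda>a. quadrature s r dt NT (\<lambda>j. amplification \<theta> (dt * (1 / nu a)) ^ j))"
  define F where "F = frac_inverse P bc \<phi> lam s f"
  define c where "c m = L2_inner M f (\<phi> m)" for m
  define I where "I n = modes bc lam \<inter> {..<n}" for n :: nat
  define x where "x n = (\<Sum>m\<in>I n. c m *\<^sub>R seq (\<phi> m))" for n
  define y where "y n = (\<Sum>m\<in>I n. (lam m powr (- s) * c m) *\<^sub>R seq (\<phi> m))" for n
  have s0: "0 \<le> s" using s by simp
  have sqf: "square_integrable M f" by (rule data_sq[OF f(1)])
  have Q: "square_integrable M Q" "seq Q = diag modesh G (seq f)"
    using seq_quadrature[OF f(1) w \<theta> dt] by (simp_all add: Q_def[abs_def] G_def)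
  have xl: "x \<longlonglongrightarrow> seq f"
    using seq_limit[OF f(1)] by (simp add: x_def[abs_def] c_def I_def)
  have yl: "y \<longlonglongrightarrow> seq F"
    using seq_frac_inverse_limit[OF sqf s0] by (simp add: y_def[abs_def] c_def I_def F_def)
  have le: "norm (diag modesh G (x n) - y n) \<le> C * HB_norm P bc \<phi> lam r f" for n
  proof -
    define B where "B = (\<lambda>m. seq (\<phi> m)) ` I n"
    \<comment> \<open>\<open>g\<close> is the vector from which the power \<open>r / 2\<close> of
      the inverse eigenvalues produces \<open>x n\<close>; the square of its norm is a partial sum
      of the series defining the \<open>HB_norm\<close> of \<open>f\<close>.\<close>
    define g where "g = (\<Sum>m\<in>I n. (lam m powr (r / 2) * c m) *\<^sub>R seq (\<phi> m))"
    have fin: "finite (I n)" by (simp add: I_def)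
    have lp: "0 < lam m" if "m \<in> I n" for m using lam_pos that by (simp add: I_def)
    have inv: "inv_lam (seq (\<phi> m)) powr p = lam m powr (- p)" if "m \<in> I n" for m p
      using lp[OF that] by (simp add: inv_lam_basis powr_divide powr_minus_divide)
    have gx: "diag B (\<lambda>b. inv_lam b powr (r / 2)) g = x n"
      unfolding B_def g_def diag_seq_basis[OF fin] x_def
    proof (rule sum.cong[OF refl])
      fix m assume m: "m \<in> I n"
      have "lam m powr (- (r / 2)) * lam m powr (r / 2) = 1"
        using lp[OF m] by (simp add: powr_minus)
      thus "(inv_lam (seq (\<phi> m)) powr (r / 2) * (lam m powr (r / 2) * c m)) *\<^sub>R seq (\<phi> m) = c m *\<^sub>R seq (\<phi> m)"
        by (simp add: inv[OF m] mult.assoc[symmetric])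
    qed
    have xy: "diag B (\<lambda>b. inv_lam b powr s) (x n) = y n"
      unfolding B_def x_def y_def diag_seq_basis[OF fin] using inv by (intro sum.cong) auto
    have gB: "g \<in> span B"
      unfolding g_def B_def by (intro span_sum span_scale span_base imageI)
    have "norm (diag modesh G (x n) - y n) \<le> C * norm g"
      using bound[of B g] gB fin unfolding gx xy G_def by (auto simp: B_def I_def)
    also have "norm g \<le> HB_norm P bc \<phi> lam r f"
    proof -
      have "(norm g)\<^sup>2 = (\<Sum>m\<in>I n. lam m powr r * (c m)\<^sup>2)"
      proof -
        have "g \<bullet> g = (\<Sum>m\<in>I n. (lam m powr (r / 2) * c m) * (seq (\<phi> m) \<bullet> g))"
          by (subst (1) g_def) (simp add: inner_sum_left)
        also have "\<dots> = (\<Sum>m\<in>I n. lam m powr r * (c m)\<^sup>2)"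
        proof (rule sum.cong[OF refl])
          fix m assume m: "m \<in> I n"
          have "seq (\<phi> m) \<bullet> g = lam m powr (r / 2) * c m"
            using m fin unfolding g_def inner_sum_right inner_scaleR_right seq_basis_orth
            by (simp add: if_distrib cong: if_cong)
          moreover have "lam m powr (r / 2) * lam m powr (r / 2) = lam m powr r"
            by (simp add: powr_add[symmetric])
          ultimately show "(lam m powr (r / 2) * c m) * (seq (\<phi> m) \<bullet> g) = lam m powr r * (c m)\<^sup>2"
            by (simp add: power2_eq_square algebra_simps)
        qed
        finally show ?thesis by (simp add: power2_norm_eq_inner)
      qed
      also have "\<dots> \<le> (\<Sum>\<^sub>\<infinity>m\<in>modes bc lam. lam m powr r * (c m)\<^sup>2)"
        using f(2) fin by (intro finite_sum_le_infsum) (auto simp: HB_def fourier_coeff_def c_def I_def)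
      finally show ?thesis
        by (simp add: HB_norm_def fourier_coeff_def c_def real_le_rsqrt)
    qed
    finally show ?thesis using C by (simp add: mult_left_mono)
  qed
  have "(\<lambda>n. diag modesh G (x n) - y n) \<longlonglongrightarrow> diag modesh G (seq f) - seq F"
    unfolding diag_def by (intro tendsto_intros xl yl)
  hence "(\<lambda>n. norm (diag modesh G (x n) - y n)) \<longlonglongrightarrow> norm (diag modesh G (seq f) - seq F)"
    by (rule tendsto_norm)
  hence "norm (diag modesh G (seq f) - seq F) \<le> C * HB_norm P bc \<phi> lam r f"
    by (rule tendsto_upperbound) (use le in auto)
  moreover have "L2_norm M (\<lambda>x. Q x - F x) = norm (seq Q - seq F)"
    using Q(1) frac_inverse(1)[OF sqf s0, folded F_def]
    by (simp add: seq_diff[symmetric] norm_seq square_integrable_diff)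
  ultimately show ?thesis by (simp add: Q Q_def F_def)
qed

end

section \<open>Assembling the convergence rate\<close>

lemma nonneg_of_square_lower_bounds:
  fixes e B h0 :: real
  assumes h0: "0 < h0" and le: "\<And>h. h \<in> {0<..h0} \<Longrightarrow> - (B * h\<^sup>2) \<le> e"
  shows "0 \<le> e"
proof -
  have "(\<lambda>n. - (B * (h0 * inverse (real (Suc n)))\<^sup>2)) \<longlonglongrightarrow> - (B * (h0 * 0)\<^sup>2)"
    by (intro tendsto_intros LIMSEQ_inverse_real_of_nat)
  moreover have "- (B * (h0 * inverse (real (Suc n)))\<^sup>2) \<le> e" for n
    using h0 by (intro le) (auto simp: field_simps)
  ultimately have "- (B * (h0 * 0)\<^sup>2) \<le> e"
    by (intro tendsto_upperbound[where F = sequentially]) auto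
  thus ?thesis by simp
qed

text \<open>As \<open>h \<le> h0 < 1\<close>, the logarithm \<open>ln (h powr (- a))\<close> is at
  least \<open>a * ln (1 / h0) > 0\<close>, so under \<open>crit\<close> a constant may be traded
  for a multiple of it: the first summand of the coefficient. The second, \<open>2 / a\<close>,
  converts \<open>ln (1 / h\<^sup>2)\<close>. The flag \<open>crit\<close> must hold for
  \<open>q = 1\<close> and may also hold elsewhere.\<close>

lemma rate_le:
  fixes a c h h0 q :: real
  assumes a: "0 < a" "a \<le> 2" and c: "0 < c" and h0: "0 < h0" "h0 < 1" and h: "0 < h" "h \<le> h0" and q: "0 \<le> q"
    and crit: "q = 1 \<Longrightarrow> crit"
  shows "(c * h powr a) powr q + h\<^sup>2 * (if q = 1 then 1 + ln (1 / h\<^sup>2) else 1)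
    \<le> (if crit then ((c powr q + 1) / (a * ln (1 / h0)) + 2 / a) * ln (h powr (- a)) else c powr q + 1) * h powr min 2 (a * q)"
proof -
  define H where "H = h powr min 2 (a * q)"
  define L where "L = ln (h powr (- a))"
  define L0 where "L0 = a * ln (1 / h0)"
  have H: "0 \<le> H" by (simp add: H_def)
  have h1: "h < 1" using h h0 by simp
  have L0: "0 < L0" using a h0 by (simp add: L0_def)
  have L: "L = a * ln (1 / h)" using h by (simp add: L_def ln_powr ln_div)
  have "ln (1 / h0) \<le> ln (1 / h)" using h h0 by (simp add: frac_le)
  hence LL0: "L0 \<le> L" using a by (simp add: L L0_def)
  have "(c * h powr a) powr q = c powr q * h powr (a * q)"
    using c h by (simp add: powr_mult powr_powr)
  also have "\<dots> \<le> c powr q * H"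
    unfolding H_def using h h1 by (intro mult_left_mono powr_mono') auto
  finally have 1: "(c * h powr a) powr q \<le> c powr q * H" .
  have "h\<^sup>2 = h powr 2" using h by simp
  also have "\<dots> \<le> H" unfolding H_def using h h1 by (intro powr_mono') auto
  finally have 2: "h\<^sup>2 \<le> H" .
  show ?thesis
  proof (cases crit)
    case True
    have "1 \<le> L / L0" using LL0 L0 by simp
    hence 3: "(c powr q + 1) * 1 \<le> (c powr q + 1) * (L / L0)"
      by (intro mult_left_mono) auto
    have ln2: "ln (1 / h\<^sup>2) = 2 / a * L"
      using a h by (simp add: L ln_div ln_realpow)
    have "0 \<le> 2 / a * L" using a LL0 L0 by (intro mult_nonneg_nonneg) auto
    hence "(if q = 1 then 1 + ln (1 / h\<^sup>2) else 1) \<le> 1 + 2 / a * L" "0 \<le> 1 + 2 / a * L"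
      by (auto simp: ln2)
    hence "h\<^sup>2 * (if q = 1 then 1 + ln (1 / h\<^sup>2) else 1) \<le> H * (1 + 2 / a * L)"
      using 2 H by (intro order_trans[OF mult_left_mono mult_right_mono]) auto
    hence "(c * h powr a) powr q + h\<^sup>2 * (if q = 1 then 1 + ln (1 / h\<^sup>2) else 1) \<le> c powr q * H + H * (1 + 2 / a * L)"
      using 1 by (rule add_mono[rotated])
    also have "\<dots> = ((c powr q + 1) * 1 + 2 / a * L) * H" by (simp add: algebra_simps)
    also have "\<dots> \<le> ((c powr q + 1) * (L / L0) + 2 / a * L) * H"
      using 3 H by (intro mult_right_mono add_right_mono)
    also have "\<dots> = ((c powr q + 1) / L0 + 2 / a) * L * H"
      by (simp add: algebra_simps add_divide_distrib)
    finally show ?thesis using True by (simp only: if_True L_def H_def L0_def)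
  next
    case False
    hence "q \<noteq> 1" using crit by blast
    hence "(c * h powr a) powr q + h\<^sup>2 * (if q = 1 then 1 + ln (1 / h\<^sup>2) else 1) \<le> c powr q * H + H"
      using 1 2 by simp
    thus ?thesis using False by (simp add: H_def distrib_right)
  qed
qed

theorem theorem2p3:
  fixes P :: "(real^'n) set"
    and bc :: "(real^'n) boundary_operator"
    and tr :: "(real^'n \<Rightarrow> real) \<Rightarrow> real^'n \<Rightarrow> real"
    and \<phi> :: "nat \<Rightarrow> real^'n \<Rightarrow> real" and lam :: "nat \<Rightarrow> real" and lam_min :: real
    and s a c h0 \<theta> r Cst :: real and \<tau> :: nat
    and \<T> :: "real \<Rightarrow> (real^'n) set set"
    and N :: "real \<Rightarrow> nat" and b :: "real \<Rightarrow> nat \<Rightarrow> real^'n \<Rightarrow> real"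
    and E :: "(real^'n \<Rightarrow> real) \<Rightarrow> real^'n \<Rightarrow> real"
    and Eh :: "real \<Rightarrow> (real^'n \<Rightarrow> real) \<Rightarrow> real^'n \<Rightarrow> real"
  assumes dim: "CARD('n) = 2 \<or> CARD('n) = 3"
    and polytope: "polytope P" "interior P \<noteq> {}"
    and operator: "admissible_operator P bc"
    and trace: "trace_operator P tr"
    and eigen: "eigenpairs P tr bc \<phi> lam"
    and lam_min: "first_positive_eigenvalue lam lam_min"
    and s: "0 < s" "s < 1"
    and a: "0 < a" "a \<le> 2"
    and c: "0 < c"
    and h0: "0 < h0" "h0 < 1"
    and \<theta>: "0 \<le> \<theta>" "\<theta> \<le> 1"
    and r: "0 \<le> r" "r \<le> 4 - 2 * s"
    and \<tau>: "\<tau> = time_order \<theta>" "2 - 2 * s \<le> r \<Longrightarrow> \<tau> = 2"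
    and mesh: "quasi_uniform_triangulations P h0 \<T>"
    and fe_basis: "\<And>h. h \<in> {0<..h0} \<Longrightarrow> fe_basis P bc (N h) (b h)"
    and E: "exact_solution_operator P tr bc E"
    and Eh: "\<And>h. h \<in> {0<..h0} \<Longrightarrow> fe_solution_operator P tr bc (N h) (b h) (Eh h)"
    and Eh_pos: "\<And>h. h \<in> {0<..h0} \<Longrightarrow> selfadjoint_positive P bc (N h) (b h) (Eh h)"
    and Eh_order: "\<exists>C. \<forall>h\<in>{0<..h0}. \<forall>g\<in>data_space P bc.
        L2_norm (lebesgue_on (interior P)) (\<lambda>x. Eh h g x - E g x)
        \<le> C * h\<^sup>2 * L2_norm (lebesgue_on (interior P)) g"
    and Cst: "0 < Cst" "\<theta> < 1/2 \<Longrightarrow> stability_constant P tr bc h0 N b \<theta> Cst"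
  shows "\<exists>C>0. \<forall>h dt T NT f w.
     0 < h \<and> h \<le> h0 \<and> dt = c * h powr a \<and> (\<theta> < 1/2 \<longrightarrow> dt \<le> Cst * h\<^sup>2) \<and>
     2 \<le> NT \<and> T = real NT * dt \<and> T > 1 / lam_min * ln (1 / dt powr (r / 2 + s)) \<and>
     f \<in> HB P bc \<phi> lam r \<and>
     (bc = Neumann \<longrightarrow> (LINT x|lebesgue_on (interior P). f x) = 0) \<and>
     fe_heat_solution P tr bc (N h) (b h) \<theta> dt NT f w
     \<longrightarrow>
     L2_norm (lebesgue_on (interior P))
       (\<lambda>x. quadrature s r dt NT (\<lambda>j. w j x) - frac_inverse P bc \<phi> lam s f x)
     \<le> (if r \<in> {2 - 2 * s, 4 - 2 * s} then C * ln (h powr (- a)) else C)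
        * h powr min 2 (a * (r / 2 + s)) * HB_norm P bc \<phi> lam r f"
proof -
  let ?M = "lebesgue_on (interior P)"
  have bP: "bounded P" using polytope by (simp add: polytope_imp_bounded)
  obtain C0 where C0: "\<And>h g. h \<in> {0<..h0} \<Longrightarrow> g \<in> data_space P bc \<Longrightarrow>
      L2_norm ?M (\<lambda>x. Eh h g x - E g x) \<le> C0 * h\<^sup>2 * L2_norm ?M g"
    using Eh_order by blast
  define D where "D = max C0 1"
  have D: "0 < D" by (simp add: D_def)
  have order: "L2_norm ?M (\<lambda>x. Eh h g x - E g x) \<le> (D * h\<^sup>2) * L2_norm ?M g"
    if "h \<in> {0<..h0}" "g \<in> data_space P bc" for h g
    by (rule order_trans[OF C0[OF that]]) (intro mult_right_mono L2_norm_nonneg; simp add: D_def)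
  \<comment> \<open>Nonnegativity passes from \<open>Eh h\<close> to \<open>E\<close> as
    \<open>h\<close> tends to 0, with an error of order \<open>h\<^sup>2\<close>.\<close>
  have E_pos: "0 \<le> L2_inner ?M (E g) g" if g: "g \<in> data_space P bc" for g
  proof (rule nonneg_of_square_lower_bounds[OF h0(1)])
    fix h assume h: "h \<in> {0<..h0}"
    have sq: "square_integrable ?M g" "square_integrable ?M (E g)" "square_integrable ?M (Eh h g)"
      using g E Eh[OF h] by (auto simp: data_space_def exact_solution_operator_def fe_solution_operator_def)
    note sqd = square_integrable_diff[OF sq(3,2)]
    have "L2_inner ?M (\<lambda>x. Eh h g x - E g x) g \<le> L2_norm ?M (\<lambda>x. Eh h g x - E g x) * L2_norm ?M g"
      using L2_Cauchy_Schwarz[OF sqd sq(1)] by linarith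
    also have "\<dots> \<le> (D * h\<^sup>2 * L2_norm ?M g) * L2_norm ?M g"
      by (intro mult_right_mono order h g L2_norm_nonneg)
    finally have "L2_inner ?M (Eh h g) g - L2_inner ?M (E g) g \<le> D * (L2_norm ?M g)\<^sup>2 * h\<^sup>2"
      by (simp add: L2_inner_diff_left sq power2_eq_square mult_ac)
    moreover have "0 \<le> L2_inner ?M (Eh h g) g"
      using Eh_pos[OF h] g unfolding selfadjoint_positive_def by blast
    ultimately show "- (D * (L2_norm ?M g)\<^sup>2 * h\<^sup>2) \<le> L2_inner ?M (E g) g" by linarith
  qed
  interpret heat_problem P tr bc \<phi> lam lam_min E
    by unfold_locales (use bP eigen lam_min E E_pos in auto)
  have CN: "2 - 2 * s \<le> r \<Longrightarrow> \<theta> = 1/2"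
    using \<tau> by (auto simp: time_order_def split: if_splits)
  define q where "q = s + r / 2"
  have q: "0 < q" using s r by (simp add: q_def add_pos_nonneg)
  have \<sigma>: "0 \<le> r / 2" "r / 2 \<le> 2" using r s by auto
  obtain C1 where C1: "0 < C1" "\<And>NT dt \<mu>. 2 \<le> NT \<Longrightarrow> 0 < dt \<Longrightarrow> 0 < \<mu> \<Longrightarrow> -1 \<le> amplification \<theta> (dt * \<mu>) \<Longrightarrow>
     \<bar>quadrature s r dt NT (\<lambda>j. amplification \<theta> (dt * \<mu>) ^ j) - \<mu> powr (- s)\<bar>
     \<le> C1 * dt powr s * min 1 (dt * \<mu>) powr (r / 2)
       + (if dt * \<mu> \<le> 1/2 then C1 * \<mu> powr (- s) * amplification \<theta> (dt * \<mu>) ^ NT else 0)"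
    using quadrature_mode_error[OF s r \<theta> CN] by blast
  define tm nm where "tm = 1 / lam_min" and "nm = 1 / lam_min + D"
  have tm: "0 < tm" "0 < nm" using mu_pos D by (auto simp: tm_def nm_def intro: add_pos_pos)
  \<comment> \<open>The constant of the tail: \<open>nm powr s\<close> bounds the power of a
    discrete eigenvalue, and the exponential is the loss in \<open>amplification_tail\<close> with
    \<open>D / c\<close>, since \<open>D * h\<^sup>2 \<le> D / c * dt\<close>.\<close>
  define e where "e = nm powr s * exp (q * (lam_min * (D / c + 1)))"
  have e: "0 < e" using tm by (simp add: e_def)
  define C2 where "C2 = C1 + C1 * e"
  have C2: "0 < C2" using C1 e by (simp add: C2_def add_pos_pos)
  have c1: "0 < 1 / c" using c by simp
  \<comment> \<open>To be used with \<open>\<epsilon> = h\<^sup>2\<close> and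
    \<open>\<eta> = dt\<close>. The bounds \<open>1 / c\<close> and \<open>c\<close> come from
    \<open>h\<^sup>2 \<le> h powr a \<le> 1\<close>, where a \<le> 2 enters.\<close>
  obtain K where K: "0 < K" "\<And>A \<nu> B t \<epsilon> \<eta> G. \<And>g::ell2.
    0 < \<epsilon> \<and> \<epsilon> \<le> 1 \<and> \<epsilon> \<le> 1 / c * \<eta> \<and> \<eta> \<le> c \<and> diag_close A \<nu> B t (D * \<epsilon>) \<and> g \<in> span B \<and>
    (\<forall>b\<in>B. t b \<le> tm) \<and> (\<forall>a\<in>A. \<nu> a \<le> nm) \<and>
    (\<forall>a\<in>A. \<bar>G a - \<nu> a powr s\<bar> \<le> C2 * \<eta> powr s * min 1 (\<eta> / \<nu> a) powr (r / 2) + C2 * \<eta> powr (s + r / 2)) \<Longrightarrow>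
    norm (diag A G (diag B (\<lambda>b. t b powr (r / 2)) g) - diag B (\<lambda>b. t b powr s) (diag B (\<lambda>b. t b powr (r / 2)) g))
      \<le> K * (\<eta> powr (s + r / 2) + \<epsilon> * (if s + r / 2 = 1 then 1 + ln (1 / \<epsilon>) else 1)) * norm g"
    using diag_functional_error[OF s \<sigma> D tm c1 c C2, where 'a = ell2] by blast
  define C3 where "C3 = ((c powr q + 1) / (a * ln (1 / h0)) + 2 / a) + (c powr q + 1)"
  have C3: "0 < C3" "(c powr q + 1) / (a * ln (1 / h0)) + 2 / a \<le> C3" "c powr q + 1 \<le> C3"
  proof -
    have "0 \<le> (c powr q + 1) / (a * ln (1 / h0))" using a h0 by (intro divide_nonneg_nonneg mult_nonneg_nonneg) auto
    moreover have "0 < 2 / a" "0 < c powr q + 1" using a by (auto simp: add_nonneg_pos)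
    ultimately show "0 < C3" "(c powr q + 1) / (a * ln (1 / h0)) + 2 / a \<le> C3" "c powr q + 1 \<le> C3"
      unfolding C3_def by linarith+
  qed
  show ?thesis
  proof (intro exI[of _ "K * C3"] conjI allI impI)
    show "0 < K * C3" using K C3 by simp
    fix h dt T NT f w
    assume H: "0 < h \<and> h \<le> h0 \<and> dt = c * h powr a \<and> (\<theta> < 1/2 \<longrightarrow> dt \<le> Cst * h\<^sup>2) \<and>
     2 \<le> NT \<and> T = real NT * dt \<and> T > 1 / lam_min * ln (1 / dt powr (r / 2 + s)) \<and>
     f \<in> HB P bc \<phi> lam r \<and>
     (bc = Neumann \<longrightarrow> (LINT x|lebesgue_on (interior P). f x) = 0) \<and>
     fe_heat_solution P tr bc (N h) (b h) \<theta> dt NT f w"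
    have h: "h \<in> {0<..h0}" "0 < h" "h < 1" using H h0 by auto
    have dt: "0 < dt" "dt = c * h powr a" using H c by auto
    interpret fe_level P tr bc \<phi> lam lam_min E "N h" "b h" "Eh h" "D * h\<^sup>2"
      by unfold_locales (use fe_basis[OF h(1)] Eh[OF h(1)] Eh_pos[OF h(1)] order[OF h(1)] in auto)
    have f: "f \<in> data" "f \<in> HB P bc \<phi> lam r" using H by (auto simp: data_space_def HB_def)
    have hdt: "h\<^sup>2 \<le> 1 / c * dt" "h\<^sup>2 \<le> 1" "dt \<le> c"
    proof -
      have "h powr 2 \<le> h powr a" using h a by (intro powr_mono') auto
      thus "h\<^sup>2 \<le> 1 / c * dt" using h c by (simp add: dt(2))
      show "h\<^sup>2 \<le> 1" using h by (simp add: power_le_one)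
      have "h powr a \<le> 1" using h a by (intro powr_le1) auto
      thus "dt \<le> c" using c by (simp add: dt(2) mult_left_le)
    qed
    have nu_nm: "nu a \<le> nm" if "a \<in> modesh" for a
    proof -
      have "nu a \<le> 1 / lam_min + D * h\<^sup>2" by (rule nu_le[OF that])
      also have "\<dots> \<le> 1 / lam_min + D * 1" using D hdt(2) by (intro add_left_mono mult_left_mono) auto
      finally show ?thesis by (simp add: nm_def)
    qed
    \<comment> \<open>For \<theta> \<ge> 1/2 this is A-stability; for smaller \<theta> the step size
      restriction provides it through the stability of the scheme.\<close>
    have ampl: "-1 \<le> amplification \<theta> (dt * (1 / nu a))" if a: "a \<in> modesh" for a
    proof (cases "\<theta> < 1/2")
      case True
      then obtain K' where K': "\<And>h dt J W. h \<in> {0<..h0} \<Longrightarrow> 0 < dt \<Longrightarrow> dt \<le> Cst * h\<^sup>2 \<Longrightarrow>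
           theta_scheme P tr bc (N h) (b h) \<theta> dt J W \<Longrightarrow>
           L2_norm ?M (fe_fun (N h) (b h) (W J)) \<le> K' * L2_norm ?M (fe_fun (N h) (b h) (W 0))"
        using Cst(2) unfolding stability_constant_def by blast
      have "dt \<le> Cst * h\<^sup>2" using H True by blast
      thus ?thesis
        using K'[OF h(1) dt(1)] by (intro stable_amplification[OF _ a \<theta>(1) dt(1)]) blast
    next
      case False
      thus ?thesis using dt nu_pos[OF a] by (intro amplification_ge_minus_1) auto
    qed
    define G where "G = (\<lambda>a. quadrature s r dt NT (\<lambda>j. amplification \<theta> (dt * (1 / nu a)) ^ j))"
    have G: "\<bar>G a - nu a powr s\<bar> \<le> C2 * dt powr s * min 1 (dt / nu a) powr (r / 2) + C2 * dt powr (s + r / 2)"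
      if a: "a \<in> modesh" for a
    proof -
      define z where "z = dt * (1 / nu a)"
      have p: "0 < 1 / nu a" using nu_pos[OF a] by simp
      have inv: "(1 / nu a) powr (- s) = nu a powr s"
        using nu_pos[OF a] by (simp add: powr_divide powr_minus_divide)
      have "(if z \<le> 1/2 then C1 * (1 / nu a) powr (- s) * amplification \<theta> z ^ NT else 0) \<le> C1 * e * dt powr q"
      proof (cases "z \<le> 1/2")
        case True
        have "1 / (1 / nu a) \<le> 1 / lam_min + D / c * dt"
        proof -
          have "nu a \<le> 1 / lam_min + D * h\<^sup>2" by (rule nu_le[OF a])
          also have "\<dots> \<le> 1 / lam_min + D * (1 / c * dt)"
            using D hdt(1) by (intro add_left_mono mult_left_mono) auto
          finally show ?thesis by simp
        qed
        moreover have "real NT * dt > 1 / lam_min * ln (1 / dt powr q)"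
        proof -
          have "T = real NT * dt" "T > 1 / lam_min * ln (1 / dt powr (r / 2 + s))" using H by blast+
          moreover have "r / 2 + s = q" by (simp add: q_def)
          ultimately show ?thesis by (simp only:)
        qed
        ultimately have tail: "amplification \<theta> z ^ NT \<le> exp (q * (lam_min * (D / c + 1))) * dt powr q"
          unfolding z_def using True D c mu_pos q dt p
          by (intro amplification_tail \<theta>) (auto simp: z_def)
        have A0: "0 \<le> amplification \<theta> z"
          using amplification_small(1)[OF \<theta>, of z] True dt p by (simp add: z_def)
        have "C1 * nu a powr s * amplification \<theta> z ^ NT \<le> C1 * nm powr s * (exp (q * (lam_min * (D / c + 1))) * dt powr q)"
          using C1 nu_nm[OF a] nu_pos[OF a] s tail A0
          by (intro mult_mono powr_mono2) (auto intro: mult_left_mono powr_mono2)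
        thus ?thesis using True by (simp add: inv e_def mult_ac)
      next
        case False
        thus ?thesis using C1 e by simp
      qed
      hence "\<bar>G a - nu a powr s\<bar> \<le> C1 * dt powr s * min 1 z powr (r / 2) + C1 * e * dt powr q"
        using C1(2)[OF _ dt(1) p ampl[OF a], of NT] H unfolding z_def[symmetric] inv G_def by auto
      also have "\<dots> \<le> C2 * dt powr s * min 1 z powr (r / 2) + C2 * dt powr q"
        using C1 e by (intro add_mono mult_right_mono) (auto simp: C2_def)
      finally show ?thesis by (simp add: z_def q_def)
    qed
    define R where "R = dt powr q + h\<^sup>2 * (if q = 1 then 1 + ln (1 / h\<^sup>2) else 1)"
    have "L2_norm ?M (\<lambda>x. quadrature s r dt NT (\<lambda>j. w j x) - frac_inverse P bc \<phi> lam s f x)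
      \<le> (K * R) * HB_norm P bc \<phi> lam r f"
    proof (rule quadrature_error_le[OF f _ \<theta>(1) dt(1) s(1)])
      show "fe_heat_solution P tr bc (N h) (b h) \<theta> dt NT f w" using H by blast
      have "0 \<le> (if q = 1 then 1 + ln (1 / h\<^sup>2) else 1)" using h hdt(2) by (simp add: ln_ge_zero)
      thus "0 \<le> K * R"
        unfolding R_def using K(1) by (intro mult_nonneg_nonneg add_nonneg_nonneg) auto
      fix B g
      assume B: "finite B" "B \<subseteq> (\<lambda>m. seq (\<phi> m)) ` modes bc lam" and g: "g \<in> span B"
      then obtain I where I: "finite I" "I \<subseteq> modes bc lam" "B = (\<lambda>m. seq (\<phi> m)) ` I"
        by (metis finite_subset_image)
      have tB: "inv_lam b \<le> tm" if "b \<in> B" for b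
      proof -
        obtain m where m: "m \<in> modes bc lam" "b = seq (\<phi> m)" using \<open>b \<in> B\<close> I by auto
        thus ?thesis
          using mu_le_lam[OF m(1)] mu_pos by (simp add: inv_lam_basis tm_def frac_le)
      qed
      have "0 < h\<^sup>2" using h by simp
      show "norm (diag modesh (\<lambda>a. quadrature s r dt NT (\<lambda>j. amplification \<theta> (dt * (1 / nu a)) ^ j))
           (diag B (\<lambda>b. inv_lam b powr (r / 2)) g)
        - diag B (\<lambda>b. inv_lam b powr s) (diag B (\<lambda>b. inv_lam b powr (r / 2)) g)) \<le> (K * R) * norm g"
        using K(2)[of "h\<^sup>2" dt modesh nu B inv_lam g G] \<open>0 < h\<^sup>2\<close> hdt tB nu_nm G g
          diag_close_modesh[OF I(1,2)]
        unfolding R_def q_def G_def I(3) by blast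
    qed
    also have "\<dots> \<le> ((if r \<in> {2 - 2 * s, 4 - 2 * s} then (K * C3) * ln (h powr (- a)) else K * C3)
        * h powr min 2 (a * (r / 2 + s))) * HB_norm P bc \<phi> lam r f"
    proof (rule mult_right_mono)
      show "0 \<le> HB_norm P bc \<phi> lam r f" by (simp add: HB_norm_def infsum_nonneg)
      let ?crit = "r \<in> {2 - 2 * s, 4 - 2 * s}"
      have l: "0 \<le> ln (h powr (- a))" using h a by (simp add: ln_powr mult_nonpos_nonpos mult_nonneg_nonpos)
      have "R \<le> (if ?crit then ((c powr q + 1) / (a * ln (1 / h0)) + 2 / a) * ln (h powr (- a)) else c powr q + 1) * h powr min 2 (a * q)"
        unfolding R_def dt(2) using H q by (intro rate_le a c h0) (auto simp: q_def)
      also have "\<dots> \<le> (if ?crit then C3 * ln (h powr (- a)) else C3) * h powr min 2 (a * q)"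
        using mult_right_mono[OF C3(2) l] C3(3)
        by (intro mult_right_mono) (simp_all only: split: if_split, simp_all)
      finally have "K * R \<le> K * ((if ?crit then C3 * ln (h powr (- a)) else C3) * h powr min 2 (a * q))"
        using K(1) by (intro mult_left_mono) auto
      thus "K * R \<le> (if ?crit then (K * C3) * ln (h powr (- a)) else K * C3) * h powr min 2 (a * (r / 2 + s))"
        by (auto simp: q_def add.commute mult_ac split: if_splits)
    qed
    finally show "L2_norm ?M (\<lambda>x. quadrature s r dt NT (\<lambda>j. w j x) - frac_inverse P bc \<phi> lam s f x)
      \<le> (if r \<in> {2 - 2 * s, 4 - 2 * s} then (K * C3) * ln (h powr (- a)) else K * C3)
        * h powr min 2 (a * (r / 2 + s)) * HB_norm P bc \<phi> lam r f" .
  qed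
qed

end
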